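(* Let $\alpha$ be a positive integer and $\omega_0,\omega\in\mathbb{C}$. Let $e(z)=1+\sum_{j\ge1}e_jz^j$ and $d(z)=1+\sum_{j\ge1}d_jz^j$ be formal power series with $e_1=0$, $e_2>0$, and $\alpha e_3\pi^2+12d_1e_2\log2>0$. Then \[ [z^n]\sum_{k\ge0}d(z)^{k+\omega_0}\prod_{1\le j\le k}\bigl(e(z)^{j+\omega}-1\bigr)^{\alpha}=c\,e^{\beta\sqrt n}\rho^{\frac12n}n^{\frac12(n+\alpha)+\alpha\omega}\bigl(1+O(n^{-1/2})\bigr), \] with the $O$-term uniform for bounded $\omega_0,\omega$, where $\beta=\frac{\sqrt6\,d_1\log2}{\sqrt{e_2\alpha}\,\pi}+\frac{\sqrt\alpha\,e_3\pi}{2\sqrt6\,e_2^{3/2}}$, $\rho=\frac{6e_2}{e\pi^2\alpha}$, and \[ c=\frac{\sqrt3}{\sqrt2\,\alpha\pi}\left(\frac1{\Gamma(1+\omega)}\sqrt{\frac{12}{\alpha\pi}}\Bigl(\frac6{\alpha\pi^2}\Bigr)^{\omega}\right)^{\alpha}2^{-\frac{d_1^2}{2e_2}-\frac{3d_1e_3}{4e_2^2}+\frac{d_2}{e_2}}\exp\!\Bigl(-\frac{d_1^2}{4\alpha e_2}-\frac{\alpha\pi^2}{12}\Bigl(\frac{7e_3^2}{8e_2^3}-\frac{e_4}{e_2^2}+\frac12\Bigr)+\frac{3d_1^2}{2e_2\alpha\pi^2}(\log2)^2\Bigr). \]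
   Context: For a formal power series $f$ with $f(0)=1$ and $s\in\mathbb{C}$, $f(z)^s:=\exp(s\log f(z))$. $[z^n]$ denotes coefficient extraction. The quantities $d_1,d_2,e_2,e_3,e_4$ are assumed real (as implicit in the inequality hypothesis). Convention: when $\omega$ is a negative integer, $1/\Gamma(1+\omega)$ is interpreted as $0$ and the estimate is read as the big-$O$ bound $O(e^{\beta\sqrt n}\rho^{n/2}n^{\frac12(n+\alpha)+\alpha\omega-\frac12})$.
   Formalization: The formal power series e(z), d(z) are assumed to converge near z=0 (false for fast-growing coefficients), and the relative O-term is uniform for bounded ω0, ω only with ω bounded away from negative integers; near them the error is uniformly O(n^{-1/2}) times the main term without c. *)

theory Defs
  imports "HOL-Analysis.Analysis"
begin

text \<open>The power \<open>f\<^sup>s = exp (s log f)\<close> of a formal power series with constant term 1. Since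
  \<^term>\<open>fps_ln 1\<close> is the expansion of \<open>log (1 + X)\<close>, one substitutes \<open>f - 1\<close>.\<close>

definition fps_cpow :: "complex fps \<Rightarrow> complex \<Rightarrow> complex fps" where
  "fps_cpow f s = fps_exp 1 oo (fps_const s * (fps_ln 1 oo (f - 1)))"

definition gf_term :: "nat \<Rightarrow> complex fps \<Rightarrow> complex fps \<Rightarrow> complex \<Rightarrow> complex \<Rightarrow> nat \<Rightarrow> complex fps" where
  "gf_term \<alpha> d e \<omega>0 \<omega> k =
     fps_cpow d (of_nat k + \<omega>0) * (\<Prod>j=1..k. (fps_cpow e (of_nat j + \<omega>) - 1) ^ \<alpha>)"

text \<open>The infinite sum is taken in the \<open>X\<close>-adic topology on formal power series; it always
  converges, and only the terms with \<open>k \<le> n\<close> contribute to the \<open>n\<close>-th coefficient (see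
  \<open>gf_series_sums\<close> and \<open>gf_series_nth\<close> below).\<close>

definition gf_series :: "nat \<Rightarrow> complex fps \<Rightarrow> complex fps \<Rightarrow> complex \<Rightarrow> complex \<Rightarrow> complex fps" where
  "gf_series \<alpha> d e \<omega>0 \<omega> = (\<Sum>k. gf_term \<alpha> d e \<omega>0 \<omega> k)"

definition beta_const :: "nat \<Rightarrow> real \<Rightarrow> real \<Rightarrow> real \<Rightarrow> real" where
  "beta_const \<alpha> d1 e2 e3 =
     sqrt 6 * d1 * ln 2 / (sqrt (e2 * real \<alpha>) * pi)
     + sqrt (real \<alpha>) * e3 * pi / (2 * sqrt 6 * e2 powr (3/2))"

definition rho_const :: "nat \<Rightarrow> real \<Rightarrow> real" where
  "rho_const \<alpha> e2 = 6 * e2 / (exp 1 * pi\<^sup>2 * real \<alpha>)"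

text \<open>The asymptotic main term is \<open>lead_const * growth\<close>.
  \<^const>\<open>rGamma\<close> is the entire function \<open>1/\<Gamma>\<close>; in particular it is 0 at the poles of \<open>\<Gamma>\<close>, so
  \<open>lead_const\<close> vanishes exactly when \<open>\<omega>\<close> is a negative integer. Since its zeros preclude a
  relative error term that is uniform near the negative integers, uniformity there has to be
  understood as an error of order \<open>|growth| / sqrt n\<close>, which has no such zeros.\<close>

definition lead_const ::
    "nat \<Rightarrow> real \<Rightarrow> real \<Rightarrow> real \<Rightarrow> real \<Rightarrow> real \<Rightarrow> complex \<Rightarrow> complex" where
  "lead_const \<alpha> d1 d2 e2 e3 e4 \<omega> =
     of_real (sqrt 3 / (sqrt 2 * real \<alpha> * pi))
     * (rGamma (1 + \<omega>) * of_real (sqrt (12 / (real \<alpha> * pi)))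
          * of_real (6 / (real \<alpha> * pi\<^sup>2)) powr \<omega>) ^ \<alpha>
     * of_real (2 powr (- d1\<^sup>2 / (2 * e2) - 3 * d1 * e3 / (4 * e2\<^sup>2) + d2 / e2))
     * of_real (exp (- d1\<^sup>2 / (4 * real \<alpha> * e2)
          - real \<alpha> * pi\<^sup>2 / 12 * (7 * e3\<^sup>2 / (8 * e2 ^ 3) - e4 / e2\<^sup>2 + 1/2)
          + 3 * d1\<^sup>2 / (2 * e2 * real \<alpha> * pi\<^sup>2) * (ln 2)\<^sup>2))"

definition growth :: "nat \<Rightarrow> real \<Rightarrow> real \<Rightarrow> real \<Rightarrow> complex \<Rightarrow> nat \<Rightarrow> complex" where
  "growth \<alpha> d1 e2 e3 \<omega> n =
     of_real (exp (beta_const \<alpha> d1 e2 e3 * sqrt (real n)))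
     * of_real (rho_const \<alpha> e2 powr (real n / 2))
     * of_nat n powr ((of_nat n + of_nat \<alpha>) / 2 + of_nat \<alpha> * \<omega>)"


lemma fps_cpow_nth_0 [simp]: "fps_nth (fps_cpow f s) 0 = 1"
  by (simp add: fps_cpow_def)

lemma gf_term_nth_eq_0:
  assumes "\<alpha> > 0" "n < k"
  shows   "fps_nth (gf_term \<alpha> d e \<omega>0 \<omega> k) n = 0"
proof -
  have "fps_X ^ k dvd (\<Prod>j=1..k. (fps_cpow e (of_nat j + \<omega>) - 1) ^ \<alpha>)"
  proof -
    have "fps_X dvd (fps_cpow e (of_nat j + \<omega>) - 1) ^ \<alpha>" for j
    proof -
      have "fps_X dvd fps_cpow e (of_nat j + \<omega>) - 1"
        by (cases "fps_cpow e (of_nat j + \<omega>) - 1 = 0")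
           (auto simp: fps_dvd_iff Suc_le_eq subdegree_eq_0_iff simp flip: neq0_conv)
      thus ?thesis
        using assms(1) by (metis dvd_power dvd_trans)
    qed
    hence "(\<Prod>j=1..k. fps_X) dvd (\<Prod>j=1..k. (fps_cpow e (of_nat j + \<omega>) - 1) ^ \<alpha>)"
      by (intro prod_dvd_prod) auto
    thus ?thesis by simp
  qed
  then obtain g where "gf_term \<alpha> d e \<omega>0 \<omega> k = fps_X ^ k * g"
    unfolding gf_term_def by (metis dvdE dvd_mult)
  thus ?thesis
    using assms(2) by (simp add: fps_X_power_mult_nth)
qed

lemma gf_series_sums:
  assumes "\<alpha> > 0"
  shows   "gf_term \<alpha> d e \<omega>0 \<omega> sums Abs_fps (\<lambda>n. \<Sum>k\<le>n. fps_nth (gf_term \<alpha> d e \<omega>0 \<omega> k) n)"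
  unfolding sums_def
proof (rule tendsto_fpsI)
  fix n
  show "\<forall>\<^sub>F N in sequentially. fps_nth (\<Sum>k<N. gf_term \<alpha> d e \<omega>0 \<omega> k) n =
          fps_nth (Abs_fps (\<lambda>n. \<Sum>k\<le>n. fps_nth (gf_term \<alpha> d e \<omega>0 \<omega> k) n)) n"
    using eventually_gt_at_top[of n]
  proof eventually_elim
    case (elim N)
    have "(\<Sum>k<N. fps_nth (gf_term \<alpha> d e \<omega>0 \<omega> k) n) = (\<Sum>k\<le>n. fps_nth (gf_term \<alpha> d e \<omega>0 \<omega> k) n)"
      using elim gf_term_nth_eq_0[OF assms] by (intro sum.mono_neutral_right) auto
    thus ?case by (simp add: fps_sum_nth)
  qed
qed

lemma gf_series_nth:
  assumes "\<alpha> > 0"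
  shows   "fps_nth (gf_series \<alpha> d e \<omega>0 \<omega>) n = (\<Sum>k\<le>n. fps_nth (gf_term \<alpha> d e \<omega>0 \<omega> k) n)"
  using sums_unique[OF gf_series_sums[OF assms, of d e \<omega>0 \<omega>]]
  unfolding gf_series_def by (metis fps_nth_Abs_fps)

end

theory Submission
  imports Defs "HOL-Complex_Analysis.Complex_Analysis" "HOL-Real_Asymp.Real_Asymp"
    "HOL-Probability.Characteristic_Functions"
begin

text \<open>Put \<open>e(z) = exp (w\<^sup>2)\<close>, which is possible near \<open>0\<close> because \<open>e\<^sub>1 = 0 < e\<^sub>2\<close>. The product in the
  \<open>k\<close>-th term then becomes the model product \<open>\<Prod>j\<le>k. (exp ((j + \<omega>) w\<^sup>2) - 1)\<^sup>\<alpha>\<close>, and \<open>e\<^sub>3, e\<^sub>4, d\<close> only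
  enter through two holomorphic factors. On the circle \<open>\<bar>w\<bar>\<^sup>2 = ln 2 / k\<close> the model product is, by
  Euler--Maclaurin and Stirling, an explicit exponential times \<open>(1/\<Gamma>(1 + \<omega>))\<^sup>\<alpha>\<close>, uniformly in
  the angle. The point \<open>w > 0\<close> is the saddle point for \<open>k\<close> near \<open>k\<^sub>0 = 6 n ln 2 / (\<alpha> \<pi>\<^sup>2)\<close>, its opposite
  \<open>w < 0\<close> is smaller by the factor \<open>exp (- 2 \<beta> sqrt n)\<close>, which is where \<open>\<beta> > 0\<close> is needed, and
  elsewhere the integrand is absolutely dominated. A Gaussian integral over the angle and a
  Riemann sum over \<open>k\<close> on the scale \<open>sqrt n\<close> give the constant.\<close>

section \<open>The integral of \<open>ln ((exp u - 1) / u)\<close> up to \<open>ln 2\<close>\<close>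

text \<open>The number ln 2 is forced by stationarity in \<open>k\<close>: the factor gained from
  \<open>k\<close> to \<open>k + 1\<close> has modulus near 1 just when exp (k w^2) = 2. On this
  circle the model part at the saddle is, to leading order, proportional to exp (- \<alpha> k
  \<open>lam0\<close>) k^(n/2), whose maximum over \<open>k\<close> is at \<open>k0\<close>. The
  circle is centred exactly only at \<open>k0\<close>; for indices off by O(sqrt n) the mismatch is
  a cross term between index and angle in one quadratic form, so no saddle point per
  \<open>k\<close> is located. As |w| is of order n^(-1/2), the linear coefficients of
  \<open>q\<close> and \<open>l\<close> give exp (\<beta> sqrt n), the quadratic ones a constant,
  the cubic remainders the error n^(-1/2). The obstacle is uniformity in \<omega>: 1/\<Gamma>(1 +
  \<omega>) vanishes at negative integers, so the product of the 1 + \<omega>/j has no usable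
  logarithm. It is split off and approximated additively, all else is measured against the nowhere
  vanishing \<open>scale\<close>, and the relative error form is recovered by compactness away from
  the zeros. For bounded \<open>k\<close> the product asymptotics are void; there a fixed circle
  gives a bound C^n, which loses against n^(n/2).\<close>

text \<open>The alternating dilogarithm series, whose value at 1 is the source of \<open>\<pi>\<^sup>2 / 12\<close>.\<close>

definition eta2 :: "real \<Rightarrow> real" where "eta2 v = (\<Sum>n. (-1) ^ n * v ^ Suc n / (real (Suc n))\<^sup>2)"

text \<open>Changing the sign of the even terms subtracts them twice, and twice the even part of the
  first \<open>2 * n\<close> terms of the series for \<zeta>(2) is half of the first
  \<open>n\<close> terms. Hence pi^2/6 - pi^2/12.\<close>

lemma eta2_one: "eta2 1 = pi\<^sup>2 / 12"
proof -
  have s: "(\<lambda>n. 1 / (real (Suc n))\<^sup>2) sums (pi\<^sup>2/6)"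
    using inverse_squares_sums by (simp add: add.commute)
  have "(\<lambda>n. (\<Sum>k<2*n. 1 / (real (Suc k))\<^sup>2)) \<longlonglongrightarrow> pi\<^sup>2/6"
    using LIMSEQ_subseq_LIMSEQ[OF s[unfolded sums_def], of "\<lambda>n. 2*n"]
    by (simp add: strict_mono_def o_def)
  moreover have "(\<lambda>n. (\<Sum>k<n. 1 / (real (Suc k))\<^sup>2)) \<longlonglongrightarrow> pi\<^sup>2/6"
    using s by (simp add: sums_def)
  ultimately have l: "(\<lambda>n. (\<Sum>k<2*n. 1 / (real (Suc k))\<^sup>2) - 1/2 * (\<Sum>k<n. 1 / (real (Suc k))\<^sup>2))
      \<longlonglongrightarrow> pi\<^sup>2/6 - 1/2 * (pi\<^sup>2/6)"
    by (intro tendsto_intros)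
  have eq: "(\<Sum>k<2*n. 1 / (real (Suc k))\<^sup>2) - 1/2 * (\<Sum>k<n. 1 / (real (Suc k))\<^sup>2)
     = (\<Sum>k<2*n. (-1)^k / (real (Suc k))\<^sup>2)" for n
  proof (induction n)
    case (Suc n)
    have "1 / (2 * real n + 2)\<^sup>2 = 1/4 * (1 / (real n + 1)\<^sup>2)"
      by (simp add: power2_eq_square field_simps)
    with Suc show ?case by (simp add: algebra_simps)
  qed auto
  have "summable (\<lambda>n. (-1) ^ n * 1 ^ Suc n / (real (Suc n))\<^sup>2)"
    by (rule summable_comparison_test'[OF sums_summable[OF s], of 0]) (auto simp: norm_divide norm_power norm_mult)
  hence "(\<lambda>n. (\<Sum>k<n. (-1)^k / (real (Suc k))\<^sup>2)) \<longlonglongrightarrow> eta2 1"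
    unfolding eta2_def by (simp add: summable_LIMSEQ)
  from LIMSEQ_subseq_LIMSEQ[OF this, of "\<lambda>n. 2*n"]
  have "(\<lambda>n. (\<Sum>k<2*n. (-1)^k / (real (Suc k))\<^sup>2)) \<longlonglongrightarrow> eta2 1"
    by (simp add: strict_mono_def o_def)
  from LIMSEQ_unique[OF this l[unfolded eq]] show ?thesis by simp
qed

lemma eta2_cont: "continuous_on {0..1} eta2"
proof -
  have s: "summable (\<lambda>n. 1 / (real (Suc n))\<^sup>2)"
    using inverse_squares_sums by (simp add: add.commute sums_iff)
  have "uniform_limit {0..1} (\<lambda>n v. \<Sum>i<n. (-1) ^ i * v ^ Suc i / (real (Suc i))\<^sup>2)
     (\<lambda>v. suminf (\<lambda>i. (-1) ^ i * v ^ Suc i / (real (Suc i))\<^sup>2)) sequentially"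
  proof (rule Weierstrass_m_test[OF _ s])
    fix n and x :: real assume "x \<in> {0..1}"
    hence "\<bar>x\<bar> ^ Suc n \<le> 1" by (intro power_le_one) auto
    thus "norm ((-1) ^ n * x ^ Suc n / (real (Suc n))\<^sup>2) \<le> 1 / (real (Suc n))\<^sup>2"
      unfolding norm_mult norm_divide norm_power by (simp add: divide_right_mono)
  qed
  thus ?thesis unfolding eta2_def
    by (rule uniform_limit_theorem[rotated]) (auto intro!: always_eventually continuous_intros)
qed

lemma eta2_deriv:
  assumes "0 < v" "v < 1"
  shows "(eta2 has_real_derivative ln (1 + v) / v) (at v)"
proof -
  \<comment> \<open>Re-indexing as a power series with constant term 0, the form in which termwise
    differentiation is available.\<close>
  define c where "c = (\<lambda>n. if n = 0 then 0 else (-1) ^ (n-1) / (real n)\<^sup>2)"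
  have sc: "summable (\<lambda>n. c n * x ^ n)" if "norm x < 1" for x
  proof -
    have "norm (c n * x ^ n) \<le> \<bar>x\<bar>^n" for n
      proof (cases n)
      case (Suc m)
      have "1 \<le> (real n)\<^sup>2" using Suc by (intro one_le_power) (simp add: Suc)
      hence "\<bar>x\<bar> ^ n / (real n)\<^sup>2 \<le> \<bar>x\<bar> ^ n / 1" using Suc by (intro divide_left_mono) auto
      thus ?thesis using Suc by (simp add: c_def norm_mult norm_divide norm_power abs_mult power_abs)
    qed (simp add: c_def)
    thus ?thesis using that by (intro summable_comparison_test'[OF summable_geometric, of "\<bar>x\<bar>" 0]) auto
  qed
  have e: "eta2 x = (\<Sum>n. c n * x ^ n)" if "norm x < 1" for x
    using suminf_split_head[OF sc[OF that]] by (simp add: c_def eta2_def)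
  have "((\<lambda>x. \<Sum>n. c n * x ^ n) has_real_derivative (\<Sum>n. diffs c n * v ^ n)) (at v)"
    by (rule termdiffs_strong_converges_everywhere[where x = v] termdiffs_strong[where K = "(1+v)/2"] , rule sc) (use assms in auto)
  hence d: "(eta2 has_real_derivative (\<Sum>n. diffs c n * v ^ n)) (at v)"
    by (rule has_field_derivative_transform_within_open[where S = "{-1<..<1}"]) (use assms e in auto)
  have "ln (1 + v) = (\<Sum>n. (-1) ^ n * (1 / real (n + 1)) * v ^ Suc n)"
    using ln_series[of "1+v"] assms by simp
  also have "\<dots> = (\<Sum>n. v * (diffs c n * v ^ n))"
    by (intro suminf_cong) (simp add: diffs_def c_def power2_eq_square del: of_nat_Suc)
  also have "\<dots> = v * (\<Sum>n. diffs c n * v ^ n)"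
    using termdiff_converges[of v 1 c, OF _ sc] assms by (intro suminf_mult) auto
  finally show ?thesis using d assms by simp
qed

text \<open>An antiderivative is explicit: in \<open>H\<close> the derivative of
  \<open>eta2 (exp t - 1)\<close> is t exp t / (exp t - 1), which cancels against the product rule
  for t ln (exp t - 1). At ln 2 the logarithm is 0 and \<open>eta2 1\<close> remains; at 0 both
  terms vanish. Speaking of an arbitrary antiderivative \<open>G\<close> that is continuous up to
  the ends avoids an improper integral at 0.\<close>

lemma integral_ln_expm1:
  fixes G :: "real \<Rightarrow> real"
  assumes "continuous_on {0..ln 2} G"
    and "\<And>t. 0 < t \<Longrightarrow> t < ln 2 \<Longrightarrow> (G has_real_derivative - ln (exp t - 1)) (at t)"
  shows "G (ln 2) - G 0 = pi\<^sup>2 / 12"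
proof -
  define H where "H = (\<lambda>t::real. eta2 (exp t - 1) - t * ln (exp t - 1))"
  have rng: "exp t - 1 \<in> {0..1}" if "t \<in> {0..ln 2}" for t :: real
  proof -
    have "exp t \<le> exp (ln 2)" using that by (intro exp_le_cancel_iff[THEN iffD2]) auto
    thus ?thesis using that by auto
  qed
  have c1: "continuous_on {0..ln 2} (\<lambda>t. eta2 (exp t - 1))"
    by (rule continuous_on_compose2[OF eta2_cont]) (use rng in \<open>auto intro!: continuous_intros\<close>)
  have c2: "continuous_on {0..ln 2} (\<lambda>t::real. t * ln (exp t - 1))"
    unfolding continuous_on_def
  proof
    fix x :: real assume x: "x \<in> {0..ln 2}"
    show "((\<lambda>t::real. t * ln (exp t - 1)) \<longlongrightarrow> x * ln (exp x - 1)) (at x within {0..ln 2})"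
    proof (cases "x = 0")
      case True
      have "((\<lambda>t::real. t * ln (exp t - 1)) \<longlongrightarrow> 0) (at_right 0)" by real_asymp
      thus ?thesis using True by (simp add: at_within_Icc_at_right)
    next
      case False
      hence "exp x - 1 \<noteq> 0" by simp
      thus ?thesis using False by (intro tendsto_intros) auto
    qed
  qed
  have "(\<lambda>t. G t - H t) (ln 2) = (\<lambda>t. G t - H t) 0"
  proof (rule DERIV_isconst_end[where f = "\<lambda>t. G t - H t"])
    show "continuous_on {0..ln 2} (\<lambda>t. G t - H t)"
      unfolding H_def by (intro continuous_on_diff assms(1) c1 c2)
    fix t :: real assume t: "0 < t" "t < ln 2"
    have "exp t < exp (ln 2)" using t by (subst exp_less_cancel_iff)
    hence t2: "0 < exp t - 1" "exp t - 1 < 1" using t by auto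
    have "((\<lambda>t. eta2 (exp t - 1)) has_real_derivative (ln (1 + (exp t - 1)) / (exp t - 1)) * exp t) (at t)"
      by (rule DERIV_chain2[OF eta2_deriv]) (use t2 in \<open>auto intro!: derivative_eq_intros\<close>)
    moreover have "((\<lambda>t. t * ln (exp t - 1)) has_real_derivative
        1 * ln (exp t - 1) + (inverse (exp t - 1) * (exp t - 0)) * t) (at t)"
      using t2 by (intro DERIV_mult DERIV_ident DERIV_chain2[OF DERIV_ln] DERIV_diff DERIV_exp DERIV_const) auto
    ultimately have "((\<lambda>t. G t - H t) has_real_derivative (- ln (exp t - 1) - ((ln (1 + (exp t - 1)) / (exp t - 1)) * exp t -
       (1 * ln (exp t - 1) + (inverse (exp t - 1) * (exp t - 0)) * t)))) (at t)"
      unfolding H_def by (intro DERIV_diff assms(2) t)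
    hence "((\<lambda>t. G t - H t) has_real_derivative 0) (at t)" by (simp add: divide_inverse)
    thus "((\<lambda>t. G t - H t) has_real_derivative 0) (at t)" by simp
  qed auto
  thus ?thesis by (simp add: H_def eta2_one) (simp add: eta2_def)
qed

section \<open>Stirling and Gauss product limits with rates\<close>

text \<open>1/j^2 \<le> 2 (1/j - 1/(j+1)) for j \<ge> 1, so increments of size C/j^2 telescope. This
  gives both the Cauchy property and, in the limit, the rate O(1/k), for Stirling as well as for the
  Gauss product.\<close>

lemma telescope_inverse_square:
  fixes a :: "nat \<Rightarrow> 'a :: real_normed_vector"
  assumes "\<And>k. k \<ge> 1 \<Longrightarrow> norm (a (Suc k) - a k) \<le> C / (real k)\<^sup>2" and "k \<ge> 1" "C \<ge> 0"
  shows "norm (a (k + m) - a k) \<le> 2 * C * (1 / real k - 1 / real (k + m))"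
proof (induction m)
  case (Suc m)
  let ?j = "real (k + m)"
  have j: "?j \<ge> 1" using assms(2) by simp
  have "C / ?j\<^sup>2 \<le> 2 * C * (1 / ?j - 1 / (?j + 1))"
  proof -
    have "1 / ?j\<^sup>2 \<le> 2 * (1 / ?j - 1 / (?j + 1))"
      using j by (auto simp: divide_simps power2_eq_square)
    from mult_left_mono[OF this assms(3)] show ?thesis by (simp add: algebra_simps)
  qed
  moreover have "norm (a (k + Suc m) - a (k + m)) \<le> C / ?j\<^sup>2"
    using assms(1)[of "k+m"] assms(2) by simp
  moreover have "norm (a (k + Suc m) - a k) \<le> norm (a (k + Suc m) - a (k + m)) + norm (a (k + m) - a k)"
    by (metis add_diff_cancel diff_add_cancel norm_triangle_ineq add_diff_eq)
  ultimately have "norm (a (k + Suc m) - a k) \<le>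
      2 * C * (1 / ?j - 1 / (?j + 1)) + 2 * C * (1 / real k - 1 / ?j)"
    using Suc.IH by linarith
  thus ?case by (simp add: algebra_simps)
qed auto

lemma LIMSEQ_inverse_square_rate:
  fixes a :: "nat \<Rightarrow> 'a :: real_normed_vector"
  assumes "\<And>k. k \<ge> 1 \<Longrightarrow> norm (a (Suc k) - a k) \<le> C / (real k)\<^sup>2" and "a \<longlonglongrightarrow> L"
    and "k \<ge> 1" "C \<ge> 0"
  shows "norm (a k - L) \<le> 2 * C / real k"
proof -
  have "(\<lambda>m. norm (a (m + k) - a k)) \<longlonglongrightarrow> norm (L - a k)"
    using LIMSEQ_ignore_initial_segment[OF assms(2), of k] by (intro tendsto_intros)
  moreover have "norm (a (m + k) - a k) \<le> 2 * C / real k" for m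
  proof -
    have "2 * C * (1 / real k - 1 / real (k + m)) \<le> 2 * C * (1 / real k)"
      using assms(3,4) by (intro mult_left_mono) auto
    thus ?thesis using telescope_inverse_square[OF assms(1,3,4), of m] by (simp add: add.commute)
  qed
  ultimately have "norm (L - a k) \<le> 2 * C / real k"
    by (intro LIMSEQ_le_const2) auto
  thus ?thesis by (simp add: norm_minus_commute)
qed

text \<open>2x/(2+x) is the [1/1] Pade approximant of ln (1 + x). It is chosen because (1/x + 1/2) *
  2x/(2+x) = 1 exactly, which is the cancellation in the increments of Stirling's formula. Both
  bounds follow from the derivative x^2 / ((1+x)(2+x)^2) of the difference.\<close>

lemma ln_one_plus_pade:
  fixes x :: real assumes "0 \<le> x" "x \<le> 1"
  shows "0 \<le> ln (1 + x) - 2 * x / (2 + x)" "ln (1 + x) - 2 * x / (2 + x) \<le> x ^ 3 / 4"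
proof -
  have d: "((\<lambda>x. ln (1 + x) - 2 * x / (2 + x)) has_real_derivative y\<^sup>2 / ((1 + y) * (2 + y)\<^sup>2)) (at y)"
    if "0 \<le> y" for y :: real
  proof -
    have "1 / (1 + y) - (2 * (2 + y) - 2 * y) / ((2 + y) * (2 + y)) = y\<^sup>2 / ((1 + y) * (2 + y)\<^sup>2)"
      using that by (simp add: divide_simps power2_eq_square) (simp add: algebra_simps)
    moreover have "((\<lambda>x. ln (1 + x) - 2 * x / (2 + x)) has_real_derivative 1 / (1 + y) - (2 * (2 + y) - 2 * y) / ((2 + y) * (2 + y))) (at y)"
      using that by (auto intro!: derivative_eq_intros)
    ultimately show ?thesis by simp
  qed
  have "(\<lambda>x. ln (1 + x) - 2 * x / (2 + x)) 0 \<le> (\<lambda>x. ln (1 + x) - 2 * x / (2 + x)) x"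
  proof (rule DERIV_nonneg_imp_nondecreasing[OF assms(1)])
    fix y assume y: "0 \<le> y" "y \<le> x"
    have "0 \<le> y\<^sup>2 / ((1 + y) * (2 + y)\<^sup>2)" using y by simp
    thus "\<exists>z. ((\<lambda>x. ln (1 + x) - 2 * x / (2 + x)) has_real_derivative z) (at y) \<and> 0 \<le> z"
      using d[OF y(1)] by blast
  qed
  thus "0 \<le> ln (1 + x) - 2 * x / (2 + x)" by simp
  have "(\<lambda>x. x ^ 3 / 4 - (ln (1 + x) - 2 * x / (2 + x))) 0 \<le> (\<lambda>x. x ^ 3 / 4 - (ln (1 + x) - 2 * x / (2 + x))) x"
  proof (rule DERIV_nonneg_imp_nondecreasing[OF assms(1)])
    fix y assume y: "0 \<le> y" "y \<le> x"
    have "y\<^sup>2 / ((1 + y) * (2 + y)\<^sup>2) \<le> y\<^sup>2 / (1 * 2\<^sup>2)"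
      using y by (intro divide_left_mono mult_mono power_mono) auto
    also have "\<dots> \<le> 3 * y\<^sup>2 / 4" by simp
    finally have "0 \<le> 3 * y\<^sup>2 / 4 - y\<^sup>2 / ((1 + y) * (2 + y)\<^sup>2)" by simp
    moreover have "((\<lambda>x. x ^ 3 / 4 - (ln (1 + x) - 2 * x / (2 + x))) has_real_derivative
        3 * y\<^sup>2 / 4 - y\<^sup>2 / ((1 + y) * (2 + y)\<^sup>2)) (at y)"
      by (rule DERIV_diff[OF _ d[OF y(1)]]) (auto intro!: derivative_eq_intros)
    ultimately show "\<exists>z. ((\<lambda>x. x ^ 3 / 4 - (ln (1 + x) - 2 * x / (2 + x))) has_real_derivative z) (at y) \<and> 0 \<le> z"
      by blast
  qed
  thus "ln (1 + x) - 2 * x / (2 + x) \<le> x ^ 3 / 4" by simp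
qed

lemma stirling_aux_rate:
  fixes k :: nat
  defines "a \<equiv> \<lambda>k::nat. ln (fact k :: real) - (real k + 1/2) * ln (real k) + real k"
  assumes "k \<ge> 1"
  shows "norm (a (Suc k) - a k) \<le> 1 / (real k)\<^sup>2"
proof -
  define x where "x = 1 / real k"
  have x: "0 < x" "x \<le> 1" "real k = 1 / x" using assms(2) by (auto simp: x_def)
  have "ln (fact (Suc k) :: real) = ln (real (Suc k)) + ln (fact k)"
    by (subst fact_Suc) (simp add: ln_mult del: of_nat_Suc)
  moreover have "ln (real (Suc k)) = ln (real k) + ln (1 + x)"
  proof -
    have "real (Suc k) = real k * (1 + x)" using assms(2) by (simp add: x_def field_simps)
    thus ?thesis using x assms(2) by (simp only: ln_mult_pos)
  qed
  ultimately have "a (Suc k) - a k = 1 - (1/x + 1/2) * ln (1 + x)"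
    unfolding a_def using x(3) by (simp add: algebra_simps)
  also have "\<dots> = - ((1/x + 1/2) * (ln (1 + x) - 2 * x / (2 + x)))"
  proof -
    have "(1/x + 1/2) * (2 * x / (2 + x)) = 1" using x by (simp add: divide_simps)
    thus ?thesis by (simp only: right_diff_distrib)
  qed
  finally have e: "a (Suc k) - a k = - ((1/x + 1/2) * (ln (1 + x) - 2 * x / (2 + x)))" .
  have "norm (a (Suc k) - a k) = (1/x + 1/2) * (ln (1 + x) - 2 * x / (2 + x))"
    unfolding e using x ln_one_plus_pade(1)[of x] by (simp add: abs_mult)
  also have "\<dots> \<le> (2 / x) * (x ^ 3 / 4)"
    using x ln_one_plus_pade[of x] by (intro mult_mono) (auto simp: field_simps)
  also have "\<dots> \<le> x\<^sup>2" using x by (simp add: power3_eq_cube power2_eq_square)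
  finally show ?thesis by (simp add: x_def power_divide)
qed

text \<open>Wallis' product, read off from the Gauss product for \<Gamma>(1/2) = sqrt pi and
  pochhammer (1/2) n = (2n)! / (4^n n!). It serves to identify the constant in Stirling's
  formula.\<close>

lemma LIMSEQ_central_binomial:
  "(\<lambda>n. (fact n)\<^sup>2 * 4 ^ n / (fact (2 * n) * sqrt (real n))) \<longlonglongrightarrow> sqrt pi"
proof -
  have "(\<lambda>n. (1 + 1 / (2 * real n)) / rGamma_series (1/2) n) \<longlonglongrightarrow> 1 / rGamma (1/2 :: real)"
  proof (intro tendsto_divide rGamma_series_LIMSEQ)
    show "(\<lambda>n. 1 + 1 / (2 * real n)) \<longlonglongrightarrow> 1" by real_asymp
    show "rGamma (1/2 :: real) \<noteq> 0" by (simp add: rGamma_inverse_Gamma Gamma_one_half_real)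
  qed
  also have "1 / rGamma (1/2 :: real) = sqrt pi"
    by (simp only: rGamma_inverse_Gamma Gamma_one_half_real inverse_eq_divide) simp
  finally have l: "(\<lambda>n. (1 + 1 / (2 * real n)) / rGamma_series (1/2) n) \<longlonglongrightarrow> sqrt pi" .
  have "\<forall>\<^sub>F n in sequentially. (1 + 1 / (2 * real n)) / rGamma_series (1/2) n =
     (fact n)\<^sup>2 * 4 ^ n / (fact (2 * n) * sqrt (real n))"
    using eventually_gt_at_top[of 0]
  proof eventually_elim
    case (elim n)
    have p: "pochhammer (1/2 :: real) n > 0" by (intro pochhammer_pos) auto
    have s: "exp (1/2 * of_real (ln (real n))) = sqrt (real n)" 
    proof -
      have "exp (ln (sqrt (real n))) = sqrt (real n)" using elim by simp
      thus ?thesis using elim by (simp add: ln_sqrt)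
    qed
    have e1: "rGamma_series (1/2 :: real) n = pochhammer (1/2) n * (1/2 + real n) / (fact n * sqrt (real n))"
      by (simp only: rGamma_series_def s Suc_eq_plus1[symmetric] pochhammer_Suc)
    have e2: "(1 + 1 / (2 * real n)) = (1/2 + real n) / real n" using elim by (simp add: field_simps)
    have e3: "1/2 + real n \<noteq> 0" using elim by auto
    have "(1 + 1 / (2 * real n)) / rGamma_series (1/2) n = fact n * sqrt (real n) / (real n * pochhammer (1/2) n)"
    proof -
      have "(h / m) / (P * h / (F * S)) = F * S / (m * P)" if "h \<noteq> 0" "P \<noteq> 0" for h m P F S :: real
        using that by (simp add: field_simps)
      note gen = this
      have pz: "pochhammer (1/2 :: real) n \<noteq> 0" using p by simp
      show ?thesis unfolding e1 e2 by (rule gen[OF e3 pz])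
    qed
    also have "\<dots> = fact n / (sqrt (real n) * pochhammer (1/2) n)"
      using elim p real_sqrt_mult_self[of "real n"] by (simp add: divide_simps)
    also have "\<dots> = (fact n)\<^sup>2 * 4 ^ n / (fact (2 * n) * sqrt (real n))"
    proof -
      have "(4::real) ^ n = 2 ^ (2 * n)" by (simp add: power_mult)
      thus ?thesis unfolding fact_double power2_eq_square using p by simp
    qed
    finally show ?case .
  qed
  from Lim_transform_eventually[OF l this] show ?thesis .
qed

text \<open>The normalised sequence \<open>a\<close> has increments O(1/k^2), hence a limit
  \<open>L\<close> with rate O(1/k). The value of \<open>L\<close> comes from the duplication 2 a(n)
  - a(2n), which tends to \<open>L\<close> and equals the logarithm of sqrt 2 times the Wallis
  quotient.\<close>

lemma stirling_rate:
  fixes k :: nat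
  assumes "k \<ge> 1"
  shows "\<bar>ln (fact k) - ((real k + 1/2) * ln (real k) - real k + ln (2 * pi) / 2)\<bar> \<le> 2 / real k"
proof -
  define a where "a = (\<lambda>k::nat. ln (fact k :: real) - (real k + 1/2) * ln (real k) + real k)"
  have r: "norm (a (Suc k) - a k) \<le> 1 / (real k)\<^sup>2" if "k \<ge> 1" for k
    using stirling_aux_rate[OF that] unfolding a_def .
  have "Cauchy a"
  proof (rule CauchyI')
    fix e :: real assume e: "e > 0"
    obtain M where M: "M \<ge> 1" "2 / real M < e"
    proof -
      obtain M :: nat where "2 / e < real M" using reals_Archimedean2 by blast
      thus ?thesis using e by (intro that[of "Suc M"]) (auto simp: field_simps)
    qed
    show "\<exists>M. \<forall>m\<ge>M. \<forall>n>m. dist (a m) (a n) < e"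
    proof (intro exI allI impI)
      fix m n assume mn: "m \<ge> M" "n > m"
      then obtain j where j: "n = m + j" using less_imp_add_positive by blast
      have "norm (a (m + j) - a m) \<le> 2 * 1 * (1 / real m - 1 / real (m + j))"
        using mn M by (intro telescope_inverse_square r) simp_all
      also have "\<dots> \<le> 2 / real m" by simp
      also have "\<dots> \<le> 2 / real M" using mn M by (intro divide_left_mono) auto
      also have "\<dots> < e" by fact
      finally show "dist (a m) (a n) < e" by (simp add: j dist_norm norm_minus_commute)
    qed
  qed
  then obtain L where L: "a \<longlonglongrightarrow> L" using Cauchy_convergent convergent_def by blast
  have "(\<lambda>n. exp (2 * a n - a (2 * n))) \<longlonglongrightarrow> exp (2 * L - L)"
    using LIMSEQ_subseq_LIMSEQ[OF L, of "\<lambda>n. 2*n"]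
    by (intro tendsto_intros L) (simp add: strict_mono_def o_def)
  moreover have "(\<lambda>n. exp (2 * a n - a (2 * n))) \<longlonglongrightarrow> sqrt 2 * sqrt pi"
  proof (rule Lim_transform_eventually[OF tendsto_mult[OF tendsto_const LIMSEQ_central_binomial, of "sqrt 2"]])
    show "\<forall>\<^sub>F n in sequentially. sqrt 2 * ((fact n)\<^sup>2 * 4 ^ n / (fact (2 * n) * sqrt (real n))) = exp (2 * a n - a (2 * n))"
      using eventually_gt_at_top[of 0]
    proof eventually_elim
      case (elim n)
      have "2 * a n - a (2*n) = 2 * ln (fact n) - ln (fact (2*n)) + ln 2 / 2 + real n * (2 * ln 2) - ln (real n) / 2"
        using elim by (simp add: a_def ln_mult algebra_simps add_divide_distrib)
      also have "\<dots> = ln (sqrt 2 * ((fact n)\<^sup>2 * 4 ^ n / (fact (2 * n) * sqrt (real n))))"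
      proof -
        have "ln ((4::real) ^ n) = real n * (2 * ln 2)"
          using ln_realpow[of 4 n] ln_realpow[of 2 2] by simp
        thus ?thesis using elim by (simp add: ln_mult ln_div ln_realpow ln_sqrt)
      qed
      finally show ?case using elim by simp
    qed
  qed
  ultimately have "exp L = sqrt (2 * pi)" using LIMSEQ_unique by (fastforce simp: real_sqrt_mult)
  hence "L = ln (sqrt (2 * pi))" by (metis ln_exp)
  hence Lv: "L = ln (2 * pi) / 2" by (simp add: ln_sqrt)
  have "norm (a k - L) \<le> 2 * 1 / real k"
    by (rule LIMSEQ_inverse_square_rate[OF r L assms]) auto
  thus ?thesis by (simp add: a_def Lv algebra_simps)
qed

text \<open>Gauss's partial product for 1/\<Gamma>(1 + \<omega>), with
  \<open>exp (- \<omega> * ln k)\<close> in the role of k^(-\<omega>). It is kept as a product and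
  never written as an exponential, because it has zeros at negative integers.\<close>

definition gprod :: "complex \<Rightarrow> nat \<Rightarrow> complex" where
  "gprod \<omega> k = (\<Prod>j=1..k. 1 + \<omega> / of_nat j) * exp (- \<omega> * of_real (ln (real k)))"

text \<open>\<open>rGamma_series (1 + \<omega>) n\<close> has one factor more in its Pochhammer
  symbol and one more power of \<open>n\<close>; the quotient of the two sequences is 1 + (1 +
  \<omega>)/n, which tends to 1.\<close>

lemma gprod_LIMSEQ: "gprod \<omega> \<longlonglongrightarrow> rGamma (1 + \<omega>)"
proof -
  have "(\<lambda>n. rGamma_series (1 + \<omega>) n / (1 + (1 + \<omega>) / of_nat n)) \<longlonglongrightarrow> rGamma (1 + \<omega>) / (1 + 0)"
    by (intro tendsto_intros lim_const_over_n) auto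
  moreover have "\<forall>\<^sub>F n in sequentially. rGamma_series (1 + \<omega>) n / (1 + (1 + \<omega>) / of_nat n) = gprod \<omega> n"
    using eventually_gt_at_top[of "nat \<lceil>norm (1 + \<omega>)\<rceil>"]
  proof eventually_elim
    case (elim n)
    have n: "n > 0" "norm (1 + \<omega>) < real n" using elim by linarith+
    have nz: "of_nat n + (1 + \<omega>) \<noteq> 0"
    proof
      assume "of_nat n + (1 + \<omega>) = 0"
      hence "1 + \<omega> = - of_nat n" by (simp add: eq_neg_iff_add_eq_0 add.commute)
      thus False using n by (simp add: norm_minus_cancel)
    qed
    have pr: "(\<Prod>j=1..k. 1 + \<omega> / of_nat j) = pochhammer (1 + \<omega>) k / fact k" for k
    proof (induction k)
      case (Suc k)
      have "1 + \<omega> / of_nat (Suc k) = (1 + \<omega> + of_nat k) / of_nat (Suc k)"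
        by (simp add: field_simps del: of_nat_Suc) simp
      with Suc show ?case by (simp add: pochhammer_Suc del: of_nat_Suc)
    qed auto
    have ln0: "ln (of_nat n :: complex) = of_real (ln (real n))"
      using n Ln_of_real[of "real n"] by simp
    have ex: "exp ((1 + \<omega>) * of_real (ln (real n))) = of_nat n * exp (\<omega> * of_real (ln (real n)))"
      using n by (simp add: algebra_simps exp_add exp_of_real)
    have "rGamma_series (1 + \<omega>) n = (1 + (1 + \<omega>) / of_nat n) * gprod \<omega> n"
    proof -
      have "1 + (1 + \<omega>) / of_nat n = (of_nat n + (1 + \<omega>)) / of_nat n" using n by (simp add: field_simps)
      moreover have "P * (1 + \<omega> + of_nat n) / (F * (of_nat n * E)) = (of_nat n + (1 + \<omega>)) / of_nat n * (P / F * inverse E)"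
        for P F E :: complex
        by (simp add: divide_inverse add_ac mult_ac)
      moreover have "exp (- \<omega> * of_real (ln (real n))) = inverse (exp (\<omega> * of_real (ln (real n))))"
        by (simp add: exp_minus)
      ultimately show ?thesis
        unfolding gprod_def pr rGamma_series_def ln0 ex Suc_eq_plus1[symmetric] pochhammer_Suc
        by presburger
    qed
    moreover have "1 + (1 + \<omega>) / of_nat n \<noteq> 0" using n nz by (simp add: field_simps)
    ultimately show ?case by simp
  qed
  ultimately show ?thesis by (simp add: Lim_transform_eventually)
qed

text \<open>The increments are bounded by |gprod| D / k^2, relative to the current value. This first
  yields boundedness, uniformly for |\<omega>| \<le> R, and then the additive rate. No division by
  \<open>gprod\<close> occurs, so the zeros do no harm.\<close>

lemma gprod_rate:
  assumes "R \<ge> 0"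
  shows "\<exists>C\<ge>0. \<forall>\<omega> k. norm \<omega> \<le> R \<longrightarrow> k \<ge> 1 \<longrightarrow>
     norm (gprod \<omega> k) \<le> C \<and> norm (gprod \<omega> k - rGamma (1 + \<omega>)) \<le> C / real k"
proof -
  \<comment> \<open>The three summands bound the three parts of (1 + \<omega> x) exp (\<omega> l) -
    1 with x = 1/(k+1) and l = ln (1 - x): the term \<omega> (x + l), the term \<omega>^2 x l, and
    the second order remainder of the exponential.\<close>
  define D where "D = R * 2 + R\<^sup>2 * 2 + (1 + R) * (exp R * (4 * R\<^sup>2))"
  have D: "D \<ge> 0" using assms by (auto simp: D_def)
  have diff_le: "norm (gprod \<omega> (Suc k) - gprod \<omega> k) \<le> norm (gprod \<omega> k) * (D / (real k)\<^sup>2)"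
    if w: "norm \<omega> \<le> R" and k: "k \<ge> 1" for \<omega> k
  proof -
    define x where "x = 1 / real (Suc k)"
    define l where "l = ln (1 - x)"
    define z where "z = \<omega> * of_real l"
    have x: "0 < x" "x \<le> 1/2" using k by (auto simp: x_def field_simps)
    have lb: "\<bar>l + x\<bar> \<le> 2 * x\<^sup>2"
      using abs_ln_one_plus_x_minus_x_bound[of "-x"] x by (simp add: l_def)
    have "2 * x\<^sup>2 \<le> x" using x by (simp add: power2_eq_square)
    hence l2: "\<bar>l\<bar> \<le> 2 * x" using lb by linarith
    have "norm z \<le> R * (2 * x)" unfolding z_def norm_mult using w l2 assms by (intro mult_mono) auto
    moreover have "R * (2 * x) \<le> R * 1" using x assms by (intro mult_left_mono) auto
    ultimately have z: "norm z \<le> R * (2*x)" "norm z \<le> R" by linarith+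
    have E: "norm (exp z - 1 - z) \<le> exp R * (4 * R\<^sup>2) * x\<^sup>2"
    proof -
      have "norm (exp z - (\<Sum>k\<le>1. z ^ k / fact k)) \<le> exp \<bar>Re z\<bar> * norm z ^ Suc 1 / fact 1"
        by (rule Taylor_exp)
      also have "\<dots> \<le> exp R * (R * (2 * x)) ^ 2"
        using z abs_Re_le_cmod[of z] assms x 
        by (simp only: fact_1 div_by_1 One_nat_def[symmetric] Suc_1, intro mult_mono power_mono) auto
      finally show ?thesis by (simp add: power2_eq_square algebra_simps)
    qed
    have kx: "real k / real (Suc k) = 1 - x" by (simp add: x_def field_simps)
    have lnS: "ln (real (Suc k)) = ln (real k) - l"
    proof -
      have "l = ln (real k / real (Suc k))" by (simp only: l_def kx)
      thus ?thesis using k by (simp add: ln_div)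
    qed
    have "gprod \<omega> (Suc k) = gprod \<omega> k * ((1 + \<omega> * of_real x) * exp z)"
    proof -
      have "exp (- \<omega> * of_real (ln (real k) - l)) = exp (- \<omega> * of_real (ln (real k))) * exp z"
        by (simp add: z_def exp_add[symmetric] right_diff_distrib)
      moreover have "\<omega> / of_nat (Suc k) = \<omega> * of_real x" by (simp add: x_def)
      ultimately show ?thesis
        unfolding gprod_def lnS prod.nat_ivl_Suc'[OF le_SucI[OF k, unfolded One_nat_def[symmetric]]]
        by (simp only: mult_ac)
    qed
    hence "gprod \<omega> (Suc k) - gprod \<omega> k = gprod \<omega> k *
       (\<omega> * of_real (x + l) + \<omega>\<^sup>2 * of_real x * of_real l + (1 + \<omega> * of_real x) * (exp z - 1 - z))"
      by (simp add: z_def algebra_simps power2_eq_square)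
    also have "norm \<dots> \<le> norm (gprod \<omega> k) * (D * x\<^sup>2)"
    proof -
      have "norm (\<omega> * of_real (x + l) + \<omega>\<^sup>2 * of_real x * of_real l + (1 + \<omega> * of_real x) * (exp z - 1 - z)) \<le>
         norm (\<omega> * of_real (x + l)) + norm (\<omega>\<^sup>2 * of_real x * of_real l) + norm ((1 + \<omega> * of_real x) * (exp z - 1 - z))"
        by (rule order_trans[OF norm_triangle_ineq add_right_mono[OF norm_triangle_ineq]])
      moreover have "norm (\<omega> * of_real (x + l)) \<le> R * (2 * x\<^sup>2)"
        unfolding norm_mult norm_of_real using w lb assms by (intro mult_mono) (auto simp: add.commute)
      moreover have "norm (\<omega>\<^sup>2 * of_real x * of_real l) \<le> R\<^sup>2 * x * (2 * x)"
        unfolding norm_mult norm_of_real norm_power using w l2 x assms by (intro mult_mono power_mono) auto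
      moreover have "norm ((1 + \<omega> * of_real x) * (exp z - 1 - z)) \<le> (1 + R) * (exp R * (4 * R\<^sup>2) * x\<^sup>2)"
        unfolding norm_mult
      proof (intro mult_mono E)
        have "norm (1 + \<omega> * of_real x) \<le> 1 + norm \<omega> * x" 
          using norm_triangle_ineq[of 1 "\<omega> * of_real x"] x by (simp add: norm_mult)
        also have "\<dots> \<le> 1 + R * 1" using w x assms by (intro add_left_mono mult_mono) auto
        finally show "norm (1 + \<omega> * of_real x) \<le> 1 + R" by simp
      qed (use assms in auto)
      moreover have "D * x\<^sup>2 = R * (2 * x\<^sup>2) + R\<^sup>2 * x * (2 * x) + (1 + R) * (exp R * (4 * R\<^sup>2) * x\<^sup>2)"
        by (simp add: D_def algebra_simps power2_eq_square)
      ultimately have "norm (\<omega> * of_real (x + l) + \<omega>\<^sup>2 * of_real x * of_real l + (1 + \<omega> * of_real x) * (exp z - 1 - z)) \<le> D * x\<^sup>2"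
        by linarith
      thus ?thesis unfolding norm_mult[of "gprod \<omega> k"] by (intro mult_left_mono) auto
    qed
    finally have "norm (gprod \<omega> (Suc k) - gprod \<omega> k) \<le> norm (gprod \<omega> k) * (D * x\<^sup>2)" .
    moreover have "D * x\<^sup>2 \<le> D / (real k)\<^sup>2"
    proof -
      have "x\<^sup>2 \<le> (1 / real k)\<^sup>2" using k by (intro power_mono) (auto simp: x_def field_simps)
      from mult_left_mono[OF this D] show ?thesis by (simp add: power_divide)
    qed
    ultimately show ?thesis using mult_left_mono[of "D * x\<^sup>2" "D / (real k)\<^sup>2" "norm (gprod \<omega> k)"] by simp
  qed
  \<comment> \<open>The exponent 1 - 1/k, rather than a plain constant, makes the induction close:
    the factor 1 + D/n^2 is at most the exponential of 2 D (1/n - 1/(n+1)).\<close>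
  have bd: "norm (gprod \<omega> k) \<le> (1 + R) * exp (2 * D * (1 - 1 / real k))"
    if w: "norm \<omega> \<le> R" and k: "k \<ge> 1" for \<omega> k
    using k
  proof (induction k rule: dec_induct)
    case base
    have "norm (1 + \<omega>) \<le> 1 + R" using norm_triangle_ineq[of 1 \<omega>] w by simp
    thus ?case by (simp add: gprod_def)
  next
    case (step n)
    have n: "real n \<ge> 1" using step by simp
    have "norm (gprod \<omega> (Suc n)) \<le> norm (gprod \<omega> n) + norm (gprod \<omega> (Suc n) - gprod \<omega> n)"
      by (metis add.commute diff_add_cancel norm_triangle_ineq)
    also have "\<dots> \<le> norm (gprod \<omega> n) * (1 + D / (real n)\<^sup>2)"
      using diff_le[OF w, of n] step(1) by (simp add: algebra_simps)
    also have "\<dots> \<le> ((1 + R) * exp (2 * D * (1 - 1 / real n))) * exp (2 * D * (1 / real n - 1 / real (Suc n)))"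
    proof (intro mult_mono step.IH)
      have "1 / (real n)\<^sup>2 \<le> 2 * (1 / real n - 1 / (real n + 1))"
        using n by (auto simp: divide_simps power2_eq_square)
      from mult_left_mono[OF this D] have "D / (real n)\<^sup>2 \<le> 2 * D * (1 / real n - 1 / real (Suc n))"
        by (simp add: algebra_simps)
      thus "1 + D / (real n)\<^sup>2 \<le> exp (2 * D * (1 / real n - 1 / real (Suc n)))"
        using exp_ge_add_one_self[of "2 * D * (1 / real n - 1 / real (Suc n))"] by linarith
    qed (use assms D in auto)
    also have "\<dots> = (1 + R) * exp (2 * D * (1 - 1 / real (Suc n)))"
      by (simp add: exp_add[symmetric] algebra_simps)
    finally show ?case .
  qed
  define B where "B = (1 + R) * exp (2 * D)"
  have B: "norm (gprod \<omega> k) \<le> B" if "norm \<omega> \<le> R" "k \<ge> 1" for \<omega> k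
  proof -
    have "(1 + R) * exp (2 * D * (1 - 1 / real k)) \<le> B" unfolding B_def
      using assms D by (intro mult_left_mono) (auto simp: algebra_simps)
    thus ?thesis using bd[OF that] by linarith
  qed
  have B0: "B \<ge> 0" using assms by (simp add: B_def)
  have r: "norm (gprod \<omega> k - rGamma (1 + \<omega>)) \<le> 2 * (B * D) / real k" if "norm \<omega> \<le> R" "k \<ge> 1" for \<omega> k
  proof (rule LIMSEQ_inverse_square_rate[OF _ gprod_LIMSEQ that(2)])
    fix j :: nat assume "j \<ge> 1"
    thus "norm (gprod \<omega> (Suc j) - gprod \<omega> j) \<le> B * D / (real j)\<^sup>2"
      using diff_le[OF that(1), of j] mult_right_mono[OF B[OF that(1), of j], of "D / (real j)\<^sup>2"] D by simp
  qed (use B0 D in auto)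
  show ?thesis
  proof (intro exI[of _ "B + 2 * (B * D)"] conjI allI impI)
    fix \<omega> :: complex and k :: nat assume wk: "norm \<omega> \<le> R" "k \<ge> 1"
    show "norm (gprod \<omega> k) \<le> B + 2 * (B * D)" using B[OF wk] B0 D by (simp add: add_increasing2)
    have "2 * (B * D) / real k \<le> (B + 2 * (B * D)) / real k" using B0 by (intro divide_right_mono) auto
    thus "norm (gprod \<omega> k - rGamma (1 + \<omega>)) \<le> (B + 2 * (B * D)) / real k" using r[OF wk] by linarith
  qed (use B0 D in auto)
qed

section \<open>The model product on the circle\<close>

text \<open>Uniform in the base point as well as in the target point: the next derivative is bounded
  on \<open>K\<close>, and convexity keeps the segment between the two points inside
  \<open>K\<close>.\<close>

lemma taylor_bound_compact:
  fixes f :: "complex \<Rightarrow> complex"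
  assumes "f holomorphic_on S" "open S" "compact K" "convex K" "K \<subseteq> S"
  shows "\<exists>B\<ge>0. \<forall>a\<in>K. \<forall>b\<in>K. norm (f b - (\<Sum>i\<le>n. (deriv ^^ i) f a * (b - a) ^ i / fact i)) \<le> B * norm (b - a) ^ Suc n"
proof -
  have hol: "(deriv ^^ i) f holomorphic_on S" for i
    using assms by (intro holomorphic_higher_deriv)
  have "continuous_on K ((deriv ^^ Suc n) f)"
    using hol assms(5) holomorphic_on_imp_continuous_on holomorphic_on_subset by blast
  hence "bounded ((deriv ^^ Suc n) f ` K)"
    using assms(3) compact_continuous_image compact_imp_bounded by blast
  then obtain B where B: "\<And>z. z \<in> K \<Longrightarrow> norm ((deriv ^^ Suc n) f z) \<le> B" "B > 0"
    unfolding bounded_pos by blast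
  show ?thesis
  proof (intro exI[of _ B] conjI ballI)
    fix a b assume ab: "a \<in> K" "b \<in> K"
    have "norm ((deriv ^^ 0) f b - (\<Sum>i\<le>n. (deriv ^^ i) f a * (b - a) ^ i / fact i)) \<le> B * norm (b - a) ^ Suc n / fact n"
    proof (rule complex_Taylor[where f = "\<lambda>i. (deriv ^^ i) f", OF assms(4) _ B(1) ab])
      fix i x assume "x \<in> K" "i \<le> n"
      hence "((deriv ^^ i) f has_field_derivative deriv ((deriv ^^ i) f) x) (at x)"
        using hol assms(2,5) holomorphic_derivI by blast
      thus "((deriv ^^ i) f has_field_derivative (deriv ^^ Suc i) f x) (at x within K)"
        by (simp add: has_field_derivative_at_within)
    qed
    also have "\<dots> \<le> B * norm (b - a) ^ Suc n / 1"
      using B(2) fact_ge_1[of n, where ?'a = real] by (intro divide_left_mono) auto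
    finally show "norm (f b - (\<Sum>i\<le>n. (deriv ^^ i) f a * (b - a) ^ i / fact i)) \<le> B * norm (b - a) ^ Suc n"
      by simp
  qed (use B in auto)
qed

section \<open>The quotient (exp z - 1) / z, its logarithm and the primitive of the
  logarithm\<close>

definition expm1_quot :: "complex \<Rightarrow> complex" where
  "expm1_quot z = (if z = 0 then 1 else (exp z - 1) / z)"

text \<open>The principal branch is safe on the unit disc, where \<open>expm1_quot\<close> stays
  within distance 1 of the point 1. The arguments that occur later have modulus at most ln 2 plus a
  small shift.\<close>

definition ln_expm1_quot :: "complex \<Rightarrow> complex" where
  "ln_expm1_quot z = Ln (expm1_quot z)"

lemma expm1_quot_mult: "z * expm1_quot z = exp z - 1"
  by (simp add: expm1_quot_def)

lemma expm1_quot_holomorphic: "expm1_quot holomorphic_on S"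
proof -
  have "(\<lambda>z. if z = 0 then deriv exp 0 else (exp z - exp 0) / (z - 0)) holomorphic_on UNIV"
    by (rule pole_lemma) (auto intro: holomorphic_intros)
  moreover have "deriv exp (0::complex) = 1"
    by (rule DERIV_imp_deriv) (use DERIV_exp[of "0::complex"] in simp)
  moreover have "expm1_quot = (\<lambda>z. if z = 0 then 1 else (exp z - exp 0) / (z - 0))"
    by (auto simp: fun_eq_iff expm1_quot_def)
  ultimately have "expm1_quot holomorphic_on UNIV" by (simp only:)
  thus ?thesis using holomorphic_on_subset by blast
qed

text \<open>The series of exp z - 1 - z has positive coefficients, so its modulus is at most exp |z|
  - 1 - |z| \<le> |z|^2 < |z|.\<close>

lemma expm1_quot_near_1:
  assumes "norm z < 1" shows "norm (expm1_quot z - 1) < 1"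
proof (cases "z = 0")
  case False
  have s: "summable (\<lambda>n. norm (z ^ (n+2) /\<^sub>R fact (n+2)))"
    using summable_norm_exp[of z] summable_iff_shift[of "\<lambda>n. norm (z ^ n /\<^sub>R fact n)" 2] by simp
  have "exp z - 1 - z = (\<Sum>n. z ^ (n+2) /\<^sub>R fact (n+2))"
    using exp_first_two_terms[of z] by simp
  hence "norm (exp z - 1 - z) \<le> (\<Sum>n. norm (z ^ (n+2) /\<^sub>R fact (n+2)))"
    using summable_norm[OF s] by simp
  also have "\<dots> = exp (norm z) - 1 - norm z"
    using exp_first_two_terms[of "norm z"] by (simp add: norm_power norm_mult)
  also have "\<dots> \<le> norm z ^ 2" using exp_bound[of "norm z"] assms by simp
  also have "\<dots> < norm z" using assms False by (simp add: power2_eq_square)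
  finally have "norm (exp z - 1 - z) < norm z" .
  moreover have "expm1_quot z - 1 = (exp z - 1 - z) / z"
    using False by (simp add: expm1_quot_def field_simps)
  ultimately show ?thesis using False by (simp add: norm_divide)
qed (simp add: expm1_quot_def)

lemma expm1_quot_Re_pos:
  assumes "norm z < 1" shows "Re (expm1_quot z) > 0"
  using expm1_quot_near_1[OF assms] abs_Re_le_cmod[of "expm1_quot z - 1"] by simp

lemma ln_expm1_quot_holomorphic: "ln_expm1_quot holomorphic_on ball 0 1"
proof -
  have "expm1_quot z \<notin> \<real>\<^sub>\<le>\<^sub>0" if "z \<in> ball 0 1" for z
    using expm1_quot_Re_pos[of z] that by (auto elim!: nonpos_Reals_cases)
  hence "(\<lambda>z. Ln (expm1_quot z)) holomorphic_on ball 0 1"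
    by (intro holomorphic_on_Ln' expm1_quot_holomorphic)
  thus ?thesis by (simp add: ln_expm1_quot_def[abs_def])
qed

lemma exp_ln_expm1_quot: "norm z < 1 \<Longrightarrow> exp (ln_expm1_quot z) = expm1_quot z"
  using expm1_quot_Re_pos[of z] unfolding ln_expm1_quot_def by (intro exp_Ln) auto

lemma ln_expm1_quot_0 [simp]: "ln_expm1_quot 0 = 0"
  by (simp add: ln_expm1_quot_def expm1_quot_def)

lemma ln_expm1_quot_of_real:
  assumes "x > 0" shows "ln_expm1_quot (of_real x) = of_real (ln (exp x - 1) - ln x)"
proof -
  have *: "expm1_quot (of_real x) = of_real ((exp x - 1) / x)"
    using assms by (simp add: expm1_quot_def exp_of_real)
  show ?thesis
    unfolding ln_expm1_quot_def * by (subst Ln_of_real) (use assms in \<open>auto simp: ln_div\<close>)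
qed

text \<open>Write exp z - 1 = 2 exp (z/2) sinh (z/2). The sinh factor is largest on the positive
  axis, having nonnegative coefficients, and exp (z/2) loses exactly exp (- (|z| - Re z)/2) against
  its value at |z|. This gain is the origin of all decay in the angle.\<close>

lemma norm_expm1_quot_le: "norm (expm1_quot z) \<le> norm (expm1_quot (of_real (norm z))) * exp (- (norm z - Re z) / 2)"
proof (cases "z = 0")
  case False
  have *: "exp w - 1 = exp (w/2) * (2 * sinh (w/2))" for w :: complex
    by (simp add: sinh_def algebra_simps exp_add[symmetric] scaleR_conv_of_real) (simp add: exp_minus field_simps)?
  have sinh_le: "norm (sinh w) \<le> sinh (norm w)" for w :: complex
  proof (rule norm_sums_le[OF sinh_converges sinh_converges])
    show "norm (if even n then 0 else w ^ n /\<^sub>R fact n) \<le> (if even n then 0 else norm w ^ n /\<^sub>R fact n)" for n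
      by (simp add: norm_power)
  qed
  have "norm (exp z - 1) = exp (Re z / 2) * (2 * norm (sinh (z/2)))"
    by (subst *) (simp add: norm_mult)
  also have "\<dots> \<le> exp (Re z / 2) * (2 * sinh (norm z / 2))"
    using sinh_le[of "z/2"] by (simp add: norm_divide)
  also have "\<dots> = (exp (norm z) - 1) * exp (- (norm z - Re z) / 2)"
  proof -
    have h1: "exp (norm z) - 1 = 2 * sinh (norm z / 2) * exp (norm z / 2)"
      by (simp add: sinh_def algebra_simps exp_add[symmetric])
    have h2: "exp (Re z / 2) = exp (norm z / 2) * exp (- (norm z - Re z) / 2)"
      by (simp add: exp_add[symmetric] field_simps)
    show ?thesis unfolding h1 h2 by (simp only: mult_ac)
  qed
  finally have "norm (exp z - 1) / norm z \<le> (exp (norm z) - 1) / norm z * exp (- (norm z - Re z) / 2)"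
    using False by (simp add: divide_right_mono)
  moreover have "norm (expm1_quot (of_real (norm z))) = (exp (norm z) - 1) / norm z"
  proof -
    have "expm1_quot (of_real (norm z)) = of_real ((exp (norm z) - 1) / norm z)"
      using False by (simp add: expm1_quot_def exp_of_real)
    thus ?thesis by (simp only: norm_of_real) simp
  qed
  ultimately show ?thesis using False by (simp add: expm1_quot_def norm_divide)
qed (simp add: expm1_quot_def)

lemma Re_ln_expm1_quot_le:
  assumes "norm z < 1"
  shows "Re (ln_expm1_quot z) \<le> Re (ln_expm1_quot (of_real (norm z))) - (norm z - Re z) / 2"
proof -
  have e: "exp (Re (ln_expm1_quot w)) = norm (expm1_quot w)" if "norm w < 1" for w
    using exp_ln_expm1_quot[OF that] by (metis norm_exp_eq_Re)
  have "exp (Re (ln_expm1_quot z)) \<le> exp (Re (ln_expm1_quot (of_real (norm z))) + - (norm z - Re z) / 2)"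
    unfolding exp_add using norm_expm1_quot_le[of z] assms by (simp add: e)
  thus ?thesis by (simp add: field_simps)
qed

definition prim_ln_expm1_quot :: "complex \<Rightarrow> complex" where
  "prim_ln_expm1_quot = (SOME P. P 0 = 0 \<and> (\<forall>z\<in>ball 0 1. (P has_field_derivative ln_expm1_quot z) (at z)))"

lemma prim_ln_expm1_quot:
  "prim_ln_expm1_quot 0 = 0"
  "norm z < 1 \<Longrightarrow> (prim_ln_expm1_quot has_field_derivative ln_expm1_quot z) (at z)"
proof -
  obtain g where g: "\<And>z. z \<in> ball 0 1 \<Longrightarrow> (g has_field_derivative ln_expm1_quot z) (at z within ball 0 1)"
    using holomorphic_convex_primitive'[OF convex_ball open_ball ln_expm1_quot_holomorphic] by blast
  have "\<exists>P. P 0 = 0 \<and> (\<forall>z\<in>ball 0 1. (P has_field_derivative ln_expm1_quot z) (at z))"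
  proof (intro exI[of _ "\<lambda>z. g z - g 0"] conjI ballI)
    fix z :: complex assume z: "z \<in> ball 0 1"
    hence "(g has_field_derivative ln_expm1_quot z) (at z)"
      using g[OF z] at_within_open[OF z open_ball] by simp
    thus "((\<lambda>z. g z - g 0) has_field_derivative ln_expm1_quot z) (at z)"
      by (auto intro!: derivative_eq_intros)
  qed auto
  from someI_ex[OF this]
  have *: "prim_ln_expm1_quot 0 = 0 \<and> (\<forall>z\<in>ball 0 1. (prim_ln_expm1_quot has_field_derivative ln_expm1_quot z) (at z))"
    unfolding prim_ln_expm1_quot_def .
  thus "prim_ln_expm1_quot 0 = 0" by (rule conjunct1)
  show "(prim_ln_expm1_quot has_field_derivative ln_expm1_quot z) (at z)" if "norm z < 1"
    using bspec[OF conjunct2[OF *], of z] that by simp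
qed

lemma ln_2_less_7_10: "ln (2::real) < 7 / 10"
  using ln2_le_25_over_36 by linarith

lemma prim_holomorphic: "prim_ln_expm1_quot holomorphic_on ball 0 1"
proof (rule holomorphic_onI)
  fix z :: complex assume "z \<in> ball 0 1"
  hence "(prim_ln_expm1_quot has_field_derivative ln_expm1_quot z) (at z)"
    by (intro prim_ln_expm1_quot) simp
  from has_field_derivative_at_within[OF this]
  show "prim_ln_expm1_quot field_differentiable at z within ball 0 1"
    unfolding field_differentiable_def by blast
qed

text \<open>On the real axis t - t ln t - P t has derivative - ln (exp t - 1), so
  \<open>integral_ln_expm1\<close> evaluates it at ln 2. The imaginary part is constant because the
  integrand is real there.\<close>

lemma prim_ln_2: "prim_ln_expm1_quot (of_real (ln 2)) = of_real (ln 2 - ln 2 * ln (ln 2) - pi\<^sup>2 / 12)"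
proof -
  define P where "P = (\<lambda>t::real. prim_ln_expm1_quot (of_real t))"
  have cP: "continuous_on {0..ln 2} P"
  proof -
    have "continuous_on {0..ln 2} (\<lambda>t::real. prim_ln_expm1_quot (complex_of_real t))"
      by (rule continuous_on_compose2[OF holomorphic_on_imp_continuous_on[OF prim_holomorphic]])
         (use ln_2_less_7_10 in \<open>auto intro!: continuous_intros\<close>)
    thus ?thesis by (simp add: P_def)
  qed
  have dP: "(P has_vector_derivative of_real (ln (exp t - 1) - ln t)) (at t)" if "0 < t" "t < ln 2" for t
  proof -
    have "(prim_ln_expm1_quot has_field_derivative ln_expm1_quot (of_real t)) (at (of_real t))"
      by (rule prim_ln_expm1_quot) (use that ln_2_less_7_10 in auto)
    from has_vector_derivative_real_field[OF this] show ?thesis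
      using that by (simp add: ln_expm1_quot_of_real P_def)
  qed
  have dRe: "((\<lambda>t. Re (P t)) has_real_derivative ln (exp t - 1) - ln t) (at t)"
    and dIm: "((\<lambda>t. Im (P t)) has_real_derivative 0) (at t)" if "0 < t" "t < ln 2" for t
    using bounded_linear.has_vector_derivative[OF bounded_linear_Re, OF dP[OF that]] bounded_linear.has_vector_derivative[OF bounded_linear_Im, OF dP[OF that]] 
    by (auto simp: has_real_derivative_iff_has_vector_derivative)
  have "(\<lambda>t. Im (P t)) (ln 2) = (\<lambda>t. Im (P t)) 0"
    by (rule DERIV_isconst_end[where f = "\<lambda>t. Im (P t)"]) (use dIm cP in \<open>auto intro!: continuous_intros\<close>)
  hence Im: "Im (P (ln 2)) = 0" by (simp add: P_def prim_ln_expm1_quot)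
  have c2: "continuous_on {0..ln 2} (\<lambda>t::real. t * ln t)"
    unfolding continuous_on_def
  proof
    fix x :: real assume x: "x \<in> {0..ln 2}"
    show "((\<lambda>t::real. t * ln t) \<longlongrightarrow> x * ln x) (at x within {0..ln 2})"
    proof (cases "x = 0")
      case True
      have "((\<lambda>t::real. t * ln t) \<longlongrightarrow> 0) (at_right 0)" by real_asymp
      thus ?thesis using True by (simp add: at_within_Icc_at_right)
    qed (auto intro!: tendsto_intros)
  qed
  have "(\<lambda>t. t - t * ln t - Re (P t)) (ln 2) - (\<lambda>t. t - t * ln t - Re (P t)) 0 = pi\<^sup>2 / 12"
  proof (rule integral_ln_expm1)
    show "continuous_on {0..ln 2} (\<lambda>t. t - t * ln t - Re (P t))"
      by (intro continuous_on_diff c2 continuous_on_id continuous_on_Re cP)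
    fix t :: real assume t: "0 < t" "t < ln 2"
    have "((\<lambda>t. t * ln t) has_real_derivative 1 * ln t + inverse t * t) (at t)"
      using t by (intro DERIV_mult DERIV_ident DERIV_ln) auto
    hence "((\<lambda>t. t - t * ln t - Re (P t)) has_real_derivative 1 - (1 * ln t + inverse t * t) - (ln (exp t - 1) - ln t)) (at t)"
      by (intro DERIV_diff DERIV_ident dRe t)
    thus "((\<lambda>t. t - t * ln t - Re (P t)) has_real_derivative - ln (exp t - 1)) (at t)"
      using t by simp
  qed
  hence "Re (P (ln 2)) = ln 2 - ln 2 * ln (ln 2) - pi\<^sup>2 / 12" by (simp add: P_def prim_ln_expm1_quot)
  with Im show ?thesis by (simp add: P_def complex_eq_iff)
qed

text \<open>P t / t is the mean of \<open>ln_expm1_quot (s * t)\<close> over s in [0, 1];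
  integrating the gain s (|t| - Re t)/2 of \<open>Re_ln_expm1_quot_le\<close> over s gives the
  quarter. \<open>K\<close> is the difference of both sides with upper limit s, shown to be
  nondecreasing.\<close>

lemma Re_prim_div_le:
  assumes "norm t < 1" "t \<noteq> 0"
  shows "Re (prim_ln_expm1_quot t / t) \<le>
    Re (prim_ln_expm1_quot (of_real (norm t)) / of_real (norm t)) - (norm t - Re t) / 4"
proof -
  define K where "K = (\<lambda>s::real. Re (prim_ln_expm1_quot (of_real s * of_real (norm t)) / of_real (norm t))
     - s\<^sup>2 * (norm t - Re t) / 4 - Re (prim_ln_expm1_quot (of_real s * t) / t))"
  have d: "((\<lambda>s. Re (prim_ln_expm1_quot (of_real s * u) / u)) has_real_derivative Re (ln_expm1_quot (of_real s * u))) (at s)"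
    if "norm u < 1" "u \<noteq> 0" "0 \<le> s" "s \<le> 1" for u s
  proof -
    have n: "norm (of_real s * u) < 1"
      using that mult_le_one[of s "norm u"] by (smt (verit) mult_left_le_one_le norm_ge_zero norm_mult norm_of_real)
    have "((\<lambda>s. prim_ln_expm1_quot (s * u) / u) has_field_derivative ln_expm1_quot (of_real s * u) * u / u) (at (of_real s))"
      by (intro DERIV_cdivide DERIV_chain2[where g = "\<lambda>s. s * u" and f = prim_ln_expm1_quot, OF prim_ln_expm1_quot(2)[OF n]]) (auto intro!: derivative_eq_intros)
    from bounded_linear.has_vector_derivative[OF bounded_linear_Re, OF has_vector_derivative_real_field[OF this]] show ?thesis using that
      by (simp add: has_real_derivative_iff_has_vector_derivative)
  qed
  have "K 0 \<le> K 1"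
  proof (rule DERIV_nonneg_imp_nondecreasing[where f = K, OF zero_le_one])
    fix s :: real assume s: "0 \<le> s" "s \<le> 1"
    have "norm (of_real s * t) < 1"
      using s assms by (smt (verit) mult_left_le_one_le norm_ge_zero norm_mult norm_of_real)
    from Re_ln_expm1_quot_le[OF this] s
    have "Re (ln_expm1_quot (of_real s * t)) \<le> Re (ln_expm1_quot (of_real s * of_real (norm t))) - (2 * s) * (norm t - Re t) / 4"
      by (simp add: norm_mult field_simps)
    moreover have "(K has_real_derivative (Re (ln_expm1_quot (of_real s * of_real (norm t))) - (2 * s) * (norm t - Re t) / 4
        - Re (ln_expm1_quot (of_real s * t)))) (at s)"
      unfolding K_def using s assms
      by (intro DERIV_diff d DERIV_cdivide) (auto intro!: derivative_eq_intros)
    ultimately show "\<exists>y. (K has_real_derivative y) (at s) \<and> 0 \<le> y" by (intro exI conjI) auto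
  qed
  thus ?thesis by (simp add: K_def prim_ln_expm1_quot)
qed

text \<open>Euler--Maclaurin to first order with a complex shift: the sum is an integral, plus half
  the boundary term, plus \<omega> times the boundary term from moving every node by \<omega> y.
  Each of the \<open>k\<close> nodes costs O(|y|^2) = O(1/k^2).\<close>

lemma sum_ln_expm1_quot:
  assumes "R \<ge> 0"
  shows "\<exists>C\<ge>0. \<forall>\<omega> y k. norm \<omega> \<le> R \<longrightarrow> real k \<ge> 4 * R + 1 \<longrightarrow> norm y = ln 2 / real k \<longrightarrow>
     (\<forall>j\<in>{1..k}. norm ((of_nat j + \<omega>) * y) < 1) \<and>
     norm ((\<Sum>j=1..k. ln_expm1_quot ((of_nat j + \<omega>) * y)) - 
       (prim_ln_expm1_quot (of_nat k * y) / y + (1/2 + \<omega>) * ln_expm1_quot (of_nat k * y))) \<le> C / real k"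
proof -
  let ?\<phi> = ln_expm1_quot and ?\<Psi> = prim_ln_expm1_quot
  \<comment> \<open>9/10 = 7/10 + 2/10: the multiples j y have modulus at most ln 2 < 7/10, and
    |\<omega> y| \<le> 2/10 is what \<open>4 * R + 1 \<le> k\<close> provides.\<close>
  define K where "K = cball (0::complex) (9/10)"
  have K: "compact K" "convex K" "K \<subseteq> ball 0 1" by (auto simp: K_def)
  obtain B1 where B1: "B1 \<ge> 0" "\<And>a b. a \<in> K \<Longrightarrow> b \<in> K \<Longrightarrow> norm (?\<phi> b - ?\<phi> a - deriv ?\<phi> a * (b - a)) \<le> B1 * norm (b - a) ^ 2"
    using taylor_bound_compact[OF ln_expm1_quot_holomorphic open_ball K, of 1]
    by (auto simp: algebra_simps numeral_2_eq_2)
  obtain B2 where B2: "B2 \<ge> 0" "\<And>a b. a \<in> K \<Longrightarrow> b \<in> K \<Longrightarrow> norm (?\<Psi> b - ?\<Psi> a - ?\<phi> a * (b - a) - deriv ?\<phi> a * (b - a)^2 / 2) \<le> B2 * norm (b - a) ^ 3"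
  proof -
    obtain B where B: "B \<ge> 0" "\<And>a b. a \<in> K \<Longrightarrow> b \<in> K \<Longrightarrow> norm (?\<Psi> b - (\<Sum>i\<le>2. (deriv ^^ i) ?\<Psi> a * (b - a) ^ i / fact i)) \<le> B * norm (b - a) ^ 3"
      using taylor_bound_compact[OF prim_holomorphic open_ball K, of 2] by (auto simp: numeral_3_eq_3 numeral_2_eq_2)
    have d1: "deriv ?\<Psi> a = ?\<phi> a" if "norm a < 1" for a
      using prim_ln_expm1_quot(2)[OF that] DERIV_imp_deriv by blast
    have d2: "deriv (deriv ?\<Psi>) a = deriv ?\<phi> a" if "a \<in> K" for a
    proof (rule deriv_cong_ev)
      show "\<forall>\<^sub>F x in nhds a. deriv ?\<Psi> x = ?\<phi> x"
        by (rule eventually_mono[OF eventually_nhds_in_open[of "ball 0 1"]]) (use that K d1 in auto)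
    qed auto
    show ?thesis
    proof (rule that[OF B(1)])
      fix a b assume ab: "a \<in> K" "b \<in> K"
      have "norm a < 1" using ab K by auto
      thus "norm (?\<Psi> b - ?\<Psi> a - ?\<phi> a * (b - a) - deriv ?\<phi> a * (b - a)^2 / 2) \<le> B * norm (b - a) ^ 3"
        using B(2)[OF ab] d1[of a] d2[OF ab(1)] by (simp add: numeral_2_eq_2 algebra_simps)
    qed
  qed
  define C where "C = B1 * R^2 + B2 + (1/2 + R) * B1"
  have C: "C \<ge> 0" using B1 B2 assms by (auto simp: C_def)
  show ?thesis
  proof (rule exI[of _ C], intro conjI allI impI C)
    fix \<omega> y :: complex and k :: nat
    assume w: "norm \<omega> \<le> R" and k: "real k \<ge> 4 * R + 1" and y: "norm y = ln 2 / real k"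
    have k0: "k > 0" using k assms by (cases k) auto
    have y0: "y \<noteq> 0" using y k0 by auto
    have wy: "norm (\<omega> * y) \<le> R * norm y" "R * norm y \<le> 2/10"
    proof -
      show "norm (\<omega> * y) \<le> R * norm y" using w by (simp add: norm_mult mult_right_mono)
      have "R * ln 2 \<le> R * (7/10)" using assms ln_2_less_7_10 by (intro mult_left_mono) auto
      hence "R * ln 2 \<le> 2/10 * real k" using k by linarith
      thus "R * norm y \<le> 2/10" using k0 by (simp add: y field_simps)
    qed
    have jy: "norm (of_nat j * y) \<le> 7/10" if "j \<le> k" for j
    proof -
      have "real j * (ln 2 / real k) \<le> real k * (ln 2 / real k)" using that by (intro mult_right_mono) auto
      also have "\<dots> \<le> 7/10" using k0 ln_2_less_7_10 by simp
      finally show ?thesis by (simp add: norm_mult y)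
    qed
    have inK: "of_nat j * y \<in> K" "of_nat j * y + \<omega> * y \<in> K" if "j \<le> k" for j
      using jy[OF that] wy norm_triangle_ineq[of "of_nat j * y" "\<omega> * y"] by (auto simp: K_def)
    show "\<forall>j\<in>{1..k}. norm ((of_nat j + \<omega>) * y) < 1"
    proof
      fix j assume "j \<in> {1..k}"
      hence "of_nat j * y + \<omega> * y \<in> ball 0 1" using inK(2)[of j] K by auto
      thus "norm ((of_nat j + \<omega>) * y) < 1" by (simp add: algebra_simps)
    qed
    \<comment> \<open>The defect at a single node. The subtracted part telescopes over
      \<open>j\<close>, with value 0 at \<open>j = 0\<close> because both the logarithm and its
      primitive vanish at 0.\<close>
    define D where "D = (\<lambda>j. ?\<phi> ((of_nat j + \<omega>) * y) - ((?\<Psi> (of_nat j * y) - ?\<Psi> (of_nat (j-1) * y)) / y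
       + (1/2 + \<omega>) * (?\<phi> (of_nat j * y) - ?\<phi> (of_nat (j-1) * y))))"
    have D: "norm (D j) \<le> C * norm y ^ 2" if j: "j \<in> {1..k}" for j
    proof -
      define a where "a = of_nat j * y"
      have ay: "of_nat (j - 1) * y = a - y" using j by (simp add: a_def of_nat_diff algebra_simps)
      have a: "a \<in> K" "a - y \<in> K" "a + \<omega> * y \<in> K"
        using inK(1)[of j] inK(1)[of "j-1"] inK(2)[of j] j ay by (auto simp: a_def)
      define e1 where "e1 = ?\<phi> (a + \<omega> * y) - ?\<phi> a - deriv ?\<phi> a * (\<omega> * y)"
      define e2 where "e2 = ?\<Psi> (a - y) - ?\<Psi> a + ?\<phi> a * y - deriv ?\<phi> a * y^2 / 2"
      define e3 where "e3 = ?\<phi> (a - y) - ?\<phi> a + deriv ?\<phi> a * y"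
      have n1: "norm e1 \<le> B1 * (R * norm y) ^ 2"
      proof -
        have "norm e1 \<le> B1 * norm (\<omega> * y) ^ 2" using B1(2)[OF a(1,3)] by (simp add: e1_def)
        also have "\<dots> \<le> B1 * (R * norm y) ^ 2" using wy B1 by (intro mult_left_mono power_mono) auto
        finally show ?thesis .
      qed
      have n2: "norm e2 \<le> B2 * norm y ^ 3" using B2(2)[OF a(1,2)] by (simp add: e2_def)
      have n3: "norm e3 \<le> B1 * norm y ^ 2" using B1(2)[OF a(1,2)] by (simp add: e3_def)
      have s2: "(?\<Psi> a - ?\<Psi> (a - y)) / y = ?\<phi> a - deriv ?\<phi> a * y / 2 - e2 / y"
        using y0 by (simp add: e2_def field_simps power2_eq_square)
      have "D j = e1 + e2 / y + (1/2 + \<omega>) * e3"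
      proof -
        have arg: "(of_nat j + \<omega>) * y = a + \<omega> * y" by (simp add: a_def algebra_simps)
        have "u - (v - d * y / 2 - q + (1/2 + \<omega>) * (v - w)) = (u - v - d * (\<omega> * y)) + q + (1/2 + \<omega>) * (w - v + d * y)"
          for u v w d q by (simp add: field_simps)
        thus ?thesis unfolding D_def ay a_def[symmetric] s2 arg e1_def e3_def .
      qed
      also have "norm \<dots> \<le> norm e1 + norm e2 / norm y + norm (1/2 + \<omega>) * norm e3"
        using norm_triangle_ineq[of "e1 + e2 / y" "(1/2 + \<omega>) * e3"] norm_triangle_ineq[of e1 "e2 / y"]
        unfolding norm_divide norm_mult by linarith
      also have "\<dots> \<le> B1 * (R * norm y) ^ 2 + B2 * norm y ^ 2 + (1/2 + R) * (B1 * norm y ^ 2)"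
      proof (intro add_mono n1 mult_mono n3)
        have "norm e2 / norm y \<le> B2 * norm y ^ 3 / norm y" using n2 by (intro divide_right_mono) auto
        thus "norm e2 / norm y \<le> B2 * norm y ^ 2" using y0 by (simp add: power3_eq_cube power2_eq_square)
        show "norm (1/2 + \<omega>) \<le> 1/2 + R" using norm_triangle_ineq[of "1/2" \<omega>] w by simp
      qed (use assms in auto)
      also have "\<dots> = C * norm y ^ 2" by (simp add: C_def algebra_simps power2_eq_square)
      finally show ?thesis .
    qed
    have tel: "(\<Sum>j=1..k. f (of_nat j * y) - f (of_nat (j-1) * y)) = f (of_nat k * y) - f 0" for f :: "complex \<Rightarrow> complex"
      using sum_telescope''[of 0 k "\<lambda>j. f (of_nat j * y)"] by simp
    have "(\<Sum>j=1..k. ?\<phi> ((of_nat j + \<omega>) * y)) - (?\<Psi> (of_nat k * y) / y + (1/2 + \<omega>) * ?\<phi> (of_nat k * y)) = (\<Sum>j=1..k. D j)"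
      unfolding D_def sum_subtractf sum.distrib sum_divide_distrib[symmetric] sum_distrib_left[symmetric] tel[unfolded sum_subtractf]
      by (simp add: prim_ln_expm1_quot)
    also have "norm \<dots> \<le> (\<Sum>j=1..k. C * norm y ^ 2)" by (intro sum_norm_le D)
    also have "\<dots> = C * (ln 2)\<^sup>2 / real k" using k0 by (simp add: y power2_eq_square field_simps)
    also have "\<dots> \<le> C / real k"
    proof -
      have "(ln 2)\<^sup>2 \<le> (1::real)" using ln_2_less_7_10 by (intro power_le_one) auto
      thus ?thesis using C by (intro divide_right_mono) (auto simp: mult_left_le)
    qed
    finally show "norm ((\<Sum>j=1..k. ?\<phi> ((of_nat j + \<omega>) * y)) - (?\<Psi> (of_nat k * y) / y + (1/2 + \<omega>) * ?\<phi> (of_nat k * y))) \<le> C / real k" .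
  qed
qed

section \<open>The exponential rate of the model product on the circle\<close>

definition circ :: "complex \<Rightarrow> complex" where
  "circ \<theta> = of_real (ln 2) * exp (2 * \<i> * \<theta>)"

definition lam0 :: real where "lam0 = pi\<^sup>2 / (12 * ln 2)"

text \<open>The model product behaves like exp (- k lam \<theta>) up to powers of \<open>k\<close>.
  The 1 comes from k! in Stirling's formula, ln (ln 2) + 2 i \<theta> from the factor (circ \<theta>
  / k)^k, and the last term from the integral in Euler--Maclaurin. The angle is complex so that
  \<open>lam\<close> can be expanded as a holomorphic function.\<close>

definition lam :: "complex \<Rightarrow> complex" where
  "lam \<theta> = 1 - of_real (ln (ln 2)) - 2 * \<i> * \<theta> - prim_ln_expm1_quot (circ \<theta>) / circ \<theta>"

lemma lam0_pos: "lam0 > 0" by (simp add: lam0_def)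

lemma circ_nz [simp]: "circ \<theta> \<noteq> 0" by (simp add: circ_def)

lemma circ_0 [simp]: "circ 0 = of_real (ln 2)" by (simp add: circ_def)

lemma norm_circ [simp]: "norm (circ (of_real \<theta>)) = ln 2"
  by (simp add: circ_def norm_mult)

lemma norm_circ_less_1: "norm (circ (of_real \<theta>)) < 1"
  using ln_2_less_7_10 by simp

lemma Re_circ: "Re (circ (of_real \<theta>)) = ln 2 * cos (2 * \<theta>)"
proof -
  have "exp (2 * \<i> * of_real \<theta>) = cis (2 * \<theta>)" by (simp add: cis_conv_exp mult_ac)
  thus ?thesis by (simp add: circ_def)
qed

lemma lam_0: "lam 0 = of_real lam0"
proof -
  have "ln (2::real) \<noteq> 0" by simp
  hence "1 - ln (ln 2) - (ln 2 - ln 2 * ln (ln 2) - pi\<^sup>2 / 12) / ln 2 = lam0"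
    unfolding lam0_def by (simp add: field_simps)
  hence "complex_of_real (1 - ln (ln 2) - (ln 2 - ln 2 * ln (ln 2) - pi\<^sup>2 / 12) / ln 2) = of_real lam0"
    by (rule arg_cong)
  thus ?thesis unfolding lam_def circ_0 prim_ln_2 by simp
qed

text \<open>Here \<open>circ \<theta>\<close> has modulus ln 2 and real part ln 2 cos (2\<theta>).
  The bound vanishes at \<theta> = 0 and at \<theta> = pi alike, since the model depends on w^2
  only; what separates the two points is the linear term of the perturbation.\<close>

lemma Re_lam_ge: "Re (lam (of_real \<theta>)) \<ge> lam0 + ln 2 / 2 * (sin \<theta>)\<^sup>2"
proof -
  have "Re (prim_ln_expm1_quot (circ \<theta>) / circ \<theta>) \<le>
     Re (prim_ln_expm1_quot (of_real (ln 2)) / of_real (ln 2)) - (ln 2 - ln 2 * cos (2 * \<theta>)) / 4"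
    using Re_prim_div_le[OF norm_circ_less_1[of \<theta>] circ_nz] by (simp only: norm_circ Re_circ)
  also have "Re (prim_ln_expm1_quot (of_real (ln 2)) / of_real (ln 2)) = 1 - ln (ln 2) - lam0"
    using arg_cong[OF lam_0, of Re] by (simp add: lam_def)
  also have "cos (2 * \<theta>) = 1 - 2 * (sin \<theta>)\<^sup>2" by (rule cos_double_sin)
  also have "(ln 2 - ln 2 * (1 - 2 * (sin \<theta>)\<^sup>2)) / 4 = ln 2 / 2 * (sin \<theta>)\<^sup>2" by (simp add: field_simps)
  finally show ?thesis unfolding lam_def by simp
qed

lemma circ_has_derivative: "(circ has_field_derivative 2 * \<i> * circ \<theta>) (at \<theta>)"
  unfolding circ_def[abs_def] by (auto intro!: derivative_eq_intros)

text \<open>A real interval seen as a compact convex subset of the complex plane, the form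
  \<open>taylor_bound_compact\<close> asks for.\<close>

lemma segment_facts:
  fixes a :: real
  shows "compact (closed_segment (of_real (-a)) (of_real a) :: complex set)"
    "convex (closed_segment (of_real (-a)) (of_real a) :: complex set)"
    "\<bar>\<theta>\<bar> \<le> a \<Longrightarrow> of_real \<theta> \<in> (closed_segment (of_real (-a)) (of_real a) :: complex set)"
    "z \<in> closed_segment (of_real (-a)) (of_real a) \<Longrightarrow> z \<in> range complex_of_real"
proof -
  show "compact (closed_segment (of_real (-a)) (of_real a) :: complex set)"
    "convex (closed_segment (of_real (-a)) (of_real a) :: complex set)" by auto
qed (auto simp: closed_segment_of_real closed_segment_eq_real_ivl abs_le_iff simp del: of_real_minus)

text \<open>Differentiating P(c)/c along the circle gives 2 i (\<phi>(c) - P(c)/c), so only values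
  at ln 2 enter: \<phi>(ln 2) = - ln (ln 2), P(ln 2) from \<open>lam_0\<close>, and \<phi>'(ln 2).
  The linear coefficient - 2 i \<open>lam0\<close> is the one that cancels the rotation of w^(-n) at
  k = \<open>k0\<close>.\<close>

lemma lam_taylor:
  "\<exists>B\<ge>0. \<forall>\<theta>. \<bar>\<theta>\<bar> \<le> pi / 2 \<longrightarrow>
     norm (lam (of_real \<theta>) - (of_real lam0 - 2 * \<i> * of_real lam0 * of_real \<theta> + of_real ((4 * ln 2 - 2 * lam0) * \<theta>\<^sup>2))) \<le> B * \<bar>\<theta>\<bar> ^ 3"
proof -
  let ?\<phi> = ln_expm1_quot and ?\<Psi> = prim_ln_expm1_quot
  define S where "S = circ -` ball 0 1"
  have "continuous_on UNIV circ" unfolding circ_def[abs_def] by (intro continuous_intros)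
  hence S: "open S" unfolding S_def by (intro open_vimage) auto
  let ?K = "closed_segment (of_real (-(pi/2))) (of_real (pi/2)) :: complex set"
  have KS: "?K \<subseteq> S"
  proof
    fix z assume "z \<in> ?K"
    then obtain x where "z = of_real x" using segment_facts(4) by blast
    thus "z \<in> S" using norm_circ_less_1 by (simp add: S_def)
  qed
  define d1 where "d1 = (\<lambda>z. - 2 * \<i> - (2 * \<i>) * (?\<phi> (circ z) - ?\<Psi> (circ z) / circ z))"
  define d2 where "d2 = (\<lambda>z. 4 * (circ z * deriv ?\<phi> (circ z) - (?\<phi> (circ z) - ?\<Psi> (circ z) / circ z)))"
  have dq: "((\<lambda>z. ?\<Psi> (circ z) / circ z) has_field_derivative (2 * \<i>) * (?\<phi> (circ z) - ?\<Psi> (circ z) / circ z)) (at z)"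
    if "z \<in> S" for z
  proof -
    have n: "norm (circ z) < 1" using that by (simp add: S_def)
    have "((\<lambda>z. ?\<Psi> (circ z)) has_field_derivative ?\<phi> (circ z) * (2 * \<i> * circ z)) (at z)"
      by (rule DERIV_chain2[OF prim_ln_expm1_quot(2)[OF n] circ_has_derivative])
    from DERIV_divide[OF this circ_has_derivative circ_nz] show ?thesis
      by (rule DERIV_cong) (simp add: field_simps)
  qed
  have D1: "(lam has_field_derivative d1 z) (at z)" if "z \<in> S" for z
  proof -
    have "((\<lambda>z. 1 - of_real (ln (ln 2)) - 2 * \<i> * z) has_field_derivative - 2 * \<i>) (at z)"
      by (auto intro!: derivative_eq_intros)
    from DERIV_diff[OF this dq[OF that]] show ?thesis unfolding lam_def[abs_def] d1_def .
  qed
  have D2: "(d1 has_field_derivative d2 z) (at z)" if "z \<in> S" for z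
  proof -
    have n: "circ z \<in> ball 0 1" using that by (simp add: S_def)
    have p: "((\<lambda>z. ?\<phi> (circ z)) has_field_derivative deriv ?\<phi> (circ z) * (2 * \<i> * circ z)) (at z)"
      by (rule DERIV_chain2[OF holomorphic_derivI[OF ln_expm1_quot_holomorphic open_ball n] circ_has_derivative])
    have "(d1 has_field_derivative 0 - (2 * \<i>) * (deriv ?\<phi> (circ z) * (2 * \<i> * circ z) - (2 * \<i>) * (?\<phi> (circ z) - ?\<Psi> (circ z) / circ z))) (at z)"
      unfolding d1_def by (intro DERIV_diff DERIV_const DERIV_cmult p dq that)
    thus ?thesis by (rule DERIV_cong) (simp add: d2_def algebra_simps)
  qed
  have hol: "lam holomorphic_on S"
    using D1 S by (auto simp: holomorphic_on_open)
  have ddl: "deriv lam z = d1 z" if "z \<in> S" for z using D1[OF that] by (rule DERIV_imp_deriv)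
  have dd2: "deriv (deriv lam) 0 = d2 0"
  proof -
    have z: "0 \<in> S" using ln_2_less_7_10 by (simp add: S_def)
    have "deriv (deriv lam) 0 = deriv d1 0"
      by (rule deriv_cong_ev[OF eventually_mono[OF eventually_nhds_in_open[OF S z] ddl]]) auto
    also have "\<dots> = d2 0" using D2[OF z] by (rule DERIV_imp_deriv)
    finally show ?thesis .
  qed
  have l0: "?\<Psi> (of_real (ln 2)) / of_real (ln 2) = of_real (1 - ln (ln 2) - lam0)"
    using lam_0 by (simp add: lam_def algebra_simps)
  have p0: "?\<phi> (of_real (ln 2)) = of_real (- ln (ln 2))"
    by (subst ln_expm1_quot_of_real) auto
  have v1: "d1 0 = - 2 * \<i> * of_real lam0"
    unfolding d1_def circ_0 l0 p0 by (simp add: algebra_simps)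
  \<comment> \<open>Obtained by differentiating the identity z exp (\<phi> z) - exp z = -1 at ln 2,
    where exp (\<phi>) = 1 / ln 2.\<close>
  have dphi: "of_real (ln 2) * deriv ?\<phi> (of_real (ln 2)) = of_real (2 * ln 2 - 1)"
  proof -
    let ?a = "complex_of_real (ln 2)"
    have a: "norm ?a < 1" using ln_2_less_7_10 by simp
    have ea: "exp ?a = 2" unfolding exp_of_real by simp
    have q: "expm1_quot ?a = 1 / ?a" using ea by (simp add: expm1_quot_def)
    have "((\<lambda>z. z * exp (?\<phi> z) - exp z) has_field_derivative
       (1 * exp (?\<phi> ?a) + (exp (?\<phi> ?a) * deriv ?\<phi> ?a) * ?a - exp ?a)) (at ?a)"
      using a by (intro DERIV_diff DERIV_mult DERIV_ident DERIV_exp DERIV_chain2[OF DERIV_exp]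
           holomorphic_derivI[OF ln_expm1_quot_holomorphic open_ball]) auto
    moreover have "((\<lambda>z. z * exp (?\<phi> z) - exp z) has_field_derivative 0) (at ?a)"
    proof (rule has_field_derivative_transform_within_open[of "\<lambda>_. -1"])
      show "- 1 = z * exp (?\<phi> z) - exp z" if "z \<in> ball 0 1" for z
        using that by (simp add: exp_ln_expm1_quot expm1_quot_mult)
    qed (use a in auto)
    ultimately have "1 * exp (?\<phi> ?a) + (exp (?\<phi> ?a) * deriv ?\<phi> ?a) * ?a - exp ?a = 0"
      using DERIV_unique by blast
    hence "1 / ?a + deriv ?\<phi> ?a = 2"
      unfolding exp_ln_expm1_quot[OF a] q ea by (simp add: algebra_simps)
    thus ?thesis by (simp add: field_simps)
  qed
  have v2: "d2 0 = of_real (2 * (4 * ln 2 - 2 * lam0))"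
    unfolding d2_def circ_0 dphi l0 p0 by (simp add: algebra_simps)
  obtain B where B: "B \<ge> 0" "\<forall>a\<in>?K. \<forall>b\<in>?K. norm (lam b - (\<Sum>i\<le>2. (deriv ^^ i) lam a * (b - a) ^ i / fact i)) \<le> B * norm (b - a) ^ Suc 2"
    using taylor_bound_compact[OF hol S segment_facts(1,2) KS, of 2] by blast
  show ?thesis
  proof (intro exI[of _ B] conjI B(1) allI impI)
    fix \<theta> :: real assume t: "\<bar>\<theta>\<bar> \<le> pi / 2"
    have "norm (lam \<theta> - (\<Sum>i\<le>2. (deriv ^^ i) lam 0 * (of_real \<theta> - 0) ^ i / fact i)) \<le> B * norm (complex_of_real \<theta> - 0) ^ Suc 2"
    proof -
      have "\<bar>0 :: real\<bar> \<le> pi / 2" by simp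
      from segment_facts(3)[OF this] have "0 \<in> ?K" by (simp only: of_real_0)
      from B(2)[rule_format, OF this segment_facts(3)[OF t]] show ?thesis .
    qed
    moreover have "(\<Sum>i\<le>2. (deriv ^^ i) lam 0 * (of_real \<theta> - 0) ^ i / fact i) =
       of_real lam0 - 2 * \<i> * of_real lam0 * of_real \<theta> + of_real ((4 * ln 2 - 2 * lam0) * \<theta>\<^sup>2)"
      using ddl[of 0] dd2 ln_2_less_7_10
      by (simp add: numeral_2_eq_2 S_def lam_0 v1 v2)
    ultimately show "norm (lam \<theta> - (of_real lam0 - 2 * \<i> * of_real lam0 * of_real \<theta> + of_real ((4 * ln 2 - 2 * lam0) * \<theta>\<^sup>2))) \<le> B * \<bar>\<theta>\<bar> ^ 3"
      by (simp add: eval_nat_numeral)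
  qed
qed

lemma ln_expm1_quot_circ:
  "\<exists>B\<ge>0. \<forall>\<theta>. norm (ln_expm1_quot (circ (of_real \<theta>))) \<le> B \<and>
     norm (ln_expm1_quot (circ (of_real \<theta>)) + of_real (ln (ln 2))) \<le> B * \<bar>\<theta>\<bar>"
proof -
  let ?\<phi> = ln_expm1_quot
  have K: "compact (cball (0::complex) (7/10))" "convex (cball (0::complex) (7/10))" "cball (0::complex) (7/10) \<subseteq> ball 0 1" by auto
  obtain B where B: "B \<ge> 0" "\<forall>a\<in>cball 0 (7/10). \<forall>b\<in>cball 0 (7/10). norm (?\<phi> b - ?\<phi> a) \<le> B * norm (b - a)"
    using taylor_bound_compact[OF ln_expm1_quot_holomorphic open_ball K, of 0] by auto
  have p0: "?\<phi> (of_real (ln 2)) = - of_real (ln (ln 2))"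
    by (subst ln_expm1_quot_of_real) auto
  show ?thesis
  proof (intro exI[of _ "2 * B"] conjI allI)
    fix \<theta> :: real
    have c: "circ \<theta> \<in> cball 0 (7/10)" "of_real (ln 2) \<in> cball (0::complex) (7/10)" using ln_2_less_7_10 by auto
    have "norm (?\<phi> (circ \<theta>) - ?\<phi> 0) \<le> B * norm (circ \<theta> - 0)"
      using B(2)[rule_format, of 0 "circ \<theta>"] c by auto
    also have "\<dots> \<le> 2 * B" using B(1) ln_2_less_7_10 by (auto intro!: mult_left_mono simp: mult.commute[of 2])
    finally show "norm (?\<phi> (circ \<theta>)) \<le> 2 * B" by simp
    have e: "circ \<theta> - of_real (ln 2) = of_real (ln 2) * (exp (\<i> * of_real (2 * \<theta>)) - 1)"
      by (simp add: circ_def algebra_simps)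
    have n: "norm (circ \<theta> - of_real (ln 2)) \<le> 1 * (2 * \<bar>\<theta>\<bar>)"
      unfolding e norm_mult dist_exp_i_1 using ln_2_less_7_10 abs_sin_x_le_abs_x[of \<theta>]
      by (intro mult_mono) auto
    have "norm (?\<phi> (circ \<theta>) - ?\<phi> (of_real (ln 2))) \<le> B * norm (circ \<theta> - of_real (ln 2))" using B(2) c by blast
    also have "\<dots> \<le> B * (1 * (2 * \<bar>\<theta>\<bar>))" by (rule mult_left_mono[OF n B(1)])
    finally show "norm (?\<phi> (circ \<theta>) + of_real (ln (ln 2))) \<le> 2 * B * \<bar>\<theta>\<bar>"
      by (simp add: p0 mult_ac)
  qed (use B in auto)
qed

text \<open>Each factor is split as (j y)(1 + \<omega>/j) exp (\<phi> ((j + \<omega>) y)). The first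
  parts give k! y^k, the second \<open>gprod\<close> times k^\<omega>, the third the
  Euler--Maclaurin sum. The coefficient 1/2 + \<omega> arises twice, as the power of
  \<open>k\<close> and as the boundary term, and the two are merged. The error sits in the exponent,
  while \<open>gprod\<close> stays outside since it may be 0.\<close>

lemma prod_expm1_asymp:
  assumes "R \<ge> 0"
  shows "\<exists>C\<ge>0. \<forall>\<omega> \<theta> k. norm \<omega> \<le> R \<longrightarrow> real k \<ge> 4 * R + 1 \<longrightarrow>
    (\<exists>\<delta>. norm \<delta> \<le> C / real k \<and>
      (\<Prod>j=1..k. exp ((of_nat j + \<omega>) * (circ (of_real \<theta>) / of_nat k)) - 1) =
        gprod \<omega> k * exp ((1/2 + \<omega>) * (of_real (ln (real k)) + ln_expm1_quot (circ (of_real \<theta>)))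
            + of_real (ln (2 * pi) / 2) - of_nat k * lam (of_real \<theta>) + \<delta>))"
proof -
  let ?\<phi> = ln_expm1_quot and ?\<Psi> = prim_ln_expm1_quot
  obtain C where C: "C \<ge> 0" and sum: "\<And>\<omega> y k. norm \<omega> \<le> R \<Longrightarrow> real k \<ge> 4 * R + 1 \<Longrightarrow> norm y = ln 2 / real k \<Longrightarrow>
     (\<forall>j\<in>{1..k}. norm ((of_nat j + \<omega>) * y) < 1) \<and>
     norm ((\<Sum>j=1..k. ?\<phi> ((of_nat j + \<omega>) * y)) - 
       (?\<Psi> (of_nat k * y) / y + (1/2 + \<omega>) * ?\<phi> (of_nat k * y))) \<le> C / real k"
    using sum_ln_expm1_quot[OF assms] by blast
  show ?thesis
  proof (rule exI[of _ "C + 2"], intro conjI allI impI)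
    fix \<omega> :: complex and \<theta> :: real and k :: nat
    assume w: "norm \<omega> \<le> R" and k: "real k \<ge> 4 * R + 1"
    have k0: "k \<ge> 1" using k assms by (cases k) auto
    define t where "t = circ (of_real \<theta>)"
    define y where "y = t / of_nat k"
    have y: "norm y = ln 2 / real k" by (simp add: y_def t_def norm_divide)
    have ky: "of_nat k * y = t" using k0 by (simp add: y_def)
    define \<delta>2 where "\<delta>2 = (\<Sum>j=1..k. ?\<phi> ((of_nat j + \<omega>) * y)) - (?\<Psi> t / y + (1/2 + \<omega>) * ?\<phi> t)"
    have d2: "norm \<delta>2 \<le> C / real k" using sum[OF w k y] by (simp add: \<delta>2_def ky)
    define \<delta>1 where "\<delta>1 = ln (fact k) - ((real k + 1/2) * ln (real k) - real k + ln (2 * pi) / 2)"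
    have d1: "\<bar>\<delta>1\<bar> \<le> 2 / real k" using stirling_rate[OF k0] by (simp add: \<delta>1_def)
    have "(\<Prod>j=1..k. exp ((of_nat j + \<omega>) * y) - 1) = (\<Prod>j=1..k. (of_nat j * y) * (1 + \<omega> / of_nat j) * exp (?\<phi> ((of_nat j + \<omega>) * y)))"
    proof (rule prod.cong[OF refl])
      fix j assume j: "j \<in> {1..k}"
      have n: "norm ((of_nat j + \<omega>) * y) < 1" using sum[OF w k y] j by blast
      have "exp ((of_nat j + \<omega>) * y) - 1 = ((of_nat j + \<omega>) * y) * exp (?\<phi> ((of_nat j + \<omega>) * y))"
        unfolding exp_ln_expm1_quot[OF n] by (rule expm1_quot_mult[symmetric])
      also have "(of_nat j + \<omega>) * y = (of_nat j * y) * (1 + \<omega> / of_nat j)" using j by (simp add: field_simps)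
      finally show "exp ((of_nat j + \<omega>) * y) - 1 = (of_nat j * y) * (1 + \<omega> / of_nat j) * exp (?\<phi> ((of_nat j + \<omega>) * y))"
        using j by (simp add: field_simps)
    qed
    also have "\<dots> = (fact k * y ^ k) * (\<Prod>j=1..k. 1 + \<omega> / of_nat j) * exp (\<Sum>j=1..k. ?\<phi> ((of_nat j + \<omega>) * y))"
      by (simp add: prod.distrib exp_sum fact_prod)
    also have "(\<Prod>j=1..k. 1 + \<omega> / of_nat j) = gprod \<omega> k * exp (\<omega> * of_real (ln (real k)))"
      by (simp add: gprod_def exp_minus)
    also have "y ^ k = exp (of_nat k * of_real (ln (ln 2)) + of_nat k * (2 * \<i> * of_real \<theta>) - of_nat k * of_real (ln (real k)))"
    proof -
      have "complex_of_real (ln 2) = exp (of_real (ln (ln 2)))" by (simp add: exp_of_real)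
      moreover have "of_nat k = exp (complex_of_real (ln (real k)))" using k0 by (simp add: exp_of_real)
      ultimately have "y = exp (of_real (ln (ln 2)) + 2 * \<i> * of_real \<theta> - of_real (ln (real k)))"
        unfolding y_def t_def circ_def exp_add exp_diff by simp
      hence "y ^ k = exp (of_nat k * (of_real (ln (ln 2)) + 2 * \<i> * of_real \<theta> - of_real (ln (real k))))"
        by (simp add: exp_of_nat_mult)
      thus ?thesis by (simp only: distrib_left right_diff_distrib)
    qed
    also have "(fact k :: complex) = exp (of_real (\<delta>1 + ((real k + 1/2) * ln (real k) - real k + ln (2 * pi) / 2)))"
    proof -
      have "exp (\<delta>1 + ((real k + 1/2) * ln (real k) - real k + ln (2 * pi) / 2)) = fact k"
        by (simp add: \<delta>1_def)
      thus ?thesis by (metis exp_of_real of_real_fact)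
    qed
    also have "(\<Sum>j=1..k. ?\<phi> ((of_nat j + \<omega>) * y)) = \<delta>2 + of_nat k * (1 - of_real (ln (ln 2)) - 2 * \<i> * of_real \<theta> - lam (of_real \<theta>)) + (1/2 + \<omega>) * ?\<phi> t"
    proof -
      have "?\<Psi> t / y = of_nat k * (?\<Psi> t / t)" using k0 by (simp add: y_def)
      also have "?\<Psi> t / t = 1 - of_real (ln (ln 2)) - 2 * \<i> * of_real \<theta> - lam (of_real \<theta>)"
        by (simp add: lam_def t_def)
      finally show ?thesis by (simp add: \<delta>2_def)
    qed
    finally have "(\<Prod>j=1..k. exp ((of_nat j + \<omega>) * y) - 1) = gprod \<omega> k * 
       exp (of_real (\<delta>1 + ((real k + 1/2) * ln (real k) - real k + ln (2 * pi) / 2)) +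
        (of_nat k * of_real (ln (ln 2)) + of_nat k * (2 * \<i> * of_real \<theta>) - of_nat k * of_real (ln (real k))) +
        \<omega> * of_real (ln (real k)) + (\<delta>2 + of_nat k * (1 - of_real (ln (ln 2)) - 2 * \<i> * of_real \<theta> - lam (of_real \<theta>)) + (1/2 + \<omega>) * ?\<phi> t))"
      by (simp only: exp_add mult_ac)
    also have "of_real (\<delta>1 + ((real k + 1/2) * ln (real k) - real k + ln (2 * pi) / 2)) +
        (of_nat k * of_real (ln (ln 2)) + of_nat k * (2 * \<i> * of_real \<theta>) - of_nat k * of_real (ln (real k))) +
        \<omega> * of_real (ln (real k)) + (\<delta>2 + of_nat k * (1 - of_real (ln (ln 2)) - 2 * \<i> * of_real \<theta> - lam (of_real \<theta>)) + (1/2 + \<omega>) * ?\<phi> t)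
       = (1/2 + \<omega>) * (of_real (ln (real k)) + ?\<phi> t) + of_real (ln (2 * pi) / 2) - of_nat k * lam (of_real \<theta>) + (of_real \<delta>1 + \<delta>2)"
      by (simp add: algebra_simps)
    finally have eq: "(\<Prod>j=1..k. exp ((of_nat j + \<omega>) * y) - 1) = gprod \<omega> k * 
      exp ((1/2 + \<omega>) * (of_real (ln (real k)) + ?\<phi> t) + of_real (ln (2 * pi) / 2) - of_nat k * lam (of_real \<theta>) + (of_real \<delta>1 + \<delta>2))" .
    have "norm (of_real \<delta>1 + \<delta>2) \<le> (C + 2) / real k"
      using norm_triangle_ineq[of "of_real \<delta>1" \<delta>2] d1 d2 by (simp add: add_divide_distrib)
    with eq show "\<exists>\<delta>. norm \<delta> \<le> (C + 2) / real k \<and>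
      (\<Prod>j=1..k. exp ((of_nat j + \<omega>) * (circ (of_real \<theta>) / of_nat k)) - 1) =
        gprod \<omega> k * exp ((1/2 + \<omega>) * (of_real (ln (real k)) + ?\<phi> (circ (of_real \<theta>)))
            + of_real (ln (2 * pi) / 2) - of_nat k * lam (of_real \<theta>) + \<delta>)"
      unfolding y_def t_def by blast
  qed (use C in auto)
qed

section \<open>Coefficients as contour integrals\<close>

lemma has_fps_expansion_Ln_1_plus: "(\<lambda>z. Ln (1 + z)) has_fps_expansion fps_ln 1"
proof (rule has_fps_expansionI)
  show "\<forall>\<^sub>F u in nhds 0. (\<lambda>n. fps_nth (fps_ln 1) n * u ^ n) sums Ln (1 + u)"
  proof (rule eventually_mono[OF eventually_nhds_in_open[of "ball 0 1"]])
    fix u :: complex assume "u \<in> ball 0 1"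
    hence "norm u < 1" by simp
    from Ln_series[OF this] show "(\<lambda>n. fps_nth (fps_ln 1) n * u ^ n) sums Ln (1 + u)"
    proof (rule sums_cong[THEN iffD1, rotated])
      fix n show "(- 1) ^ Suc n / of_nat n * u ^ n = fps_nth (fps_ln 1) n * u ^ n"
        by (cases n) (auto simp: fps_ln_def)
    qed
  qed auto
qed

lemma has_fps_expansion_Ln:
  assumes "f has_fps_expansion F" "fps_nth F 0 = 1"
  shows "(\<lambda>z. Ln (f z)) has_fps_expansion (fps_ln 1 oo (F - 1))"
proof -
  have "((\<lambda>z. Ln (1 + z)) \<circ> (\<lambda>z. f z - 1)) has_fps_expansion (fps_ln 1 oo (F - 1))"
    using assms by (intro has_fps_expansion_compose has_fps_expansion_Ln_1_plus has_fps_expansion_diff) auto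
  thus ?thesis by (simp add: o_def)
qed

lemma has_fps_expansion_cpow:
  assumes "f has_fps_expansion F" "fps_nth F 0 = 1"
  shows "(\<lambda>z. exp (s * Ln (f z))) has_fps_expansion fps_cpow F s"
proof -
  have "(exp \<circ> (\<lambda>z. s * Ln (f z))) has_fps_expansion fps_cpow F s"
    unfolding fps_cpow_def
    by (intro has_fps_expansion_compose has_fps_expansion_exp1 has_fps_expansion_cmult_left has_fps_expansion_Ln assms) simp
  thus ?thesis by (simp add: o_def)
qed

lemma has_fps_expansion_gf_term:
  assumes "fe has_fps_expansion e" "fps_nth e 0 = 1" "fd has_fps_expansion d" "fps_nth d 0 = 1"
  shows "(\<lambda>z. exp ((of_nat k + \<omega>0) * Ln (fd z)) * (\<Prod>j=1..k. (exp ((of_nat j + \<omega>) * Ln (fe z)) - 1) ^ \<alpha>))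
     has_fps_expansion gf_term \<alpha> d e \<omega>0 \<omega> k"
  unfolding gf_term_def
  by (intro has_fps_expansion_mult has_fps_expansion_prod has_fps_expansion_power has_fps_expansion_diff
       has_fps_expansion_cpow has_fps_expansion_1 assms)

text \<open>Comparing coefficients in \<open>L' F = F'\<close> avoids expanding the composition.\<close>

lemma fps_log_nth:
  fixes L F :: "complex fps"
  assumes "f has_fps_expansion F" "fps_nth F 0 = 1" "(\<lambda>z. Ln (f z)) has_fps_expansion L"
  shows "fps_nth L 0 = 0" "fps_nth L 1 = fps_nth F 1"
    "fps_nth L 2 = fps_nth F 2 - fps_nth L 1 * fps_nth F 1 / 2"
    "fps_nth L 3 = fps_nth F 3 - (2 * fps_nth L 2 * fps_nth F 1 + fps_nth L 1 * fps_nth F 2) / 3"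
    "fps_nth L 4 = fps_nth F 4 - (3 * fps_nth L 3 * fps_nth F 1 + 2 * fps_nth L 2 * fps_nth F 2 + fps_nth L 1 * fps_nth F 3) / 4"
proof -
  have f0: "f 0 = 1" using has_fps_expansion_imp_0_eq_fps_nth_0[OF assms(1)] assms(2) by simp
  show "fps_nth L 0 = 0" using has_fps_expansion_imp_0_eq_fps_nth_0[OF assms(3)] f0 by simp
  obtain s where s: "open s" "0 \<in> s" "f holomorphic_on s" "\<And>z. z \<in> s \<Longrightarrow> f z = eval_fps F z"
    using has_fps_expansion_imp_holomorphic[OF assms(1)] by blast
  have "continuous_on s f" using s holomorphic_on_imp_continuous_on by blast
  hence "open (s \<inter> f -` ball 1 1)" using s(1) by (intro continuous_open_preimage) auto
  hence ev: "\<forall>\<^sub>F z in nhds 0. z \<in> s \<inter> f -` ball 1 1"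
    using s f0 by (intro eventually_nhds_in_open) auto
  have der: "deriv (\<lambda>z. Ln (f z)) z * f z = deriv f z" if z: "z \<in> s \<inter> f -` ball 1 1" for z
  proof -
    have "Re (f z) > 0"
    proof -
      have "norm (1 - f z) < 1" using z by (simp add: dist_norm)
      thus ?thesis using complex_Re_le_cmod[of "1 - f z"] by simp
    qed
    hence np: "f z \<notin> \<real>\<^sub>\<le>\<^sub>0" by (auto elim!: nonpos_Reals_cases)
    have "(f has_field_derivative deriv f z) (at z)" using s z holomorphic_derivI by blast
    hence "((\<lambda>z. Ln (f z)) has_field_derivative (1 / f z) * deriv f z) (at z)"
      by (rule DERIV_chain2[rotated]) (use np has_field_derivative_Ln in \<open>auto simp: divide_inverse\<close>)
    hence "deriv (\<lambda>z. Ln (f z)) z = (1 / f z) * deriv f z" by (rule DERIV_imp_deriv)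
    moreover have "f z \<noteq> 0" using np by auto
    ultimately show ?thesis by simp
  qed
  have "(\<lambda>z. deriv (\<lambda>z. Ln (f z)) z * f z) has_fps_expansion fps_deriv L * F"
    by (intro has_fps_expansion_mult has_fps_expansion_deriv assms)
  moreover have "(\<lambda>z. deriv (\<lambda>z. Ln (f z)) z * f z) has_fps_expansion fps_deriv F \<longleftrightarrow> deriv f has_fps_expansion fps_deriv F"
    by (rule has_fps_expansion_cong[OF eventually_mono[OF ev der] refl])
  moreover have "deriv f has_fps_expansion fps_deriv F" by (intro has_fps_expansion_deriv assms)
  ultimately have eq: "fps_deriv L * F = fps_deriv F" using fps_expansion_unique_complex by blast
  have n: "fps_nth (fps_deriv L * F) n = fps_nth (fps_deriv F) n" for n by (simp add: eq)
  show l1: "fps_nth L 1 = fps_nth F 1" using n[of 0] assms(2) by (simp add: fps_mult_nth)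
  show l2: "fps_nth L 2 = fps_nth F 2 - fps_nth L 1 * fps_nth F 1 / 2"
    using n[of 1] assms(2) by (simp add: fps_mult_nth numeral_2_eq_2 field_simps)
  show l3: "fps_nth L 3 = fps_nth F 3 - (2 * fps_nth L 2 * fps_nth F 1 + fps_nth L 1 * fps_nth F 2) / 3"
    using n[of 2] assms(2) by (simp add: fps_mult_nth eval_nat_numeral field_simps)
  show "fps_nth L 4 = fps_nth F 4 - (3 * fps_nth L 3 * fps_nth F 1 + 2 * fps_nth L 2 * fps_nth F 2 + fps_nth L 1 * fps_nth F 3) / 4"
    using n[of 3] assms(2) by (simp add: fps_mult_nth eval_nat_numeral field_simps)
qed

text \<open>Change of variables in the Cauchy integral. In the expansion \<open>F = \<Sum>\<^sub>m c\<^sub>m z\<^sup>m\<close> every term with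
  \<open>m \<noteq> n\<close> has a primitive along the transformed circle.\<close>

lemma coeff_substitution:
  fixes F \<psi> q :: "complex \<Rightarrow> complex" and r :: real
  assumes F: "F has_fps_expansion Fk" "F holomorphic_on ball 0 R0"
    and \<psi>: "\<psi> holomorphic_on ball 0 r1" "q holomorphic_on ball 0 r1" "\<psi> ` ball 0 r1 \<subseteq> ball 0 R0"
    and eq: "\<And>w. w \<in> ball 0 r1 \<Longrightarrow> \<psi> w = c * w * exp (- q w)" and c: "c \<noteq> 0"
    and r: "0 < r" "r < r1"
  shows "((\<lambda>\<theta>. F (\<psi> (of_real r * cis \<theta>)) * (1 - of_real r * cis \<theta> * deriv q (of_real r * cis \<theta>))
       * (exp (q (of_real r * cis \<theta>)) / (c * (of_real r * cis \<theta>))) ^ n)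
       has_integral (2 * pi * fps_nth Fk n)) {-(pi/2)..3*pi/2}"
proof -
  let ?B = "ball (0::complex) r1"
  \<comment> \<open>Starting at the angle -pi/2 makes the right and the left half circle two
    consecutive intervals, one around each of the two opposite points.\<close>
  define \<gamma> where "\<gamma> = part_circlepath 0 r (-(pi/2)) (3*pi/2)"
  have g: "valid_path \<gamma>" unfolding \<gamma>_def by simp
  have cl: "pathfinish \<gamma> = pathstart \<gamma>"
  proof -
    have "cis (3*pi/2) = cis (-(pi/2))"
    proof -
      have "3*pi/2 = -(pi/2) + 2*pi" by simp
      hence "cis (3*pi/2) = cis (-(pi/2)) * cis (2*pi)" by (simp only: cis_mult)
      thus ?thesis by simp
    qed
    thus ?thesis by (simp add: \<gamma>_def cis_conv_exp)
  qed
  have "path_image \<gamma> \<subseteq> sphere 0 r"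
    unfolding \<gamma>_def by (rule path_image_part_circlepath_subset) (use r in auto)
  hence im: "path_image \<gamma> \<subseteq> ?B - {0}" using r by (auto simp: subset_eq)
  define c' where "c' = fps_nth Fk"
  \<comment> \<open>The tail of the series divided by z^(n+1): it collects all terms with index
    above \<open>n\<close> in one holomorphic function, to which Cauchy's theorem applies.\<close>
  define G where "G = eval_fps (fps_shift (Suc n) Fk)"
  have rad: "fps_conv_radius Fk \<ge> ereal R0"
  proof (rule holomorphic_on_imp_fps_conv_radius_ge[OF F(1)])
    show "F holomorphic_on eball 0 (ereal R0)" using F(2) by simp
  qed
  have Geq: "F z = (\<Sum>m<Suc n. c' m * z ^ m) + z ^ Suc n * G z" if "norm z < R0" for z
  proof -
    have zr: "ereal (norm z) < fps_conv_radius Fk" using order_less_le_trans[of "ereal (norm z)" "ereal R0"] that rad by simp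
    have s: "(\<lambda>m. c' m * z ^ m) sums F z"
      unfolding c'_def by (rule has_fps_expansion_imp_sums_complex[OF F(1), of R0]) (use F(2) that in auto)
    hence "F z = (\<Sum>m. c' (m + Suc n) * z ^ (m + Suc n)) + (\<Sum>m<Suc n. c' m * z ^ m)"
      using suminf_split_initial_segment[OF sums_summable[OF s], of "Suc n"] by (simp add: sums_iff)
    also have "(\<Sum>m. c' (m + Suc n) * z ^ (m + Suc n)) = (\<Sum>m. z ^ Suc n * (fps_nth (fps_shift (Suc n) Fk) m * z ^ m))"
      by (intro suminf_cong) (simp add: c'_def power_add)
    also have "\<dots> = z ^ Suc n * G z"
      unfolding G_def eval_fps_def using zr by (intro suminf_mult summable_fps) auto
    finally show ?thesis by simp
  qed
  have Ghol: "G holomorphic_on ball 0 R0"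
  proof -
    have "ball 0 R0 \<subseteq> eball (0::complex) (fps_conv_radius Fk)"
    proof
      fix x :: complex assume "x \<in> ball 0 R0"
      hence "ereal (norm x) < ereal R0" by simp
      from order_less_le_trans[OF this rad] show "x \<in> eball 0 (fps_conv_radius Fk)" by (simp add: in_eball_iff)
    qed
    thus ?thesis unfolding G_def by (intro holomorphic_on_eval_fps) auto
  qed
  have d\<psi>: "(\<psi> has_field_derivative deriv \<psi> w) (at w)" if "w \<in> ?B" for w
    using \<psi>(1) that by (intro holomorphic_derivI) auto
  have dq: "(q has_field_derivative deriv q w) (at w)" if "w \<in> ?B" for w
    using \<psi>(2) that by (intro holomorphic_derivI) auto
  have nz: "\<psi> w \<noteq> 0" if "w \<in> ?B - {0}" for w using eq[of w] that c by auto
  \<comment> \<open>The logarithmic derivative 1/w - q' w of the substitution; multiplied by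
    \<open>w\<close> it is the Jacobian factor in the integral.\<close>
  have logd: "deriv \<psi> w = \<psi> w * (1 / w - deriv q w)" if w: "w \<in> ?B - {0}" for w
  proof -
    have "((\<lambda>w. c * w * exp (- q w)) has_field_derivative c * exp (- q w) + c * w * (exp (- q w) * - deriv q w)) (at w)"
      using w by (auto intro!: derivative_eq_intros dq)
    hence "(\<psi> has_field_derivative c * exp (- q w) + c * w * (exp (- q w) * - deriv q w)) (at w)"
      by (rule has_field_derivative_transform_within_open[of _ _ _ ?B]) (use w eq in auto)
    hence "deriv \<psi> w = c * exp (- q w) + c * w * (exp (- q w) * - deriv q w)" by (rule DERIV_imp_deriv)
    also have "\<dots> = (c * w * exp (- q w)) * (1 / w - deriv q w)"
      using w by (simp add: right_diff_distrib)
    finally show ?thesis using w eq[of w] by simp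
  qed
  have t1: "((\<lambda>w. c' m * (\<psi> w ^ m * deriv \<psi> w / \<psi> w ^ Suc n)) has_contour_integral 0) \<gamma>" if m: "m < n" for m
  proof -
    have "((\<lambda>w. - c' m / of_nat (n - m) * inverse (\<psi> w ^ (n - m))) has_field_derivative (c' m * (\<psi> w ^ m * deriv \<psi> w / \<psi> w ^ Suc n))) (at w within ?B - {0})"
      if w: "w \<in> ?B - {0}" for w
    proof -
      obtain l where l: "n = m + Suc l" using m less_iff_Suc_add by auto
      have "((\<lambda>w. inverse (\<psi> w ^ Suc l)) has_field_derivative - (inverse (\<psi> w ^ Suc l) * (of_nat (Suc l) * (\<psi> w ^ l * deriv \<psi> w)) * inverse (\<psi> w ^ Suc l))) (at w)"
        using DERIV_power[OF d\<psi>[of w], of "Suc l"] w nz[OF w] by (intro DERIV_inverse') (auto simp: mult_ac)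
      from DERIV_cmult[OF this, of "- c' m / of_nat (Suc l)"]
      have "((\<lambda>w. - c' m / of_nat (Suc l) * inverse (\<psi> w ^ Suc l)) has_field_derivative (c' m * (\<psi> w ^ m * deriv \<psi> w / \<psi> w ^ Suc n))) (at w)"
        by (rule DERIV_cong) (use nz[OF w] in \<open>simp add: l power_add divide_simps del: of_nat_Suc\<close>)
      thus ?thesis using l by (simp add: has_field_derivative_at_within)
    qed
    from contour_integral_primitive[OF this g im] show ?thesis by (simp add: cl)
  qed
  \<comment> \<open>Only 1/w contributes, as q' has the primitive \<open>q\<close> on the whole
    disc.\<close>
  have t2: "((\<lambda>w. deriv \<psi> w / \<psi> w) has_contour_integral (2 * pi * \<i>)) \<gamma>"
  proof -
    have "((\<lambda>t. \<i>) has_integral ((3*pi/2 - (-(pi/2))) *\<^sub>R \<i>)) {-(pi/2)..3*pi/2}"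
      using has_integral_const_real[of \<i> "-(pi/2)" "3*pi/2"] by simp
    hence "((\<lambda>t. (1 / (0 + of_real r * cis t)) * of_real r * \<i> * cis t) has_integral (2 * pi * \<i>)) {-(pi/2)..3*pi/2}"
      using r by (simp add: scaleR_conv_of_real)
    hence "((\<lambda>w. 1 / w) has_contour_integral (2 * pi * \<i>)) \<gamma>"
      unfolding \<gamma>_def by (subst has_contour_integral_part_circlepath_iff) auto
    moreover have "(deriv q has_contour_integral (q (pathfinish \<gamma>) - q (pathstart \<gamma>))) \<gamma>"
      by (rule contour_integral_primitive[of ?B]) (use dq g im in \<open>auto intro: has_field_derivative_at_within\<close>)
    ultimately have "((\<lambda>w. 1 / w - deriv q w) has_contour_integral (2 * pi * \<i> - 0)) \<gamma>"
      by (intro has_contour_integral_diff) (auto simp: cl)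
    hence *: "((\<lambda>w. 1 / w - deriv q w) has_contour_integral (2 * pi * \<i>)) \<gamma>" by simp
    show ?thesis
    proof (rule has_contour_integral_eq[OF *])
      fix w assume "w \<in> path_image \<gamma>"
      hence w: "w \<in> ?B - {0}" using im by auto
      show "1 / w - deriv q w = deriv \<psi> w / \<psi> w" unfolding logd[OF w] using nz[OF w] by simp
    qed
  qed
  have t3: "((\<lambda>w. G (\<psi> w) * deriv \<psi> w) has_contour_integral 0) \<gamma>"
  proof (rule Cauchy_theorem_disc_simple)
    show "(\<lambda>w. G (\<psi> w) * deriv \<psi> w) holomorphic_on ?B"
      by (intro holomorphic_on_mult holomorphic_deriv \<psi> holomorphic_on_compose_gen[OF \<psi>(1) Ghol, unfolded o_def]) (use \<psi>(3) in auto)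
  qed (use g im cl in auto)
  have "((\<lambda>w. (\<Sum>m<n. c' m * (\<psi> w ^ m * deriv \<psi> w / \<psi> w ^ Suc n)) + c' n * (deriv \<psi> w / \<psi> w) + G (\<psi> w) * deriv \<psi> w)
      has_contour_integral ((\<Sum>m<n. 0) + c' n * (2 * pi * \<i>) + 0)) \<gamma>"
    by (intro has_contour_integral_add has_contour_integral_lmul has_contour_integral_sum t1 t2 t3) auto
  hence total: "((\<lambda>w. (\<Sum>m<n. c' m * (\<psi> w ^ m * deriv \<psi> w / \<psi> w ^ Suc n)) + c' n * (deriv \<psi> w / \<psi> w) + G (\<psi> w) * deriv \<psi> w)
      has_contour_integral (c' n * (2 * pi * \<i>))) \<gamma>" by simp
  have "((\<lambda>w. F (\<psi> w) * deriv \<psi> w / \<psi> w ^ Suc n) has_contour_integral (c' n * (2 * pi * \<i>))) \<gamma>"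
  proof (rule has_contour_integral_eq[OF total])
    fix w assume "w \<in> path_image \<gamma>"
    hence w: "w \<in> ?B - {0}" using im by auto
    have "\<psi> w \<in> ball 0 R0" using \<psi>(3) w by blast
    hence "norm (\<psi> w) < R0" by simp
    hence "F (\<psi> w) * deriv \<psi> w / \<psi> w ^ Suc n = (\<Sum>m<n. c' m * \<psi> w ^ m) * (deriv \<psi> w / \<psi> w ^ Suc n) + c' n * \<psi> w ^ n * (deriv \<psi> w / \<psi> w ^ Suc n) + (\<psi> w ^ Suc n * G (\<psi> w)) * (deriv \<psi> w / \<psi> w ^ Suc n)"
      by (simp add: Geq distrib_right distrib_left add_divide_distrib)
    also have "\<dots> = (\<Sum>m<n. c' m * (\<psi> w ^ m * deriv \<psi> w / \<psi> w ^ Suc n)) + c' n * (deriv \<psi> w / \<psi> w) + G (\<psi> w) * deriv \<psi> w"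
      using nz[OF w] by (simp add: sum_distrib_right sum_divide_distrib mult.assoc)
    finally show "(\<Sum>m<n. c' m * (\<psi> w ^ m * deriv \<psi> w / \<psi> w ^ Suc n)) + c' n * (deriv \<psi> w / \<psi> w) + G (\<psi> w) * deriv \<psi> w
      = F (\<psi> w) * deriv \<psi> w / \<psi> w ^ Suc n" by simp
  qed
  hence "((\<lambda>t. F (\<psi> (0 + of_real r * cis t)) * deriv \<psi> (0 + of_real r * cis t) / \<psi> (0 + of_real r * cis t) ^ Suc n * of_real r * \<i> * cis t) has_integral (c' n * (2 * pi * \<i>))) {-(pi/2)..3*pi/2}"
    unfolding \<gamma>_def by (subst (asm) has_contour_integral_part_circlepath_iff) auto
  hence "((\<lambda>t. (F (\<psi> (0 + of_real r * cis t)) * deriv \<psi> (0 + of_real r * cis t) / \<psi> (0 + of_real r * cis t) ^ Suc n * of_real r * \<i> * cis t) * (1 / \<i>)) has_integral (c' n * (2 * pi * \<i>) * (1 / \<i>))) {-(pi/2)..3*pi/2}"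
    by (rule has_integral_mult_left)
  hence "((\<lambda>t. (F (\<psi> (0 + of_real r * cis t)) * deriv \<psi> (0 + of_real r * cis t) / \<psi> (0 + of_real r * cis t) ^ Suc n * of_real r * \<i> * cis t) * (1 / \<i>)) has_integral (2 * pi * fps_nth Fk n)) {-(pi/2)..3*pi/2}"
    by (simp add: c'_def mult_ac)
  thus ?thesis
  proof (rule has_integral_eq[rotated])
    fix t :: real assume "t \<in> {-(pi/2)..3*pi/2}"
    define w where "w = complex_of_real r * cis t"
    have w: "w \<in> ?B - {0}" using r by (auto simp: w_def norm_mult)
    have "\<psi> w = c * w / exp (q w)" using w eq[of w] by (simp add: exp_minus divide_inverse)
    hence "exp (q w) / (c * w) = 1 / \<psi> w" by simp
    hence p: "1 / \<psi> w ^ n = (exp (q w) / (c * w)) ^ n" by (simp add: power_one_over)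
    have "F (\<psi> w) * deriv \<psi> w / \<psi> w ^ Suc n * w = F (\<psi> w) * (1 - w * deriv q w) * (1 / \<psi> w ^ n)"
      using w nz[OF w] unfolding logd[OF w] by (simp add: divide_simps) (simp add: algebra_simps)?
    hence "F (\<psi> w) * deriv \<psi> w / \<psi> w ^ Suc n * w = F (\<psi> w) * (1 - w * deriv q w) * (exp (q w) / (c * w)) ^ n"
      unfolding p .
    thus "F (\<psi> (0 + of_real r * cis t)) * deriv \<psi> (0 + of_real r * cis t) / \<psi> (0 + of_real r * cis t) ^ Suc n * of_real r * \<i> * cis t * (1 / \<i>) =
      F (\<psi> (of_real r * cis t)) * (1 - of_real r * cis t * deriv q (of_real r * cis t)) * (exp (q (of_real r * cis t)) / (c * (of_real r * cis t))) ^ n"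
      by (simp add: w_def mult_ac)
  qed
qed

lemma has_fps_expansion_Re_pos:
  fixes f :: "complex \<Rightarrow> complex"
  assumes "f has_fps_expansion F" "fps_nth F 0 = 1"
  shows "\<exists>R>0. f holomorphic_on ball 0 R \<and> (\<forall>z\<in>ball 0 R. Re (f z) > 0)"
proof -
  have f0: "f 0 = 1" using has_fps_expansion_imp_0_eq_fps_nth_0[OF assms(1)] assms(2) by simp
  obtain s where s: "open s" "0 \<in> s" "f holomorphic_on s" "\<And>z. z \<in> s \<Longrightarrow> f z = eval_fps F z"
    using has_fps_expansion_imp_holomorphic[OF assms(1)] by blast
  have "continuous_on s f" using s holomorphic_on_imp_continuous_on by blast
  hence "open (s \<inter> f -` {z. Re z > 0})" using s(1) open_halfspace_Re_gt by (intro continuous_open_preimage) auto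
  moreover have "0 \<in> s \<inter> f -` {z. Re z > 0}" using s f0 by auto
  ultimately obtain R where R: "R > 0" "ball 0 R \<subseteq> s \<inter> f -` {z. Re z > 0}"
    using openE by blast
  show ?thesis
    using R s(3) holomorphic_on_subset[of f s "ball 0 R"] by (intro exI[of _ R]) auto
qed

lemma Re_pos_not_nonpos_Reals: "Re z > 0 \<Longrightarrow> z \<notin> \<real>\<^sub>\<le>\<^sub>0"
  by (auto elim!: nonpos_Reals_cases)

lemma fps_expansion_quadratic_bound:
  assumes "f has_fps_expansion F" "f holomorphic_on ball 0 r" "0 < r" "fps_nth F 0 = 0"
  shows "\<exists>B\<ge>0. \<forall>w. norm w \<le> r / 2 \<longrightarrow> norm (f w - (fps_nth F 1 * w + fps_nth F 2 * w\<^sup>2)) \<le> B * norm w ^ 3"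
proof -
  have K: "compact (cball (0::complex) (r/2))" "convex (cball (0::complex) (r/2))" "cball (0::complex) (r/2) \<subseteq> ball 0 r"
    using assms(3) by auto
  have "(0::complex) \<in> cball 0 (r/2)" using assms(3) by simp
  then obtain B where B: "B \<ge> 0" "\<forall>b\<in>cball 0 (r/2). norm (f b - (\<Sum>i\<le>2. (deriv ^^ i) f 0 * (b - 0) ^ i / fact i)) \<le> B * norm (b - 0) ^ Suc 2"
    using taylor_bound_compact[OF assms(2) open_ball K, of 2] by blast
  have "(\<Sum>i\<le>2. (deriv ^^ i) f 0 * (b - 0) ^ i / fact i) = (\<Sum>i\<le>2. fps_nth F i * b ^ i)" for b
    by (intro sum.cong refl) (simp add: fps_nth_fps_expansion[OF assms(1)])
  hence "(\<Sum>i\<le>2. (deriv ^^ i) f 0 * (b - 0) ^ i / fact i) = fps_nth F 1 * b + fps_nth F 2 * b\<^sup>2" for b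
    using assms(4) by (simp add: numeral_2_eq_2)
  with B show ?thesis by (intro exI[of _ B]) (simp add: eval_nat_numeral)
qed

section \<open>The local coordinate and the coefficients of the substitution\<close>

text \<open>The parameters are normalised so that ln e = e2 (z^2 + a z^3 + b z^4 + ...). A square
  root of this function is S z = sqrt e2 * z * exp (h z), injective near 0, and \<open>g\<close> is
  its inverse. With q = h o g the equation S (g w) = w turns into g w = w exp (- q w) / sqrt
  e2.\<close>

lemma uniformizer:
  fixes e :: "complex fps" and e2 a b :: real
  assumes e: "fps_conv_radius e > 0" "fps_nth e 0 = 1" "fps_nth e 1 = 0" "fps_nth e 2 = of_real e2"
      "fps_nth e 3 = of_real (a * e2)" "fps_nth e 4 = of_real (b * e2 + e2\<^sup>2 / 2)" and e2: "e2 > 0" and R: "R > 0"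
  obtains g q Q \<Psi> r where "r > 0" "g holomorphic_on ball 0 r" "q holomorphic_on ball 0 r" "g ` ball 0 r \<subseteq> ball 0 R"
     "\<And>w. w \<in> ball 0 r \<Longrightarrow> Ln (eval_fps e (g w)) = w\<^sup>2"
     "\<And>w. w \<in> ball 0 r \<Longrightarrow> g w = of_real (1 / sqrt e2) * w * exp (- q w)"
     "q has_fps_expansion Q" "fps_nth Q 0 = 0" "fps_nth Q 1 = of_real (a / (2 * sqrt e2))" "fps_nth Q 2 = of_real ((b - a\<^sup>2) / (2 * e2))"
     "g has_fps_expansion \<Psi>" "fps_nth \<Psi> 0 = 0" "fps_nth \<Psi> 1 = of_real (1 / sqrt e2)" "fps_nth \<Psi> 2 = of_real (- a / (2 * e2))"
proof -
  define E where "E = eval_fps e"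
  have E: "E has_fps_expansion e" unfolding E_def using e(1) by (rule eval_fps_has_fps_expansion)
  define LE where "LE = (\<lambda>z. Ln (E z))"
  define Lf where "Lf = fps_ln 1 oo (e - 1)"
  have LE: "LE has_fps_expansion Lf" unfolding LE_def Lf_def by (rule has_fps_expansion_Ln[OF E e(2)])
  note Lnth = fps_log_nth[OF E e(2) LE[unfolded LE_def]]
  have L: "fps_nth Lf 0 = 0" "fps_nth Lf 1 = 0" "fps_nth Lf 2 = of_real e2" "fps_nth Lf 3 = of_real (a * e2)" "fps_nth Lf 4 = of_real (b * e2)"
    using Lnth e by (simp_all add: power2_eq_square)
  \<comment> \<open>The series of ln e / (e2 z^2), i.e. 1 + a z + b z^2 + ..., whose logarithm is 2
    h.\<close>
  define m where "m = fps_const (of_real (1 / e2)) * fps_shift 2 Lf"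
  define M where "M = (\<lambda>z. of_real (1 / e2) * (if z = 0 then of_real e2 else LE z / z\<^sup>2))"
  have sub: "2 \<le> subdegree Lf"
  proof (rule subdegree_geI)
    show "Lf \<noteq> 0" using L(3) e2 by auto
    show "fps_nth Lf i = 0" if "i < 2" for i using that L(1,2) by (auto simp: less_2_cases_iff)
  qed
  have M: "M has_fps_expansion m"
    unfolding M_def m_def by (intro has_fps_expansion_cmult_left has_fps_expansion_shift LE sub) (simp add: L)
  have mn: "fps_nth m 0 = 1" "fps_nth m 1 = of_real a" "fps_nth m 2 = of_real b"
    using L e2 by (simp_all add: m_def eval_nat_numeral)
  define h where "h = (\<lambda>z. (1/2) * Ln (M z))"
  define H where "H = fps_const (1/2) * (fps_ln 1 oo (m - 1))"
  have LnM: "(\<lambda>z. Ln (M z)) has_fps_expansion (fps_ln 1 oo (m - 1))" by (rule has_fps_expansion_Ln[OF M mn(1)])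
  have h: "h has_fps_expansion H" unfolding h_def H_def by (intro has_fps_expansion_cmult_left LnM)
  have Hn: "fps_nth H 0 = 0" "fps_nth H 1 = of_real (a / 2)" "fps_nth H 2 = of_real (b / 2 - a\<^sup>2 / 4)"
    using fps_log_nth(1-3)[OF M mn(1) LnM] mn by (simp_all add: H_def power2_eq_square field_simps)
  obtain R1 where R1: "R1 > 0" "M holomorphic_on ball 0 R1" "\<And>z. z \<in> ball 0 R1 \<Longrightarrow> Re (M z) > 0"
    using has_fps_expansion_Re_pos[OF M mn(1)] by blast
  define R0 where "R0 = min R R1"
  have R0: "R0 > 0" "ball 0 R0 \<subseteq> ball (0::complex) R" "ball 0 R0 \<subseteq> ball (0::complex) R1" using R R1 by (auto simp: R0_def)
  have hh: "h holomorphic_on ball 0 R0"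
  proof -
    have "(\<lambda>z. Ln (M z)) holomorphic_on ball 0 R0"
      using R1 R0 Re_pos_not_nonpos_Reals by (intro holomorphic_on_Ln' holomorphic_on_subset[OF R1(2)]) auto
    thus ?thesis unfolding h_def by (intro holomorphic_on_mult holomorphic_on_const)
  qed
  define S where "S = (\<lambda>z. of_real (sqrt e2) * z * exp (h z))"
  have Sh: "S holomorphic_on ball 0 R0" unfolding S_def by (intro holomorphic_intros hh)
  have h0: "h 0 = 0" using has_fps_expansion_imp_0_eq_fps_nth_0[OF h] Hn by simp
  have "(S has_field_derivative of_real (sqrt e2)) (at 0)"
  proof -
    have "(h has_field_derivative deriv h 0) (at 0)" using hh R0 by (intro holomorphic_derivI) auto
    hence "(S has_field_derivative of_real (sqrt e2) * exp (h 0) + of_real (sqrt e2) * 0 * (exp (h 0) * deriv h 0)) (at 0)"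
      unfolding S_def by (auto intro!: derivative_eq_intros)
    thus ?thesis by (simp add: h0)
  qed
  from DERIV_imp_deriv[OF this] have "deriv S 0 = of_real (sqrt e2)" .
  hence dnz: "deriv S 0 \<noteq> 0" using e2 by simp
  have z0: "0 \<in> ball (0::complex) R0" using R0(1) by simp
  obtain r0 where r0: "r0 > 0" "ball 0 r0 \<subseteq> ball (0::complex) R0" "open (S ` ball 0 r0)" "inj_on S (ball 0 r0)"
    using has_complex_derivative_locally_invertible[OF Sh z0 open_ball dnz] by blast
  obtain g where g: "g holomorphic_on S ` ball 0 r0" "\<And>z. z \<in> ball 0 r0 \<Longrightarrow> g (S z) = z"
    by (rule holomorphic_has_inverse[OF holomorphic_on_subset[OF Sh r0(2)] open_ball r0(4)]) (rule that; assumption)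
  have S0: "S 0 = 0" by (simp add: S_def)
  have "0 \<in> S ` ball 0 r0" using S0 r0(1) by (intro image_eqI[of _ _ 0]) auto
  then obtain r where r: "r > 0" "ball 0 r \<subseteq> S ` ball 0 r0"
    using r0(3)[unfolded open_contains_ball] by blast
  have gim: "g w \<in> ball 0 r0" "S (g w) = w" if "w \<in> ball 0 r" for w
    using r(2) that g(2) by auto
  have gh: "g holomorphic_on ball 0 r" using g(1) r(2) holomorphic_on_subset by blast
  define q where "q = (\<lambda>w. h (g w))"
  have gR0: "g ` ball 0 r \<subseteq> ball 0 R0" using gim(1) r0(2) by blast
  have qh: "q holomorphic_on ball 0 r"
    unfolding q_def by (rule holomorphic_on_compose_gen[OF gh hh gR0, unfolded o_def])
  have geq: "g w = of_real (1 / sqrt e2) * w * exp (- q w)" if "w \<in> ball 0 r" for w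
  proof -
    have w: "of_real (sqrt e2) * g w * exp (q w) = w" using gim(2)[OF that] by (simp add: S_def q_def)
    have "exp (q w) * exp (- q w) = 1" by (rule exp_minus_inverse)
    hence "g w = of_real (1 / sqrt e2) * (of_real (sqrt e2) * g w * exp (q w)) * exp (- q w)"
      using e2 by (simp add: mult.assoc)
    thus ?thesis unfolding w .
  qed
  have Lneq: "Ln (eval_fps e (g w)) = w\<^sup>2" if "w \<in> ball 0 r" for w
  proof -
    define z where "z = g w"
    have "z \<in> ball 0 R1" using gR0 R0(3) that unfolding z_def by blast
    hence "M z \<noteq> 0" using R1(3)[of z] by auto
    hence "exp (h z) ^ 2 = M z" by (simp add: h_def exp_double[symmetric])
    moreover have "w = of_real (sqrt e2) * z * exp (h z)" using gim(2)[OF that] by (simp add: S_def z_def)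
    ultimately have "w\<^sup>2 = of_real e2 * z\<^sup>2 * M z" using e2 by (simp add: power_mult_distrib flip: of_real_power)
    also have "\<dots> = LE z"
    proof (cases "z = 0")
      case True
      have "LE 0 = 0" using has_fps_expansion_imp_0_eq_fps_nth_0[OF LE] L by simp
      thus ?thesis using True by simp
    qed (use e2 in \<open>simp add: M_def\<close>)
    finally show ?thesis by (simp add: LE_def E_def z_def)
  qed
  have g0: "g 0 = 0" using geq[of 0] r by simp
  have ga: "g analytic_on {0}" using gh r(1) by (meson analytic_at centre_in_ball open_ball)
  define \<Psi> where "\<Psi> = fps_expansion g 0"
  have \<Psi>: "g has_fps_expansion \<Psi>" unfolding \<Psi>_def using ga by (rule analytic_at_imp_has_fps_expansion_0)
  have \<Psi>0: "fps_nth \<Psi> 0 = 0" using has_fps_expansion_imp_0_eq_fps_nth_0[OF \<Psi>] g0 by simp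
  define Q where "Q = H oo \<Psi>"
  have Q: "q has_fps_expansion Q" using has_fps_expansion_compose[OF h \<Psi> \<Psi>0] by (simp add: Q_def q_def o_def)
  have Q0: "fps_nth Q 0 = 0" by (simp add: Q_def Hn)
  have A: "(\<lambda>w. of_real (1 / sqrt e2) * (w * (exp \<circ> (\<lambda>w. - q w)) w)) has_fps_expansion fps_const (of_real (1 / sqrt e2)) * (fps_X * (fps_exp 1 oo (- Q)))"
    by (intro has_fps_expansion_cmult_left has_fps_expansion_mult has_fps_expansion_fps_X has_fps_expansion_compose has_fps_expansion_exp1 has_fps_expansion_minus Q) (simp add: Q0)
  have A': "\<forall>\<^sub>F w in nhds 0. of_real (1 / sqrt e2) * (w * (exp \<circ> (\<lambda>w. - q w)) w) = g w"
    by (rule eventually_mono[OF eventually_nhds_in_open[of "ball 0 r"]]) (use r geq in \<open>auto simp: mult.assoc\<close>)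
  have "g has_fps_expansion fps_const (of_real (1 / sqrt e2)) * (fps_X * (fps_exp 1 oo (- Q)))"
    by (rule iffD1[OF has_fps_expansion_cong[OF A' refl] A])
  \<comment> \<open>The coefficients are found by alternating between this equation and Q = H o
    \<Psi>: each order of one needs only lower orders of the other, so Lagrange inversion is not
    invoked.\<close>
  hence \<Psi>eq: "\<Psi> = fps_const (of_real (1 / sqrt e2)) * (fps_X * (fps_exp 1 oo (- Q)))"
    using \<Psi> fps_expansion_unique_complex by blast
  have \<Psi>1: "fps_nth \<Psi> 1 = of_real (1 / sqrt e2)" unfolding \<Psi>eq by simp
  have Q1: "fps_nth Q 1 = of_real (a / (2 * sqrt e2))"
  proof -
    have "fps_nth Q 1 = fps_nth H 1 * fps_nth \<Psi> 1" unfolding Q_def by (simp add: fps_compose_nth \<Psi>0)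
    thus ?thesis unfolding Hn \<Psi>1 by simp
  qed
  have "fps_nth (fps_exp 1 oo (- Q)) 1 = - fps_nth Q 1"
    by (simp add: fps_compose_nth Q0)
  hence \<Psi>2: "fps_nth \<Psi> 2 = of_real (1 / sqrt e2) * (- fps_nth Q 1)" unfolding \<Psi>eq by (simp add: numeral_2_eq_2)
  have \<Psi>2': "fps_nth \<Psi> 2 = of_real (- a / (2 * e2))"
  proof -
    have "1 / sqrt e2 * (- (a / (2 * sqrt e2))) = - a / (2 * e2)"
      using e2 by (simp add: field_simps)
    moreover have "fps_nth \<Psi> 2 = of_real (1 / sqrt e2 * (- (a / (2 * sqrt e2))))" unfolding \<Psi>2 Q1 by simp
    ultimately show ?thesis by (simp only:)
  qed
  have "fps_nth Q 2 = fps_nth H 1 * fps_nth \<Psi> 2 + fps_nth H 2 * (fps_nth \<Psi> 1)\<^sup>2"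
    unfolding Q_def by (simp add: fps_compose_nth \<Psi>0 numeral_2_eq_2 fps_mult_nth)
  also have "\<dots> = of_real (- (a/2) * (a / (2 * e2)) + (b / 2 - a\<^sup>2 / 4) * (1 / e2))"
  proof -
    have "(complex_of_real (1 / sqrt e2))\<^sup>2 = of_real (1 / e2)"
      using e2 by (simp add: power_divide flip: of_real_power)
    thus ?thesis unfolding \<Psi>1 Hn \<Psi>2' by simp
  qed
  also have "- (a/2) * (a / (2 * e2)) + (b / 2 - a\<^sup>2 / 4) * (1 / e2) = (b - a\<^sup>2) / (2 * e2)"
    using e2 by (simp add: field_simps power2_eq_square)
  finally have Q2: "fps_nth Q 2 = of_real ((b - a\<^sup>2) / (2 * e2))" .
  show ?thesis
    by (rule that[OF r(1) gh qh _ Lneq geq Q Q0 Q1 Q2 \<Psi> \<Psi>0 \<Psi>1 \<Psi>2']) (use gR0 R0 in auto)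
qed

text \<open>Reduces the two given series to what the saddle point analysis uses: quadratic
  approximations of \<open>q\<close> and \<open>l\<close>, a bound on the Jacobian, and one integral
  per circle. One pair \<open>q\<close>, \<open>l\<close> serves all \<open>k\<close>,
  \<open>n\<close>, \<omega>0 and \<omega>, which is what makes later bounds uniform.\<close>

lemma gf_term_nth_integral:
  fixes e d :: "complex fps" and d1 d2 e2 e3 e4 :: real and \<alpha> :: nat
  assumes e: "fps_conv_radius e > 0" "fps_nth e 0 = 1" "fps_nth e 1 = 0" "fps_nth e 2 = of_real e2"
      "fps_nth e 3 = of_real e3" "fps_nth e 4 = of_real e4" and e2: "e2 > 0"
    and d: "fps_conv_radius d > 0" "fps_nth d 0 = 1" "fps_nth d 1 = of_real d1" "fps_nth d 2 = of_real d2"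
  obtains q l :: "complex \<Rightarrow> complex" and r B :: real where
    "r > 0" "B \<ge> 0" "q holomorphic_on ball 0 r" "l holomorphic_on ball 0 r"
    "\<And>w. norm w < r \<Longrightarrow> norm (q w - (of_real (e3 / (2 * e2 * sqrt e2)) * w + of_real ((e4 / e2 - e2 / 2 - (e3 / e2)\<^sup>2) / (2 * e2)) * w\<^sup>2)) \<le> B * norm w ^ 3"
    "\<And>w. norm w < r \<Longrightarrow> norm (l w - (of_real (d1 / sqrt e2) * w + of_real ((d2 - d1\<^sup>2 / 2) / e2 - d1 * e3 / (2 * e2\<^sup>2)) * w\<^sup>2)) \<le> B * norm w ^ 3"
    "\<And>w. norm w < r \<Longrightarrow> norm (w * deriv q w) \<le> B * norm w"
    "\<And>\<omega>0 \<omega> k n \<rho>. 0 < \<rho> \<Longrightarrow> \<rho> < r \<Longrightarrow>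
       ((\<lambda>\<theta>. exp ((of_nat k + \<omega>0) * l (of_real \<rho> * cis \<theta>)) * (\<Prod>j=1..k. (exp ((of_nat j + \<omega>) * (of_real \<rho> * cis \<theta>)\<^sup>2) - 1) ^ \<alpha>)
         * (1 - of_real \<rho> * cis \<theta> * deriv q (of_real \<rho> * cis \<theta>))
         * (exp (q (of_real \<rho> * cis \<theta>)) / (of_real (1 / sqrt e2) * (of_real \<rho> * cis \<theta>))) ^ n)
       has_integral (2 * pi * fps_nth (gf_term \<alpha> d e \<omega>0 \<omega> k) n)) {-(pi/2)..3*pi/2}"
proof -
  have E: "eval_fps e has_fps_expansion e" and D: "eval_fps d has_fps_expansion d"
    using e(1) d(1) by (auto intro: eval_fps_has_fps_expansion)
  obtain Re1 where Re1: "Re1 > 0" "eval_fps e holomorphic_on ball 0 Re1" "\<And>z. z \<in> ball 0 Re1 \<Longrightarrow> Re (eval_fps e z) > 0"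
    using has_fps_expansion_Re_pos[OF E e(2)] by blast
  obtain Rd where Rd: "Rd > 0" "eval_fps d holomorphic_on ball 0 Rd" "\<And>z. z \<in> ball 0 Rd \<Longrightarrow> Re (eval_fps d z) > 0"
    using has_fps_expansion_Re_pos[OF D d(2)] by blast
  define R where "R = min Re1 Rd"
  have R: "R > 0" using Re1 Rd by (simp add: R_def)
  have LEh: "(\<lambda>z. Ln (eval_fps e z)) holomorphic_on ball 0 R"
    using Re1 Re_pos_not_nonpos_Reals by (intro holomorphic_on_Ln' holomorphic_on_subset[OF Re1(2)]) (auto simp: R_def)
  have LDh: "(\<lambda>z. Ln (eval_fps d z)) holomorphic_on ball 0 R"
    using Rd Re_pos_not_nonpos_Reals by (intro holomorphic_on_Ln' holomorphic_on_subset[OF Rd(2)]) (auto simp: R_def)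
  define a where "a = e3 / e2"
  define b where "b = e4 / e2 - e2 / 2"
  have ab: "fps_nth e 3 = of_real (a * e2)" "fps_nth e 4 = of_real (b * e2 + e2\<^sup>2 / 2)"
    using e e2 by (simp_all add: a_def b_def field_simps power2_eq_square)
  obtain g q Q \<Psi> r where u: "r > 0" "g holomorphic_on ball 0 r" "q holomorphic_on ball 0 r" "g ` ball 0 r \<subseteq> ball 0 R"
     "\<And>w. w \<in> ball 0 r \<Longrightarrow> Ln (eval_fps e (g w)) = w\<^sup>2"
     "\<And>w. w \<in> ball 0 r \<Longrightarrow> g w = of_real (1 / sqrt e2) * w * exp (- q w)"
     "q has_fps_expansion Q" "fps_nth Q 0 = 0" "fps_nth Q 1 = of_real (a / (2 * sqrt e2))" "fps_nth Q 2 = of_real ((b - a\<^sup>2) / (2 * e2))"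
     "g has_fps_expansion \<Psi>" "fps_nth \<Psi> 0 = 0" "fps_nth \<Psi> 1 = of_real (1 / sqrt e2)" "fps_nth \<Psi> 2 = of_real (- a / (2 * e2))"
    by (rule uniformizer[OF e(1-4) ab e2 R], rule that; assumption)
  define l where "l = (\<lambda>w. Ln (eval_fps d (g w)))"
  have lh: "l holomorphic_on ball 0 r"
    unfolding l_def by (rule holomorphic_on_compose_gen[OF u(2) LDh u(4), unfolded o_def])
  have LD: "(\<lambda>z. Ln (eval_fps d z)) has_fps_expansion (fps_ln 1 oo (d - 1))" by (rule has_fps_expansion_Ln[OF D d(2)])
  define Lf where "Lf = (fps_ln 1 oo (d - 1)) oo \<Psi>"
  have l: "l has_fps_expansion Lf" using has_fps_expansion_compose[OF LD u(11,12)] by (simp add: Lf_def l_def o_def)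
  note dn = fps_log_nth(1-3)[OF D d(2) LD]
  have Lf: "fps_nth Lf 0 = 0" "fps_nth Lf 1 = of_real (d1 / sqrt e2)" "fps_nth Lf 2 = of_real ((d2 - d1\<^sup>2 / 2) / e2 - d1 * e3 / (2 * e2\<^sup>2))"
  proof -
    show "fps_nth Lf 0 = 0" using dn by (simp add: Lf_def)
    show "fps_nth Lf 1 = of_real (d1 / sqrt e2)" using dn d u(12,13) by (simp add: Lf_def fps_compose_nth)
    have "fps_nth Lf 2 = fps_nth (fps_ln 1 oo (d - 1)) 1 * fps_nth \<Psi> 2 + fps_nth (fps_ln 1 oo (d - 1)) 2 * (fps_nth \<Psi> 1)\<^sup>2"
      unfolding Lf_def by (subst fps_compose_nth) (simp add: u(12) numeral_2_eq_2 fps_mult_nth del: fps_ln_def)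
    also have "\<dots> = of_real (d1 * (- a / (2 * e2)) + (d2 - d1 * d1 / 2) * (1 / e2))"
    proof -
      have "(complex_of_real (1 / sqrt e2))\<^sup>2 = of_real (1 / e2)"
        using e2 by (simp add: power_divide flip: of_real_power)
      thus ?thesis unfolding dn u(13,14) d by simp
    qed
    also have "d1 * (- a / (2 * e2)) + (d2 - d1 * d1 / 2) * (1 / e2) = (d2 - d1\<^sup>2 / 2) / e2 - d1 * e3 / (2 * e2\<^sup>2)"
      using e2 by (simp add: a_def field_simps power2_eq_square)
    finally show "fps_nth Lf 2 = of_real ((d2 - d1\<^sup>2 / 2) / e2 - d1 * e3 / (2 * e2\<^sup>2))" .
  qed
  obtain B1 where B1: "B1 \<ge> 0" "\<And>w. norm w \<le> r / 2 \<Longrightarrow> norm (q w - (fps_nth Q 1 * w + fps_nth Q 2 * w\<^sup>2)) \<le> B1 * norm w ^ 3"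
    using fps_expansion_quadratic_bound[OF u(7,3,1,8)] by blast
  obtain B2 where B2: "B2 \<ge> 0" "\<And>w. norm w \<le> r / 2 \<Longrightarrow> norm (l w - (fps_nth Lf 1 * w + fps_nth Lf 2 * w\<^sup>2)) \<le> B2 * norm w ^ 3"
    using fps_expansion_quadratic_bound[OF l lh u(1) Lf(1)] by blast
  obtain B3 where B3: "B3 \<ge> 0" "\<And>w. norm w \<le> r / 2 \<Longrightarrow> norm (deriv q w) \<le> B3"
  proof -
    have "deriv q holomorphic_on ball 0 r" using u(3) by (intro holomorphic_deriv) auto
    hence "continuous_on (cball 0 (r/2)) (deriv q)" using u(1)
      by (intro holomorphic_on_imp_continuous_on) (auto elim!: holomorphic_on_subset)
    hence "bounded (deriv q ` cball 0 (r/2))" by (intro compact_imp_bounded compact_continuous_image) auto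
    then obtain B where "B > 0" "\<And>w. w \<in> cball 0 (r/2) \<Longrightarrow> norm (deriv q w) \<le> B" unfolding bounded_pos by blast
    thus ?thesis by (intro that[of B]) auto
  qed
  define B where "B = max B1 (max B2 B3)"
  have B: "B \<ge> 0" "B1 \<le> B" "B2 \<le> B" "B3 \<le> B" using B1 by (auto simp: B_def)
  show ?thesis
  \<comment> \<open>The radius is halved because the Taylor bounds hold on the closed disc of radius
    r/2 inside the domain of holomorphy.\<close>
  proof (rule that[of "r/2" B q l])
    show "r / 2 > 0" "B \<ge> 0" using u(1) B by auto
    show "q holomorphic_on ball 0 (r/2)" "l holomorphic_on ball 0 (r/2)"
      using u(1,3) lh by (auto elim!: holomorphic_on_subset)
    fix w :: complex assume w: "norm w < r / 2"
    have c: "a / (2 * sqrt e2) = e3 / (2 * e2 * sqrt e2)" by (simp add: a_def)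
    show "norm (q w - (of_real (e3 / (2 * e2 * sqrt e2)) * w + of_real ((e4 / e2 - e2 / 2 - (e3 / e2)\<^sup>2) / (2 * e2)) * w\<^sup>2)) \<le> B * norm w ^ 3"
      using order_trans[OF B1(2)[of w] mult_right_mono[OF B(2), of "norm w ^ 3"]] w
      unfolding u(9,10) c by (simp add: a_def b_def)
    show "norm (l w - (of_real (d1 / sqrt e2) * w + of_real ((d2 - d1\<^sup>2 / 2) / e2 - d1 * e3 / (2 * e2\<^sup>2)) * w\<^sup>2)) \<le> B * norm w ^ 3"
      using order_trans[OF B2(2)[of w] mult_right_mono[OF B(3), of "norm w ^ 3"]] w
      unfolding Lf by simp
    show "norm (w * deriv q w) \<le> B * norm w"
      using mult_mono[OF order_trans[OF B3(2)[of w] B(4)], of "norm w" "norm w"] w B(1) by (simp add: norm_mult mult.commute)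
  next
    fix \<omega>0 \<omega> :: complex and k n :: nat and \<rho> :: real assume \<rho>: "0 < \<rho>" "\<rho> < r / 2"
    define F where "F = (\<lambda>z. exp ((of_nat k + \<omega>0) * Ln (eval_fps d z)) * (\<Prod>j=1..k. (exp ((of_nat j + \<omega>) * Ln (eval_fps e z)) - 1) ^ \<alpha>))"
    have F: "F has_fps_expansion gf_term \<alpha> d e \<omega>0 \<omega> k"
      unfolding F_def by (rule has_fps_expansion_gf_term[OF E e(2) D d(2)])
    have Fh: "F holomorphic_on ball 0 R"
      unfolding F_def by (intro holomorphic_on_mult holomorphic_on_prod holomorphic_on_power holomorphic_on_diff holomorphic_on_exp' holomorphic_on_const LEh LDh)
    have c0: "complex_of_real (1 / sqrt e2) \<noteq> 0" using e2 by simp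
    have "((\<lambda>\<theta>. F (g (of_real \<rho> * cis \<theta>)) * (1 - of_real \<rho> * cis \<theta> * deriv q (of_real \<rho> * cis \<theta>))
       * (exp (q (of_real \<rho> * cis \<theta>)) / (of_real (1 / sqrt e2) * (of_real \<rho> * cis \<theta>))) ^ n)
       has_integral (2 * pi * fps_nth (gf_term \<alpha> d e \<omega>0 \<omega> k) n)) {-(pi/2)..3*pi/2}"
      by (rule coeff_substitution[OF F Fh u(2,3,4) u(6) c0]) (use \<rho> in auto)
    moreover have "F (g (of_real \<rho> * cis \<theta>)) = exp ((of_nat k + \<omega>0) * l (of_real \<rho> * cis \<theta>)) * (\<Prod>j=1..k. (exp ((of_nat j + \<omega>) * (of_real \<rho> * cis \<theta>)\<^sup>2) - 1) ^ \<alpha>)" for \<theta>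
    proof -
      have "of_real \<rho> * cis \<theta> \<in> ball 0 r" using \<rho> by (simp add: norm_mult)
      from u(5)[OF this] show ?thesis unfolding F_def l_def by simp
    qed
    ultimately show "((\<lambda>\<theta>. exp ((of_nat k + \<omega>0) * l (of_real \<rho> * cis \<theta>)) * (\<Prod>j=1..k. (exp ((of_nat j + \<omega>) * (of_real \<rho> * cis \<theta>)\<^sup>2) - 1) ^ \<alpha>)
         * (1 - of_real \<rho> * cis \<theta> * deriv q (of_real \<rho> * cis \<theta>))
         * (exp (q (of_real \<rho> * cis \<theta>)) / (of_real (1 / sqrt e2) * (of_real \<rho> * cis \<theta>))) ^ n)
       has_integral (2 * pi * fps_nth (gf_term \<alpha> d e \<omega>0 \<omega> k) n)) {-(pi/2)..3*pi/2}" by simp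
  qed
qed

section \<open>Gaussian integrals and sums\<close>

text \<open>Bound (1 + |x|)^p by exp (p |x|) and complete the square against half of the Gaussian;
  the constant is exp ((p + B)^2 / (2a)). Polynomial error factors are removed in this way
  throughout.\<close>

lemma gaussian_absorb:
  assumes "a > 0"
  shows "\<exists>C\<ge>0. \<forall>x::real. (1 + \<bar>x\<bar>) ^ p * exp (B * \<bar>x\<bar>) * exp (- a * x\<^sup>2) \<le> C * exp (- (a / 2) * x\<^sup>2)"
proof (intro exI[of _ "exp ((real p + B)\<^sup>2 / (2 * a))"] conjI allI)
  fix x :: real
  have "(1 + \<bar>x\<bar>) ^ p \<le> exp \<bar>x\<bar> ^ p" by (intro power_mono) (auto simp: exp_ge_add_one_self)
  hence "(1 + \<bar>x\<bar>) ^ p * exp (B * \<bar>x\<bar>) * exp (- a * x\<^sup>2) \<le> exp \<bar>x\<bar> ^ p * exp (B * \<bar>x\<bar>) * exp (- a * x\<^sup>2)"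
    by (intro mult_right_mono) auto
  also have "\<dots> = exp ((real p + B) * \<bar>x\<bar> - a * x\<^sup>2)"
    by (simp add: exp_of_nat_mult[symmetric] exp_add[symmetric] algebra_simps)
  also have "\<dots> \<le> exp ((real p + B)\<^sup>2 / (2 * a) - (a / 2) * x\<^sup>2)"
  proof -
    have "0 \<le> (a * \<bar>x\<bar> - (real p + B))\<^sup>2 / (2 * a)" using assms by simp
    also have "\<dots> = a / 2 * x\<^sup>2 - (real p + B) * \<bar>x\<bar> + (real p + B)\<^sup>2 / (2 * a)"
      using assms by (simp add: power2_diff power_mult_distrib field_simps power2_eq_square)
    finally show ?thesis by (simp add: algebra_simps)
  qed
  also have "\<dots> = exp ((real p + B)\<^sup>2 / (2 * a)) * exp (- (a / 2) * x\<^sup>2)"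
    by (simp add: exp_add[symmetric])
  finally show "(1 + \<bar>x\<bar>) ^ p * exp (B * \<bar>x\<bar>) * exp (- a * x\<^sup>2) \<le> exp ((real p + B)\<^sup>2 / (2 * a)) * exp (- (a / 2) * x\<^sup>2)" .
qed auto

text \<open>The characteristic function of the standard normal law at t = b / sqrt (2a), after
  rescaling the variable by sqrt (2a).\<close>

lemma has_integral_gaussian_complex:
  assumes a: "a > 0"
  shows "((\<lambda>u::real. exp (of_real (- a * u\<^sup>2) + \<i> * of_real (b * u))) has_integral
     of_real (sqrt (pi / a) * exp (- b\<^sup>2 / (4 * a)))) UNIV"
proof -
  have conv: "(g has_integral v) UNIV" if "has_bochner_integral lborel g v" for g :: "real \<Rightarrow> complex" and v
    using that has_integral_integral_lborel[of g] unfolding has_bochner_integral_iff by auto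
  define t where "t = b / sqrt (2 * a)"
  have int: "integrable lborel (\<lambda>x. std_normal_density x *\<^sub>R iexp (t * x))"
  proof (rule Bochner_Integration.integrable_bound[where f = std_normal_density])
    show "integrable lborel std_normal_density" by (rule integrable_normal_density) simp
    show "(\<lambda>x. std_normal_density x *\<^sub>R iexp (t * x)) \<in> borel_measurable lborel" by simp
  qed (simp add: norm_mult)
  have "(\<integral>x. std_normal_density x *\<^sub>R iexp (t * x) \<partial>lborel) = (\<integral>x. iexp (t * x) \<partial>std_normal_distribution)"
    by (subst integral_density) auto
  also have "\<dots> = of_real (exp (- (t\<^sup>2) / 2))"
    using fun_cong[OF char_std_normal_distribution, of t] by (simp add: char_def)
  finally have "has_bochner_integral lborel (\<lambda>x. std_normal_density x *\<^sub>R iexp (t * x)) (of_real (exp (- (t\<^sup>2) / 2)))"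
    using int by (simp add: has_bochner_integral_iff)
  hence "has_bochner_integral lborel (\<lambda>x. std_normal_density (0 + sqrt (2 * a) * x) *\<^sub>R iexp (t * (0 + sqrt (2 * a) * x)))
     (of_real (exp (- (t\<^sup>2) / 2)) /\<^sub>R \<bar>sqrt (2 * a)\<bar>)"
    using a lborel_has_bochner_integral_real_affine_iff[of "sqrt (2 * a)" "\<lambda>x. std_normal_density x *\<^sub>R iexp (t * x)" _ 0] by simp
  hence "((\<lambda>x. std_normal_density (0 + sqrt (2 * a) * x) *\<^sub>R iexp (t * (0 + sqrt (2 * a) * x))) has_integral
     (of_real (exp (- (t\<^sup>2) / 2)) /\<^sub>R \<bar>sqrt (2 * a)\<bar>)) UNIV"
    by (rule conv)
  hence "((\<lambda>x. of_real (sqrt (2 * pi)) * (std_normal_density (0 + sqrt (2 * a) * x) *\<^sub>R iexp (t * (0 + sqrt (2 * a) * x)))) has_integral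
     of_real (sqrt (2 * pi)) * (of_real (exp (- (t\<^sup>2) / 2)) /\<^sub>R \<bar>sqrt (2 * a)\<bar>)) UNIV"
    by (rule has_integral_mult_right)
  moreover have "of_real (sqrt (2 * pi)) * (std_normal_density (0 + sqrt (2 * a) * x) *\<^sub>R iexp (t * (0 + sqrt (2 * a) * x)))
      = exp (of_real (- a * x\<^sup>2) + \<i> * of_real (b * x))" for x
  proof -
    have e1: "std_normal_density (0 + sqrt (2 * a) * x) = exp (- a * x\<^sup>2) / sqrt (2 * pi)"
      using a by (simp add: std_normal_density_def power_mult_distrib)
    have e2: "t * (0 + sqrt (2 * a) * x) = b * x" using a by (simp add: t_def)
    show ?thesis unfolding e1 e2 exp_add exp_of_real by (simp add: scaleR_conv_of_real)
  qed
  moreover have "of_real (sqrt (2 * pi)) * (of_real (exp (- (t\<^sup>2) / 2)) /\<^sub>R \<bar>sqrt (2 * a)\<bar>) = complex_of_real (sqrt (pi / a) * exp (- b\<^sup>2 / (4 * a)))"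
  proof -
    have e1: "- (t\<^sup>2) / 2 = - b\<^sup>2 / (4 * a)" using a by (simp add: t_def power_divide)
    have e2: "sqrt (pi / a) = sqrt (2 * pi) / sqrt (2 * a)" using a by (simp add: real_sqrt_divide real_sqrt_mult)
    have "sqrt (2 * pi) * (exp (- (t\<^sup>2) / 2) / sqrt (2 * a)) = sqrt (pi / a) * exp (- b\<^sup>2 / (4 * a))"
      unfolding e1 e2 by simp
    hence "complex_of_real (sqrt (2 * pi) * (exp (- (t\<^sup>2) / 2) / sqrt (2 * a))) = of_real (sqrt (pi / a) * exp (- b\<^sup>2 / (4 * a)))"
      by (rule arg_cong)
    moreover have "(of_real E /\<^sub>R \<bar>sqrt (2 * a)\<bar> :: complex) = of_real (E / sqrt (2 * a))" for E
      using a by (simp add: scaleR_conv_of_real field_simps)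
    ultimately show ?thesis by (simp only: of_real_mult)
  qed
  ultimately show ?thesis by (simp only:)
qed

lemma has_integral_gaussian_real:
  assumes a: "a > 0"
  shows "((\<lambda>u::real. exp (- a * u\<^sup>2 + b * u + c)) has_integral sqrt (pi / a) * exp (b\<^sup>2 / (4 * a) + c)) UNIV"
proof -
  define \<sigma> where "\<sigma> = 1 / sqrt (2 * a)"
  define m where "m = b / (2 * a)"
  have \<sigma>: "\<sigma> > 0" "2 * \<sigma>\<^sup>2 = 1 / a" using a by (auto simp: \<sigma>_def power_divide)
  have "((\<lambda>x. normal_density m \<sigma> x) has_integral 1) UNIV"
    using has_integral_integral_lborel[OF integrable_normal_density[OF \<sigma>(1), of m]] integral_normal_density[OF \<sigma>(1), of m] by simp
  hence "((\<lambda>x. sqrt (pi / a) * exp (b\<^sup>2 / (4 * a) + c) * normal_density m \<sigma> x) has_integral sqrt (pi / a) * exp (b\<^sup>2 / (4 * a) + c) * 1) UNIV"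
    by (rule has_integral_mult_right)
  moreover have "sqrt (pi / a) * exp (b\<^sup>2 / (4 * a) + c) * normal_density m \<sigma> x = exp (- a * x\<^sup>2 + b * x + c)" for x
  proof -
    have "2 * pi * \<sigma>\<^sup>2 = pi / a" using \<sigma>(2) by (simp add: field_simps)
    hence "normal_density m \<sigma> x = 1 / sqrt (pi / a) * exp (- (x - m)\<^sup>2 / (1 / a))"
      unfolding normal_density_def \<sigma>(2) by simp
    hence "sqrt (pi / a) * exp (b\<^sup>2 / (4 * a) + c) * normal_density m \<sigma> x = exp (b\<^sup>2 / (4 * a) + c) * exp (- (x - m)\<^sup>2 / (1 / a))"
      using a by simp
    also have "\<dots> = exp (b\<^sup>2 / (4 * a) + c + - (x - m)\<^sup>2 / (1 / a))" by (rule exp_add[symmetric])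
    also have "b\<^sup>2 / (4 * a) + c + - (x - m)\<^sup>2 / (1 / a) = - a * x\<^sup>2 + b * x + c"
      using a by (simp add: m_def power2_eq_square field_simps)
    finally show ?thesis .
  qed
  ultimately show ?thesis by simp
qed

text \<open>A single majorant \<open>E\<close> covers the approximation error on the interval and
  the discarded tail of \<open>f\<close> outside, so truncation and approximation are paid for by
  one integral.\<close>

lemma has_integral_compare:
  fixes f g :: "real \<Rightarrow> 'a :: euclidean_space" and E :: "real \<Rightarrow> real"
  assumes f: "(f has_integral I) UNIV" and g: "(g has_integral J) {p..q}" and E: "(E has_integral S) UNIV"
    and near: "\<And>x. x \<in> {p..q} \<Longrightarrow> norm (g x - f x) \<le> E x"
    and far: "\<And>x. x \<notin> {p..q} \<Longrightarrow> norm (f x) \<le> E x"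
  shows "norm (J - I) \<le> S"
proof -
  have "((\<lambda>x. if x \<in> {p..q} then g x else 0) has_integral J) UNIV"
    using g by (subst has_integral_restrict_UNIV)
  hence d: "((\<lambda>x. (if x \<in> {p..q} then g x else 0) - f x) has_integral (J - I)) UNIV"
    using f by (rule has_integral_diff)
  have "norm (integral UNIV (\<lambda>x. (if x \<in> {p..q} then g x else 0) - f x)) \<le> integral UNIV E"
    by (rule integral_norm_bound_integral) (use d E near far in \<open>auto intro: has_integral_integrable\<close>)
  thus ?thesis using integral_unique[OF d] integral_unique[OF E] by simp
qed

text \<open>Mean value theorem cell by cell. Since a cell has length at most 1, moving the Gaussian
  bound from the intermediate point \<xi> to x costs x^2 \<le> 2 \<xi>^2 + 2, that is, half of the
  exponent and a factor exp c. The local errors are thus integrals of one function \<open>E\<close>,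
  and they add up to its integral over the line.\<close>

lemma riemann_sum_gaussian:
  fixes f f' :: "real \<Rightarrow> real"
  assumes der: "\<And>x. (f has_real_derivative f' x) (at x)"
    and bound: "\<And>x. \<bar>f' x\<bar> \<le> C * exp (- c * x\<^sup>2)" and c: "c > 0" and C: "C \<ge> 0"
    and h: "0 < h" "h \<le> 1" and k: "k1 \<le> k2"
  shows "\<bar>(\<Sum>k=k1..<k2. h * f (h * real k - t)) - integral {h * real k1 - t..h * real k2 - t} f\<bar>
     \<le> h * (C * exp c * sqrt (2 * pi / c))"
proof -
  have cf: "continuous_on A f" for A using der DERIV_isCont continuous_at_imp_continuous_on by blast
  define E where "E = (\<lambda>x::real. h * (C * exp c) * exp (- (c/2) * x\<^sup>2))"
  have Ec: "continuous_on A E" for A unfolding E_def by (intro continuous_intros)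
  let ?X = "\<lambda>k::nat. h * real k - t"
  have step: "\<bar>h * f (?X k) - integral {?X k..?X (Suc k)} f\<bar> \<le> integral {?X k..?X (Suc k)} E" for k
  proof -
    have X: "?X (Suc k) = ?X k + h" by (simp add: algebra_simps)
    have "((\<lambda>x. f (?X k)) has_integral (?X (Suc k) - ?X k) *\<^sub>R f (?X k)) {?X k..?X (Suc k)}"
      using has_integral_const_real[of "f (?X k)" "?X k" "?X (Suc k)"] h X by simp
    hence i1: "((\<lambda>x. f (?X k)) has_integral h * f (?X k)) {?X k..?X (Suc k)}" using X by simp
    have i2: "(f has_integral integral {?X k..?X (Suc k)} f) {?X k..?X (Suc k)}"
      by (intro integrable_integral integrable_continuous_real cf)
    from has_integral_diff[OF i1 i2]
    have i3: "((\<lambda>x. f (?X k) - f x) has_integral (h * f (?X k) - integral {?X k..?X (Suc k)} f)) {?X k..?X (Suc k)}" .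
    have "norm (integral {?X k..?X (Suc k)} (\<lambda>x. f (?X k) - f x)) \<le> integral {?X k..?X (Suc k)} E"
    proof (rule integral_norm_bound_integral)
      show "(\<lambda>x. f (?X k) - f x) integrable_on {?X k..?X (Suc k)}" using i3 by blast
      show "E integrable_on {?X k..?X (Suc k)}" by (intro integrable_continuous_real Ec)
      fix x assume x: "x \<in> {?X k..?X (Suc k)}"
      show "norm (f (?X k) - f x) \<le> E x"
      proof (cases "x = ?X k")
        case True
        thus ?thesis using h C by (simp add: E_def)
      next
        case False
        hence lt: "?X k < x" using x by simp
        obtain \<xi> where \<xi>: "?X k < \<xi>" "\<xi> < x" "f x - f (?X k) = (x - ?X k) * f' \<xi>"
          using MVT2[OF lt, of f f'] der by blast
        have "\<bar>x - \<xi>\<bar> \<le> 1" using x \<xi> X h by auto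
        hence "(x - \<xi>)\<^sup>2 \<le> 1" by (simp add: abs_square_le_1)
        moreover have "x\<^sup>2 \<le> 2 * \<xi>\<^sup>2 + 2 * (x - \<xi>)\<^sup>2"
          using zero_le_power2[of "x - 2 * \<xi>"] by (simp add: power2_eq_square algebra_simps)
        ultimately have x2: "x\<^sup>2 / 2 - 1 \<le> \<xi>\<^sup>2" by simp
        have "norm (f (?X k) - f x) = \<bar>x - ?X k\<bar> * \<bar>f' \<xi>\<bar>" using \<xi>(3) by (simp add: abs_minus_commute abs_mult)
        also have "\<dots> \<le> h * (C * exp (- c * \<xi>\<^sup>2))"
          using x X h by (intro mult_mono bound) auto
        also have "\<dots> \<le> h * (C * exp (c + - (c/2) * x\<^sup>2))"
          using mult_left_mono[OF x2, of c] c h C by (intro mult_left_mono) (auto simp: algebra_simps)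
        also have "\<dots> = E x" unfolding exp_add E_def by simp
        finally show ?thesis .
      qed
    qed
    thus ?thesis using integral_unique[OF i3] by simp
  qed
  have "\<bar>(\<Sum>k=k1..<k2. h * f (?X k)) - integral {?X k1..?X k2} f\<bar> \<le> integral {?X k1..?X k2} E"
    using k
  proof (induction k2 rule: dec_induct)
    case (step m)
    have ord: "?X k1 \<le> ?X m" "?X m \<le> ?X (Suc m)" using step h by (auto intro!: mult_left_mono)
    have "integral {?X k1..?X m} f + integral {?X m..?X (Suc m)} f = integral {?X k1..?X (Suc m)} f"
      by (rule Henstock_Kurzweil_Integration.integral_combine[OF ord integrable_continuous_real[OF cf]])
    moreover have "integral {?X k1..?X m} E + integral {?X m..?X (Suc m)} E = integral {?X k1..?X (Suc m)} E"
      by (rule Henstock_Kurzweil_Integration.integral_combine[OF ord integrable_continuous_real[OF Ec]])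
    ultimately show ?case using step.IH step(1) \<open>\<And>k. \<bar>h * f (?X k) - integral {?X k..?X (Suc k)} f\<bar> \<le> _\<close>[of m]
      by simp
  qed auto
  also have "integral {?X k1..?X k2} E \<le> h * (C * exp c * sqrt (2 * pi / c))"
  proof -
    have "((\<lambda>x. h * (C * exp c) * exp (- (c/2) * x\<^sup>2 + 0 * x + 0)) has_integral h * (C * exp c) * (sqrt (pi / (c/2)) * exp (0\<^sup>2 / (4 * (c/2)) + 0))) UNIV"
      using c by (intro has_integral_mult_right has_integral_gaussian_real) auto
    hence i: "(E has_integral h * (C * exp c * sqrt (2 * pi / c))) UNIV" by (simp add: E_def mult_ac)
    have "integral {?X k1..?X k2} E \<le> integral UNIV E"
      using i h C by (intro integral_subset_le integrable_continuous_real Ec) (auto simp: E_def)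
    thus ?thesis using integral_unique[OF i] by simp
  qed
  finally show ?thesis .
qed

section \<open>The saddle point estimate\<close>

text \<open>\<open>q\<close> and \<open>l\<close> come from \<open>z = w exp (- q w) / sqrt e2\<close> and \<open>ln (d z) = l w\<close> under the substitution
  \<open>e z = exp (w\<^sup>2)\<close>.\<close>

locale saddle =
  fixes \<alpha> :: nat and q l :: "complex \<Rightarrow> complex" and e2 r B q1 q2 D1 D2 :: real
  assumes alpha_pos: "\<alpha> > 0" and e2_pos: "e2 > 0" and r_pos: "r > 0" and B_nonneg: "B \<ge> 0"
    and q_approx: "\<And>w. norm w < r \<Longrightarrow> norm (q w - (of_real q1 * w + of_real q2 * w\<^sup>2)) \<le> B * norm w ^ 3"
    and l_approx: "\<And>w. norm w < r \<Longrightarrow> norm (l w - (of_real D1 * w + of_real D2 * w\<^sup>2)) \<le> B * norm w ^ 3"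
    and dq_bound: "\<And>w. norm w < r \<Longrightarrow> norm (w * deriv q w) \<le> B * norm w"
begin

text \<open>For k = s k0 the linear contributions n q1 |w| and k D1 |w| equal sqrt n times
  \<open>c1 / sqrt s\<close> and \<open>c2 * sqrt s\<close>; see \<open>linear_coeff\<close>. They
  move in opposite directions with s, which is why the difference of \<open>c1\<close> and
  \<open>c2\<close> appears beside their sum.\<close>

definition c1 :: real where "c1 = q1 * (pi * sqrt (real \<alpha> / 6))"
definition c2 :: real where "c2 = D1 * (ln 2 * sqrt (6 / real \<alpha>) / pi)"
definition \<beta> :: real where "\<beta> = c1 + c2"
text \<open>exp (- L0) is the base 6 / (\<alpha> pi^2) of the power in the leading constant, and ln
  k0 = ln n - L0 + ln (ln 2).\<close>

definition L0 :: real where "L0 = ln (real \<alpha> * pi\<^sup>2 / 6)"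
text \<open>The maximiser of - \<alpha> k \<open>lam0\<close> + (n/2) ln k.\<close>

definition k0 :: "nat \<Rightarrow> real" where "k0 n = real n / (2 * real \<alpha> * lam0)"
definition rad :: "nat \<Rightarrow> real" where "rad k = sqrt (ln 2 / real k)"
definition wt :: "nat \<Rightarrow> real \<Rightarrow> complex" where "wt k \<theta> = of_real (rad k) * cis \<theta>"

definition integrand :: "nat \<Rightarrow> nat \<Rightarrow> complex \<Rightarrow> complex \<Rightarrow> complex \<Rightarrow> complex" where
  "integrand n k \<omega>0 \<omega> w = exp ((of_nat k + \<omega>0) * l w) * (\<Prod>j=1..k. (exp ((of_nat j + \<omega>) * w\<^sup>2) - 1) ^ \<alpha>)
     * (1 - w * deriv q w) * (exp (q w) / (of_real (1 / sqrt e2) * w)) ^ n"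

text \<open>The size of the integrand at the saddle point of the dominant index \<open>k0 n\<close>, up to bounded
  factors.\<close>

definition scale :: "nat \<Rightarrow> complex \<Rightarrow> complex" where
  "scale n \<omega> = exp (of_real (\<beta> * sqrt (real n)) + of_real (real n / 2 * (ln e2 - 1 - L0))
     + ((of_nat n + of_nat \<alpha>) / 2 + of_nat \<alpha> * \<omega>) * of_real (ln (real n))
     + (of_nat \<alpha> * of_real (ln (2 * pi) / 2) - of_nat \<alpha> * (1/2 + \<omega>) * of_real L0))"

text \<open>The logarithm of the integrand divided by \<^const>\<open>scale\<close>; \<open>\<delta>\<close> stands for the error of the
  product asymptotics.\<close>

definition expo :: "nat \<Rightarrow> nat \<Rightarrow> complex \<Rightarrow> complex \<Rightarrow> real \<Rightarrow> complex \<Rightarrow> complex" where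
  "expo n k \<omega>0 \<omega> \<theta> \<delta> =
     - of_real (real n / 2 * (real k / k0 n - 1 - ln (real k / k0 n)))
     - of_nat \<alpha> * of_nat k * (lam (of_real \<theta>) - of_real lam0) - \<i> * of_nat n * of_real \<theta>
     + of_nat \<alpha> * (1/2 + \<omega>) * (of_real (ln (real k / k0 n)) + ln_expm1_quot (circ (of_real \<theta>)) + of_real (ln (ln 2)))
     + of_nat n * q (wt k \<theta>) + (of_nat k + \<omega>0) * l (wt k \<theta>) - of_real (\<beta> * sqrt (real n)) + of_nat \<alpha> * \<delta>"

lemma k0_pos: "n > 0 \<Longrightarrow> k0 n > 0"
  using alpha_pos lam0_pos by (simp add: k0_def)

lemma L0_eq: "L0 = ln (2 * real \<alpha> * lam0) + ln (ln 2)"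
proof -
  have "real \<alpha> * pi\<^sup>2 / 6 = (2 * real \<alpha> * lam0) * ln 2" by (simp add: lam0_def)
  thus ?thesis unfolding L0_def using alpha_pos lam0_pos by (simp add: ln_mult)
qed

lemma rad_pos: "k > 0 \<Longrightarrow> rad k > 0" by (simp add: rad_def)

lemma norm_wt: "norm (wt k \<theta>) = rad k" by (simp add: wt_def norm_mult rad_def)

lemma wt_square: "k > 0 \<Longrightarrow> (wt k \<theta>)\<^sup>2 = circ (of_real \<theta>) / of_nat k"
proof -
  assume k: "k > 0"
  have "(complex_of_real (rad k))\<^sup>2 = of_real (ln 2 / real k)"
    unfolding of_real_power[symmetric] rad_def using k by (subst real_sqrt_pow2) auto
  moreover have "(cis \<theta>)\<^sup>2 = exp (2 * \<i> * of_real \<theta>)"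
    by (simp add: cis_conv_exp power2_eq_square exp_add[symmetric] mult_ac)
  ultimately show ?thesis by (simp add: wt_def power_mult_distrib circ_def)
qed

text \<open>An identity, not an estimate, once \<delta> is given: all factors are exponentials
  except \<open>gprod\<close> and the Jacobian. With s = k / k0 the terms \<alpha> k
  \<open>lam0\<close> = n s / 2 and ln k = ln s + ln n - L0 + ln (ln 2) split into a part depending
  on \<open>n\<close> and \<omega> only, which is \<open>scale\<close>, and the rest, which is
  \<open>expo\<close>.\<close>

lemma integrand_eq:
  assumes "R \<ge> 0"
  shows "\<exists>C\<ge>0. \<forall>\<omega>0 \<omega> \<theta> n k. norm \<omega> \<le> R \<longrightarrow> real k \<ge> 4 * R + 1 \<longrightarrow> n > 0 \<longrightarrow>
    (\<exists>\<delta>. norm \<delta> \<le> C / real k \<and>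
      integrand n k \<omega>0 \<omega> (wt k \<theta>) =
        scale n \<omega> * (gprod \<omega> k ^ \<alpha> * (1 - wt k \<theta> * deriv q (wt k \<theta>)) * exp (expo n k \<omega>0 \<omega> \<theta> \<delta>)))"
proof -
  obtain C where C: "C \<ge> 0" and P: "\<And>\<omega> \<theta> k. norm \<omega> \<le> R \<Longrightarrow> real k \<ge> 4 * R + 1 \<Longrightarrow>
    \<exists>\<delta>. norm \<delta> \<le> C / real k \<and>
      (\<Prod>j=1..k. exp ((of_nat j + \<omega>) * (circ (of_real \<theta>) / of_nat k)) - 1) =
        gprod \<omega> k * exp ((1/2 + \<omega>) * (of_real (ln (real k)) + ln_expm1_quot (circ (of_real \<theta>)))
            + of_real (ln (2 * pi) / 2) - of_nat k * lam (of_real \<theta>) + \<delta>)"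
    using prod_expm1_asymp[OF assms] by blast
  show ?thesis
  proof (rule exI[of _ C], intro conjI C allI impI)
    fix \<omega>0 \<omega> :: complex and \<theta> :: real and n k :: nat
    assume w: "norm \<omega> \<le> R" and k: "real k \<ge> 4 * R + 1" and n: "n > 0"
    have kp: "k > 0" using k assms by (cases k) auto
    obtain \<delta> where d: "norm \<delta> \<le> C / real k" and eq: "(\<Prod>j=1..k. exp ((of_nat j + \<omega>) * (circ (of_real \<theta>) / of_nat k)) - 1) =
        gprod \<omega> k * exp ((1/2 + \<omega>) * (of_real (ln (real k)) + ln_expm1_quot (circ (of_real \<theta>)))
            + of_real (ln (2 * pi) / 2) - of_nat k * lam (of_real \<theta>) + \<delta>)"
      using P[OF w k] by blast
    define W where "W = wt k \<theta>"
    define \<phi> where "\<phi> = ln_expm1_quot (circ (of_real \<theta>))"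
    have prod: "(\<Prod>j=1..k. (exp ((of_nat j + \<omega>) * W\<^sup>2) - 1) ^ \<alpha>) = gprod \<omega> k ^ \<alpha> * 
       exp (of_nat \<alpha> * ((1/2 + \<omega>) * (of_real (ln (real k)) + \<phi>) + of_real (ln (2 * pi) / 2) - of_nat k * lam (of_real \<theta>) + \<delta>))"
      unfolding W_def wt_square[OF kp] prod_power_distrib[symmetric] eq \<phi>_def by (simp only: power_mult_distrib exp_of_nat_mult)
    have W: "of_real (1 / sqrt e2) * W = exp (- of_real (ln e2 / 2) + of_real ((ln (ln 2) - ln (real k)) / 2) + \<i> * of_real \<theta>)"
    proof -
      have s1: "1 / sqrt e2 = exp (- (ln e2 / 2))"
      proof -
        have "exp (ln (sqrt e2)) = sqrt e2" using e2_pos by simp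
        hence "exp (ln e2 / 2) = sqrt e2" using e2_pos by (simp add: ln_sqrt)
        thus ?thesis by (simp add: exp_minus inverse_eq_divide)
      qed
      have s2: "rad k = exp ((ln (ln 2) - ln (real k)) / 2)"
      proof -
        have p: "ln 2 / real k > 0" using kp by simp
        have "exp (ln (sqrt (ln 2 / real k))) = sqrt (ln 2 / real k)" using p by simp
        moreover have "ln (sqrt (ln 2 / real k)) = (ln (ln 2) - ln (real k)) / 2"
          using p kp by (simp add: ln_sqrt ln_div)
        ultimately show ?thesis by (simp add: rad_def)
      qed
      show ?thesis unfolding W_def wt_def s1 s2 cis_conv_exp exp_of_real[symmetric] exp_add[symmetric] mult.assoc[symmetric] of_real_minus
        by (simp only: add.assoc)
    qed
    have pw: "(exp (q W) / (of_real (1 / sqrt e2) * W)) ^ n = exp (of_nat n * (q W - (- of_real (ln e2 / 2) + of_real ((ln (ln 2) - ln (real k)) / 2) + \<i> * of_real \<theta>)))"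
      unfolding W exp_diff[symmetric] exp_of_nat_mult ..
    define s where "s = real k / k0 n"
    have sp: "s > 0" using kp k0_pos[OF n] by (simp add: s_def)
    have ks: "real k = s * real n / (2 * real \<alpha> * lam0)" 
    proof -
      have "real k = s * k0 n" using k0_pos[OF n] by (simp add: s_def)
      thus ?thesis by (simp add: k0_def)
    qed
    have lnk: "ln (real k) = ln s + ln (real n) - L0 + ln (ln 2)"
      unfolding ks L0_eq using sp n alpha_pos lam0_pos by (simp add: ln_mult ln_div)
    have akl: "real \<alpha> * real k * lam0 = real n / 2 * s"
      unfolding ks using alpha_pos lam0_pos by simp
    have aklc: "of_nat \<alpha> * of_nat k * complex_of_real lam0 = of_real (real n / 2 * s)"
      unfolding akl[symmetric] by simp
    have exps: "(of_nat k + \<omega>0) * l W + of_nat \<alpha> * ((1/2 + \<omega>) * (of_real (ln (real k)) + \<phi>) + of_real (ln (2 * pi) / 2) - of_nat k * lam (of_real \<theta>) + \<delta>)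
       + of_nat n * (q W - (- of_real (ln e2 / 2) + of_real ((ln (ln 2) - ln (real k)) / 2) + \<i> * of_real \<theta>))
      = (of_real (\<beta> * sqrt (real n)) + of_real (real n / 2 * (ln e2 - 1 - L0))
     + ((of_nat n + of_nat \<alpha>) / 2 + of_nat \<alpha> * \<omega>) * of_real (ln (real n))
     + (of_nat \<alpha> * of_real (ln (2 * pi) / 2) - of_nat \<alpha> * (1/2 + \<omega>) * of_real L0)) + expo n k \<omega>0 \<omega> \<theta> \<delta>" (is "?A + ?B + ?C = ?S + ?E")
    proof -
      \<comment> \<open>All transcendental constants become atoms, so that what remains is a
        polynomial identity.\<close>
      define a where "a = (of_nat \<alpha> :: complex)"
      define N where "N = (of_nat n :: complex)"
      define K where "K = (of_nat k :: complex)"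
      define x where "x = complex_of_real (ln s)"
      define y where "y = complex_of_real (ln (real n))"
      define z where "z = complex_of_real L0"
      define t where "t = complex_of_real (ln (ln 2))"
      define e where "e = complex_of_real (ln e2)"
      define b where "b = complex_of_real (\<beta> * sqrt (real n))"
      define p where "p = complex_of_real (ln (2 * pi) / 2)"
      define \<theta>' where "\<theta>' = complex_of_real \<theta>"
      have alk: "a * K * (lam \<theta>' - of_real lam0) = a * K * lam \<theta>' - N / 2 * of_real s"
        using aklc by (simp add: a_def K_def N_def right_diff_distrib)
      have lk: "complex_of_real (ln (real k)) = x + y - z + t" by (simp add: lnk x_def y_def z_def t_def)
      have c1: "complex_of_real ((ln (ln 2) - ln (real k)) / 2) = (z - x - y) / 2" by (simp add: lnk x_def y_def z_def)
      have c2: "complex_of_real (ln e2 / 2) = e / 2" by (simp add: e_def)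
      have c3: "complex_of_real (real n / 2 * (ln e2 - 1 - L0)) = N / 2 * (e - 1 - z)" by (simp add: e_def z_def N_def)
      have c4: "complex_of_real (real n / 2 * (s - 1 - ln s)) = N / 2 * (of_real s - 1 - x)" by (simp add: x_def N_def)
      show ?thesis
        unfolding expo_def s_def[symmetric]
        unfolding c1 c2 c3 c4 lk alk[unfolded a_def K_def \<theta>'_def] W_def[symmetric] \<phi>_def[symmetric]
        unfolding a_def[symmetric] N_def[symmetric] K_def[symmetric] x_def[symmetric] y_def[symmetric] z_def[symmetric]
           t_def[symmetric] b_def[symmetric] p_def[symmetric] \<theta>'_def[symmetric]
        by (simp add: field_simps)
    qed
    have h: "exp ?A * exp ?B * exp ?C = exp ?S * exp ?E"
      unfolding exp_add[of "?A + ?B" ?C, symmetric] exp_add[of ?A ?B, symmetric] exp_add[of ?S ?E, symmetric] exps ..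
    have rearrange: "a * (g * b) * D * c = s * (g * D * e)" if "a * b * c = s * e" for a b c g D s e :: complex
    proof -
      have "a * (g * b) * D * c = (a * b * c) * (g * D)" by (simp add: mult_ac)
      thus ?thesis unfolding that by (simp add: mult_ac)
    qed
    have "integrand n k \<omega>0 \<omega> W = scale n \<omega> * (gprod \<omega> k ^ \<alpha> * (1 - W * deriv q W) * exp (expo n k \<omega>0 \<omega> \<theta> \<delta>))"
      unfolding integrand_def prod pw scale_def by (rule rearrange[OF h])
    thus "\<exists>\<delta>. norm \<delta> \<le> C / real k \<and> integrand n k \<omega>0 \<omega> (wt k \<theta>) =
        scale n \<omega> * (gprod \<omega> k ^ \<alpha> * (1 - wt k \<theta> * deriv q (wt k \<theta>)) * exp (expo n k \<omega>0 \<omega> \<theta> \<delta>))"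
      using d unfolding W_def by blast
  qed
qed

end

section \<open>Elementary real estimates around s = 1\<close>

lemma ln_quadratic_bound:
  "\<exists>C\<ge>0. \<forall>s::real. \<bar>s - 1\<bar> \<le> 1/2 \<longrightarrow> \<bar>ln s - (s - 1) + (s - 1)\<^sup>2 / 2\<bar> \<le> C * \<bar>s - 1\<bar> ^ 3"
proof -
  have hol: "(\<lambda>z. Ln (1 + z)) holomorphic_on ball 0 1"
  proof (rule holomorphic_on_Ln')
    fix z :: complex assume "z \<in> ball 0 1"
    hence "Re (1 + z) > 0" using abs_Re_le_cmod[of z] by auto
    thus "1 + z \<notin> \<real>\<^sub>\<le>\<^sub>0" by (rule Re_pos_not_nonpos_Reals)
  qed (intro holomorphic_intros)
  have n: "fps_nth (fps_ln 1 :: complex fps) 0 = 0" "fps_nth (fps_ln 1 :: complex fps) 1 = 1" "fps_nth (fps_ln 1 :: complex fps) 2 = - 1 / 2"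
    by (simp_all add: fps_ln_def)
  obtain C where C: "C \<ge> 0" "\<And>w. norm w \<le> 1 / 2 \<Longrightarrow> norm (Ln (1 + w) - (fps_nth (fps_ln 1) 1 * w + fps_nth (fps_ln 1) 2 * w\<^sup>2)) \<le> C * norm w ^ 3"
    using fps_expansion_quadratic_bound[OF has_fps_expansion_Ln_1_plus hol _ n(1)] by auto
  show ?thesis
  proof (intro exI[of _ C] conjI allI impI C(1))
    fix s :: real assume s: "\<bar>s - 1\<bar> \<le> 1/2"
    have "norm (Ln (1 + of_real (s - 1)) - (fps_nth (fps_ln 1) 1 * of_real (s - 1) + fps_nth (fps_ln 1) 2 * (of_real (s - 1))\<^sup>2)) \<le> C * norm (complex_of_real (s - 1)) ^ 3"
      by (rule C(2)) (use s in \<open>simp only: norm_of_real\<close>)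
    moreover have "Ln (1 + of_real (s - 1)) - (fps_nth (fps_ln 1) 1 * of_real (s - 1) + fps_nth (fps_ln 1) 2 * (of_real (s - 1))\<^sup>2)
       = complex_of_real (ln s - (s - 1) + (s - 1)\<^sup>2 / 2)"
    proof -
      have "1 + complex_of_real (s - 1) = of_real s" by simp
      hence "Ln (1 + of_real (s - 1)) = of_real (ln s)" using s by (simp only: Ln_of_real)
      thus ?thesis unfolding n by simp
    qed
    ultimately show "\<bar>ln s - (s - 1) + (s - 1)\<^sup>2 / 2\<bar> \<le> C * \<bar>s - 1\<bar> ^ 3"
      by (simp only: norm_of_real)
  qed
qed

text \<open>With x = sqrt s the remainders are exact: x - 1 - (x^2 - 1)/2 = - (x - 1)^2/2 and 1/x -
  1 + (x^2 - 1)/2 = (x - 1)^2 (x + 2)/(2x). Moreover |x - 1| \<le> |s - 1|.\<close>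

lemma sqrt_expansions:
  fixes s :: real
  assumes "\<bar>s - 1\<bar> \<le> 1/2"
  shows "\<bar>sqrt s - 1 - (s - 1) / 2\<bar> \<le> (s - 1)\<^sup>2" "\<bar>1 / sqrt s - 1 + (s - 1) / 2\<bar> \<le> 4 * (s - 1)\<^sup>2"
    "\<bar>ln s\<bar> \<le> 2 * \<bar>s - 1\<bar>" "\<bar>1 / s - 1\<bar> \<le> 2 * \<bar>s - 1\<bar>"
proof -
  define x where "x = sqrt s"
  have s: "1/2 \<le> s" "s \<le> 3/2" using assms by (auto simp: abs_if split: if_splits)
  have x: "x\<^sup>2 = s" "x > 0" using s by (auto simp: x_def)
  have x1: "1/2 \<le> x" unfolding x_def by (rule real_le_rsqrt) (use s in \<open>simp add: power2_eq_square\<close>)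
  have x2: "x \<le> 3/2" unfolding x_def by (rule real_le_lsqrt) (use s in \<open>auto simp: power2_eq_square\<close>)
  have e0: "s - 1 = (x - 1) * (x + 1)" using x(1) by (simp add: power2_eq_square algebra_simps)
  have sq: "(x - 1)\<^sup>2 \<le> (s - 1)\<^sup>2"
  proof -
    have "(x - 1)\<^sup>2 * 1 \<le> (x - 1)\<^sup>2 * (x + 1)\<^sup>2" using x by (intro mult_left_mono) (auto simp: one_le_power)
    thus ?thesis unfolding e0 by (simp add: power_mult_distrib)
  qed
  have "x - 1 - (s - 1) / 2 = - ((x - 1)\<^sup>2) / 2" unfolding x(1)[symmetric] by (simp add: power2_eq_square field_simps)
  hence "\<bar>x - 1 - (s - 1) / 2\<bar> = (x - 1)\<^sup>2 / 2" by simp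
  also have "\<dots> \<le> (s - 1)\<^sup>2" using sq zero_le_power2[of "x - 1"] by linarith
  finally show "\<bar>sqrt s - 1 - (s - 1) / 2\<bar> \<le> (s - 1)\<^sup>2" by (simp add: x_def)
  have "1 / x - 1 + (s - 1) / 2 = (x - 1)\<^sup>2 * ((x + 2) / (2 * x))"
    unfolding x(1)[symmetric] using x(2) by (simp add: power2_eq_square field_simps)
  hence "\<bar>1 / x - 1 + (s - 1) / 2\<bar> = (x - 1)\<^sup>2 * ((x + 2) / (2 * x))" using x by (simp add: abs_mult)
  also have "\<dots> \<le> (s - 1)\<^sup>2 * 4"
  proof (intro mult_mono sq)
    show "(x + 2) / (2 * x) \<le> 4" using x1 x(2) by (simp add: field_simps)
  qed (use x in auto)
  finally show "\<bar>1 / sqrt s - 1 + (s - 1) / 2\<bar> \<le> 4 * (s - 1)\<^sup>2" by (simp add: x_def)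
  have r: "1 / s - 1 = (1 - s) * (1 / s)" using s by (simp add: field_simps)
  have "\<bar>1 / s - 1\<bar> \<le> \<bar>s - 1\<bar> * 2"
    unfolding r abs_mult using s by (intro mult_mono) (auto simp: field_simps abs_minus_commute)
  thus r': "\<bar>1 / s - 1\<bar> \<le> 2 * \<bar>s - 1\<bar>" by simp
  have "ln s \<le> s - 1" using s by (intro ln_le_minus_one) auto
  moreover have "ln (1 / s) \<le> 1 / s - 1" using s by (intro ln_le_minus_one) auto
  hence "- ln s \<le> 1 / s - 1" using s by (simp add: ln_div)
  moreover have "1 / s - 1 \<le> 2 * \<bar>s - 1\<bar>" by (rule order_trans[OF abs_ge_self r'])
  moreover have "s - 1 \<le> 2 * \<bar>s - 1\<bar>" by (cases "s \<ge> 1") auto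
  ultimately have "ln s \<le> 2 * \<bar>s - 1\<bar>" "- ln s \<le> 2 * \<bar>s - 1\<bar>" by (blast intro: order_trans)+
  thus "\<bar>ln s\<bar> \<le> 2 * \<bar>s - 1\<bar>" by (simp only: abs_le_iff)
qed

lemma norm_cis_minus_1: "norm (cis \<theta> - 1) \<le> \<bar>\<theta>\<bar>"
  using dist_exp_i_1[of \<theta>] abs_sin_x_le_abs_x[of "\<theta> / 2"] by (simp add: cis_conv_exp)

lemma norm_cis_minus_linear: "norm (cis \<theta> - 1 - \<i> * of_real \<theta>) \<le> \<theta>\<^sup>2"
proof -
  have "norm (exp (\<i> * of_real \<theta>) - (\<Sum>k\<le>1. (\<i> * of_real \<theta>) ^ k / fact k)) \<le> exp \<bar>Re (\<i> * of_real \<theta>)\<bar> * norm (\<i> * complex_of_real \<theta>) ^ Suc 1 / fact 1"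
    by (rule Taylor_exp)
  thus ?thesis by (simp add: cis_conv_exp norm_mult power2_eq_square algebra_simps)
qed

text \<open>The excess over the parabola has derivative (x - 1)(1/x - 1/3), which has the sign of x
  - 1 for x < 3. Beyond distance 1/2 the function is monotone away from 1, so its values at 1/2 and
  3/2 decide, and 1/24 = (1/2)^2/6. This term confines the sum to indices near
  \<open>k0\<close>.\<close>

lemma entropy_ge:
  fixes s :: real
  assumes "s > 0"
  shows "\<bar>s - 1\<bar> \<le> 1/2 \<Longrightarrow> s - 1 - ln s \<ge> (s - 1)\<^sup>2 / 6" "\<bar>s - 1\<bar> \<ge> 1/2 \<Longrightarrow> s - 1 - ln s \<ge> 1/24"
proof -
  define f where "f = (\<lambda>s::real. s - 1 - ln s - (s - 1)\<^sup>2 / 6)"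
  have d: "(f has_real_derivative ((x - 1) * (1 / x - 1 / 3))) (at x)" if "x > 0" for x
    unfolding f_def using that by (auto intro!: derivative_eq_intros simp: field_simps power2_eq_square)
  have f1: "f 1 = 0" by (simp add: f_def)
  have near: "f s \<ge> 0" if "1/2 \<le> s" "s \<le> 3/2" for s
  proof (cases "s \<ge> 1")
    case True
    have "f 1 \<le> f s"
    proof (rule DERIV_nonneg_imp_nondecreasing[where f = f, OF True])
      fix x assume "1 \<le> x" "x \<le> s"
      hence "(x - 1) * (1 / x - 1 / 3) \<ge> 0" using that by (intro mult_nonneg_nonneg) (auto simp: field_simps)
      thus "\<exists>y. (f has_real_derivative y) (at x) \<and> 0 \<le> y"
        using d[of x] \<open>1 \<le> x\<close> by (intro exI conjI) auto
    qed
    thus ?thesis by (simp add: f1)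
  next
    case False
    hence "s \<le> 1" by simp
    hence "f 1 \<le> f s"
    proof (rule DERIV_nonpos_imp_nonincreasing[where f = f])
      fix x assume x: "s \<le> x" "x \<le> 1"
      have "(x - 1) * (1 / x - 1 / 3) \<le> 0" using x that by (intro mult_nonpos_nonneg) (auto simp: field_simps)
      thus "\<exists>y. (f has_real_derivative y) (at x) \<and> y \<le> 0"
        using d[of x] x that by (intro exI conjI) auto
    qed
    thus ?thesis by (simp add: f1)
  qed
  show "s - 1 - ln s \<ge> (s - 1)\<^sup>2 / 6" if "\<bar>s - 1\<bar> \<le> 1/2"
    using near[of s] that by (simp add: f_def abs_if split: if_splits)
  show "s - 1 - ln s \<ge> 1/24" if far: "\<bar>s - 1\<bar> \<ge> 1/2"
  proof -
    define g where "g = (\<lambda>s::real. s - 1 - ln s)"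
    have dg: "(g has_real_derivative (1 - 1 / x)) (at x)" if "x > 0" for x
      unfolding g_def using that by (auto intro!: derivative_eq_intros simp: field_simps)
    have g: "g (3/2) \<ge> 1/24" "g (1/2) \<ge> 1/24" using near[of "3/2"] near[of "1/2"] by (auto simp: f_def g_def power2_eq_square)
    show ?thesis
    proof (cases "s \<ge> 3/2")
      case True
      have "g (3/2) \<le> g s"
      proof (rule DERIV_nonneg_imp_nondecreasing[where f = g, OF True])
        fix x assume "3/2 \<le> x" "x \<le> s"
        thus "\<exists>y. (g has_real_derivative y) (at x) \<and> 0 \<le> y" using dg[of x] by (intro exI conjI) auto
      qed
      thus ?thesis using g by (simp add: g_def)
    next
      case False
      hence le: "s \<le> 1/2" using far by (auto simp: abs_if split: if_splits)
      have "g (1/2) \<le> g s"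
      proof (rule DERIV_nonpos_imp_nonincreasing[where f = g, OF le])
        fix x assume "s \<le> x" "x \<le> 1/2"
        thus "\<exists>y. (g has_real_derivative y) (at x) \<and> y \<le> 0" using dg[of x] assms by (intro exI conjI) (auto simp: field_simps)
      qed
      thus ?thesis using g by (simp add: g_def)
    qed
  qed
qed

section \<open>Local expansion and global upper bound of the exponent\<close>

context saddle
begin

text \<open>n \<mu> \<theta>^2 is the quadratic Taylor term of \<alpha> k0 (lam \<theta> -
  lam0).\<close>

definition \<mu> :: real where "\<mu> = 2 * ln 2 / lam0 - 1"
text \<open>The value of (n q2 + k D2) w^2 at k = k0 and angle 0, where n / k0 = 2 \<alpha>
  \<open>lam0\<close> and k0 w^2 = ln 2.\<close>

definition \<kappa> :: real where "\<kappa> = (2 * real \<alpha> * lam0 * q2 + D2) * ln 2"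
text \<open>The deviation of \<open>k\<close> from \<open>k0\<close> in units of sqrt n, scaled so
  that the entropy term (n/2)(s - 1 - ln s) becomes X^2 to leading order.\<close>

definition Xv :: "nat \<Rightarrow> nat \<Rightarrow> real" where "Xv n k = sqrt (real n) * (real k / k0 n - 1) / 2"
text \<open>The limiting exponent in the rescaled index X and angle u = sqrt n \<theta>. The term
  (c2 - c1) X is the variation of the linear contribution with \<open>k\<close>; in the cross term,
  2 X u measures how far the circle is from being centred for this \<open>k\<close>, and \<beta> u
  is the first order rotation of exp (\<beta> sqrt n cis \<theta>).\<close>

definition quad :: "real \<Rightarrow> real \<Rightarrow> complex" where
  "quad X u = of_real (- X\<^sup>2 + (c2 - c1) * X - \<mu> * u\<^sup>2) + \<i> * of_real ((2 * X + \<beta>) * u)"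

lemma rad_square: "k > 0 \<Longrightarrow> (rad k)\<^sup>2 = ln 2 / real k"
  unfolding rad_def by (rule real_sqrt_pow2) auto

lemma linear_coeff:
  assumes n: "n > 0" and k: "k > 0"
  defines "s \<equiv> real k / k0 n"
  shows "(real n * q1 + real k * D1) * rad k = sqrt (real n) * (c1 / sqrt s + c2 * sqrt s)"
proof -
  have s: "s > 0" using k k0_pos[OF n] by (simp add: s_def)
  have kn: "k0 n > 0" using k0_pos[OF n] .
  have ks: "real k = s * k0 n" using kn by (simp add: s_def)
  have al: "real \<alpha> > 0" using alpha_pos by simp
  have a1: "ln 2 / k0 n = real \<alpha> * pi\<^sup>2 / 6 / real n"
    using n alpha_pos by (simp add: k0_def lam0_def field_simps)
  have r: "rad k = pi * sqrt (real \<alpha> / 6) / sqrt (real n) / sqrt s"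
  proof -
    have "ln 2 / real k = (ln 2 / k0 n) / s" by (simp add: ks)
    also have "\<dots> = pi\<^sup>2 * (real \<alpha> / 6) / real n / s" unfolding a1 by simp
    finally show ?thesis unfolding rad_def by (simp add: real_sqrt_divide real_sqrt_mult)
  qed
  have t1: "real n * q1 * rad k = sqrt (real n) * (c1 / sqrt s)"
  proof -
    have "real n = sqrt (real n) * sqrt (real n)" by simp
    hence "real n / sqrt (real n) = sqrt (real n)" by (simp add: real_div_sqrt)
    hence "real n * (1 / sqrt (real n)) = sqrt (real n)" by simp
    moreover have "real n * q1 * rad k = (real n * (1 / sqrt (real n))) * (c1 / sqrt s)" by (simp add: r c1_def)
    ultimately show ?thesis by simp
  qed
  have t2: "real k * D1 * rad k = sqrt (real n) * (c2 * sqrt s)"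
  proof -
    have "k0 n * (pi * sqrt (real \<alpha> / 6) / sqrt (real n)) = sqrt (real n) * (ln 2 * sqrt (6 / real \<alpha>) / pi)"
    proof -
      define a where "a = sqrt (real \<alpha> / 6)"
      have a: "a > 0" "a\<^sup>2 = real \<alpha> / 6" using al by (auto simp: a_def)
      have a': "sqrt (6 / real \<alpha>) = 1 / a" by (simp add: a_def real_sqrt_divide)
      define N where "N = sqrt (real n)"
      have N: "N\<^sup>2 = real n" "N > 0" using n by (auto simp: N_def)
      have k0: "k0 n = N\<^sup>2 * ln 2 / (pi\<^sup>2 * a\<^sup>2)"
        unfolding a(2) N(1) using n al by (simp add: k0_def lam0_def field_simps)
      have "N\<^sup>2 * t / (P\<^sup>2 * a\<^sup>2) * (P * a / N) = N * (t * (1 / a) / P)" if "P > 0" for t P :: real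
        using a(1) N(2) that by (simp add: field_simps power2_eq_square)
      from this[OF pi_gt_zero] show ?thesis unfolding a_def[symmetric] N_def[symmetric] a' k0 .
    qed
    moreover have "s / sqrt s = sqrt s" using s by (simp add: real_div_sqrt)
    moreover have "real k * D1 * rad k = D1 * (k0 n * (pi * sqrt (real \<alpha> / 6) / sqrt (real n))) * (s / sqrt s)"
      unfolding r by (simp add: ks)
    ultimately show ?thesis by (simp add: c2_def)
  qed
  show ?thesis using t1 t2 by (simp add: distrib_left distrib_right)
qed

lemma l_bound:
  assumes "norm w < r" "norm w \<le> 1"
  shows "norm (l w) \<le> (\<bar>D1\<bar> + \<bar>D2\<bar> + B) * norm w"
proof -
  have "norm (l w) \<le> norm (l w - (of_real D1 * w + of_real D2 * w\<^sup>2)) + (norm (of_real D1 * w) + norm (of_real D2 * w\<^sup>2))"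
    using norm_triangle_ineq[of "l w - (of_real D1 * w + of_real D2 * w\<^sup>2)" "of_real D1 * w + of_real D2 * w\<^sup>2"]
      norm_triangle_ineq[of "of_real D1 * w" "of_real D2 * w\<^sup>2"] by simp
  also have "\<dots> \<le> B * norm w + (\<bar>D1\<bar> * norm w + \<bar>D2\<bar> * norm w)"
  proof (intro add_mono)
    have "norm w ^ 3 \<le> norm w ^ 1" by (rule power_decreasing) (use assms in auto)
    hence "B * norm w ^ 3 \<le> B * norm w" using B_nonneg by (intro mult_left_mono) auto
    thus "norm (l w - (of_real D1 * w + of_real D2 * w\<^sup>2)) \<le> B * norm w" using l_approx[OF assms(1)] by linarith
    have "norm w ^ 2 \<le> norm w ^ 1" by (rule power_decreasing) (use assms in auto)
    thus "norm (of_real D2 * w\<^sup>2) \<le> \<bar>D2\<bar> * norm w" by (auto simp: norm_mult norm_power intro!: mult_left_mono)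
  qed (simp add: norm_mult)
  finally show ?thesis by (simp add: algebra_simps)
qed

text \<open>Valid for all angles and all k, not only near the saddle. The entropy, the angular gain,
  the linear term and the normalisation \<beta> sqrt n are kept explicit; the remaining ones are of
  smaller order and go into \<open>C\<close>. Both later decay estimates start from here.\<close>

lemma Re_expo_le:
  assumes "R \<ge> 0"
  shows "\<exists>C\<ge>0. \<forall>n k \<omega>0 \<omega> \<theta> \<delta>. n > 0 \<longrightarrow> k > 0 \<longrightarrow> rad k < r \<longrightarrow> rad k \<le> 1 \<longrightarrow> norm \<omega>0 \<le> R \<longrightarrow> norm \<omega> \<le> R \<longrightarrow>
    Re (expo n k \<omega>0 \<omega> \<theta> \<delta>) \<le> - (real n / 2 * (real k / k0 n - 1 - ln (real k / k0 n)))
      - real \<alpha> * real k * (ln 2 / 2 * (sin \<theta>)\<^sup>2) + C * (1 + \<bar>ln (real k / k0 n)\<bar>)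
      + (real n * q1 + real k * D1) * rad k * cos \<theta> + C * (real n + real k) * (rad k)\<^sup>2
      - \<beta> * sqrt (real n) + real \<alpha> * norm \<delta>"
proof -
  obtain Bp where Bp: "Bp \<ge> 0" "\<And>\<theta>. norm (ln_expm1_quot (circ (of_real \<theta>))) \<le> Bp"
    using ln_expm1_quot_circ by blast
  define Ca where "Ca = real \<alpha> * (1/2 + R) * (1 + Bp + \<bar>ln (ln 2)\<bar>)"
  define Cb where "Cb = R * (\<bar>D1\<bar> + \<bar>D2\<bar> + B)"
  define Cc where "Cc = \<bar>q2\<bar> + \<bar>D2\<bar> + B"
  have pos: "Ca \<ge> 0" "Cb \<ge> 0" "Cc \<ge> 0" using assms Bp B_nonneg by (auto simp: Ca_def Cb_def Cc_def)
  show ?thesis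
  proof (rule exI[of _ "Ca + Cb + Cc"], intro conjI allI impI)
    fix n k :: nat and \<omega>0 \<omega> :: complex and \<theta> :: real and \<delta> :: complex
    assume n: "n > 0" and k: "k > 0" and rk: "rad k < r" "rad k \<le> 1" and w: "norm \<omega>0 \<le> R" "norm \<omega> \<le> R"
    define s where "s = real k / k0 n"
    define W where "W = wt k \<theta>"
    define \<rho> where "\<rho> = rad k"
    have nW: "norm W = \<rho>" by (simp add: W_def \<rho>_def norm_wt)
    have \<rho>0: "\<rho> \<ge> 0" using nW norm_ge_zero by metis
    have p3: "\<rho> ^ 3 \<le> \<rho>\<^sup>2" by (rule power_decreasing) (use rk \<rho>0 in \<open>auto simp: \<rho>_def\<close>)
    define eq where "eq = q W - (of_real q1 * W + of_real q2 * W\<^sup>2)"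
    define el where "el = l W - (of_real D1 * W + of_real D2 * W\<^sup>2)"
    have neq: "norm eq \<le> B * \<rho>\<^sup>2"
      using q_approx[of W] rk mult_left_mono[OF p3 B_nonneg] unfolding eq_def nW by (simp add: \<rho>_def)
    have nel: "norm el \<le> B * \<rho>\<^sup>2"
      using l_approx[of W] rk mult_left_mono[OF p3 B_nonneg] unfolding el_def nW by (simp add: \<rho>_def)
    have R1: "Re (of_real (real n * q1 + real k * D1) * W) = (real n * q1 + real k * D1) * \<rho> * cos \<theta>"
      by (simp add: W_def wt_def \<rho>_def)
    have R2: "Re (of_real (real n * q2 + real k * D2) * W\<^sup>2) \<le> (\<bar>q2\<bar> + \<bar>D2\<bar>) * (real n + real k) * \<rho>\<^sup>2"
    proof -
      have "Re (of_real (real n * q2 + real k * D2) * W\<^sup>2) \<le> norm (of_real (real n * q2 + real k * D2) * W\<^sup>2)" by (rule complex_Re_le_cmod)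
      also have "\<dots> = \<bar>real n * q2 + real k * D2\<bar> * \<rho>\<^sup>2" by (simp only: norm_mult norm_of_real norm_power nW)
      also have "\<dots> \<le> ((\<bar>q2\<bar> + \<bar>D2\<bar>) * (real n + real k)) * \<rho>\<^sup>2"
      proof (rule mult_right_mono)
        have "\<bar>real n * q2 + real k * D2\<bar> \<le> real n * \<bar>q2\<bar> + real k * \<bar>D2\<bar>"
          by (rule order_trans[OF abs_triangle_ineq]) (simp add: abs_mult)
        also have "\<dots> \<le> (\<bar>q2\<bar> + \<bar>D2\<bar>) * (real n + real k)" by (simp add: algebra_simps)
        finally show "\<bar>real n * q2 + real k * D2\<bar> \<le> (\<bar>q2\<bar> + \<bar>D2\<bar>) * (real n + real k)" .
      qed auto
      finally show ?thesis .
    qed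
    have R3: "Re (of_nat n * eq + of_nat k * el) \<le> B * (real n + real k) * \<rho>\<^sup>2"
    proof -
      have "Re (of_nat n * eq + of_nat k * el) \<le> norm (of_nat n * eq) + norm (of_nat k * el)"
        using complex_Re_le_cmod norm_triangle_ineq order_trans by blast
      also have "\<dots> \<le> real n * (B * \<rho>\<^sup>2) + real k * (B * \<rho>\<^sup>2)"
        unfolding norm_mult norm_of_nat using neq nel by (intro add_mono mult_left_mono) auto
      finally show ?thesis by (simp add: algebra_simps)
    qed
    have R4: "Re (\<omega>0 * l W) \<le> Cb"
    proof -
      have "norm (l W) \<le> (\<bar>D1\<bar> + \<bar>D2\<bar> + B) * 1"
      proof (rule order_trans)
        show "norm (l W) \<le> (\<bar>D1\<bar> + \<bar>D2\<bar> + B) * norm W" using rk nW by (intro l_bound) (auto simp: \<rho>_def)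
        show "(\<bar>D1\<bar> + \<bar>D2\<bar> + B) * norm W \<le> (\<bar>D1\<bar> + \<bar>D2\<bar> + B) * 1"
          using rk nW B_nonneg by (intro mult_left_mono) (auto simp: \<rho>_def)
      qed
      hence "norm \<omega>0 * norm (l W) \<le> R * ((\<bar>D1\<bar> + \<bar>D2\<bar> + B) * 1)" using w assms by (intro mult_mono) auto
      thus ?thesis using complex_Re_le_cmod[of "\<omega>0 * l W"] by (simp add: norm_mult Cb_def)
    qed
    define \<phi> where "\<phi> = ln_expm1_quot (circ (of_real \<theta>))"
    have R5: "Re (of_nat \<alpha> * (1/2 + \<omega>) * (of_real (ln s) + \<phi> + of_real (ln (ln 2)))) \<le> Ca * (1 + \<bar>ln s\<bar>)"
    proof -
      have "norm (of_real (ln s) + \<phi> + of_real (ln (ln 2))) \<le> \<bar>ln s\<bar> + Bp + \<bar>ln (ln 2)\<bar>"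
        using norm_triangle_ineq[of "of_real (ln s) + \<phi>" "of_real (ln (ln 2))"] norm_triangle_ineq[of "of_real (ln s)" \<phi>] Bp(2)[of \<theta>]
        by (simp add: \<phi>_def)
      also have "\<dots> \<le> (1 + Bp + \<bar>ln (ln 2)\<bar>) * (1 + \<bar>ln s\<bar>)" using Bp by (simp add: algebra_simps)
      finally have a: "norm (of_real (ln s) + \<phi> + of_real (ln (ln 2))) \<le> (1 + Bp + \<bar>ln (ln 2)\<bar>) * (1 + \<bar>ln s\<bar>)" .
      have b: "norm (1/2 + \<omega>) \<le> 1/2 + R" using norm_triangle_ineq[of "1/2" \<omega>] w by simp
      have "norm (of_nat \<alpha> * (1/2 + \<omega>) * (of_real (ln s) + \<phi> + of_real (ln (ln 2)))) \<le> real \<alpha> * (1/2 + R) * ((1 + Bp + \<bar>ln (ln 2)\<bar>) * (1 + \<bar>ln s\<bar>))"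
        unfolding norm_mult norm_of_nat using a b assms by (intro mult_mono) auto
      thus ?thesis using complex_Re_le_cmod[of "of_nat \<alpha> * (1/2 + \<omega>) * (of_real (ln s) + \<phi> + of_real (ln (ln 2)))"]
        by (simp add: Ca_def mult_ac)
    qed
    have R6: "real \<alpha> * real k * (ln 2 / 2 * (sin \<theta>)\<^sup>2) \<le> real \<alpha> * real k * (Re (lam (of_real \<theta>)) - lam0)"
      using Re_lam_ge[of \<theta>] by (intro mult_left_mono) auto
    have R7: "Re (of_nat \<alpha> * \<delta>) \<le> real \<alpha> * norm \<delta>"
      using complex_Re_le_cmod[of "of_nat \<alpha> * \<delta>"] by (simp add: norm_mult)
    have dec: "of_nat n * q W + (of_nat k + \<omega>0) * l W = of_real (real n * q1 + real k * D1) * W + of_real (real n * q2 + real k * D2) * W\<^sup>2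
        + (of_nat n * eq + of_nat k * el) + \<omega>0 * l W"
      by (simp add: eq_def el_def algebra_simps)
    have "Re (of_nat n * q W + (of_nat k + \<omega>0) * l W) \<le> (real n * q1 + real k * D1) * \<rho> * cos \<theta> + Cc * (real n + real k) * \<rho>\<^sup>2 + Cb"
    proof -
      have "(\<bar>q2\<bar> + \<bar>D2\<bar>) * (real n + real k) * \<rho>\<^sup>2 + B * (real n + real k) * \<rho>\<^sup>2 = Cc * (real n + real k) * \<rho>\<^sup>2"
        by (simp add: Cc_def algebra_simps)
      thus ?thesis unfolding dec plus_complex.sel(1) R1 using R2 R3[unfolded plus_complex.sel(1)] R4 by linarith
    qed
    moreover have "Re (expo n k \<omega>0 \<omega> \<theta> \<delta>) = - (real n / 2 * (s - 1 - ln s)) - real \<alpha> * real k * (Re (lam (of_real \<theta>)) - lam0)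
       + Re (of_nat \<alpha> * (1/2 + \<omega>) * (of_real (ln s) + \<phi> + of_real (ln (ln 2))))
       + Re (of_nat n * q W + (of_nat k + \<omega>0) * l W) - \<beta> * sqrt (real n) + Re (of_nat \<alpha> * \<delta>)"
    proof -
      have "Re (of_nat \<alpha> * of_nat k * (lam (of_real \<theta>) - of_real lam0)) = real \<alpha> * real k * (Re (lam (of_real \<theta>)) - lam0)"
        by simp
      moreover have "Re (\<i> * of_nat n * of_real \<theta>) = 0" by simp
      ultimately show ?thesis
        unfolding expo_def s_def[symmetric] W_def[symmetric] \<phi>_def[symmetric] plus_complex.sel(1) minus_complex.sel(1) uminus_complex.sel(1) Re_complex_of_real
        by linarith
    qed
    ultimately have "Re (expo n k \<omega>0 \<omega> \<theta> \<delta>) \<le> - (real n / 2 * (s - 1 - ln s)) - real \<alpha> * real k * (ln 2 / 2 * (sin \<theta>)\<^sup>2)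
       + Ca * (1 + \<bar>ln s\<bar>) + (real n * q1 + real k * D1) * \<rho> * cos \<theta> + Cc * (real n + real k) * \<rho>\<^sup>2 + Cb - \<beta> * sqrt (real n) + real \<alpha> * norm \<delta>"
      using R5 R6 R7 by linarith
    moreover have "Ca * (1 + \<bar>ln s\<bar>) + Cb \<le> (Ca + Cb + Cc) * (1 + \<bar>ln s\<bar>)"
    proof -
      have "0 \<le> Cb * \<bar>ln s\<bar>" "0 \<le> Cc * (1 + \<bar>ln s\<bar>)" using pos by auto
      thus ?thesis by (simp add: algebra_simps)
    qed
    moreover have "Cc * (real n + real k) * \<rho>\<^sup>2 \<le> (Ca + Cb + Cc) * (real n + real k) * \<rho>\<^sup>2"
      using pos by (intro mult_right_mono) auto
    ultimately show "Re (expo n k \<omega>0 \<omega> \<theta> \<delta>) \<le> - (real n / 2 * (real k / k0 n - 1 - ln (real k / k0 n)))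
      - real \<alpha> * real k * (ln 2 / 2 * (sin \<theta>)\<^sup>2) + (Ca + Cb + Cc) * (1 + \<bar>ln (real k / k0 n)\<bar>)
      + (real n * q1 + real k * D1) * rad k * cos \<theta> + (Ca + Cb + Cc) * (real n + real k) * (rad k)\<^sup>2
      - \<beta> * sqrt (real n) + real \<alpha> * norm \<delta>"
      unfolding s_def[symmetric] \<rho>_def[symmetric] by linarith
  qed (use pos in auto)
qed

text \<open>The difference from the quadratic form splits into seven errors, one per source: the
  cubic term of the entropy (\<open>K1\<close>), of \<open>lam\<close> (\<open>K2\<close>), the
  variation of the power 1/2 + \<omega> (\<open>K3\<close>), the remainders of \<open>q\<close> and
  \<open>l\<close> together with \<omega>0 (\<open>K4\<close>), the linear terms
  (\<open>K5\<close>), the quadratic terms (\<open>K6\<close>), and the product asymptotics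
  (\<open>K7\<close>).\<close>

lemma expo_near:
  assumes R: "R \<ge> 0" and D: "D \<ge> 0"
  shows "\<exists>C\<ge>0. \<forall>n k \<omega>0 \<omega> \<theta> \<delta>. n > 0 \<longrightarrow> \<bar>real k / k0 n - 1\<bar> \<le> 1/2 \<longrightarrow> rad k < r \<longrightarrow> rad k \<le> 1 \<longrightarrow>
    \<bar>\<theta>\<bar> \<le> pi / 2 \<longrightarrow> norm \<omega>0 \<le> R \<longrightarrow> norm \<omega> \<le> R \<longrightarrow> norm \<delta> \<le> D / real k \<longrightarrow>
    norm (expo n k \<omega>0 \<omega> \<theta> \<delta> - (of_real \<kappa> + quad (Xv n k) (sqrt (real n) * \<theta>)))
      \<le> C * ((1 + \<bar>Xv n k\<bar>) ^ 3 * (1 + \<bar>sqrt (real n) * \<theta>\<bar>) ^ 3 / sqrt (real n))"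
proof -
  obtain Cl where Cl: "Cl \<ge> 0" "\<And>s::real. \<bar>s - 1\<bar> \<le> 1/2 \<Longrightarrow> \<bar>ln s - (s - 1) + (s - 1)\<^sup>2 / 2\<bar> \<le> Cl * \<bar>s - 1\<bar> ^ 3"
    using ln_quadratic_bound by blast
  obtain Bl where Bl: "Bl \<ge> 0" "\<And>\<theta>. \<bar>\<theta>\<bar> \<le> pi / 2 \<Longrightarrow>
     norm (lam (of_real \<theta>) - (of_real lam0 - 2 * \<i> * of_real lam0 * of_real \<theta> + of_real ((4 * ln 2 - 2 * lam0) * \<theta>\<^sup>2))) \<le> Bl * \<bar>\<theta>\<bar> ^ 3"
    using lam_taylor by blast
  obtain Bp where Bp: "Bp \<ge> 0" "\<And>\<theta>. norm (ln_expm1_quot (circ (of_real \<theta>)) + of_real (ln (ln 2))) \<le> Bp * \<bar>\<theta>\<bar>"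
    using ln_expm1_quot_circ by blast
  define Cr where "Cr = sqrt (4 * real \<alpha> * lam0 * ln 2)"
  define ck where "ck = 3 / (4 * real \<alpha> * lam0)"
  define Cd where "Cd = \<bar>D1\<bar> + \<bar>D2\<bar> + B"
  define Cb where "Cb = 4 * \<bar>c1\<bar> + \<bar>c2\<bar> + \<bar>c2 - c1\<bar>"
  define Cq where "Cq = \<bar>2 * real \<alpha> * lam0 * q2 * ln 2\<bar>"
  define K1 where "K1 = Cl / 2"
  define K2 where "K2 = \<bar>\<mu>\<bar> + 3 / (4 * lam0) * Bl"
  define K3 where "K3 = real \<alpha> * (1/2 + R) * (2 + Bp)"
  define K4 where "K4 = (1 + ck) * B * Cr ^ 3 + R * (Cd * Cr)"
  define K5 where "K5 = (\<bar>\<beta>\<bar> + Cb) + Cb + Cb"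
  define K6 where "K6 = (\<bar>\<kappa>\<bar> + Cq * 2) * 2 + Cq * 2"
  define K7 where "K7 = real \<alpha> * (D * (4 * real \<alpha> * lam0))"
  have al: "real \<alpha> > 0" using alpha_pos by simp
  note l0 = lam0_pos
  have pos: "Cr \<ge> 0" "ck \<ge> 0" "Cd \<ge> 0" "Cb \<ge> 0" "Cq \<ge> 0"
    using al l0 B_nonneg by (auto simp: Cr_def ck_def Cd_def Cb_def Cq_def)
  have Kpos: "K1 \<ge> 0" "K2 \<ge> 0" "K3 \<ge> 0" "K4 \<ge> 0" "K5 \<ge> 0" "K6 \<ge> 0" "K7 \<ge> 0"
    using Cl Bl Bp R D al l0 B_nonneg pos
    by (auto simp: K1_def K2_def K3_def K4_def K5_def K6_def K7_def intro!: add_nonneg_nonneg mult_nonneg_nonneg)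
  show ?thesis
  proof (rule exI[of _ "(K1 + K2 + K3 + K4 + K5 + K6 + K7) * 8"], intro conjI allI impI)
    fix n k :: nat and \<omega>0 \<omega> :: complex and \<theta> :: real and \<delta> :: complex
    assume n: "n > 0" and near: "\<bar>real k / k0 n - 1\<bar> \<le> 1/2" and rk: "rad k < r" "rad k \<le> 1" and th: "\<bar>\<theta>\<bar> \<le> pi / 2"
      and w: "norm \<omega>0 \<le> R" "norm \<omega> \<le> R" and dl: "norm \<delta> \<le> D / real k"
    define s where "s = real k / k0 n"
    define \<sigma> where "\<sigma> = s - 1"
    define N where "N = sqrt (real n)"
    define X where "X = Xv n k"
    define u where "u = N * \<theta>"
    define P where "P = (1 + \<bar>X\<bar>) ^ 3 * (1 + \<bar>u\<bar>) ^ 3"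
    define M where "M = 8 * P / N"
    have N: "N \<ge> 1" "N\<^sup>2 = real n" using n by (auto simp: N_def)
    have N0: "N > 0" using N by simp
    have kp: "k0 n > 0" by (rule k0_pos[OF n])
    have sg: "\<bar>\<sigma>\<bar> \<le> 1/2" using near by (simp add: \<sigma>_def s_def)
    have s: "1/2 \<le> s" "s \<le> 3/2" using sg by (auto simp: \<sigma>_def abs_if split: if_splits)
    have ks: "real k = s * k0 n" using kp by (simp add: s_def)
    have k: "k > 0" using ks s kp by (cases k) auto
    have XN: "X = N * \<sigma> / 2" by (simp add: X_def Xv_def N_def \<sigma>_def s_def)
    \<comment> \<open>Every error is a constant times a monomial in N |\<sigma>| and N |\<theta>|,
      with exponents at most 3, divided by N; a single majorant \<open>M\<close> thus serves for
      all. The 8 is 2^3, from N |\<sigma>| = 2 |X|.\<close>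
    have mono: "(N * \<bar>\<sigma>\<bar>) ^ i * (N * \<bar>\<theta>\<bar>) ^ j \<le> 8 * P" if "i \<le> 3" "j \<le> 3" for i j
    proof -
      have "(N * \<bar>\<sigma>\<bar>) ^ i \<le> (2 * (1 + \<bar>X\<bar>)) ^ i"
        using N0 by (intro power_mono) (auto simp: XN abs_mult)
      also have "\<dots> \<le> (2 * (1 + \<bar>X\<bar>)) ^ 3" using that by (intro power_increasing) auto
      also have "\<dots> = 8 * (1 + \<bar>X\<bar>) ^ 3" unfolding power_mult_distrib by simp
      finally have 1: "(N * \<bar>\<sigma>\<bar>) ^ i \<le> 8 * (1 + \<bar>X\<bar>) ^ 3" .
      have "(N * \<bar>\<theta>\<bar>) ^ j \<le> (1 + \<bar>u\<bar>) ^ j" using N0 by (intro power_mono) (auto simp: u_def abs_mult)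
      also have "\<dots> \<le> (1 + \<bar>u\<bar>) ^ 3" using that by (intro power_increasing) auto
      finally have 2: "(N * \<bar>\<theta>\<bar>) ^ j \<le> (1 + \<bar>u\<bar>) ^ 3" .
      have "(N * \<bar>\<sigma>\<bar>) ^ i * (N * \<bar>\<theta>\<bar>) ^ j \<le> (8 * (1 + \<bar>X\<bar>) ^ 3) * (1 + \<bar>u\<bar>) ^ 3"
        using 1 2 N0 by (intro mult_mono) auto
      thus ?thesis by (simp add: P_def)
    qed
    have mM: "(N * \<bar>\<sigma>\<bar>) ^ i * (N * \<bar>\<theta>\<bar>) ^ j / N \<le> M" if "i \<le> 3" "j \<le> 3" for i j
      unfolding M_def using mono[OF that] N0 by (intro divide_right_mono) auto
    have g3: "(N * a) ^ 3 / N = real n * a ^ 3" for a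
      using N0 by (simp add: N(2)[symmetric] power_mult_distrib power3_eq_cube power2_eq_square)
    have g12: "(N * a) * (N * c)\<^sup>2 / N = real n * (a * c\<^sup>2)" for a c
      using N0 by (simp add: N(2)[symmetric] power_mult_distrib power2_eq_square)
    have m30: "real n * \<bar>\<sigma>\<bar> ^ 3 \<le> M" using mM[of 3 0] unfolding power_0 mult_1_right g3 by simp
    have m03: "real n * \<bar>\<theta>\<bar> ^ 3 \<le> M" using mM[of 0 3] unfolding power_0 mult_1_left g3 by simp
    have m12: "real n * (\<bar>\<sigma>\<bar> * \<theta>\<^sup>2) \<le> M" using mM[of 1 2] unfolding power_one_right g12 by simp
    have g2: "(N * a)\<^sup>2 / N = N * a\<^sup>2" for a
      using N0 by (simp add: power_mult_distrib power2_eq_square)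
    have m20: "N * \<sigma>\<^sup>2 \<le> M" using mM[of 2 0] unfolding power_0 mult_1_right g2 by simp
    have m02: "N * \<theta>\<^sup>2 \<le> M" using mM[of 0 2] unfolding power_0 mult_1_left g2 by simp
    have m11: "N * (\<bar>\<sigma>\<bar> * \<bar>\<theta>\<bar>) \<le> M" using mM[of 1 1] N0 by (simp add: mult_ac)
    have m10: "\<bar>\<sigma>\<bar> \<le> M" using mM[of 1 0] N0 by simp
    have m01: "\<bar>\<theta>\<bar> \<le> M" using mM[of 0 1] N0 by simp
    have m00: "1 / N \<le> M" using mM[of 0 0] by simp
    have M0: "M \<ge> 0" using m10 by linarith
    define e1 where "e1 = real n / 2 * (s - 1 - ln s) - X\<^sup>2"
    have n1: "\<bar>e1\<bar> \<le> K1 * M"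
    proof -
      have X2: "X\<^sup>2 = real n / 2 * (\<sigma>\<^sup>2 / 2)" by (simp add: XN N(2)[symmetric] power_mult_distrib power_divide)
      have "e1 = - (real n / 2) * (ln s - (s - 1) + (s - 1)\<^sup>2 / 2)"
      proof -
        have "A * (d - L) - A * (D / 2) = - A * (L - d + D / 2)" for A L d D :: real
          by (simp add: algebra_simps)
        thus ?thesis unfolding e1_def X2 \<sigma>_def .
      qed
      hence "\<bar>e1\<bar> = real n / 2 * \<bar>ln s - (s - 1) + (s - 1)\<^sup>2 / 2\<bar>" by (simp add: abs_mult)
      also have "\<dots> \<le> real n / 2 * (Cl * \<bar>\<sigma>\<bar> ^ 3)"
        using Cl(2)[of s] sg by (intro mult_left_mono) (auto simp: \<sigma>_def)
      also have "\<dots> = K1 * (real n * \<bar>\<sigma>\<bar> ^ 3)" by (simp add: K1_def)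
      also have "\<dots> \<le> K1 * M" using m30 Kpos by (intro mult_left_mono) auto
      finally show ?thesis .
    qed
    have alk: "real \<alpha> * real k = real n * s / (2 * lam0)"
      unfolding ks using al l0 by (simp add: k0_def)
    define \<epsilon> where "\<epsilon> = lam (of_real \<theta>) - (of_real lam0 - 2 * \<i> * of_real lam0 * of_real \<theta> + of_real ((4 * ln 2 - 2 * lam0) * \<theta>\<^sup>2))"
    \<comment> \<open>The linear term of \<open>lam\<close> gives - i n s \<theta>, of which the
      part s = 1 cancels against i n \<theta>; what survives is - i n \<sigma> \<theta> = - 2 i X
      u.\<close>
    define e2 where "e2 = of_nat \<alpha> * of_nat k * (lam (of_real \<theta>) - of_real lam0) + \<i> * of_nat n * of_real \<theta> - (of_real (\<mu> * u\<^sup>2) - \<i> * of_real (2 * X * u))"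
    have n2: "norm e2 \<le> K2 * M"
    proof -
      have a1: "of_nat \<alpha> * of_nat k = complex_of_real (real n * s / (2 * lam0))" unfolding alk[symmetric] by simp
      have a2: "2 * X * u = real n * \<sigma> * \<theta>" by (simp add: XN u_def N(2)[symmetric] power2_eq_square)
      have a3: "\<mu> * u\<^sup>2 = \<mu> * (real n * \<theta>\<^sup>2)" by (simp add: u_def N(2)[symmetric] power_mult_distrib)
      have a4: "real n * s / (2 * lam0) * ((4 * ln 2 - 2 * lam0) * \<theta>\<^sup>2) = \<mu> * (real n * \<theta>\<^sup>2) + real n * \<mu> * \<sigma> * \<theta>\<^sup>2"
        using l0 by (simp add: \<mu>_def \<sigma>_def field_simps)
      have a5: "real n * s / (2 * lam0) * (2 * lam0 * \<theta>) = real n * \<theta> + real n * \<sigma> * \<theta>"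
        using l0 by (simp add: \<sigma>_def field_simps)
      have "lam (of_real \<theta>) - of_real lam0 = \<epsilon> - \<i> * of_real (2 * lam0 * \<theta>) + of_real ((4 * ln 2 - 2 * lam0) * \<theta>\<^sup>2)"
        by (simp add: \<epsilon>_def)
      hence "of_nat \<alpha> * of_nat k * (lam (of_real \<theta>) - of_real lam0) = of_nat \<alpha> * of_nat k * \<epsilon>
         - \<i> * of_real (real n * s / (2 * lam0) * (2 * lam0 * \<theta>)) + of_real (real n * s / (2 * lam0) * ((4 * ln 2 - 2 * lam0) * \<theta>\<^sup>2))"
        unfolding a1 of_real_mult by (simp only: distrib_left right_diff_distrib mult_ac)
      hence "e2 = of_nat \<alpha> * of_nat k * \<epsilon> + of_real (real n * \<mu> * \<sigma> * \<theta>\<^sup>2)"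
        unfolding e2_def a4 a5 a2 a3 by (simp add: algebra_simps)
      also have "norm \<dots> \<le> real \<alpha> * real k * norm \<epsilon> + \<bar>real n * \<mu> * \<sigma> * \<theta>\<^sup>2\<bar>"
        by (rule order_trans[OF norm_triangle_ineq]) (simp only: norm_mult norm_of_nat norm_of_real order_refl)
      also have "\<dots> \<le> (3 / (4 * lam0) * Bl) * M + \<bar>\<mu>\<bar> * M"
      proof (rule add_mono)
        have "real \<alpha> * real k * norm \<epsilon> \<le> (real n * (3/2) / (2 * lam0)) * (Bl * \<bar>\<theta>\<bar> ^ 3)"
          unfolding alk using s l0 Bl(2)[OF th] by (intro mult_mono divide_right_mono mult_left_mono) (auto simp: \<epsilon>_def)
        also have "\<dots> = (3 / (4 * lam0) * Bl) * (real n * \<bar>\<theta>\<bar> ^ 3)" by simp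
        also have "\<dots> \<le> (3 / (4 * lam0) * Bl) * M" using m03 l0 Bl(1) by (intro mult_left_mono) auto
        finally show "real \<alpha> * real k * norm \<epsilon> \<le> (3 / (4 * lam0) * Bl) * M" .
        have "\<bar>real n * \<mu> * \<sigma> * \<theta>\<^sup>2\<bar> = \<bar>\<mu>\<bar> * (real n * (\<bar>\<sigma>\<bar> * \<theta>\<^sup>2))" by (simp add: abs_mult)
        also have "\<dots> \<le> \<bar>\<mu>\<bar> * M" using m12 by (intro mult_left_mono) auto
        finally show "\<bar>real n * \<mu> * \<sigma> * \<theta>\<^sup>2\<bar> \<le> \<bar>\<mu>\<bar> * M" .
      qed
      finally show ?thesis by (simp add: K2_def algebra_simps)
    qed
    define e3 where "e3 = of_nat \<alpha> * (1/2 + \<omega>) * (of_real (ln s) + ln_expm1_quot (circ (of_real \<theta>)) + of_real (ln (ln 2)))"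
    have n3: "norm e3 \<le> K3 * M"
    proof -
      have "norm (of_real (ln s) + ln_expm1_quot (circ (of_real \<theta>)) + of_real (ln (ln 2))) \<le> \<bar>ln s\<bar> + norm (ln_expm1_quot (circ (of_real \<theta>)) + of_real (ln (ln 2)))"
        using norm_triangle_ineq[of "of_real (ln s)" "ln_expm1_quot (circ (of_real \<theta>)) + of_real (ln (ln 2))"] by (simp add: add.assoc)
      also have "\<dots> \<le> 2 * M + Bp * M"
      proof (rule add_mono)
        have "\<bar>ln s\<bar> \<le> 2 * \<bar>\<sigma>\<bar>" using sqrt_expansions(3)[of s] sg by (simp add: \<sigma>_def)
        also have "\<dots> \<le> 2 * M" using m10 by simp
        finally show "\<bar>ln s\<bar> \<le> 2 * M" .
        show "norm (ln_expm1_quot (circ (of_real \<theta>)) + of_real (ln (ln 2))) \<le> Bp * M"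
          by (rule order_trans[OF Bp(2) mult_left_mono[OF m01 Bp(1)]])
      qed
      finally have a: "norm (of_real (ln s) + ln_expm1_quot (circ (of_real \<theta>)) + of_real (ln (ln 2))) \<le> (2 + Bp) * M" by (simp add: algebra_simps)
      have b: "norm (1/2 + \<omega>) \<le> 1/2 + R" using norm_triangle_ineq[of "1/2" \<omega>] w by simp
      have "norm e3 \<le> real \<alpha> * (1/2 + R) * ((2 + Bp) * M)"
        unfolding e3_def norm_mult norm_of_nat using a b R by (intro mult_mono) auto
      thus ?thesis by (simp add: K3_def mult_ac)
    qed
    define W where "W = wt k \<theta>"
    define \<rho> where "\<rho> = rad k"
    have nW: "norm W = \<rho>" by (simp add: W_def \<rho>_def norm_wt)
    have \<rho>0: "\<rho> > 0" using rad_pos[OF k] by (simp add: \<rho>_def)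
    have \<rho>2: "\<rho>\<^sup>2 = ln 2 / real k" using rad_square[OF k] by (simp add: \<rho>_def)
    have \<rho>N: "\<rho> \<le> Cr / N"
    proof -
      have "\<rho>\<^sup>2 \<le> (Cr / N)\<^sup>2"
      proof -
        have "(Cr / N)\<^sup>2 = 4 * real \<alpha> * lam0 * ln 2 / real n" using al l0 by (simp add: Cr_def power_divide N(2))
        moreover have "ln 2 / real k \<le> ln 2 / (1/2 * k0 n)"
          unfolding ks using s kp by (intro divide_left_mono mult_right_mono mult_pos_pos) auto
        moreover have "ln 2 / (1/2 * k0 n) = 4 * real \<alpha> * lam0 * ln 2 / real n" using al l0 n by (simp add: k0_def)
        ultimately show ?thesis using \<rho>2 by simp
      qed
      moreover have "0 \<le> Cr / N" using N0 pos by simp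
      ultimately show ?thesis by (rule power2_le_imp_le)
    qed
    have kn: "real k \<le> ck * real n"
    proof -
      have "real k \<le> 3/2 * k0 n" unfolding ks using s kp by (intro mult_right_mono) auto
      thus ?thesis using al l0 by (simp add: ck_def k0_def)
    qed
    define eq where "eq = q W - (of_real q1 * W + of_real q2 * W\<^sup>2)"
    define el where "el = l W - (of_real D1 * W + of_real D2 * W\<^sup>2)"
    define e4 where "e4 = of_nat n * eq + of_nat k * el + \<omega>0 * l W"
    have n4: "norm e4 \<le> K4 * M"
    proof -
      have "norm e4 \<le> norm (of_nat n * eq) + norm (of_nat k * el) + norm (\<omega>0 * l W)"
        unfolding e4_def by (rule order_trans[OF norm_triangle_ineq add_right_mono[OF norm_triangle_ineq]])
      also have "\<dots> \<le> real n * (B * \<rho> ^ 3) + (ck * real n) * (B * \<rho> ^ 3) + R * (Cd * \<rho>)"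
        unfolding norm_mult norm_of_nat
      proof (intro add_mono mult_mono kn w)
        show "norm eq \<le> B * \<rho> ^ 3" "norm el \<le> B * \<rho> ^ 3"
          using q_approx[of W] l_approx[of W] rk unfolding eq_def el_def nW by (auto simp: \<rho>_def)
        show "norm (l W) \<le> Cd * \<rho>" using l_bound[of W] rk unfolding nW Cd_def by (simp add: \<rho>_def)
      qed (use pos R in auto)
      also have "\<dots> = (1 + ck) * B * (real n * \<rho> ^ 3) + R * (Cd * \<rho>)" by (simp add: algebra_simps)
      also have "\<dots> \<le> (1 + ck) * B * (Cr ^ 3 * (1 / N)) + R * (Cd * (Cr * (1 / N)))"
      proof (intro add_mono mult_left_mono)
        have "\<rho> ^ 3 \<le> (Cr / N) ^ 3" using \<rho>N \<rho>0 by (intro power_mono) auto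
        hence "real n * \<rho> ^ 3 \<le> N\<^sup>2 * (Cr / N) ^ 3" unfolding N(2) by (intro mult_left_mono) auto
        also have "\<dots> = Cr ^ 3 * (1 / N)" using N0 by (simp add: power_divide power3_eq_cube power2_eq_square)
        finally show "real n * \<rho> ^ 3 \<le> Cr ^ 3 * (1 / N)" .
      qed (use \<rho>N pos R B_nonneg in auto)
      also have "\<dots> = K4 * (1 / N)" by (simp add: K4_def algebra_simps add_divide_distrib)
      also have "\<dots> \<le> K4 * M" using m00 Kpos by (intro mult_left_mono) auto
      finally show ?thesis .
    qed
    define b where "b = c1 / sqrt s + c2 * sqrt s"
    have lin: "(real n * q1 + real k * D1) * \<rho> = N * b"
      using linear_coeff[OF n k] by (simp add: b_def s_def N_def \<rho>_def)
    have b1: "\<bar>b - \<beta> - (c2 - c1) * \<sigma> / 2\<bar> \<le> (4 * \<bar>c1\<bar> + \<bar>c2\<bar>) * \<sigma>\<^sup>2"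
    proof -
      have "b - \<beta> - (c2 - c1) * \<sigma> / 2 = c1 * (1 / sqrt s - 1 + (s - 1) / 2) + c2 * (sqrt s - 1 - (s - 1) / 2)"
        by (simp add: b_def \<beta>_def \<sigma>_def field_simps)
      also have "\<bar>\<dots>\<bar> \<le> \<bar>c1\<bar> * (4 * \<sigma>\<^sup>2) + \<bar>c2\<bar> * \<sigma>\<^sup>2"
        using sqrt_expansions(1,2)[of s] sg
        by (intro order_trans[OF abs_triangle_ineq] add_mono) (auto simp: abs_mult \<sigma>_def intro!: mult_left_mono)
      finally show ?thesis by (simp add: algebra_simps)
    qed
    have sq: "\<sigma>\<^sup>2 \<le> \<bar>\<sigma>\<bar>" using sg mult_left_mono[of "\<bar>\<sigma>\<bar>" 1 "\<bar>\<sigma>\<bar>"] by (simp add: power2_eq_square)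
    have b2: "\<bar>b - \<beta>\<bar> \<le> Cb * \<bar>\<sigma>\<bar>"
    proof -
      have "\<bar>b - \<beta>\<bar> \<le> \<bar>b - \<beta> - (c2 - c1) * \<sigma> / 2\<bar> + \<bar>(c2 - c1) * \<sigma> / 2\<bar>" by linarith
      also have "\<dots> \<le> (4 * \<bar>c1\<bar> + \<bar>c2\<bar>) * \<bar>\<sigma>\<bar> + \<bar>c2 - c1\<bar> * \<bar>\<sigma>\<bar>"
      proof (rule add_mono)
        show "\<bar>b - \<beta> - (c2 - c1) * \<sigma> / 2\<bar> \<le> (4 * \<bar>c1\<bar> + \<bar>c2\<bar>) * \<bar>\<sigma>\<bar>"
          by (rule order_trans[OF b1 mult_left_mono[OF sq]]) simp
      qed (simp add: abs_mult)
      finally show ?thesis by (simp add: Cb_def algebra_simps)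
    qed
    have b3: "\<bar>b\<bar> \<le> \<bar>\<beta>\<bar> + Cb"
    proof -
      have "Cb * \<bar>\<sigma>\<bar> \<le> Cb * 1" using sg pos by (intro mult_left_mono) auto
      thus ?thesis using b2 by linarith
    qed
    \<comment> \<open>N b cis \<theta> with b = \<beta> + (c2 - c1) \<sigma>/2 + O(\<sigma>^2). Its
      constant part cancels with the normalisation, and the first order parts in \<sigma> and in
      \<theta> are the two linear terms of \<open>quad\<close>.\<close>
    define e5 where "e5 = of_real (real n * q1 + real k * D1) * W - of_real (\<beta> * N) - of_real ((c2 - c1) * X) - \<i> * of_real (\<beta> * u)"
    have n5: "norm e5 \<le> K5 * M"
    proof -
      have "of_real (real n * q1 + real k * D1) * W = of_real (N * b) * cis \<theta>"
        unfolding W_def wt_def \<rho>_def[symmetric] mult.assoc[symmetric] of_real_mult[symmetric] lin ..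
      hence "e5 = of_real (N * b) * (cis \<theta> - 1 - \<i> * of_real \<theta>) + of_real (N * (b - \<beta> - (c2 - c1) * \<sigma> / 2)) + \<i> * of_real (N * (b - \<beta>) * \<theta>)"
        unfolding e5_def by (simp add: XN u_def algebra_simps)
      also have "norm \<dots> \<le> norm (of_real (N * b) * (cis \<theta> - 1 - \<i> * of_real \<theta>)) + norm (complex_of_real (N * (b - \<beta> - (c2 - c1) * \<sigma> / 2))) + norm (\<i> * complex_of_real (N * (b - \<beta>) * \<theta>))"
        by (rule order_trans[OF norm_triangle_ineq add_right_mono[OF norm_triangle_ineq]])
      also have "\<dots> \<le> (\<bar>\<beta>\<bar> + Cb) * M + Cb * M + Cb * M"
      proof (intro add_mono)
        have "norm (of_real (N * b) * (cis \<theta> - 1 - \<i> * of_real \<theta>)) = N * \<bar>b\<bar> * norm (cis \<theta> - 1 - \<i> * of_real \<theta>)"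
          using N0 by (simp only: norm_mult norm_of_real abs_mult, simp?)
        also have "\<dots> \<le> N * (\<bar>\<beta>\<bar> + Cb) * \<theta>\<^sup>2"
          using b3 N0 pos by (intro mult_mono norm_cis_minus_linear) auto
        also have "\<dots> = (\<bar>\<beta>\<bar> + Cb) * (N * \<theta>\<^sup>2)" by simp
        also have "\<dots> \<le> (\<bar>\<beta>\<bar> + Cb) * M" using m02 pos by (intro mult_left_mono) auto
        finally show "norm (of_real (N * b) * (cis \<theta> - 1 - \<i> * of_real \<theta>)) \<le> (\<bar>\<beta>\<bar> + Cb) * M" .
        have "norm (complex_of_real (N * (b - \<beta> - (c2 - c1) * \<sigma> / 2))) = N * \<bar>b - \<beta> - (c2 - c1) * \<sigma> / 2\<bar>"
          using N0 by (simp only: norm_of_real abs_mult, simp?)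
        also have "\<dots> \<le> N * ((4 * \<bar>c1\<bar> + \<bar>c2\<bar>) * \<sigma>\<^sup>2)" using b1 N0 by (intro mult_left_mono) auto
        also have "\<dots> = (4 * \<bar>c1\<bar> + \<bar>c2\<bar>) * (N * \<sigma>\<^sup>2)" by simp
        also have "\<dots> \<le> Cb * M" using m20 pos N0 by (intro mult_mono) (auto simp: Cb_def)
        finally show "norm (complex_of_real (N * (b - \<beta> - (c2 - c1) * \<sigma> / 2))) \<le> Cb * M" .
        have "norm (\<i> * complex_of_real (N * (b - \<beta>) * \<theta>)) = N * \<bar>b - \<beta>\<bar> * \<bar>\<theta>\<bar>"
          using N0 by (simp only: norm_mult norm_of_real abs_mult norm_ii, simp?)
        also have "\<dots> \<le> N * (Cb * \<bar>\<sigma>\<bar>) * \<bar>\<theta>\<bar>" using b2 N0 by (intro mult_right_mono mult_left_mono) auto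
        also have "\<dots> = Cb * (N * (\<bar>\<sigma>\<bar> * \<bar>\<theta>\<bar>))" by simp
        also have "\<dots> \<le> Cb * M" using m11 pos by (intro mult_left_mono) auto
        finally show "norm (\<i> * complex_of_real (N * (b - \<beta>) * \<theta>)) \<le> Cb * M" .
      qed
      finally show ?thesis by (simp add: K5_def algebra_simps)
    qed
    define ks' where "ks' = (real n * q2 + real k * D2) * \<rho>\<^sup>2"
    \<comment> \<open>The coefficient D2 enters as (k D2)(ln 2 / k), independent of
      \<open>k\<close>; only the part with n / k varies.\<close>
    have ks'_eq: "ks' - \<kappa> = (2 * real \<alpha> * lam0 * q2 * ln 2) * (1 / s - 1)"
    proof -
      have "real n = 2 * real \<alpha> * lam0 * k0 n" using al l0 by (simp add: k0_def)
      hence nk: "real n / real k = 2 * real \<alpha> * lam0 / s" unfolding ks using kp s by simp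
      have "ks' = (q2 * (real n / real k) + D2) * ln 2" unfolding ks'_def \<rho>2 using k by (simp add: field_simps)
      thus ?thesis unfolding nk \<kappa>_def by (simp add: algebra_simps)
    qed
    have ks'_bound: "\<bar>ks' - \<kappa>\<bar> \<le> Cq * (2 * \<bar>\<sigma>\<bar>)"
      unfolding ks'_eq abs_mult[of _ "1 / s - 1"] Cq_def using sqrt_expansions(4)[of s] sg by (intro mult_left_mono) (auto simp: \<sigma>_def)
    define e6 where "e6 = of_real (real n * q2 + real k * D2) * W\<^sup>2 - of_real \<kappa>"
    have n6: "norm e6 \<le> K6 * M"
    proof -
      have "W\<^sup>2 = of_real (\<rho>\<^sup>2) * cis (2 * \<theta>)"
        unfolding W_def wt_def \<rho>_def[symmetric] power_mult_distrib Complex.DeMoivre by simp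
      hence "of_real (real n * q2 + real k * D2) * W\<^sup>2 = of_real ks' * cis (2 * \<theta>)"
        by (simp add: ks'_def)
      hence "e6 = of_real ks' * (cis (2 * \<theta>) - 1) + of_real (ks' - \<kappa>)" by (simp add: e6_def algebra_simps)
      also have "norm \<dots> \<le> \<bar>ks'\<bar> * norm (cis (2 * \<theta>) - 1) + \<bar>ks' - \<kappa>\<bar>"
        by (rule order_trans[OF norm_triangle_ineq]) (simp only: norm_mult norm_of_real order_refl)
      also have "\<dots> \<le> (\<bar>\<kappa>\<bar> + Cq * 2) * (2 * \<bar>\<theta>\<bar>) + Cq * (2 * \<bar>\<sigma>\<bar>)"
      proof (intro add_mono mult_mono ks'_bound)
        have "Cq * (2 * \<bar>\<sigma>\<bar>) \<le> Cq * 2" using sg pos by (intro mult_left_mono) auto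
        thus "\<bar>ks'\<bar> \<le> \<bar>\<kappa>\<bar> + Cq * 2" using ks'_bound by linarith
        show "norm (cis (2 * \<theta>) - 1) \<le> 2 * \<bar>\<theta>\<bar>" using norm_cis_minus_1[of "2 * \<theta>"] by (simp add: abs_mult)
      qed (use pos in auto)
      also have "\<dots> \<le> (\<bar>\<kappa>\<bar> + Cq * 2) * (2 * M) + Cq * (2 * M)"
        using m01 m10 pos by (intro add_mono mult_left_mono) auto
      finally show ?thesis by (simp add: K6_def algebra_simps)
    qed
    have n7: "norm (of_nat \<alpha> * \<delta>) \<le> K7 * M"
    proof -
      have "D / real k \<le> D / (1/2 * k0 n)"
        unfolding ks using s kp D by (intro divide_left_mono mult_right_mono mult_pos_pos) auto
      also have "\<dots> = (D * (4 * real \<alpha> * lam0)) * (1 / real n)" using al l0 n by (simp add: k0_def)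
      also have "\<dots> \<le> (D * (4 * real \<alpha> * lam0)) * M"
      proof (rule mult_left_mono)
        have "N * 1 \<le> N * N" using N by (intro mult_left_mono) auto
        hence "1 / real n \<le> 1 / N" unfolding N(2)[symmetric] power2_eq_square using N0 by (intro divide_left_mono) auto
        thus "1 / real n \<le> M" using m00 by linarith
      qed (use D al l0 in auto)
      finally have "norm \<delta> \<le> (D * (4 * real \<alpha> * lam0)) * M" using dl by linarith
      hence "real \<alpha> * norm \<delta> \<le> real \<alpha> * ((D * (4 * real \<alpha> * lam0)) * M)" by (intro mult_left_mono) auto
      thus ?thesis unfolding norm_mult norm_of_nat by (simp add: K7_def mult_ac)
    qed
    have "expo n k \<omega>0 \<omega> \<theta> \<delta> - (of_real \<kappa> + quad X u) = - of_real e1 - e2 + e3 + e4 + e5 + e6 + of_nat \<alpha> * \<delta>"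
      unfolding expo_def s_def[symmetric] W_def[symmetric] N_def[symmetric] quad_def e1_def e2_def e3_def e4_def e5_def e6_def eq_def el_def
      by (simp add: algebra_simps)
    also have "norm \<dots> \<le> norm (complex_of_real e1) + norm e2 + norm e3 + norm e4 + norm e5 + norm e6 + norm (of_nat \<alpha> * \<delta>)"
      using norm_triangle_ineq[of "- of_real e1 - e2 + e3 + e4 + e5 + e6" "of_nat \<alpha> * \<delta>"]
        norm_triangle_ineq[of "- of_real e1 - e2 + e3 + e4 + e5" e6] norm_triangle_ineq[of "- of_real e1 - e2 + e3 + e4" e5]
        norm_triangle_ineq[of "- of_real e1 - e2 + e3" e4] norm_triangle_ineq[of "- of_real e1 - e2" e3]
        norm_triangle_ineq4[of "- of_real e1" e2] norm_minus_cancel[of "complex_of_real e1"]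
      by linarith
    also have "\<dots> \<le> K1 * M + K2 * M + K3 * M + K4 * M + K5 * M + K6 * M + K7 * M"
      using n1 n2 n3 n4 n5 n6 n7 by (intro add_mono) auto
    also have "\<dots> = (K1 + K2 + K3 + K4 + K5 + K6 + K7) * 8 * (P / N)" by (simp add: M_def algebra_simps)
    finally show "norm (expo n k \<omega>0 \<omega> \<theta> \<delta> - (of_real \<kappa> + quad (Xv n k) (sqrt (real n) * \<theta>)))
      \<le> (K1 + K2 + K3 + K4 + K5 + K6 + K7) * 8 * ((1 + \<bar>Xv n k\<bar>) ^ 3 * (1 + \<bar>sqrt (real n) * \<theta>\<bar>) ^ 3 / sqrt (real n))"
      unfolding X_def u_def N_def P_def .
  qed (use Kpos in auto)
qed

end

section \<open>Inequalities for angles, exponentials and powers\<close>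

text \<open>sin x \<ge> x/2 up to pi/3 because cos \<ge> 1/2 there; beyond, sin x \<ge> sin (pi/3)
  \<ge> 8/10, and x/2 does not exceed this up to pi/2.\<close>

lemma sin_square_ge: "\<bar>\<theta>\<bar> \<le> pi / 2 \<Longrightarrow> (sin \<theta>)\<^sup>2 \<ge> \<theta>\<^sup>2 / 4"
proof -
  have main: "x / 2 \<le> sin x" if x: "0 \<le> x" "x \<le> pi / 2" for x :: real
  proof (cases "x \<le> pi / 3")
    case True
    have "(\<lambda>x. sin x - x / 2) 0 \<le> (\<lambda>x. sin x - x / 2) x"
    proof (rule DERIV_nonneg_imp_nondecreasing[where f = "\<lambda>x. sin x - x / 2", OF x(1)])
      fix y assume y: "0 \<le> y" "y \<le> x"
      have "cos (pi / 3) \<le> cos y" using y True pi_gt3 by (intro cos_monotone_0_pi_le) auto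
      hence "0 \<le> cos y - 1 / 2" by (simp add: cos_60)
      moreover have "((\<lambda>x. sin x - x / 2) has_real_derivative cos y - 1 / 2) (at y)"
        by (auto intro!: derivative_eq_intros)
      ultimately show "\<exists>d. ((\<lambda>x. sin x - x / 2) has_real_derivative d) (at y) \<and> 0 \<le> d" by blast
    qed
    thus ?thesis by simp
  next
    case False
    have "sin (pi / 3) \<le> sin x" using False x by (intro sin_monotone_2pi_le) auto
    moreover have "sin (pi / 3) \<ge> (8/10 :: real)"
    proof -
      have "(16/10 :: real) \<le> sqrt 3" by (rule real_le_rsqrt) (simp add: power2_eq_square)
      thus ?thesis by (simp add: sin_60)
    qed
    moreover have "x / 2 \<le> 8/10" using x pi_approx by simp
    ultimately show ?thesis by linarith
  qed
  assume t: "\<bar>\<theta>\<bar> \<le> pi / 2"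
  have "\<bar>\<theta>\<bar> / 2 \<le> sin \<bar>\<theta>\<bar>" using main[of "\<bar>\<theta>\<bar>"] t by simp
  hence "(\<bar>\<theta>\<bar> / 2)\<^sup>2 \<le> (sin \<bar>\<theta>\<bar>)\<^sup>2" by (intro power_mono) auto
  moreover have "(sin \<bar>\<theta>\<bar>)\<^sup>2 = (sin \<theta>)\<^sup>2" by (cases "\<theta> \<ge> 0") auto
  ultimately show ?thesis by (simp add: power_divide)
qed

text \<open>Mean value inequality on the half plane Re z \<le> m, which is convex and on which exp
  has modulus at most exp m. It turns an error in the exponent into one carrying the full Gaussian
  decay.\<close>

lemma norm_exp_diff_le:
  fixes a b :: complex
  assumes "Re a \<le> m" "Re b \<le> m"
  shows "norm (exp a - exp b) \<le> exp m * norm (a - b)"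
proof (rule field_differentiable_bound[of "{z. Re z \<le> m}" exp exp])
  show "norm (exp z) \<le> exp m" if "z \<in> {z. Re z \<le> m}" for z :: complex using that by simp
qed (use assms convex_halfspace_Re_le in \<open>auto intro: DERIV_exp has_field_derivative_at_within\<close>)

lemma norm_power_diff_le:
  fixes a b :: complex
  assumes "norm a \<le> M" "norm b \<le> M" "M \<ge> 1"
  shows "norm (a ^ n - b ^ n) \<le> real n * M ^ n * norm (a - b)"
proof (induction n)
  case (Suc n)
  have "a ^ Suc n - b ^ Suc n = a * (a ^ n - b ^ n) + b ^ n * (a - b)" by (simp add: algebra_simps)
  also have "norm \<dots> \<le> norm a * norm (a ^ n - b ^ n) + norm b ^ n * norm (a - b)"
    by (rule order_trans[OF norm_triangle_ineq]) (simp add: norm_mult norm_power)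
  also have "\<dots> \<le> M * (real n * M ^ n * norm (a - b)) + M ^ Suc n * norm (a - b)"
  proof (intro add_mono mult_mono Suc.IH)
    have "norm b ^ n \<le> M ^ n" using assms by (intro power_mono) auto
    also have "\<dots> \<le> M ^ Suc n" using assms by (intro power_increasing) auto
    finally show "norm b ^ n \<le> M ^ Suc n" .
  qed (use assms in auto)
  also have "\<dots> = real (Suc n) * M ^ Suc n * norm (a - b)" by (simp add: algebra_simps)
  finally show ?case .
qed auto

text \<open>Ensures that 3/2 k0 \<le> n, so that the window of dominant indices lies inside the
  range of summation.\<close>

lemma lam0_ge: "lam0 \<ge> 3 / 4"
proof -
  have "3 * 3 \<le> pi * pi" using pi_gt3 by (intro mult_mono) auto
  moreover have "12 * ln 2 * (3 / 4) \<le> (9 :: real)" using ln_2_less_7_10 by simp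
  ultimately have "3 / 4 * (12 * ln 2) \<le> pi\<^sup>2" by (simp add: power2_eq_square)
  thus ?thesis unfolding lam0_def by (simp add: field_simps)
qed

section \<open>Decay of the integrand near and far from the dominant index\<close>

context saddle
begin

text \<open>Amounts to 24 (ln 2)^2 > pi^2, which rough bounds settle: ln 2 \<ge> 2/3 and pi \<le>
  3.2. It says that the saddle is a nondegenerate maximum in the angle.\<close>

lemma mu_pos: "\<mu> > 0"
proof -
  have "pi\<^sup>2 \<le> (32/10)\<^sup>2" using pi_approx by (intro power_mono) auto
  also have "(32/10)\<^sup>2 < 24 * ((2/3)\<^sup>2 :: real)" by (simp add: power2_eq_square)
  also have "\<dots> \<le> 24 * (ln 2)\<^sup>2" using ln2_ge_two_thirds by (intro mult_left_mono power_mono) auto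
  finally have "pi\<^sup>2 < 24 * (ln 2)\<^sup>2" .
  hence "1 < 24 * (ln 2)\<^sup>2 / pi\<^sup>2" by simp
  moreover have "2 * ln 2 / lam0 = 24 * (ln 2)\<^sup>2 / pi\<^sup>2" by (simp add: lam0_def power2_eq_square)
  ultimately show ?thesis by (simp add: \<mu>_def)
qed

lemma slope_diff:
  assumes "\<bar>s - 1\<bar> \<le> 1/2"
  shows "\<bar>c1 / sqrt s + c2 * sqrt s - \<beta>\<bar> \<le> (3 * \<bar>c1\<bar> + 2 * \<bar>c2\<bar>) * \<bar>s - 1\<bar>"
proof -
  have sq: "(s - 1)\<^sup>2 \<le> \<bar>s - 1\<bar> / 2"
    using assms mult_left_mono[of "\<bar>s - 1\<bar>" "1/2" "\<bar>s - 1\<bar>"] by (simp add: power2_eq_square)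
  have a: "\<bar>1 / sqrt s - 1\<bar> \<le> 3 * \<bar>s - 1\<bar>"
    using sqrt_expansions(2)[OF assms] sq by linarith
  have b: "\<bar>sqrt s - 1\<bar> \<le> 2 * \<bar>s - 1\<bar>"
    using sqrt_expansions(1)[OF assms] sq by linarith
  have "c1 / sqrt s + c2 * sqrt s - \<beta> = c1 * (1 / sqrt s - 1) + c2 * (sqrt s - 1)"
    by (simp add: \<beta>_def algebra_simps)
  also have "\<bar>\<dots>\<bar> \<le> \<bar>c1\<bar> * (3 * \<bar>s - 1\<bar>) + \<bar>c2\<bar> * (2 * \<bar>s - 1\<bar>)"
    unfolding abs_mult[symmetric]
    by (rule order_trans[OF abs_triangle_ineq]) (unfold abs_mult, intro add_mono mult_left_mono a b, auto)
  finally show ?thesis by (simp add: algebra_simps)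
qed

text \<open>The entropy supplies X^2/3. Half of it absorbs the linear drift 2 Cb |X| of the slope,
  by completing the square, and X^2/6 remains. On the right half the angular gain is quadratic in
  sqrt n \<theta>. On the left half cos \<theta> \<le> 0 removes the linear term, while the
  normalisation still subtracts \<beta> sqrt n.\<close>

lemma Re_expo_near:
  assumes R: "R \<ge> 0" and D: "D \<ge> 0" and bp: "\<beta> > 0"
  shows "\<exists>C\<ge>0. \<exists>c>0. \<forall>n k \<omega>0 \<omega> \<theta> \<delta>. n > 0 \<longrightarrow> \<bar>real k / k0 n - 1\<bar> \<le> 1/2 \<longrightarrow> rad k < r \<longrightarrow> rad k \<le> 1 \<longrightarrow>
    norm \<omega>0 \<le> R \<longrightarrow> norm \<omega> \<le> R \<longrightarrow> norm \<delta> \<le> D / real k \<longrightarrow>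
    (\<bar>\<theta>\<bar> \<le> pi / 2 \<longrightarrow> Re (expo n k \<omega>0 \<omega> \<theta> \<delta>) \<le> C - c * (Xv n k)\<^sup>2 - c * (sqrt (real n) * \<theta>)\<^sup>2) \<and>
    (cos \<theta> \<le> 0 \<longrightarrow> Re (expo n k \<omega>0 \<omega> \<theta> \<delta>) \<le> C - c * (Xv n k)\<^sup>2 - \<beta> * sqrt (real n))"
proof -
  obtain C0 where C0: "C0 \<ge> 0" and E: "\<And>n k \<omega>0 \<omega> \<theta> \<delta>. n > 0 \<Longrightarrow> k > 0 \<Longrightarrow> rad k < r \<Longrightarrow> rad k \<le> 1 \<Longrightarrow> norm \<omega>0 \<le> R \<Longrightarrow> norm \<omega> \<le> R \<Longrightarrow>
    Re (expo n k \<omega>0 \<omega> \<theta> \<delta>) \<le> - (real n / 2 * (real k / k0 n - 1 - ln (real k / k0 n)))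
      - real \<alpha> * real k * (ln 2 / 2 * (sin \<theta>)\<^sup>2) + C0 * (1 + \<bar>ln (real k / k0 n)\<bar>)
      + (real n * q1 + real k * D1) * rad k * cos \<theta> + C0 * (real n + real k) * (rad k)\<^sup>2
      - \<beta> * sqrt (real n) + real \<alpha> * norm \<delta>"
    using Re_expo_le[OF R] by blast
  define Cb where "Cb = 3 * \<bar>c1\<bar> + 2 * \<bar>c2\<bar>"
  define C1 where "C1 = C0 * 2 + C0 * (4 * real \<alpha> * lam0 + 1) + real \<alpha> * D"
  \<comment> \<open>\<alpha> k \<ge> n / (4 lam0) for s \<ge> 1/2, times ln 2 / 2, times the lower
    bound \<theta>^2/4 for (sin \<theta>)^2.\<close>
  define cu where "cu = ln 2 / (32 * lam0)"
  have al: "real \<alpha> > 0" using alpha_pos by simp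
  note l0 = lam0_pos
  have Cb0: "Cb \<ge> 0" by (simp add: Cb_def)
  have C1: "C1 \<ge> 0" using C0 al l0 D by (auto simp: C1_def intro!: add_nonneg_nonneg)
  have cu: "cu > 0" using l0 by (simp add: cu_def)
  define c where "c = min (1/6) cu"
  have c: "c > 0" "c \<le> 1/6" "c \<le> cu" using cu by (auto simp: c_def)
  show ?thesis
  proof (rule exI[of _ "C1 + 6 * Cb\<^sup>2"], rule conjI, use C1 in simp, rule exI[of _ c], rule conjI, rule c(1), intro allI impI)
    fix n k :: nat and \<omega>0 \<omega> :: complex and \<theta> :: real and \<delta> :: complex
    assume n: "n > 0" and near: "\<bar>real k / k0 n - 1\<bar> \<le> 1/2" and rk: "rad k < r" "rad k \<le> 1"
      and w: "norm \<omega>0 \<le> R" "norm \<omega> \<le> R" and dl: "norm \<delta> \<le> D / real k"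
    define s where "s = real k / k0 n"
    define N where "N = sqrt (real n)"
    define X where "X = Xv n k"
    have N: "N > 0" "N\<^sup>2 = real n" using n by (auto simp: N_def)
    have kp: "k0 n > 0" by (rule k0_pos[OF n])
    have sg: "\<bar>s - 1\<bar> \<le> 1/2" using near by (simp add: s_def)
    have s: "1/2 \<le> s" "s \<le> 3/2" using sg by (auto simp: abs_if split: if_splits)
    have ks: "real k = s * k0 n" using kp by (simp add: s_def)
    have k: "k > 0" using ks s kp by (cases k) auto
    have XN: "X = N * (s - 1) / 2" by (simp add: X_def Xv_def N_def s_def)
    have t1: "real n / 2 * (s - 1 - ln s) \<ge> X\<^sup>2 / 3"
    proof -
      have "real n / 2 * (s - 1 - ln s) \<ge> real n / 2 * ((s - 1)\<^sup>2 / 6)"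
        using entropy_ge(1)[of s] s sg by (intro mult_left_mono) auto
      moreover have "real n / 2 * ((s - 1)\<^sup>2 / 6) = X\<^sup>2 / 3" by (simp add: XN N(2)[symmetric] power_mult_distrib power_divide)
      ultimately show ?thesis by simp
    qed
    have t3: "C0 * (1 + \<bar>ln s\<bar>) \<le> C0 * 2"
      using sqrt_expansions(3)[OF sg] sg C0 by (intro mult_left_mono) auto
    have t4: "C0 * (real n + real k) * (rad k)\<^sup>2 \<le> C0 * (4 * real \<alpha> * lam0 + 1)"
    proof -
      have "real n / real k \<le> real n / (1/2 * k0 n)"
        unfolding ks using s kp by (intro divide_left_mono mult_right_mono mult_pos_pos) auto
      also have "\<dots> = 4 * real \<alpha> * lam0" using al l0 n by (simp add: k0_def)
      finally have a: "real n / real k \<le> 4 * real \<alpha> * lam0" .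
      have "(real n + real k) * (rad k)\<^sup>2 = (real n / real k + 1) * ln 2"
        using k by (simp add: rad_square field_simps)
      also have "\<dots> \<le> (4 * real \<alpha> * lam0 + 1) * 1"
        using a ln_2_less_7_10 al l0 by (intro mult_mono) auto
      finally show ?thesis using C0 by (simp add: mult.assoc mult_left_mono)
    qed
    have t5: "real \<alpha> * norm \<delta> \<le> real \<alpha> * D"
    proof -
      have "D / real k \<le> D / 1" using k D by (intro divide_left_mono) auto
      thus ?thesis using dl by (intro mult_left_mono) auto
    qed
    define b where "b = c1 / sqrt s + c2 * sqrt s"
    have lin: "(real n * q1 + real k * D1) * rad k = N * b"
      using linear_coeff[OF n k] by (simp add: b_def s_def N_def)
    have bb: "N * \<bar>b - \<beta>\<bar> \<le> 2 * Cb * \<bar>X\<bar>"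
    proof -
      have "N * \<bar>b - \<beta>\<bar> \<le> N * (Cb * \<bar>s - 1\<bar>)"
        using slope_diff[OF sg] N by (intro mult_left_mono) (auto simp: b_def Cb_def)
      thus ?thesis using N by (simp add: XN abs_mult)
    qed
    have t6: "N * b * cos \<theta> \<le> 2 * Cb * \<bar>X\<bar> + N * \<beta> * cos \<theta>"
    proof -
      have "N * (b - \<beta>) * cos \<theta> \<le> \<bar>N * (b - \<beta>) * cos \<theta>\<bar>" by (rule abs_ge_self)
      also have "\<dots> = N * \<bar>b - \<beta>\<bar> * \<bar>cos \<theta>\<bar>" using N by (simp add: abs_mult)
      also have "\<dots> \<le> N * \<bar>b - \<beta>\<bar> * 1" using N by (intro mult_left_mono) auto
      finally show ?thesis using bb by (simp add: algebra_simps)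
    qed
    have t7: "2 * Cb * \<bar>X\<bar> \<le> 6 * Cb\<^sup>2 + X\<^sup>2 / 6"
    proof -
      have "0 \<le> (\<bar>X\<bar> - 6 * Cb)\<^sup>2 / 6" by simp
      also have "\<dots> = X\<^sup>2 / 6 - 2 * Cb * \<bar>X\<bar> + 6 * Cb\<^sup>2" by (simp add: power2_diff power_mult_distrib field_simps)
      finally show ?thesis by simp
    qed
    have E': "Re (expo n k \<omega>0 \<omega> \<theta> \<delta>) \<le> C1 + 6 * Cb\<^sup>2 - X\<^sup>2 / 6 - real \<alpha> * real k * (ln 2 / 2 * (sin \<theta>)\<^sup>2) + N * \<beta> * cos \<theta> - \<beta> * N"
      using E[OF n k rk w, of \<theta> \<delta>, folded s_def N_def, unfolded lin] t1 t3 t4 t5 t6 t7 unfolding C1_def by linarith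
    have X6: "c * X\<^sup>2 \<le> X\<^sup>2 / 6" using mult_right_mono[OF c(2), of "X\<^sup>2"] by simp
    show "(\<bar>\<theta>\<bar> \<le> pi / 2 \<longrightarrow> Re (expo n k \<omega>0 \<omega> \<theta> \<delta>) \<le> C1 + 6 * Cb\<^sup>2 - c * (Xv n k)\<^sup>2 - c * (sqrt (real n) * \<theta>)\<^sup>2) \<and>
      (cos \<theta> \<le> 0 \<longrightarrow> Re (expo n k \<omega>0 \<omega> \<theta> \<delta>) \<le> C1 + 6 * Cb\<^sup>2 - c * (Xv n k)\<^sup>2 - \<beta> * sqrt (real n))"
    proof (intro conjI impI)
      assume th: "\<bar>\<theta>\<bar> \<le> pi / 2"
      have "real \<alpha> * real k = real n * s / (2 * lam0)" unfolding ks using al l0 by (simp add: k0_def)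
      hence "real \<alpha> * real k * (ln 2 / 2 * (sin \<theta>)\<^sup>2) = real n * s / (2 * lam0) * (ln 2 / 2 * (sin \<theta>)\<^sup>2)" by simp
      also have "\<dots> \<ge> real n * (1/2) / (2 * lam0) * (ln 2 / 2 * (\<theta>\<^sup>2 / 4))"
        using s l0 sin_square_ge[OF th] by (intro mult_mono divide_right_mono mult_left_mono) auto
      also have "real n * (1/2) / (2 * lam0) * (ln 2 / 2 * (\<theta>\<^sup>2 / 4)) = cu * (N * \<theta>)\<^sup>2"
        by (simp add: cu_def power_mult_distrib N(2))
      finally have a: "real \<alpha> * real k * (ln 2 / 2 * (sin \<theta>)\<^sup>2) \<ge> cu * (N * \<theta>)\<^sup>2" .
      have a': "c * (N * \<theta>)\<^sup>2 \<le> cu * (N * \<theta>)\<^sup>2" using c(3) by (intro mult_right_mono) auto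
      have "N * \<beta> * cos \<theta> \<le> N * \<beta> * 1" using N bp by (intro mult_left_mono) auto
      hence "N * \<beta> * cos \<theta> \<le> \<beta> * N" by (simp only: mult_1_right mult.commute[of N \<beta>])
      thus "Re (expo n k \<omega>0 \<omega> \<theta> \<delta>) \<le> C1 + 6 * Cb\<^sup>2 - c * (Xv n k)\<^sup>2 - c * (sqrt (real n) * \<theta>)\<^sup>2"
        using E' a a' X6 unfolding X_def[symmetric] N_def[symmetric] by linarith
    next
      assume "cos \<theta> \<le> 0"
      hence "N * \<beta> * cos \<theta> \<le> 0" using N bp by (intro mult_nonneg_nonpos) auto
      moreover have "0 \<le> real \<alpha> * real k * (ln 2 / 2 * (sin \<theta>)\<^sup>2)" by simp
      ultimately show "Re (expo n k \<omega>0 \<omega> \<theta> \<delta>) \<le> C1 + 6 * Cb\<^sup>2 - c * (Xv n k)\<^sup>2 - \<beta> * sqrt (real n)"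
        using E' X6 unfolding X_def[symmetric] N_def[symmetric] by linarith
    qed
  qed
qed

text \<open>The entropy gives n/48. Perturbations proportional to n carry a factor
  \<open>rad k\<close> and are made at most n/192 by the choice of \<eta>; those of order sqrt n,
  among them C |ln s| for 1 \<le> k \<le> n, are at most n/128 plus a constant. The balance is 1/48
  - 1/192 - 1/128 = 1/128.\<close>

lemma Re_expo_far:
  assumes R: "R \<ge> 0" and D: "D \<ge> 0"
  shows "\<exists>C\<ge>0. \<exists>\<eta>>0. \<forall>n k \<omega>0 \<omega> \<theta> \<delta>. k > 0 \<longrightarrow> k \<le> n \<longrightarrow> \<bar>real k / k0 n - 1\<bar> \<ge> 1/2 \<longrightarrow> rad k < r \<longrightarrow> rad k \<le> 1 \<longrightarrow> rad k \<le> \<eta> \<longrightarrow>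
    norm \<omega>0 \<le> R \<longrightarrow> norm \<omega> \<le> R \<longrightarrow> norm \<delta> \<le> D / real k \<longrightarrow>
    Re (expo n k \<omega>0 \<omega> \<theta> \<delta>) \<le> C - real n / 128"
proof -
  obtain C0 where C0: "C0 \<ge> 0" and E: "\<And>n k \<omega>0 \<omega> \<theta> \<delta>. n > 0 \<Longrightarrow> k > 0 \<Longrightarrow> rad k < r \<Longrightarrow> rad k \<le> 1 \<Longrightarrow> norm \<omega>0 \<le> R \<Longrightarrow> norm \<omega> \<le> R \<Longrightarrow>
    Re (expo n k \<omega>0 \<omega> \<theta> \<delta>) \<le> - (real n / 2 * (real k / k0 n - 1 - ln (real k / k0 n)))
      - real \<alpha> * real k * (ln 2 / 2 * (sin \<theta>)\<^sup>2) + C0 * (1 + \<bar>ln (real k / k0 n)\<bar>)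
      + (real n * q1 + real k * D1) * rad k * cos \<theta> + C0 * (real n + real k) * (rad k)\<^sup>2
      - \<beta> * sqrt (real n) + real \<alpha> * norm \<delta>"
    using Re_expo_le[OF R] by blast
  have al: "real \<alpha> > 0" using alpha_pos by simp
  note l0 = lam0_pos
  define C3 where "C3 = \<bar>q1\<bar> + \<bar>D1\<bar> + 2 * C0 + 1"
  define C4 where "C4 = 2 * C0 + \<bar>\<beta>\<bar>"
  define C5 where "C5 = C0 * (1 + \<bar>ln (2 * real \<alpha> * lam0)\<bar>) + real \<alpha> * D"
  define \<eta> where "\<eta> = 1 / (192 * C3)"
  have C3: "C3 > 0" using C0 by (auto simp: C3_def)
  have \<eta>: "\<eta> > 0" using C3 by (simp add: \<eta>_def)
  have C5: "C5 \<ge> 0" using C0 al D by (auto simp: C5_def intro!: add_nonneg_nonneg)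
  show ?thesis
  proof (rule exI[of _ "C5 + 32 * C4\<^sup>2"], rule conjI, use C5 in simp, rule exI[of _ \<eta>], rule conjI, rule \<eta>, intro allI impI)
    fix n k :: nat and \<omega>0 \<omega> :: complex and \<theta> :: real and \<delta> :: complex
    assume k: "k > 0" "k \<le> n" and far: "\<bar>real k / k0 n - 1\<bar> \<ge> 1/2" and rk: "rad k < r" "rad k \<le> 1" and re: "rad k \<le> \<eta>"
      and w: "norm \<omega>0 \<le> R" "norm \<omega> \<le> R" and dl: "norm \<delta> \<le> D / real k"
    define s where "s = real k / k0 n"
    define N where "N = sqrt (real n)"
    define \<rho> where "\<rho> = rad k"
    have n: "n > 0" using k by simp
    have N: "N \<ge> 1" "N\<^sup>2 = real n" using n by (auto simp: N_def)
    have kp: "k0 n > 0" by (rule k0_pos[OF n])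
    have sp: "s > 0" using k kp by (simp add: s_def)
    have \<rho>: "0 < \<rho>" "\<rho> \<le> 1" "\<rho> \<le> \<eta>" using rad_pos[OF k(1)] rk re by (auto simp: \<rho>_def)
    have t1: "real n / 2 * (s - 1 - ln s) \<ge> real n / 48"
      using mult_left_mono[OF entropy_ge(2)[OF sp], of "real n / 2"] far by (simp add: s_def)
    have lns: "\<bar>ln s\<bar> \<le> \<bar>ln (2 * real \<alpha> * lam0)\<bar> + 2 * N"
    proof -
      have "s = (2 * real \<alpha> * lam0) * (real k / real n)" using n al l0 by (simp add: s_def k0_def)
      hence "ln s = ln (2 * real \<alpha> * lam0) + (ln (real k) - ln (real n))"
        using k n al l0 by (simp add: ln_mult ln_div)
      moreover have "0 \<le> ln (real k)" "ln (real k) \<le> ln (real n)" using k by auto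
      moreover have "ln (real n) \<le> 2 * N"
      proof -
        have "ln (N\<^sup>2) = 2 * ln N" using N(1) by (simp add: ln_realpow)
        hence "ln (real n) = 2 * ln N" unfolding N(2) .
        also have "\<dots> \<le> 2 * N" using ln_le_minus_one[of N] N by simp
        finally show ?thesis .
      qed
      ultimately show ?thesis by linarith
    qed
    have t3: "C0 * (1 + \<bar>ln s\<bar>) \<le> C0 * (1 + \<bar>ln (2 * real \<alpha> * lam0)\<bar>) + 2 * C0 * N"
      using mult_left_mono[OF lns C0] by (simp add: algebra_simps)
    have t4: "(real n * q1 + real k * D1) * \<rho> * cos \<theta> \<le> real n * (\<bar>q1\<bar> + \<bar>D1\<bar>) * \<rho>"
    proof -
      have "(real n * q1 + real k * D1) * \<rho> * cos \<theta> \<le> \<bar>(real n * q1 + real k * D1) * \<rho> * cos \<theta>\<bar>" by (rule abs_ge_self)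
      also have "\<dots> = \<bar>real n * q1 + real k * D1\<bar> * \<rho> * \<bar>cos \<theta>\<bar>" using \<rho> by (simp add: abs_mult)
      also have "\<dots> \<le> \<bar>real n * q1 + real k * D1\<bar> * \<rho> * 1" using \<rho> by (intro mult_left_mono) auto
      also have "\<dots> \<le> (real n * (\<bar>q1\<bar> + \<bar>D1\<bar>)) * \<rho>"
      proof -
        have "\<bar>real n * q1 + real k * D1\<bar> \<le> real n * \<bar>q1\<bar> + real k * \<bar>D1\<bar>"
          by (rule order_trans[OF abs_triangle_ineq]) (simp add: abs_mult)
        also have "\<dots> \<le> real n * \<bar>q1\<bar> + real n * \<bar>D1\<bar>" using k by (intro add_left_mono mult_right_mono) auto
        finally have "\<bar>real n * q1 + real k * D1\<bar> \<le> real n * (\<bar>q1\<bar> + \<bar>D1\<bar>)" by (simp only: distrib_left)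
        thus ?thesis unfolding mult_1_right using \<rho> by (intro mult_right_mono) auto
      qed
      finally show ?thesis .
    qed
    have t5: "C0 * (real n + real k) * \<rho>\<^sup>2 \<le> real n * (2 * C0) * \<rho>"
    proof -
      have "\<rho>\<^sup>2 \<le> \<rho>" using \<rho> mult_left_mono[of \<rho> 1 \<rho>] by (simp add: power2_eq_square)
      hence "C0 * (real n + real k) * \<rho>\<^sup>2 \<le> C0 * (real n + real n) * \<rho>"
        using C0 k \<rho> by (intro mult_mono mult_left_mono) auto
      thus ?thesis by (simp add: algebra_simps)
    qed
    have t6: "real n * C3 * \<rho> \<le> real n / 192"
    proof -
      have "real n * C3 * \<rho> \<le> real n * C3 * \<eta>" using \<rho> C3 by (intro mult_left_mono) auto
      thus ?thesis using C3 by (simp add: \<eta>_def)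
    qed
    have t6': "real n * (\<bar>q1\<bar> + \<bar>D1\<bar>) * \<rho> + real n * (2 * C0) * \<rho> \<le> real n * C3 * \<rho>"
      using \<rho> by (simp add: C3_def algebra_simps)
    have t7: "real \<alpha> * norm \<delta> \<le> real \<alpha> * D"
    proof -
      have "D / real k \<le> D / 1" using k D by (intro divide_left_mono) auto
      thus ?thesis using dl by (intro mult_left_mono) auto
    qed
    \<comment> \<open>Completing the square with weight 1/128; the 64 and the 32 are determined by
      it.\<close>
    have t8: "C4 * N \<le> 32 * C4\<^sup>2 + real n / 128"
    proof -
      have "0 \<le> (N - 64 * C4)\<^sup>2 / 128" by simp
      also have "\<dots> = real n / 128 - C4 * N + 32 * C4\<^sup>2" unfolding N(2)[symmetric] by (simp add: power2_diff power_mult_distrib field_simps)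
      finally show ?thesis by simp
    qed
    have t9: "2 * C0 * N - \<beta> * N \<le> C4 * N"
    proof -
      have "- \<beta> * N \<le> \<bar>\<beta>\<bar> * N" by (rule mult_right_mono) (use N in auto)
      thus ?thesis by (simp add: C4_def algebra_simps)
    qed
    have "0 \<le> real \<alpha> * real k * (ln 2 / 2 * (sin \<theta>)\<^sup>2)" by simp
    thus "Re (expo n k \<omega>0 \<omega> \<theta> \<delta>) \<le> C5 + 32 * C4\<^sup>2 - real n / 128"
      using E[OF n k(1) rk w, of \<theta> \<delta>, folded s_def N_def \<rho>_def] t1 t3 t4 t5 t6 t6' t7 t8 t9
      unfolding C5_def by linarith
  qed
qed

end

lemma exp_minus_le_inverse: "x > 0 \<Longrightarrow> exp (- x) \<le> 1 / (x::real)"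
proof -
  assume x: "x > 0"
  have "x \<le> exp x" using exp_ge_add_one_self[of x] by linarith
  thus ?thesis using x by (simp add: exp_minus field_simps)
qed

lemma exp_minus_le_inverse_square: "x > 0 \<Longrightarrow> exp (- x) \<le> 4 / (x::real)\<^sup>2"
proof -
  assume x: "x > 0"
  have "exp (- x) = exp (- (x / 2)) * exp (- (x / 2))" by (simp add: exp_add[symmetric])
  also have "\<dots> \<le> (1 / (x / 2)) * (1 / (x / 2))"
    using x exp_minus_le_inverse[of "x / 2"] by (intro mult_mono) auto
  finally show ?thesis by (simp add: power2_eq_square)
qed

section \<open>The normalised integrand\<close>

context saddle
begin

definition nint :: "nat \<Rightarrow> nat \<Rightarrow> complex \<Rightarrow> complex \<Rightarrow> real \<Rightarrow> complex" where
  "nint n k \<omega>0 \<omega> \<theta> = integrand n k \<omega>0 \<omega> (wt k \<theta>) / scale n \<omega>"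

lemma scale_nz [simp]: "scale n \<omega> \<noteq> 0" by (simp add: scale_def)

lemma rad_small: "\<eta> > 0 \<Longrightarrow> real k \<ge> 1 / \<eta>\<^sup>2 \<Longrightarrow> rad k \<le> \<eta>"
proof -
  assume e: "\<eta> > 0" and k: "real k \<ge> 1 / \<eta>\<^sup>2"
  have "1 / \<eta>\<^sup>2 > 0" using e by simp
  hence k0: "real k > 0" using k by linarith
  have "ln 2 / real k \<le> 1 / real k" using k0 ln_2_less_7_10 by (intro divide_right_mono) auto
  also have "\<dots> \<le> \<eta>\<^sup>2" using k k0 e by (simp add: field_simps)
  finally show "rad k \<le> \<eta>" unfolding rad_def using e by (intro real_le_lsqrt) auto
qed

text \<open>Half of X^2 is spent on absorbing the drift (c2 - c1) X. The limiting profile thus gets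
  a Gaussian majorant of the same kind as the true integrand.\<close>

lemma Re_quad_le: "Re (quad X u) \<le> (c2 - c1)\<^sup>2 / 2 - X\<^sup>2 / 2 - \<mu> * u\<^sup>2"
proof -
  have "0 \<le> (X - (c2 - c1))\<^sup>2 / 2" by simp
  also have "\<dots> = X\<^sup>2 / 2 - (c2 - c1) * X + (c2 - c1)\<^sup>2 / 2" by (simp add: power2_eq_square field_simps)
  finally have "(c2 - c1) * X \<le> X\<^sup>2 / 2 + (c2 - c1)\<^sup>2 / 2" by simp
  moreover have "Re (quad X u) = - X\<^sup>2 + (c2 - c1) * X - \<mu> * u\<^sup>2" by (simp add: quad_def)
  ultimately show ?thesis by (simp add: field_simps)
qed

text \<open>Three regimes: near index and right half circle, near index and left half circle, far
  index. In the first, exponent and limiting quadratic form share one Gaussian majorant for their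
  real parts, so the O(n^(-1/2)) distance of the exponents carries over to the exponentials; its
  polynomial factor is absorbed by halving the decay rate. The prefactor is compared additively with
  the power of 1/\<Gamma>, so the bound remains meaningful at its zeros.\<close>

lemma nint_bounds:
  assumes R: "R \<ge> 0" and bp: "\<beta> > 0"
  shows "\<exists>C\<ge>1. \<exists>c>0. \<exists>K::nat. K > 0 \<and> (\<forall>n k \<omega>0 \<omega> \<theta>. n > 0 \<longrightarrow> k \<ge> K \<longrightarrow> norm \<omega>0 \<le> R \<longrightarrow> norm \<omega> \<le> R \<longrightarrow>
     rad k < r \<and> norm (rGamma (1 + \<omega>)) \<le> C \<and>
     (\<bar>real k / k0 n - 1\<bar> \<le> 1/2 \<longrightarrow> \<bar>\<theta>\<bar> \<le> pi / 2 \<longrightarrow>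
        norm (nint n k \<omega>0 \<omega> \<theta> - rGamma (1 + \<omega>) ^ \<alpha> * exp (of_real \<kappa> + quad (Xv n k) (sqrt (real n) * \<theta>)))
          \<le> C / sqrt (real n) * exp (- c * (Xv n k)\<^sup>2) * exp (- c * (sqrt (real n) * \<theta>)\<^sup>2)) \<and>
     (\<bar>real k / k0 n - 1\<bar> \<le> 1/2 \<longrightarrow> cos \<theta> \<le> 0 \<longrightarrow>
        norm (nint n k \<omega>0 \<omega> \<theta>) \<le> C * exp (- c * (Xv n k)\<^sup>2) * exp (- \<beta> * sqrt (real n))) \<and>
     (\<bar>real k / k0 n - 1\<bar> \<ge> 1/2 \<longrightarrow> k \<le> n \<longrightarrow> norm (nint n k \<omega>0 \<omega> \<theta>) \<le> C * exp (- real n / 128)))"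
proof -
  obtain D where D: "D \<ge> 0" and IE: "\<And>\<omega>0 \<omega> \<theta> n k. norm \<omega> \<le> R \<Longrightarrow> real k \<ge> 4 * R + 1 \<Longrightarrow> n > 0 \<Longrightarrow>
    \<exists>\<delta>. norm \<delta> \<le> D / real k \<and> integrand n k \<omega>0 \<omega> (wt k \<theta>) =
        scale n \<omega> * (gprod \<omega> k ^ \<alpha> * (1 - wt k \<theta> * deriv q (wt k \<theta>)) * exp (expo n k \<omega>0 \<omega> \<theta> \<delta>))"
    using integrand_eq[OF R] by blast
  obtain C2 where C2: "C2 \<ge> 0" and EN: "\<And>n k \<omega>0 \<omega> \<theta> \<delta>. n > 0 \<Longrightarrow> \<bar>real k / k0 n - 1\<bar> \<le> 1/2 \<Longrightarrow> rad k < r \<Longrightarrow> rad k \<le> 1 \<Longrightarrow>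
    \<bar>\<theta>\<bar> \<le> pi / 2 \<Longrightarrow> norm \<omega>0 \<le> R \<Longrightarrow> norm \<omega> \<le> R \<Longrightarrow> norm \<delta> \<le> D / real k \<Longrightarrow>
    norm (expo n k \<omega>0 \<omega> \<theta> \<delta> - (of_real \<kappa> + quad (Xv n k) (sqrt (real n) * \<theta>)))
      \<le> C2 * ((1 + \<bar>Xv n k\<bar>) ^ 3 * (1 + \<bar>sqrt (real n) * \<theta>\<bar>) ^ 3 / sqrt (real n))"
    using expo_near[OF R D] by blast
  obtain C3 c3 where C3: "C3 \<ge> 0" "c3 > 0" and RN: "\<And>n k \<omega>0 \<omega> \<theta> \<delta>. n > 0 \<Longrightarrow> \<bar>real k / k0 n - 1\<bar> \<le> 1/2 \<Longrightarrow> rad k < r \<Longrightarrow> rad k \<le> 1 \<Longrightarrow>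
    norm \<omega>0 \<le> R \<Longrightarrow> norm \<omega> \<le> R \<Longrightarrow> norm \<delta> \<le> D / real k \<Longrightarrow>
    (\<bar>\<theta>\<bar> \<le> pi / 2 \<longrightarrow> Re (expo n k \<omega>0 \<omega> \<theta> \<delta>) \<le> C3 - c3 * (Xv n k)\<^sup>2 - c3 * (sqrt (real n) * \<theta>)\<^sup>2) \<and>
    (cos \<theta> \<le> 0 \<longrightarrow> Re (expo n k \<omega>0 \<omega> \<theta> \<delta>) \<le> C3 - c3 * (Xv n k)\<^sup>2 - \<beta> * sqrt (real n))"
    using Re_expo_near[OF R D bp] by blast
  obtain C4 \<eta>4 where C4: "C4 \<ge> 0" "\<eta>4 > 0" and RF: "\<And>n k \<omega>0 \<omega> \<theta> \<delta>. k > 0 \<Longrightarrow> k \<le> n \<Longrightarrow> \<bar>real k / k0 n - 1\<bar> \<ge> 1/2 \<Longrightarrow> rad k < r \<Longrightarrow> rad k \<le> 1 \<Longrightarrow> rad k \<le> \<eta>4 \<Longrightarrow>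
    norm \<omega>0 \<le> R \<Longrightarrow> norm \<omega> \<le> R \<Longrightarrow> norm \<delta> \<le> D / real k \<Longrightarrow> Re (expo n k \<omega>0 \<omega> \<theta> \<delta>) \<le> C4 - real n / 128"
    using Re_expo_far[OF R D] by blast
  obtain Cg where Cg: "Cg \<ge> 0" and G: "\<And>\<omega> k. norm \<omega> \<le> R \<Longrightarrow> k \<ge> 1 \<Longrightarrow>
     norm (gprod \<omega> k) \<le> Cg \<and> norm (gprod \<omega> k - rGamma (1 + \<omega>)) \<le> Cg / real k"
    using gprod_rate[OF R] by blast
  define M where "M = 2 * Cg + 1"
  have M: "M \<ge> 1" "Cg \<le> M" using Cg by (auto simp: M_def)
  \<comment> \<open>1/\<Gamma>(1 + \<omega>) is bounded through the rate at k = 1, which gives 2 Cg;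
    the additional 1 in \<open>M\<close> is for \<open>norm_power_diff_le\<close>.\<close>
  have GM: "norm (rGamma (1 + \<omega>)) \<le> M" if "norm \<omega> \<le> R" for \<omega> :: complex
    using norm_triangle_ineq4[of "gprod \<omega> 1" "gprod \<omega> 1 - rGamma (1 + \<omega>)"] G[OF that, of 1] by (simp add: M_def)
  \<comment> \<open>\<open>c3\<close> is the rate available for the exponent, 1/2 and \<mu> are
    those of \<open>Re_quad_le\<close>.\<close>
  define c' where "c' = min c3 (min (1/2) \<mu>)"
  have c': "c' > 0" "c' \<le> c3" "c' \<le> 1/2" "c' \<le> \<mu>" using C3 mu_pos by (auto simp: c'_def)
  define c where "c = c' / 2"
  have c: "c > 0" "c \<le> c'" using c' by (auto simp: c_def)
  define Cm where "Cm = max C3 ((c2 - c1)\<^sup>2 / 2 + \<bar>\<kappa>\<bar>)"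
  have Cm: "C3 \<le> Cm" "(c2 - c1)\<^sup>2 / 2 + \<bar>\<kappa>\<bar> \<le> Cm" by (auto simp: Cm_def)
  obtain Ca where Ca: "Ca \<ge> 0" "\<And>x::real. (1 + \<bar>x\<bar>) ^ 3 * exp (- c' * x\<^sup>2) \<le> Ca * exp (- c * x\<^sup>2)"
    using gaussian_absorb[OF c'(1), of 3 0] by (auto simp: c_def)
  define Cr where "Cr = sqrt (4 * real \<alpha> * lam0 * ln 2)"
  have al: "real \<alpha> > 0" using alpha_pos by simp
  note l0 = lam0_pos
  have Cr: "Cr \<ge> 0" using al l0 by (simp add: Cr_def)
  define Cv where "Cv = real \<alpha> * M ^ \<alpha> * (Cg * (4 * real \<alpha> * lam0)) * (1 + B) + M ^ \<alpha> * (B * Cr)"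
  have Cv: "Cv \<ge> 0" using al l0 M Cg B_nonneg Cr by (auto simp: Cv_def intro!: add_nonneg_nonneg mult_nonneg_nonneg)
  define Ct where "Ct = Cv * exp Cm + M ^ \<alpha> * (exp Cm * (C2 * (Ca * Ca)))"
  have Ct: "Ct \<ge> 0" using Cv M C2 Ca by (auto simp: Ct_def intro!: add_nonneg_nonneg mult_nonneg_nonneg)
  define Cf where "Cf = M ^ \<alpha> * (1 + B)"
  have Cf: "Cf \<ge> 0" using M B_nonneg by (auto simp: Cf_def)
  define \<eta> where "\<eta> = min (r / 2) (min 1 \<eta>4)"
  have \<eta>: "\<eta> > 0" "\<eta> < r" "\<eta> \<le> 1" "\<eta> \<le> \<eta>4" using r_pos C4 by (auto simp: \<eta>_def min_def)
  \<comment> \<open>Threshold with two purposes: the product asymptotics, and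
    \<open>rad k \<le> \<eta>\<close> from then on.\<close>
  define K where "K = nat \<lceil>max (4 * R + 1) (1 / \<eta>\<^sup>2)\<rceil>"
  have K: "real K \<ge> 4 * R + 1" "real K \<ge> 1 / \<eta>\<^sup>2" unfolding K_def by linarith+
  have K0: "K > 0" using K(1) R by (cases K) auto
  define Cx where "Cx = M + Ct + Cf * exp Cm + Cf * exp C4"
  have Cx: "Cx \<ge> 1" "M \<le> Cx" "Ct \<le> Cx" "Cf * exp Cm \<le> Cx" "Cf * exp C4 \<le> Cx"
  proof -
    have "0 \<le> Cf * exp Cm" "0 \<le> Cf * exp C4" using Cf by auto
    thus "Cx \<ge> 1" "M \<le> Cx" "Ct \<le> Cx" "Cf * exp Cm \<le> Cx" "Cf * exp C4 \<le> Cx"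
      using M Ct unfolding Cx_def by linarith+
  qed
  show ?thesis
  proof (rule exI[of _ Cx], rule conjI, rule Cx(1), rule exI[of _ c], rule conjI, rule c(1), rule exI[of _ K], rule conjI, rule K0, intro allI impI)
    fix n k :: nat and \<omega>0 \<omega> :: complex and \<theta> :: real
    assume n: "n > 0" and k: "k \<ge> K" and w: "norm \<omega>0 \<le> R" "norm \<omega> \<le> R"
    have kK: "real k \<ge> real K" using k by simp
    have k1: "k \<ge> 1" using k K0 by simp
    have k4: "real k \<ge> 4 * R + 1" using kK K by linarith
    have rk: "rad k \<le> \<eta>" using kK K \<eta> by (intro rad_small) linarith+
    have rk': "rad k < r" "rad k \<le> 1" "rad k \<le> \<eta>4" using rk \<eta> by linarith+
    obtain \<delta> where d: "norm \<delta> \<le> D / real k" and ie: "integrand n k \<omega>0 \<omega> (wt k \<theta>) =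
        scale n \<omega> * (gprod \<omega> k ^ \<alpha> * (1 - wt k \<theta> * deriv q (wt k \<theta>)) * exp (expo n k \<omega>0 \<omega> \<theta> \<delta>))"
      using IE[OF w(2) k4 n] by blast
    define g where "g = gprod \<omega> k"
    define v where "v = 1 - wt k \<theta> * deriv q (wt k \<theta>)"
    define E where "E = expo n k \<omega>0 \<omega> \<theta> \<delta>"
    define \<Gamma>' where "\<Gamma>' = rGamma (1 + \<omega>)"
    define X where "X = Xv n k"
    define u where "u = sqrt (real n) * \<theta>"
    have J: "nint n k \<omega>0 \<omega> \<theta> = g ^ \<alpha> * v * exp E" unfolding nint_def ie by (simp add: g_def v_def E_def)
    have gM: "norm g \<le> M" using G[OF w(2) k1] M by (auto simp: g_def)
    have GM': "norm \<Gamma>' \<le> M" using GM[OF w(2)] by (simp add: \<Gamma>'_def)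
    have v1: "norm (v - 1) \<le> B * rad k" using dq_bound[of "wt k \<theta>"] rk' by (simp add: v_def norm_wt norm_minus_commute)
    have vB: "norm v \<le> 1 + B"
    proof -
      have "B * rad k \<le> B * 1" using rk' B_nonneg by (intro mult_left_mono) auto
      thus ?thesis using norm_triangle_ineq[of "v - 1" 1] v1 by simp
    qed
    have pre: "norm (g ^ \<alpha> * v) \<le> Cf"
      unfolding norm_mult norm_power Cf_def using gM vB M by (intro mult_mono power_mono) auto
    have nrm: "norm (nint n k \<omega>0 \<omega> \<theta>) \<le> Cf * exp (Re E)"
      unfolding J norm_mult[of "g ^ \<alpha> * v"] norm_exp_eq_Re using pre by (intro mult_right_mono) auto
    have right: "norm (nint n k \<omega>0 \<omega> \<theta> - \<Gamma>' ^ \<alpha> * exp (of_real \<kappa> + quad X u)) \<le> Cx / sqrt (real n) * exp (- c * X\<^sup>2) * exp (- c * u\<^sup>2)"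
      if near: "\<bar>real k / k0 n - 1\<bar> \<le> 1/2" and th: "\<bar>\<theta>\<bar> \<le> pi / 2"
    proof -
      define N where "N = sqrt (real n)"
      have N: "N \<ge> 1" "N\<^sup>2 = real n" using n by (auto simp: N_def)
      have kp: "k0 n > 0" by (rule k0_pos[OF n])
      have ks: "real k \<ge> 1/2 * k0 n"
      proof -
        have "real k / k0 n \<ge> 1/2" using near unfolding abs_le_iff by linarith
        thus ?thesis using kp by (simp add: field_simps)
      qed
      have k0n: "1/2 * k0 n = real n / (4 * real \<alpha> * lam0)" by (simp add: k0_def)
      have ik: "1 / real k \<le> 4 * real \<alpha> * lam0 * (1 / real n)"
      proof -
        have "1 / real k \<le> 1 / (1/2 * k0 n)" using ks kp k1 by (intro divide_left_mono mult_pos_pos) auto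
        thus ?thesis unfolding k0n by simp
      qed
      have nN: "1 / real n \<le> 1 / N"
      proof -
        have "N * 1 \<le> N * N" using N by (intro mult_left_mono) auto
        thus ?thesis unfolding N(2)[symmetric] power2_eq_square using N by (intro divide_left_mono) auto
      qed
      have \<rho>N: "rad k \<le> Cr / N"
      proof -
        have "(rad k)\<^sup>2 = ln 2 * (1 / real k)" using rad_square[of k] k1 by simp
        also have "\<dots> \<le> ln 2 * (4 * real \<alpha> * lam0 * (1 / real n))" using ik by (intro mult_left_mono) auto
        also have "\<dots> = (Cr / N)\<^sup>2" using al l0 by (simp add: Cr_def power_divide N(2))
        finally have "(rad k)\<^sup>2 \<le> (Cr / N)\<^sup>2" .
        moreover have "0 \<le> Cr / N" using N Cr by simp
        ultimately show ?thesis by (rule power2_le_imp_le)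
      qed
      define m where "m = Cm - c' * X\<^sup>2 - c' * u\<^sup>2"
      define Q where "Q = of_real \<kappa> + quad X u"
      have sqs: "c' * X\<^sup>2 \<le> c3 * X\<^sup>2" "c' * u\<^sup>2 \<le> c3 * u\<^sup>2" "c' * X\<^sup>2 \<le> 1/2 * X\<^sup>2" "c' * u\<^sup>2 \<le> \<mu> * u\<^sup>2"
        using c' by (auto intro!: mult_right_mono simp del: times_divide_eq_left)
      have m1: "Re E \<le> m"
        using RN[OF n near rk'(1,2) w d, of \<theta>] th sqs(1,2) Cm(1) unfolding E_def m_def X_def u_def by linarith
      have m2: "Re Q \<le> m"
        using Re_quad_le[of X u] sqs(3,4) Cm(2) unfolding Q_def m_def by simp
      have em: "exp m = exp Cm * (exp (- c' * X\<^sup>2) * exp (- c' * u\<^sup>2))"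
        by (simp add: m_def exp_add[symmetric])
      have "norm (exp E - exp Q) \<le> exp m * norm (E - Q)" by (rule norm_exp_diff_le[OF m1 m2])
      also have "\<dots> \<le> exp m * (C2 * ((1 + \<bar>X\<bar>) ^ 3 * (1 + \<bar>u\<bar>) ^ 3 / N))"
        using EN[OF n near rk'(1,2) th w d] by (intro mult_left_mono) (auto simp: E_def Q_def X_def u_def N_def)
      also have "\<dots> = exp Cm * C2 / N * (((1 + \<bar>X\<bar>) ^ 3 * exp (- c' * X\<^sup>2)) * ((1 + \<bar>u\<bar>) ^ 3 * exp (- c' * u\<^sup>2)))"
        unfolding em by simp
      also have "\<dots> \<le> exp Cm * C2 / N * ((Ca * exp (- c * X\<^sup>2)) * (Ca * exp (- c * u\<^sup>2)))"
        using C2 N Ca by (intro mult_left_mono mult_mono Ca(2)) auto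
      finally have d1: "norm (exp E - exp Q) \<le> exp Cm * (C2 * (Ca * Ca)) / N * (exp (- c * X\<^sup>2) * exp (- c * u\<^sup>2))"
        by (simp add: mult_ac)
      have d2: "norm (exp E) \<le> exp Cm * (exp (- c * X\<^sup>2) * exp (- c * u\<^sup>2))"
      proof -
        have "norm (exp E) \<le> exp m" using m1 by simp
        also have "\<dots> \<le> exp Cm * (exp (- c * X\<^sup>2) * exp (- c * u\<^sup>2))"
          unfolding em using c by (intro mult_left_mono mult_mono) (auto intro!: mult_right_mono)
        finally show ?thesis .
      qed
      \<comment> \<open>\<open>gprod\<close> is off by O(1/k) and the Jacobian by
        O(\<open>rad k\<close>); the latter dominates and already limits the rate to
        n^(-1/2).\<close>
      have d3: "norm (g ^ \<alpha> * v - \<Gamma>' ^ \<alpha>) \<le> Cv / N"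
      proof -
        have "g ^ \<alpha> * v - \<Gamma>' ^ \<alpha> = (g ^ \<alpha> - \<Gamma>' ^ \<alpha>) * v + \<Gamma>' ^ \<alpha> * (v - 1)" by (simp add: algebra_simps)
        also have "norm \<dots> \<le> norm (g ^ \<alpha> - \<Gamma>' ^ \<alpha>) * norm v + norm \<Gamma>' ^ \<alpha> * norm (v - 1)"
          by (rule order_trans[OF norm_triangle_ineq]) (simp add: norm_mult norm_power)
        also have "\<dots> \<le> (real \<alpha> * M ^ \<alpha> * (Cg * (4 * real \<alpha> * lam0) * (1 / N))) * (1 + B) + M ^ \<alpha> * (B * (Cr / N))"
        proof (intro add_mono mult_mono vB)
          have "norm (g - \<Gamma>') \<le> Cg * (1 / real k)" using G[OF w(2) k1] by (simp add: g_def \<Gamma>'_def)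
          also have "\<dots> \<le> Cg * (4 * real \<alpha> * lam0 * (1 / N))"
          proof (rule mult_left_mono[OF order_trans[OF ik] Cg])
            show "4 * real \<alpha> * lam0 * (1 / real n) \<le> 4 * real \<alpha> * lam0 * (1 / N)" using nN al l0 by (intro mult_left_mono) auto
          qed
          finally have "norm (g - \<Gamma>') \<le> Cg * (4 * real \<alpha> * lam0) * (1 / N)" by (simp add: mult_ac)
          thus "norm (g ^ \<alpha> - \<Gamma>' ^ \<alpha>) \<le> real \<alpha> * M ^ \<alpha> * (Cg * (4 * real \<alpha> * lam0) * (1 / N))"
            using M by (intro order_trans[OF norm_power_diff_le[OF gM GM' M(1)]] mult_left_mono) auto
          show "norm \<Gamma>' ^ \<alpha> \<le> M ^ \<alpha>" using GM' by (intro power_mono) auto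
          show "norm (v - 1) \<le> B * (Cr / N)" by (rule order_trans[OF v1 mult_left_mono[OF \<rho>N B_nonneg]])
        qed (use M Cg al l0 N in auto)
        also have "\<dots> = Cv / N" by (simp add: Cv_def add_divide_distrib mult_ac)
        finally show ?thesis .
      qed
      have "nint n k \<omega>0 \<omega> \<theta> - \<Gamma>' ^ \<alpha> * exp Q = (g ^ \<alpha> * v - \<Gamma>' ^ \<alpha>) * exp E + \<Gamma>' ^ \<alpha> * (exp E - exp Q)"
        unfolding J by (simp add: algebra_simps)
      also have "norm \<dots> \<le> norm (g ^ \<alpha> * v - \<Gamma>' ^ \<alpha>) * norm (exp E) + norm \<Gamma>' ^ \<alpha> * norm (exp E - exp Q)"
        by (rule order_trans[OF norm_triangle_ineq]) (simp add: norm_mult norm_power)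
      also have "\<dots> \<le> (Cv / N) * (exp Cm * (exp (- c * X\<^sup>2) * exp (- c * u\<^sup>2))) + M ^ \<alpha> * (exp Cm * (C2 * (Ca * Ca)) / N * (exp (- c * X\<^sup>2) * exp (- c * u\<^sup>2)))"
        using GM' M N Cv by (intro add_mono mult_mono d1 d2 d3 power_mono) auto
      also have "\<dots> = Ct / N * (exp (- c * X\<^sup>2) * exp (- c * u\<^sup>2))"
        by (simp add: Ct_def add_divide_distrib algebra_simps)
      also have "\<dots> \<le> Cx / N * (exp (- c * X\<^sup>2) * exp (- c * u\<^sup>2))"
        using Cx N by (intro mult_right_mono divide_right_mono) auto
      finally show ?thesis by (simp add: Q_def N_def mult_ac)
    qed
    have left: "norm (nint n k \<omega>0 \<omega> \<theta>) \<le> Cx * exp (- c * X\<^sup>2) * exp (- \<beta> * sqrt (real n))"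
      if near: "\<bar>real k / k0 n - 1\<bar> \<le> 1/2" and th: "cos \<theta> \<le> 0"
    proof -
      have "c * X\<^sup>2 \<le> c3 * X\<^sup>2" using c c' by (intro mult_right_mono) auto
      hence "Re E \<le> Cm - c * X\<^sup>2 - \<beta> * sqrt (real n)"
        using RN[OF n near rk'(1,2) w d, of \<theta>] th Cm(1) unfolding E_def X_def by linarith
      hence "exp (Re E) \<le> exp (Cm - c * X\<^sup>2 - \<beta> * sqrt (real n))" by simp
      also have "\<dots> = exp Cm * (exp (- c * X\<^sup>2) * exp (- \<beta> * sqrt (real n)))" by (simp add: exp_add[symmetric])
      finally have "Cf * exp (Re E) \<le> Cf * (exp Cm * (exp (- c * X\<^sup>2) * exp (- \<beta> * sqrt (real n))))"
        using Cf by (intro mult_left_mono) auto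
      also have "\<dots> = (Cf * exp Cm) * (exp (- c * X\<^sup>2) * exp (- \<beta> * sqrt (real n)))" by simp
      also have "\<dots> \<le> Cx * (exp (- c * X\<^sup>2) * exp (- \<beta> * sqrt (real n)))" using Cx by (intro mult_right_mono) auto
      finally show ?thesis using nrm by (simp add: mult_ac)
    qed
    have far: "norm (nint n k \<omega>0 \<omega> \<theta>) \<le> Cx * exp (- real n / 128)" if f: "\<bar>real k / k0 n - 1\<bar> \<ge> 1/2" "k \<le> n"
    proof -
      have "Re E \<le> C4 - real n / 128" unfolding E_def using k1 by (intro RF f rk' w d) auto
      hence "exp (Re E) \<le> exp (C4 - real n / 128)" by simp
      also have "\<dots> = exp C4 * exp (- real n / 128)" by (simp add: exp_add[symmetric])
      finally have "Cf * exp (Re E) \<le> Cf * (exp C4 * exp (- real n / 128))" using Cf by (intro mult_left_mono) auto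
      also have "\<dots> = (Cf * exp C4) * exp (- real n / 128)" by simp
      also have "\<dots> \<le> Cx * exp (- real n / 128)" using Cx by (intro mult_right_mono) auto
      finally show ?thesis using nrm by linarith
    qed
    show "rad k < r \<and> norm (rGamma (1 + \<omega>)) \<le> Cx \<and>
     (\<bar>real k / k0 n - 1\<bar> \<le> 1/2 \<longrightarrow> \<bar>\<theta>\<bar> \<le> pi / 2 \<longrightarrow>
        norm (nint n k \<omega>0 \<omega> \<theta> - rGamma (1 + \<omega>) ^ \<alpha> * exp (of_real \<kappa> + quad (Xv n k) (sqrt (real n) * \<theta>)))
          \<le> Cx / sqrt (real n) * exp (- c * (Xv n k)\<^sup>2) * exp (- c * (sqrt (real n) * \<theta>)\<^sup>2)) \<and>
     (\<bar>real k / k0 n - 1\<bar> \<le> 1/2 \<longrightarrow> cos \<theta> \<le> 0 \<longrightarrow>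
        norm (nint n k \<omega>0 \<omega> \<theta>) \<le> Cx * exp (- c * (Xv n k)\<^sup>2) * exp (- \<beta> * sqrt (real n))) \<and>
     (\<bar>real k / k0 n - 1\<bar> \<ge> 1/2 \<longrightarrow> k \<le> n \<longrightarrow> norm (nint n k \<omega>0 \<omega> \<theta>) \<le> Cx * exp (- real n / 128))"
      using rk'(1) order_trans[OF GM[OF w(2)] Cx(2)] right left far unfolding \<Gamma>'_def X_def u_def by blast
  qed
qed

end

section \<open>From Gaussian sums to Gaussian integrals\<close>

text \<open>The step size accounts for the term h, the truncation at distance T for 1/T^2. The tail
  is bounded by splitting the Gaussian into two halves: one is at most a multiple of 1/T^2, the
  other is integrated.\<close>

lemma gaussian_riemann_limit:
  fixes a b c :: real
  assumes a: "a > 0"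
  shows "\<exists>C\<ge>0. \<forall>h t T. \<forall>k1 k2::nat. 0 < h \<longrightarrow> h \<le> 1 \<longrightarrow> k1 \<le> k2 \<longrightarrow> T > 0 \<longrightarrow> h * real k1 - t \<le> - T \<longrightarrow> h * real k2 - t \<ge> T \<longrightarrow>
    \<bar>(\<Sum>k=k1..<k2. h * exp (- a * (h * real k - t)\<^sup>2 + b * (h * real k - t) + c)) - sqrt (pi / a) * exp (b\<^sup>2 / (4 * a) + c)\<bar>
      \<le> C * (h + 1 / T\<^sup>2)"
proof -
  define f where "f = (\<lambda>x. exp (- a * x\<^sup>2 + b * x + c))"
  define f' where "f' = (\<lambda>x. f x * (- 2 * a * x + b))"
  obtain C1 where C1: "C1 \<ge> 0" "\<And>x::real. (1 + \<bar>x\<bar>) ^ 1 * exp (\<bar>b\<bar> * \<bar>x\<bar>) * exp (- a * x\<^sup>2) \<le> C1 * exp (- (a / 2) * x\<^sup>2)"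
    using gaussian_absorb[OF a, of 1 "\<bar>b\<bar>"] by blast
  define C2 where "C2 = exp c * (2 * a + \<bar>b\<bar> + 1) * C1"
  have C2: "C2 \<ge> 0" using a C1 by (auto simp: C2_def)
  have fle: "f x \<le> exp c * (exp (\<bar>b\<bar> * \<bar>x\<bar>) * exp (- a * x\<^sup>2))" for x
  proof -
    have "b * x \<le> \<bar>b\<bar> * \<bar>x\<bar>" by (metis abs_ge_self abs_mult)
    hence "f x \<le> exp (c + (\<bar>b\<bar> * \<bar>x\<bar> + - a * x\<^sup>2))" unfolding f_def by simp
    thus ?thesis by (simp only: exp_add)
  qed
  have fb: "(1 + \<bar>x\<bar>) * f x \<le> exp c * (C1 * exp (- (a / 2) * x\<^sup>2))" for x
  proof -
    have "(1 + \<bar>x\<bar>) * f x \<le> (1 + \<bar>x\<bar>) * (exp c * (exp (\<bar>b\<bar> * \<bar>x\<bar>) * exp (- a * x\<^sup>2)))" by (intro mult_left_mono fle) auto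
    also have "\<dots> = exp c * ((1 + \<bar>x\<bar>) ^ 1 * exp (\<bar>b\<bar> * \<bar>x\<bar>) * exp (- a * x\<^sup>2))" by simp
    also have "\<dots> \<le> exp c * (C1 * exp (- (a / 2) * x\<^sup>2))" by (intro mult_left_mono C1) auto
    finally show ?thesis .
  qed
  have f0: "f x > 0" for x by (simp add: f_def)
  have fb0: "f x \<le> C2 * exp (- (a / 2) * x\<^sup>2)" for x
  proof -
    have "f x * 1 \<le> f x * (1 + \<bar>x\<bar>)" using f0[of x] by (intro mult_left_mono) auto
    also have "\<dots> \<le> exp c * (C1 * exp (- (a / 2) * x\<^sup>2))" using fb[of x] by (simp add: mult.commute)
    also have "\<dots> = (exp c * 1 * C1) * exp (- (a / 2) * x\<^sup>2)" by simp
    also have "\<dots> \<le> C2 * exp (- (a / 2) * x\<^sup>2)" unfolding C2_def using a C1 by (intro mult_right_mono mult_left_mono) auto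
    finally show ?thesis by simp
  qed
  have der: "(f has_real_derivative f' x) (at x)" for x
    unfolding f_def f'_def by (auto intro!: derivative_eq_intros)
  have bound: "\<bar>f' x\<bar> \<le> C2 * exp (- (a / 2) * x\<^sup>2)" for x
  proof -
    have "\<bar>- 2 * a * x + b\<bar> \<le> 2 * a * \<bar>x\<bar> + \<bar>b\<bar>"
      using a by (intro order_trans[OF abs_triangle_ineq]) (auto simp: abs_mult)
    also have "\<dots> \<le> (2 * a + \<bar>b\<bar> + 1) * (1 + \<bar>x\<bar>)" using a by (simp add: algebra_simps)
    finally have "\<bar>f' x\<bar> \<le> f x * ((2 * a + \<bar>b\<bar> + 1) * (1 + \<bar>x\<bar>))"
      unfolding f'_def abs_mult using f0[of x] by (simp add: mult_left_mono)
    also have "\<dots> = (2 * a + \<bar>b\<bar> + 1) * ((1 + \<bar>x\<bar>) * f x)" by simp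
    also have "\<dots> \<le> (2 * a + \<bar>b\<bar> + 1) * (exp c * (C1 * exp (- (a / 2) * x\<^sup>2)))" using a by (intro mult_left_mono fb) auto
    finally show ?thesis by (simp add: C2_def mult_ac)
  qed
  define C3 where "C3 = C2 * exp (a / 2) * sqrt (2 * pi / (a / 2))"
  define C4 where "C4 = C2 * (4 / a) * sqrt (pi / (a / 4))"
  have C34: "C3 \<ge> 0" "C4 \<ge> 0" using C2 a by (auto simp: C3_def C4_def)
  define I where "I = sqrt (pi / a) * exp (b\<^sup>2 / (4 * a) + c)"
  have fI: "(f has_integral I) UNIV" unfolding f_def I_def by (rule has_integral_gaussian_real[OF a])
  show ?thesis
  proof (rule exI[of _ "C3 + C4"], intro conjI allI impI)
    fix h t T :: real and k1 k2 :: nat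
    assume h: "0 < h" "h \<le> 1" and k: "k1 \<le> k2" and T: "T > 0" and X: "h * real k1 - t \<le> - T" "h * real k2 - t \<ge> T"
    let ?p = "h * real k1 - t" and ?q = "h * real k2 - t"
    have r: "\<bar>(\<Sum>k=k1..<k2. h * f (h * real k - t)) - integral {?p..?q} f\<bar> \<le> h * C3"
      unfolding C3_def by (rule riemann_sum_gaussian[OF der bound _ C2 h k]) (use a in auto)
    define E where "E = (\<lambda>x. C2 * (4 / (a * T\<^sup>2)) * exp (- (a / 4) * x\<^sup>2 + 0 * x + 0))"
    have Ei: "(E has_integral C2 * (4 / (a * T\<^sup>2)) * (sqrt (pi / (a / 4)) * exp (0\<^sup>2 / (4 * (a / 4)) + 0))) UNIV"
      unfolding E_def using a by (intro has_integral_mult_right has_integral_gaussian_real) auto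
    have fpq: "(f has_integral integral {?p..?q} f) {?p..?q}"
      unfolding f_def by (intro integrable_integral integrable_continuous_real continuous_intros)
    have "norm (integral {?p..?q} f - I) \<le> C2 * (4 / (a * T\<^sup>2)) * (sqrt (pi / (a / 4)) * exp (0\<^sup>2 / (4 * (a / 4)) + 0))"
    proof (rule has_integral_compare[OF fI fpq Ei])
      show "norm (f x - f x) \<le> E x" for x using C2 a by (simp add: E_def)
      fix x assume "x \<notin> {?p..?q}"
      hence "\<bar>x\<bar> \<ge> T" using X T by auto
      hence x2: "T\<^sup>2 \<le> x\<^sup>2" using T by (metis abs_le_square_iff abs_of_pos)
      have xp: "x\<^sup>2 > 0" using x2 T by (smt (verit) zero_less_power)
      have "exp (- (a / 2) * x\<^sup>2) = exp (- (a / 4 * x\<^sup>2)) * exp (- (a / 4) * x\<^sup>2)" by (simp add: exp_add[symmetric])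
      also have "\<dots> \<le> (1 / (a / 4 * T\<^sup>2)) * exp (- (a / 4) * x\<^sup>2)"
      proof (rule mult_right_mono)
        have "exp (- (a / 4 * x\<^sup>2)) \<le> 1 / (a / 4 * x\<^sup>2)" using a xp by (intro exp_minus_le_inverse) auto
        also have "\<dots> \<le> 1 / (a / 4 * T\<^sup>2)" using a xp x2 T by (intro divide_left_mono mult_left_mono mult_pos_pos) auto
        finally show "exp (- (a / 4 * x\<^sup>2)) \<le> 1 / (a / 4 * T\<^sup>2)" .
      qed auto
      finally have "C2 * exp (- (a / 2) * x\<^sup>2) \<le> C2 * ((1 / (a / 4 * T\<^sup>2)) * exp (- (a / 4) * x\<^sup>2))" using C2 by (intro mult_left_mono) auto
      hence "f x \<le> C2 * ((1 / (a / 4 * T\<^sup>2)) * exp (- (a / 4) * x\<^sup>2))" using fb0[of x] by linarith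
      thus "norm (f x) \<le> E x" using f0[of x] by (simp add: E_def)
    qed
    hence t: "\<bar>integral {?p..?q} f - I\<bar> \<le> C4 * (1 / T\<^sup>2)" by (simp add: C4_def)
    have "\<bar>(\<Sum>k=k1..<k2. h * f (h * real k - t)) - I\<bar> \<le> h * C3 + C4 * (1 / T\<^sup>2)" using r t by linarith
    also have "\<dots> \<le> (C3 + C4) * (h + 1 / T\<^sup>2)"
    proof -
      have "(C3 + C4) * (h + 1 / T\<^sup>2) = h * C3 + C4 * (1 / T\<^sup>2) + (C4 * h + C3 * (1 / T\<^sup>2))"
        by (simp only: distrib_left distrib_right mult.commute[of h] add_ac)
      moreover have "0 \<le> C4 * h" "0 \<le> C3 * (1 / T\<^sup>2)" using C34 h by simp_all
      ultimately show ?thesis by linarith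
    qed
    finally show "\<bar>(\<Sum>k=k1..<k2. h * exp (- a * (h * real k - t)\<^sup>2 + b * (h * real k - t) + c)) - sqrt (pi / a) * exp (b\<^sup>2 / (4 * a) + c)\<bar>
      \<le> (C3 + C4) * (h + 1 / T\<^sup>2)" unfolding f_def I_def .
  qed (use C34 in auto)
qed

section \<open>Summation over \<open>k\<close>\<close>

text \<open>\<open>a\<close> abstracts the coefficients of the single summands. The integral is
  assumed on every small circle, since each large \<open>k\<close> uses its own radius
  \<open>rad k\<close>, and bounded \<open>k\<close> use one fixed radius.\<close>

locale saddle_coeff = saddle +
  fixes a :: "nat \<Rightarrow> nat \<Rightarrow> complex \<Rightarrow> complex \<Rightarrow> complex"
  assumes beta_pos: "\<beta> > 0"
    and coeff: "\<And>n k \<omega>0 \<omega> \<rho>. 0 < \<rho> \<Longrightarrow> \<rho> < r \<Longrightarrow>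
      ((\<lambda>\<theta>. integrand n k \<omega>0 \<omega> (of_real \<rho> * cis \<theta>)) has_integral (2 * pi * a n k \<omega>0 \<omega>)) {-(pi/2)..3*pi/2}"
begin

definition na :: "nat \<Rightarrow> nat \<Rightarrow> complex \<Rightarrow> complex \<Rightarrow> complex" where
  "na n k \<omega>0 \<omega> = 2 * pi * a n k \<omega>0 \<omega> / scale n \<omega>"

text \<open>\<open>quad\<close> with the angle integrated out: the Gaussian in u turns the phase (2
  X + \<beta>) u into - (2 X + \<beta>)^2 / (4 \<mu>), which is here merged with - X^2 + (c2 - c1)
  X.\<close>

definition prof :: "real \<Rightarrow> real" where
  "prof X = exp (- (1 + 1 / \<mu>) * X\<^sup>2 + (c2 - c1 - \<beta> / \<mu>) * X + (- \<beta>\<^sup>2 / (4 * \<mu>)))"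

lemma nint_has_integral:
  assumes "k > 0" "rad k < r"
  shows "((\<lambda>\<theta>. nint n k \<omega>0 \<omega> \<theta>) has_integral na n k \<omega>0 \<omega>) {-(pi/2)..3*pi/2}"
proof -
  have "((\<lambda>\<theta>. integrand n k \<omega>0 \<omega> (of_real (rad k) * cis \<theta>) * (1 / scale n \<omega>)) has_integral (2 * pi * a n k \<omega>0 \<omega> * (1 / scale n \<omega>))) {-(pi/2)..3*pi/2}"
    by (intro has_integral_mult_left coeff rad_pos assms)
  thus ?thesis by (simp add: nint_def na_def wt_def)
qed

text \<open>The main term is of order n^(-1/2), from the width of the angular Gaussian, and the
  error is of order 1/n. The factor exp (- c X^2) keeps that error summable over the sqrt n relevant
  indices.\<close>

lemma coeff_bounds:
  assumes R: "R \<ge> 0"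
  shows "\<exists>C\<ge>1. \<exists>c>0. \<exists>K::nat. K > 0 \<and> (\<forall>n k \<omega>0 \<omega>. n > 0 \<longrightarrow> k \<ge> K \<longrightarrow> norm \<omega>0 \<le> R \<longrightarrow> norm \<omega> \<le> R \<longrightarrow>
     norm (rGamma (1 + \<omega>)) \<le> C \<and>
     (\<bar>real k / k0 n - 1\<bar> \<le> 1/2 \<longrightarrow>
        norm (na n k \<omega>0 \<omega> - rGamma (1 + \<omega>) ^ \<alpha> * of_real (exp \<kappa> * sqrt (pi / \<mu>) / sqrt (real n) * prof (Xv n k))) \<le> C / real n * exp (- c * (Xv n k)\<^sup>2)) \<and>
     (\<bar>real k / k0 n - 1\<bar> \<ge> 1/2 \<longrightarrow> k \<le> n \<longrightarrow> norm (na n k \<omega>0 \<omega>) \<le> C * exp (- real n / 128)))"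
proof -
  obtain C0 c0 and K :: nat where C0: "C0 \<ge> 1" "c0 > 0" "K > 0" and NB: "\<And>n k \<omega>0 \<omega> \<theta>. n > 0 \<Longrightarrow> k \<ge> K \<Longrightarrow> norm \<omega>0 \<le> R \<Longrightarrow> norm \<omega> \<le> R \<Longrightarrow>
     rad k < r \<and> norm (rGamma (1 + \<omega>)) \<le> C0 \<and>
     (\<bar>real k / k0 n - 1\<bar> \<le> 1/2 \<longrightarrow> \<bar>\<theta>\<bar> \<le> pi / 2 \<longrightarrow>
        norm (nint n k \<omega>0 \<omega> \<theta> - rGamma (1 + \<omega>) ^ \<alpha> * exp (of_real \<kappa> + quad (Xv n k) (sqrt (real n) * \<theta>)))
          \<le> C0 / sqrt (real n) * exp (- c0 * (Xv n k)\<^sup>2) * exp (- c0 * (sqrt (real n) * \<theta>)\<^sup>2)) \<and>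
     (\<bar>real k / k0 n - 1\<bar> \<le> 1/2 \<longrightarrow> cos \<theta> \<le> 0 \<longrightarrow>
        norm (nint n k \<omega>0 \<omega> \<theta>) \<le> C0 * exp (- c0 * (Xv n k)\<^sup>2) * exp (- \<beta> * sqrt (real n))) \<and>
     (\<bar>real k / k0 n - 1\<bar> \<ge> 1/2 \<longrightarrow> k \<le> n \<longrightarrow> norm (nint n k \<omega>0 \<omega> \<theta>) \<le> C0 * exp (- real n / 128))"
    using nint_bounds[OF R beta_pos] by blast
  note mp = mu_pos
  define c where "c = min c0 (min (1/2) (\<mu> / 2))"
  have c: "c > 0" "c \<le> c0" "c \<le> 1/2" "c \<le> \<mu> / 2" using C0 mp by (auto simp: c_def)
  define C1 where "C1 = C0 ^ \<alpha> * exp (\<bar>\<kappa>\<bar> + (c2 - c1)\<^sup>2 / 2) * (2 / \<mu>)"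
  have C1: "C1 \<ge> 0" using C0 mp by (simp add: C1_def)
  define C2 where "C2 = (C0 + C1) * sqrt (pi / c)"
  define C3 where "C3 = C0 * (4 / \<beta>\<^sup>2) * pi"
  have C23: "C2 \<ge> 0" "C3 \<ge> 0" using C0 C1 c by (auto simp: C2_def C3_def)
  define Cx where "Cx = C0 + C2 + C3 + C0 * (2 * pi)"
  have Cx: "1 \<le> Cx" "C0 \<le> Cx" "C2 + C3 \<le> Cx" "C0 * (2 * pi) \<le> Cx"
  proof -
    have "0 \<le> C0 * (2 * pi)" using C0 by auto
    thus "1 \<le> Cx" "C0 \<le> Cx" "C2 + C3 \<le> Cx" "C0 * (2 * pi) \<le> Cx" using C0 C23 unfolding Cx_def by linarith+
  qed
  show ?thesis
  proof (rule exI[of _ Cx], rule conjI, rule Cx(1), rule exI[of _ c], rule conjI, rule c(1), rule exI[of _ K], rule conjI, rule C0(3), intro allI impI)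
    fix n k :: nat and \<omega>0 \<omega> :: complex
    assume n: "n > 0" and k: "k \<ge> K" and w: "norm \<omega>0 \<le> R" "norm \<omega> \<le> R"
    note B = NB[OF n k w]
    have kp: "k > 0" using k C0 by simp
    have rk: "rad k < r" using B by blast
    note int = nint_has_integral[OF kp rk, of n \<omega>0 \<omega>]
    define \<Gamma>' where "\<Gamma>' = rGamma (1 + \<omega>)"
    define X where "X = Xv n k"
    define N where "N = sqrt (real n)"
    have N: "N \<ge> 1" "N\<^sup>2 = real n" using n by (auto simp: N_def)
    have GM: "norm \<Gamma>' \<le> C0" using B by (simp add: \<Gamma>'_def)
    have near: "norm (na n k \<omega>0 \<omega> - \<Gamma>' ^ \<alpha> * of_real (exp \<kappa> * sqrt (pi / \<mu>) / N * prof X)) \<le> Cx / real n * exp (- c * X\<^sup>2)"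
      if nr: "\<bar>real k / k0 n - 1\<bar> \<le> 1/2"
    proof -
      have cX: "exp (- c0 * X\<^sup>2) \<le> exp (- c * X\<^sup>2)" using c by (simp add: mult_right_mono)
      define H where "H = (\<lambda>\<theta>. \<Gamma>' ^ \<alpha> * exp (of_real \<kappa> + quad X (N * \<theta>)))"
      have mN: "\<mu> * real n > 0" using mp n by simp
      have Hi: "(H has_integral \<Gamma>' ^ \<alpha> * of_real (exp \<kappa> * sqrt (pi / \<mu>) / N * prof X)) UNIV"
      proof -
        define P where "P = \<Gamma>' ^ \<alpha> * of_real (exp (\<kappa> + (- X\<^sup>2 + (c2 - c1) * X)))"
        have "((\<lambda>u. P * exp (of_real (- (\<mu> * real n) * u\<^sup>2) + \<i> * of_real (((2 * X + \<beta>) * N) * u))) has_integral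
            P * of_real (sqrt (pi / (\<mu> * real n)) * exp (- ((2 * X + \<beta>) * N)\<^sup>2 / (4 * (\<mu> * real n))))) UNIV"
          by (intro has_integral_mult_right has_integral_gaussian_complex mN)
        moreover have "P * exp (of_real (- (\<mu> * real n) * u\<^sup>2) + \<i> * of_real (((2 * X + \<beta>) * N) * u)) = H u" for u
        proof -
          have "of_real \<kappa> + quad X (N * u) = of_real (\<kappa> + (- X\<^sup>2 + (c2 - c1) * X)) + (of_real (- (\<mu> * real n) * u\<^sup>2) + \<i> * of_real (((2 * X + \<beta>) * N) * u))"
            unfolding quad_def N(2)[symmetric] by (simp add: power_mult_distrib algebra_simps)
          hence "exp (of_real \<kappa> + quad X (N * u)) = of_real (exp (\<kappa> + (- X\<^sup>2 + (c2 - c1) * X))) * exp (of_real (- (\<mu> * real n) * u\<^sup>2) + \<i> * of_real (((2 * X + \<beta>) * N) * u))"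
            by (simp only: exp_add[of "of_real (\<kappa> + (- X\<^sup>2 + (c2 - c1) * X))"] exp_of_real)
          thus ?thesis unfolding H_def P_def by (simp only: mult.assoc)
        qed
        moreover have "P * of_real (sqrt (pi / (\<mu> * real n)) * exp (- ((2 * X + \<beta>) * N)\<^sup>2 / (4 * (\<mu> * real n)))) = \<Gamma>' ^ \<alpha> * of_real (exp \<kappa> * sqrt (pi / \<mu>) / N * prof X)"
        proof -
          have e1: "((2 * X + \<beta>) * N)\<^sup>2 / (4 * (\<mu> * real n)) = (2 * X + \<beta>)\<^sup>2 / (4 * \<mu>)"
            unfolding power_mult_distrib N(2) using n mp by (simp add: field_simps)
          have e2: "sqrt (pi / (\<mu> * real n)) = sqrt (pi / \<mu>) / N"
            by (simp add: real_sqrt_divide real_sqrt_mult N_def)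
          have e3: "(- X\<^sup>2 + (c2 - c1) * X) + - ((2 * X + \<beta>)\<^sup>2 / (4 * \<mu>)) = - (1 + 1 / \<mu>) * X\<^sup>2 + (c2 - c1 - \<beta> / \<mu>) * X + (- \<beta>\<^sup>2 / (4 * \<mu>))"
            using mp by (simp add: field_simps power2_eq_square)
          have p: "prof X = exp (- X\<^sup>2 + (c2 - c1) * X) * exp (- ((2 * X + \<beta>)\<^sup>2 / (4 * \<mu>)))"
            unfolding exp_add[symmetric] e3 prof_def ..
          have k: "exp (\<kappa> + (- X\<^sup>2 + (c2 - c1) * X)) = exp \<kappa> * exp (- X\<^sup>2 + (c2 - c1) * X)" by (rule exp_add)
          have e1': "- ((2 * X + \<beta>) * N)\<^sup>2 / (4 * (\<mu> * real n)) = - ((2 * X + \<beta>)\<^sup>2 / (4 * \<mu>))"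
            by (simp only: minus_divide_left[symmetric] e1)
          have "exp (\<kappa> + (- X\<^sup>2 + (c2 - c1) * X)) * (sqrt (pi / (\<mu> * real n)) * exp (- ((2 * X + \<beta>) * N)\<^sup>2 / (4 * (\<mu> * real n))))
              = exp \<kappa> * sqrt (pi / \<mu>) / N * prof X"
            unfolding e1' e2 k p by (simp only: times_divide_eq_left times_divide_eq_right mult_ac)
          hence "complex_of_real (exp (\<kappa> + (- X\<^sup>2 + (c2 - c1) * X)) * (sqrt (pi / (\<mu> * real n)) * exp (- ((2 * X + \<beta>) * N)\<^sup>2 / (4 * (\<mu> * real n)))))
              = of_real (exp \<kappa> * sqrt (pi / \<mu>) / N * prof X)" by (rule arg_cong)
          thus ?thesis unfolding P_def mult.assoc of_real_mult[of "exp (\<kappa> + (- X\<^sup>2 + (c2 - c1) * X))"] by (simp only:)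
        qed
        ultimately show ?thesis by (simp only:)
      qed
      have sub: "{-(pi/2)..pi/2} \<subseteq> {-(pi/2)..3*pi/2}" "{pi/2..3*pi/2} \<subseteq> {-(pi/2)..3*pi/2}" by auto
      define J1 where "J1 = integral {-(pi/2)..pi/2} (nint n k \<omega>0 \<omega>)"
      define J2 where "J2 = integral {pi/2..3*pi/2} (nint n k \<omega>0 \<omega>)"
      have on: "nint n k \<omega>0 \<omega> integrable_on {-(pi/2)..3*pi/2}" using int by blast
      have i1: "(nint n k \<omega>0 \<omega> has_integral J1) {-(pi/2)..pi/2}"
        unfolding J1_def by (rule integrable_integral[OF integrable_on_subinterval[OF on sub(1)]])
      have i2: "(nint n k \<omega>0 \<omega> has_integral J2) {pi/2..3*pi/2}"
        unfolding J2_def by (rule integrable_integral[OF integrable_on_subinterval[OF on sub(2)]])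
      have na: "na n k \<omega>0 \<omega> = J1 + J2"
      proof -
        have "J1 + J2 = integral {-(pi/2)..3*pi/2} (nint n k \<omega>0 \<omega>)"
          unfolding J1_def J2_def by (rule Henstock_Kurzweil_Integration.integral_combine[OF _ _ on]) auto
        thus ?thesis using integral_unique[OF int] by simp
      qed
      define E where "E = (\<lambda>\<theta>. ((C0 + C1) / N * exp (- c * X\<^sup>2)) * exp (- (c * real n) * \<theta>\<^sup>2 + 0 * \<theta> + 0))"
      have cn: "c * real n > 0" using c n by simp
      have Ei: "(E has_integral ((C0 + C1) / N * exp (- c * X\<^sup>2)) * (sqrt (pi / (c * real n)) * exp (0\<^sup>2 / (4 * (c * real n)) + 0))) UNIV"
        unfolding E_def by (intro has_integral_mult_right has_integral_gaussian_real cn)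
      have "norm (J1 - \<Gamma>' ^ \<alpha> * of_real (exp \<kappa> * sqrt (pi / \<mu>) / N * prof X)) \<le> ((C0 + C1) / N * exp (- c * X\<^sup>2)) * (sqrt (pi / (c * real n)) * exp (0\<^sup>2 / (4 * (c * real n)) + 0))"
      proof (rule has_integral_compare[OF Hi i1 Ei])
        fix \<theta> :: real assume "\<theta> \<in> {-(pi/2)..pi/2}"
        hence "\<bar>\<theta>\<bar> \<le> pi / 2" by auto
        hence "norm (nint n k \<omega>0 \<omega> \<theta> - H \<theta>) \<le> C0 / N * exp (- c0 * X\<^sup>2) * exp (- c0 * (N * \<theta>)\<^sup>2)"
          using B[of \<theta>] nr unfolding H_def \<Gamma>'_def X_def N_def by blast
        also have "\<dots> \<le> (C0 + C1) / N * exp (- c * X\<^sup>2) * exp (- c * (N * \<theta>)\<^sup>2)"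
          using C0 C1 N c cX by (intro mult_mono divide_right_mono) (auto intro!: mult_right_mono)
        finally show "norm (nint n k \<omega>0 \<omega> \<theta> - H \<theta>) \<le> E \<theta>"
          by (simp add: E_def power_mult_distrib N(2) mult_ac)
      next
        fix \<theta> :: real assume "\<theta> \<notin> {-(pi/2)..pi/2}"
        hence "\<bar>\<theta>\<bar> > pi / 2" by auto
        hence "\<bar>\<theta>\<bar> \<ge> 1" using pi_gt3 by linarith
        \<comment> \<open>Outside the half circle \<theta>^2 \<ge> 1, so half of \<mu> (N
          \<theta>)^2 is at least \<mu> n / 2 and pays for the factor 1/N; the other half keeps the
          Gaussian shape of the majorant.\<close>
        hence t2: "\<theta>\<^sup>2 \<ge> 1" using abs_le_square_iff[of 1 \<theta>] by simp
        have "norm (H \<theta>) \<le> C0 ^ \<alpha> * exp (\<kappa> + Re (quad X (N * \<theta>)))"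
          unfolding H_def norm_mult norm_power norm_exp_eq_Re using GM by (auto intro!: mult_mono power_mono)
        also have "\<dots> \<le> C0 ^ \<alpha> * exp ((\<bar>\<kappa>\<bar> + (c2 - c1)\<^sup>2 / 2) + (- c * X\<^sup>2 + (- (\<mu> / 2 * real n) + - c * (N * \<theta>)\<^sup>2)))"
        proof -
          have a1: "c * X\<^sup>2 \<le> X\<^sup>2 / 2" using mult_right_mono[OF c(3), of "X\<^sup>2"] by simp
          have a2: "c * (N * \<theta>)\<^sup>2 \<le> \<mu> / 2 * (N * \<theta>)\<^sup>2" using c(4) by (intro mult_right_mono) auto
          have a3: "\<mu> / 2 * real n \<le> \<mu> / 2 * (N * \<theta>)\<^sup>2"
            unfolding power_mult_distrib N(2) using t2 mp n by (intro mult_left_mono) auto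
          have a4: "\<mu> * (N * \<theta>)\<^sup>2 = \<mu> / 2 * (N * \<theta>)\<^sup>2 + \<mu> / 2 * (N * \<theta>)\<^sup>2" by simp
          have a5: "\<kappa> \<le> \<bar>\<kappa>\<bar>" by simp
          have "\<kappa> + Re (quad X (N * \<theta>)) \<le> (\<bar>\<kappa>\<bar> + (c2 - c1)\<^sup>2 / 2) + (- c * X\<^sup>2 + (- (\<mu> / 2 * real n) + - c * (N * \<theta>)\<^sup>2))"
            using Re_quad_le[of X "N * \<theta>"] a1 a2 a3 a4 a5 by linarith
          thus ?thesis using C0 by (intro mult_left_mono) auto
        qed
        also have "\<dots> = C0 ^ \<alpha> * exp (\<bar>\<kappa>\<bar> + (c2 - c1)\<^sup>2 / 2) * exp (- (\<mu> / 2 * real n)) * (exp (- c * X\<^sup>2) * exp (- c * (N * \<theta>)\<^sup>2))"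
          by (simp only: exp_add mult_ac)
        also have "\<dots> \<le> C0 ^ \<alpha> * exp (\<bar>\<kappa>\<bar> + (c2 - c1)\<^sup>2 / 2) * (2 / \<mu> * (1 / N)) * (exp (- c * X\<^sup>2) * exp (- c * (N * \<theta>)\<^sup>2))"
        proof (intro mult_right_mono mult_left_mono)
          have "exp (- (\<mu> / 2 * real n)) \<le> 1 / (\<mu> / 2 * real n)" using mp n by (intro exp_minus_le_inverse) auto
          also have "\<dots> = 2 / \<mu> * (1 / real n)" by simp
          also have "\<dots> \<le> 2 / \<mu> * (1 / N)"
          proof (rule mult_left_mono)
            have "N * 1 \<le> N * N" using N by (intro mult_left_mono) auto
            thus "1 / real n \<le> 1 / N" unfolding N(2)[symmetric] power2_eq_square using N by (intro divide_left_mono) auto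
          qed (use mp in auto)
          finally show "exp (- (\<mu> / 2 * real n)) \<le> 2 / \<mu> * (1 / N)" .
        qed (use C0 in auto)
        also have "\<dots> = C1 / N * (exp (- c * X\<^sup>2) * exp (- c * (N * \<theta>)\<^sup>2))" by (simp add: C1_def)
        also have "\<dots> \<le> (C0 + C1) / N * (exp (- c * X\<^sup>2) * exp (- c * (N * \<theta>)\<^sup>2))"
          using C0 N by (intro mult_right_mono divide_right_mono) auto
        finally show "norm (H \<theta>) \<le> E \<theta>" by (simp add: E_def power_mult_distrib N(2) mult_ac)
      qed
      also have "\<dots> = C2 / real n * exp (- c * X\<^sup>2)"
      proof -
        have "sqrt (pi / (c * real n)) = sqrt (pi / c) / N" by (simp add: real_sqrt_divide real_sqrt_mult N_def)
        thus ?thesis using N by (simp add: C2_def N(2)[symmetric] power2_eq_square)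
      qed
      finally have b1: "norm (J1 - \<Gamma>' ^ \<alpha> * of_real (exp \<kappa> * sqrt (pi / \<mu>) / N * prof X)) \<le> C2 / real n * exp (- c * X\<^sup>2)" .
      have b2: "norm J2 \<le> C3 / real n * exp (- c * X\<^sup>2)"
      proof -
        have "norm J2 \<le> (C0 * exp (- c * X\<^sup>2) * (4 / \<beta>\<^sup>2 * (1 / real n))) * measure lborel {pi/2..3*pi/2}"
        proof (rule has_integral_bound_real[OF _ _ i2, of _ "{}"])
          fix \<theta> :: real assume t: "\<theta> \<in> {pi/2..3*pi/2} - {}"
          have "cos (\<theta> - pi) \<ge> 0" using t by (intro cos_ge_zero) auto
          hence "cos \<theta> \<le> 0" by (simp add: cos_diff)
          hence "norm (nint n k \<omega>0 \<omega> \<theta>) \<le> C0 * exp (- c0 * X\<^sup>2) * exp (- \<beta> * N)"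
            using B[of \<theta>] nr unfolding X_def N_def by blast
          also have "\<dots> \<le> C0 * exp (- c * X\<^sup>2) * (4 / \<beta>\<^sup>2 * (1 / real n))"
          proof (intro mult_mono)
            \<comment> \<open>The only place where the opposite point is discarded; positivity of
              \<beta> makes its contribution smaller than any power of n, and 1/n suffices.\<close>
            have "exp (- (\<beta> * N)) \<le> 4 / (\<beta> * N)\<^sup>2" using beta_pos N by (intro exp_minus_le_inverse_square) auto
            thus "exp (- \<beta> * N) \<le> 4 / \<beta>\<^sup>2 * (1 / real n)" by (simp add: power_mult_distrib N(2))
          qed (use C0 cX in auto)
          finally show "norm (nint n k \<omega>0 \<omega> \<theta>) \<le> C0 * exp (- c * X\<^sup>2) * (4 / \<beta>\<^sup>2 * (1 / real n))" .
        qed (use C0 in auto)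
        thus ?thesis by (simp add: C3_def mult_ac)
      qed
      have "norm (na n k \<omega>0 \<omega> - \<Gamma>' ^ \<alpha> * of_real (exp \<kappa> * sqrt (pi / \<mu>) / N * prof X)) \<le> norm (J1 - \<Gamma>' ^ \<alpha> * of_real (exp \<kappa> * sqrt (pi / \<mu>) / N * prof X)) + norm J2"
        using norm_triangle_ineq[of "J1 - \<Gamma>' ^ \<alpha> * of_real (exp \<kappa> * sqrt (pi / \<mu>) / N * prof X)" J2] by (simp add: na algebra_simps)
      also have "\<dots> \<le> (C2 + C3) / real n * exp (- c * X\<^sup>2)" using b1 b2 by (simp add: add_divide_distrib distrib_right)
      also have "\<dots> \<le> Cx / real n * exp (- c * X\<^sup>2)" using Cx by (intro mult_right_mono divide_right_mono) auto
      finally show ?thesis .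
    qed
    have far: "norm (na n k \<omega>0 \<omega>) \<le> Cx * exp (- real n / 128)" if f: "\<bar>real k / k0 n - 1\<bar> \<ge> 1/2" "k \<le> n"
    proof -
      have "norm (na n k \<omega>0 \<omega>) \<le> (C0 * exp (- real n / 128)) * measure lborel {-(pi/2)..3*pi/2}"
        by (rule has_integral_bound_real[OF _ _ int, of _ "{}"]) (use B f C0 in auto)
      also have "\<dots> = (C0 * (2 * pi)) * exp (- real n / 128)" by simp
      also have "\<dots> \<le> Cx * exp (- real n / 128)" using Cx by (intro mult_right_mono) auto
      finally show ?thesis .
    qed
    show "norm (rGamma (1 + \<omega>)) \<le> Cx \<and>
     (\<bar>real k / k0 n - 1\<bar> \<le> 1/2 \<longrightarrow>
        norm (na n k \<omega>0 \<omega> - rGamma (1 + \<omega>) ^ \<alpha> * of_real (exp \<kappa> * sqrt (pi / \<mu>) / sqrt (real n) * prof (Xv n k))) \<le> Cx / real n * exp (- c * (Xv n k)\<^sup>2)) \<and>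
     (\<bar>real k / k0 n - 1\<bar> \<ge> 1/2 \<longrightarrow> k \<le> n \<longrightarrow> norm (na n k \<omega>0 \<omega>) \<le> Cx * exp (- real n / 128))"
      using order_trans[OF GM Cx(2)] near far unfolding \<Gamma>'_def X_def N_def by blast
  qed
qed

section \<open>Summation over the dominant window and the remaining indices\<close>

definition near :: "nat \<Rightarrow> nat set" where "near n = {k. \<bar>real k / k0 n - 1\<bar> \<le> 1/2}"

text \<open>The integral of \<open>prof\<close> over the real line.\<close>

definition peak :: real where
  "peak = sqrt (pi / (1 + 1 / \<mu>)) * exp ((c2 - c1 - \<beta> / \<mu>)\<^sup>2 / (4 * (1 + 1 / \<mu>)) + (- \<beta>\<^sup>2 / (4 * \<mu>)))"

lemma near_iff: "n > 0 \<Longrightarrow> k \<in> near n \<longleftrightarrow> k0 n / 2 \<le> real k \<and> real k \<le> 3 * k0 n / 2"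
proof -
  assume n: "n > 0"
  have kp: "k0 n > 0" by (rule k0_pos[OF n])
  have "\<bar>real k / k0 n - 1\<bar> \<le> 1/2 \<longleftrightarrow> 1/2 \<le> real k / k0 n \<and> real k / k0 n \<le> 3/2" by arith
  also have "\<dots> \<longleftrightarrow> k0 n / 2 \<le> real k \<and> real k \<le> 3 * k0 n / 2"
    using pos_le_divide_eq[OF kp, of "1/2" "real k"] pos_divide_le_eq[OF kp, of "real k" "3/2"] by simp
  finally show ?thesis by (simp add: near_def)
qed

lemma near_eq:
  assumes "n > 0"
  shows "near n = {nat \<lceil>k0 n / 2\<rceil>..<nat \<lfloor>3 * k0 n / 2\<rfloor> + 1}"
proof -
  have 1: "k0 n / 2 \<le> real k \<longleftrightarrow> nat \<lceil>k0 n / 2\<rceil> \<le> k" for k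
    by (metis ceiling_le_iff nat_le_iff of_int_of_nat_eq)
  have 2: "real k \<le> 3 * k0 n / 2 \<longleftrightarrow> k < nat \<lfloor>3 * k0 n / 2\<rfloor> + 1" for k
    using k0_pos[OF assms] by (simp add: less_Suc_eq_le le_nat_iff le_floor_iff)
  show ?thesis by (rule set_eqI) (simp only: near_iff[OF assms] atLeastLessThan_iff 1 2)
qed

lemma near_subset:
  assumes "n > 0"
  shows "near n \<subseteq> {..n}"
proof
  fix k assume "k \<in> near n"
  hence "real k \<le> 3 * k0 n / 2" using near_iff[OF assms] by simp
  also have "\<dots> = 3 / 4 * real n / (real \<alpha> * lam0)" by (simp add: k0_def)
  also have "\<dots> \<le> real n"
  proof -
    have "1 * (3/4) \<le> real \<alpha> * lam0" using alpha_pos lam0_ge by (intro mult_mono) auto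
    hence "3 / 4 * real n \<le> (real \<alpha> * lam0) * real n" by (intro mult_right_mono) auto
    thus ?thesis using alpha_pos lam0_pos by (simp add: divide_le_eq mult_ac)
  qed
  finally show "k \<in> {..n}" by simp
qed

text \<open>Xv n k = h k - N/2 with h = \<alpha> \<open>lam0\<close> / N and N = sqrt n, so the sum
  is a Riemann sum of step h and the factor 1/(\<alpha> lam0) is N-free inverse step. The window
  ends at X close to - N/4 and N/4; rounding costs at most h \<le> N/8, hence the choice T =
  N/8.\<close>

lemma near_gaussian_sum:
  fixes A b c :: real
  assumes A: "A > 0"
  shows "\<exists>C\<ge>0. \<forall>\<^sub>F n in sequentially.
    \<bar>(\<Sum>k\<in>near n. exp (- A * (Xv n k)\<^sup>2 + b * Xv n k + c)) / sqrt (real n)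
       - sqrt (pi / A) * exp (b\<^sup>2 / (4 * A) + c) / (real \<alpha> * lam0)\<bar> \<le> C / sqrt (real n)"
proof -
  define g where "g = real \<alpha> * lam0"
  have g: "g > 0" using alpha_pos lam0_pos by (simp add: g_def)
  define J where "J = sqrt (pi / A) * exp (b\<^sup>2 / (4 * A) + c)"
  obtain C where C: "C \<ge> 0" and G: "\<And>h t T (k1::nat) (k2::nat). 0 < h \<Longrightarrow> h \<le> 1 \<Longrightarrow> k1 \<le> k2 \<Longrightarrow> T > 0 \<Longrightarrow> h * real k1 - t \<le> - T \<Longrightarrow> h * real k2 - t \<ge> T \<Longrightarrow>
    \<bar>(\<Sum>k=k1..<k2. h * exp (- A * (h * real k - t)\<^sup>2 + b * (h * real k - t) + c)) - J\<bar> \<le> C * (h + 1 / T\<^sup>2)"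
    using gaussian_riemann_limit[OF A, of b c] unfolding J_def by blast
  have "\<forall>\<^sub>F n in sequentially. g \<le> sqrt (real n)" "\<forall>\<^sub>F n in sequentially. 8 * g \<le> real n" by real_asymp+
  hence ev: "\<forall>\<^sub>F n in sequentially. \<bar>(\<Sum>k\<in>near n. exp (- A * (Xv n k)\<^sup>2 + b * Xv n k + c)) / sqrt (real n) - J / g\<bar> \<le> (C * (g + 64) / g) / sqrt (real n)"
    using eventually_gt_at_top[of 0]
  proof eventually_elim
    case (elim n)
    define N where "N = sqrt (real n)"
    have N: "N \<ge> 1" "N\<^sup>2 = real n" using elim by (auto simp: N_def)
    define h where "h = g / N"
    have h: "0 < h" "h \<le> 1" using g N elim by (auto simp: h_def N_def)
    have k0: "k0 n = N\<^sup>2 / (2 * g)" by (simp add: k0_def N(2) g_def)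
    have hk0: "h * k0 n = N / 2" using g N(1) by (simp add: h_def k0 power2_eq_square)
    have Xv: "Xv n k = h * real k - N / 2" for k
      using g N(1) unfolding Xv_def k0 h_def N_def[symmetric] by (simp add: field_simps power2_eq_square)
    define k1 where "k1 = nat \<lceil>k0 n / 2\<rceil>"
    define k2 where "k2 = nat \<lfloor>3 * k0 n / 2\<rfloor> + 1"
    have kp: "k0 n > 0" by (rule k0_pos[OF elim(3)])
    have k1: "real k1 \<le> k0 n / 2 + 1" using kp unfolding k1_def by linarith
    have k2: "real k2 \<ge> 3 * k0 n / 2" using kp unfolding k2_def by linarith
    have k12: "k1 \<le> k2"
    proof -
      have "\<lceil>k0 n / 2\<rceil> \<le> \<lfloor>3 * k0 n / 2\<rfloor> + 1" using kp by linarith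
      thus ?thesis unfolding k1_def k2_def by linarith
    qed
    have hN: "h \<le> N / 8"
    proof -
      have "8 * g \<le> N * N" using elim N by (simp add: power2_eq_square)
      thus ?thesis using N by (simp add: h_def field_simps)
    qed
    have a1: "h * real k1 - N / 2 \<le> - (N / 8)"
    proof -
      have "h * real k1 \<le> h * (k0 n / 2 + 1)" using h k1 by (intro mult_left_mono) auto
      also have "\<dots> = h * k0 n / 2 + h" by (simp add: distrib_left)
      finally show ?thesis using hk0 hN by linarith
    qed
    have a2: "h * real k2 - N / 2 \<ge> N / 8"
    proof -
      have "h * real k2 \<ge> h * (3 * k0 n / 2)" using h k2 by (intro mult_left_mono) auto
      moreover have "h * (3 * k0 n / 2) = 3 * (h * k0 n) / 2" by simp
      ultimately show ?thesis using hk0 N by linarith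
    qed
    have "\<bar>(\<Sum>k=k1..<k2. h * exp (- A * (h * real k - N / 2)\<^sup>2 + b * (h * real k - N / 2) + c)) - J\<bar> \<le> C * (h + 1 / (N / 8)\<^sup>2)"
      by (rule G[OF h k12 _ a1 a2]) (use N in auto)
    hence "\<bar>h * (\<Sum>k\<in>near n. exp (- A * (Xv n k)\<^sup>2 + b * Xv n k + c)) - J\<bar> \<le> C * (h + 1 / (N / 8)\<^sup>2)"
      unfolding Xv near_eq[OF elim(3)] k1_def[symmetric] k2_def[symmetric] sum_distrib_left .
    also have "\<dots> \<le> C * ((g + 64) / N)"
    proof (rule mult_left_mono[OF _ C])
      have "1 / (N / 8)\<^sup>2 \<le> 64 / N"
      proof -
        have "64 / (N * N) \<le> 64 / (N * 1)" using N by (intro divide_left_mono mult_left_mono) auto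
        thus ?thesis by (simp add: power2_eq_square)
      qed
      thus "h + 1 / (N / 8)\<^sup>2 \<le> (g + 64) / N" by (simp add: h_def add_divide_distrib)
    qed
    finally have "\<bar>h * (\<Sum>k\<in>near n. exp (- A * (Xv n k)\<^sup>2 + b * Xv n k + c)) - J\<bar> / g \<le> C * ((g + 64) / N) / g"
      using g by (intro divide_right_mono) auto
    moreover have "\<bar>u / N - J / g\<bar> = \<bar>h * u - J\<bar> / g" for u
    proof -
      have "u / N - J / g = (h * u - J) / g" using g by (simp add: h_def diff_divide_distrib)
      thus ?thesis using g by (simp only: abs_divide abs_of_pos)
    qed
    ultimately have "\<bar>(\<Sum>k\<in>near n. exp (- A * (Xv n k)\<^sup>2 + b * Xv n k + c)) / N - J / g\<bar> \<le> C * ((g + 64) / N) / g" by (simp only:)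
    also have "\<dots> = (C * (g + 64) / g) / N" by simp
    finally show ?case unfolding N_def .
  qed
  show ?thesis
  proof (rule exI[of _ "C * (g + 64) / g"], rule conjI)
    show "0 \<le> C * (g + 64) / g" using C g by simp
  qed (use ev in \<open>simp only: J_def g_def\<close>)
qed

text \<open>Only the superexponential factor n^(n/2) matters; all other factors are at worst
  exponential in n, or powers of n bounded in terms of R.\<close>

lemma scale_lower:
  assumes R: "R \<ge> 0"
  shows "\<exists>S T. \<forall>n \<omega>. n > 0 \<longrightarrow> norm \<omega> \<le> R \<longrightarrow> norm (scale n \<omega>) \<ge> exp (- S * real n + (real n / 2 - real \<alpha> * R) * ln (real n) - T)"
proof (intro exI allI impI)
  fix n :: nat and \<omega> :: complex
  assume n: "n > 0" and w: "norm \<omega> \<le> R"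
  define S where "S = \<bar>ln e2 - 1 - L0\<bar> / 2"
  define T where "T = real \<alpha> * (1/2 + R) * \<bar>L0\<bar>"
  have ln: "ln (real n) \<ge> 0" using n by simp
  have Rew: "\<bar>Re \<omega>\<bar> \<le> R" using w abs_Re_le_cmod[of \<omega>] by linarith
  have b1: "\<beta> * sqrt (real n) \<ge> 0" using beta_pos by simp
  have b2: "real n / 2 * (ln e2 - 1 - L0) \<ge> - S * real n"
  proof -
    have "real n / 2 * (- \<bar>ln e2 - 1 - L0\<bar>) \<le> real n / 2 * (ln e2 - 1 - L0)" by (intro mult_left_mono) auto
    thus ?thesis by (simp add: S_def mult_ac)
  qed
  have b3: "((real n + real \<alpha>) / 2 + real \<alpha> * Re \<omega>) * ln (real n) \<ge> (real n / 2 - real \<alpha> * R) * ln (real n)"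
  proof (rule mult_right_mono[OF _ ln])
    have "real \<alpha> * (- R) \<le> real \<alpha> * Re \<omega>" using Rew by (intro mult_left_mono) auto
    thus "real n / 2 - real \<alpha> * R \<le> (real n + real \<alpha>) / 2 + real \<alpha> * Re \<omega>" by (simp add: add_divide_distrib)
  qed
  have b4: "real \<alpha> * (1/2 + Re \<omega>) * L0 \<le> T"
  proof -
    have "real \<alpha> * (1/2 + Re \<omega>) * L0 \<le> \<bar>real \<alpha> * (1/2 + Re \<omega>) * L0\<bar>" by (rule abs_ge_self)
    also have "\<dots> = real \<alpha> * \<bar>1/2 + Re \<omega>\<bar> * \<bar>L0\<bar>" by (simp add: abs_mult)
    also have "\<dots> \<le> T" unfolding T_def using Rew by (intro mult_right_mono mult_left_mono) auto
    finally show ?thesis .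
  qed
  have b5: "real \<alpha> * (ln (2 * pi) / 2) \<ge> 0" using pi_gt3 by (intro mult_nonneg_nonneg) auto
  have "norm (scale n \<omega>) = exp (\<beta> * sqrt (real n) + real n / 2 * (ln e2 - 1 - L0) + ((real n + real \<alpha>) / 2 + real \<alpha> * Re \<omega>) * ln (real n) + (real \<alpha> * (ln (2 * pi) / 2) - real \<alpha> * (1/2 + Re \<omega>) * L0))"
    unfolding scale_def norm_exp_eq_Re by simp
  also have "\<dots> \<ge> exp (- S * real n + (real n / 2 - real \<alpha> * R) * ln (real n) - T)"
    unfolding exp_le_cancel_iff using b1 b2 b3 b4 b5 by linarith
  finally show "norm (scale n \<omega>) \<ge> exp (- (\<bar>ln e2 - 1 - L0\<bar> / 2) * real n + (real n / 2 - real \<alpha> * R) * ln (real n) - real \<alpha> * (1/2 + R) * \<bar>L0\<bar>)"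
    unfolding S_def T_def .
qed

text \<open>For k < K neither the asymptotics nor a shrinking radius is available. On the fixed
  circle of radius r/2 every factor is bounded and the coefficient is at most a constant times D^n,
  negligible against \<open>scale\<close>.\<close>

lemma small_terms:
  assumes R: "R \<ge> 0"
  shows "\<forall>\<^sub>F n in sequentially. \<forall>k<K. \<forall>\<omega>0 \<omega>. norm \<omega>0 \<le> R \<longrightarrow> norm \<omega> \<le> R \<longrightarrow> norm (na n k \<omega>0 \<omega>) \<le> 1 / sqrt (real n)"
proof -
  define p where "p = r / 2"
  have p: "p > 0" "p < r" using r_pos by (auto simp: p_def)
  define Lb where "Lb = \<bar>D1\<bar> * p + \<bar>D2\<bar> * p\<^sup>2 + B * p ^ 3"
  define Qb where "Qb = \<bar>q1\<bar> * p + \<bar>q2\<bar> * p\<^sup>2 + B * p ^ 3"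
  have est: "norm z \<le> \<bar>u\<bar> * p + \<bar>v\<bar> * p\<^sup>2 + B * p ^ 3" if "norm (z - (of_real u * w + of_real v * w\<^sup>2)) \<le> B * norm w ^ 3" "norm w = p" for z w :: complex and u v :: real
  proof -
    have "norm z \<le> norm (z - (of_real u * w + of_real v * w\<^sup>2)) + norm (of_real u * w + of_real v * w\<^sup>2)"
      by (metis diff_add_cancel norm_triangle_ineq)
    also have "norm (of_real u * w + of_real v * w\<^sup>2) \<le> \<bar>u\<bar> * p + \<bar>v\<bar> * p\<^sup>2"
      by (rule order_trans[OF norm_triangle_ineq]) (simp add: norm_mult norm_power that(2))
    finally show ?thesis using that by simp
  qed
  define A where "A = exp ((real K + R) * p\<^sup>2) + 1"
  have A: "A \<ge> 1" by (simp add: A_def)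
  define D where "D = exp Qb * sqrt e2 / p"
  have D: "D > 0" using p e2_pos by (simp add: D_def)
  define E where "E = exp ((real K + R) * Lb) * (A ^ (\<alpha> * K)) * (1 + B * p)"
  have E: "E > 0" using A B_nonneg p by (auto simp: E_def intro!: mult_pos_pos add_pos_nonneg)
  have Lb: "Lb \<ge> 0" using p B_nonneg by (simp add: Lb_def)
  have bnd: "norm (2 * pi * a n k \<omega>0 \<omega>) \<le> E * D ^ n * (2 * pi)" if k: "k < K" and w: "norm \<omega>0 \<le> R" "norm \<omega> \<le> R" for n k \<omega>0 \<omega>
  proof -
    have "norm (2 * pi * a n k \<omega>0 \<omega>) \<le> (E * D ^ n) * measure lborel {-(pi/2)..3*pi/2}"
    proof (rule has_integral_bound_real[OF _ _ coeff[OF p], of _ "{}"])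
      fix \<theta> :: real
      define z where "z = of_real p * cis \<theta>"
      have z: "norm z = p" "norm z < r" using p by (auto simp: z_def norm_mult)
      have 1: "norm (exp ((of_nat k + \<omega>0) * l z)) \<le> exp ((real K + R) * Lb)"
      proof -
        have "norm ((of_nat k + \<omega>0) * l z) \<le> (real K + R) * Lb"
        proof -
          have "norm (of_nat k + \<omega>0) \<le> real K + R" using norm_triangle_ineq[of "of_nat k" \<omega>0] k w by simp
          moreover have "norm (l z) \<le> Lb" unfolding Lb_def by (rule est[OF l_approx z(1)]) (rule z)
          ultimately show ?thesis unfolding norm_mult using R by (intro mult_mono) auto
        qed
        hence "exp (norm ((of_nat k + \<omega>0) * l z)) \<le> exp ((real K + R) * Lb)" by simp
        thus ?thesis using norm_exp[of "(of_nat k + \<omega>0) * l z"] by linarith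
      qed
      have 2: "norm (\<Prod>j=1..k. (exp ((of_nat j + \<omega>) * z\<^sup>2) - 1) ^ \<alpha>) \<le> A ^ (\<alpha> * K)"
      proof -
        have "norm (\<Prod>j=1..k. (exp ((of_nat j + \<omega>) * z\<^sup>2) - 1) ^ \<alpha>) \<le> (\<Prod>j=1..k. A ^ \<alpha>)"
          unfolding prod_norm[symmetric]
        proof (rule prod_mono)
          fix j assume j: "j \<in> {1..k}"
          have "norm (of_nat j + \<omega>) \<le> real K + R" using norm_triangle_ineq[of "of_nat j" \<omega>] j k w by simp
          hence "norm ((of_nat j + \<omega>) * z\<^sup>2) \<le> (real K + R) * p\<^sup>2" unfolding norm_mult norm_power z(1) by (intro mult_right_mono) auto
          hence "exp (norm ((of_nat j + \<omega>) * z\<^sup>2)) \<le> exp ((real K + R) * p\<^sup>2)" by simp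
          hence "norm (exp ((of_nat j + \<omega>) * z\<^sup>2) - 1) \<le> A"
            using norm_exp[of "(of_nat j + \<omega>) * z\<^sup>2"] norm_triangle_ineq4[of "exp ((of_nat j + \<omega>) * z\<^sup>2)" 1] unfolding A_def norm_one by linarith
          thus "0 \<le> norm ((exp ((of_nat j + \<omega>) * z\<^sup>2) - 1) ^ \<alpha>) \<and> norm ((exp ((of_nat j + \<omega>) * z\<^sup>2) - 1) ^ \<alpha>) \<le> A ^ \<alpha>"
            unfolding norm_power by (intro conjI power_mono) auto
        qed
        also have "\<dots> = A ^ (\<alpha> * k)" by (simp add: power_mult)
        also have "\<dots> \<le> A ^ (\<alpha> * K)" using A k by (intro power_increasing) auto
        finally show ?thesis .
      qed
      have 3: "norm (1 - z * deriv q z) \<le> 1 + B * p"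
        using norm_triangle_ineq4[of 1 "z * deriv q z"] dq_bound[OF z(2)] unfolding z(1) norm_one by linarith
      have 4: "norm ((exp (q z) / (of_real (1 / sqrt e2) * z)) ^ n) \<le> D ^ n"
      proof -
        have "norm (q z) \<le> Qb" unfolding Qb_def by (rule est[OF q_approx z(1)]) (rule z)
        hence "norm (exp (q z)) \<le> exp Qb" using norm_exp[of "q z"] by (meson exp_le_cancel_iff order_trans)
        moreover have "norm (exp (q z) / (of_real (1 / sqrt e2) * z)) = norm (exp (q z)) * sqrt e2 / p"
          using e2_pos by (simp add: norm_divide norm_mult z(1))
        ultimately have "norm (exp (q z) / (of_real (1 / sqrt e2) * z)) \<le> D"
          unfolding D_def using p e2_pos by (auto intro!: divide_right_mono mult_right_mono)
        thus ?thesis unfolding norm_power by (intro power_mono) auto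
      qed
      have "norm (integrand n k \<omega>0 \<omega> z) \<le> exp ((real K + R) * Lb) * (A ^ (\<alpha> * K)) * (1 + B * p) * D ^ n"
        unfolding integrand_def norm_mult[of _ "(exp (q z) / (of_real (1 / sqrt e2) * z)) ^ n"] norm_mult[of _ "1 - z * deriv q z"]
          norm_mult[of _ "\<Prod>j=1..k. (exp ((of_nat j + \<omega>) * z\<^sup>2) - 1) ^ \<alpha>"]
        using A B_nonneg p by (intro mult_mono 1 2 3 4) (auto intro!: mult_nonneg_nonneg)
      thus "norm (integrand n k \<omega>0 \<omega> (of_real p * cis \<theta>)) \<le> E * D ^ n" unfolding E_def z_def .
    qed (use E D in auto)
    thus ?thesis by simp
  qed
  obtain S T where ST: "\<And>n \<omega>. n > 0 \<Longrightarrow> norm \<omega> \<le> R \<Longrightarrow> norm (scale n \<omega>) \<ge> exp (- S * real n + (real n / 2 - real \<alpha> * R) * ln (real n) - T)"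
    using scale_lower[OF R] by blast
  define a0 where "a0 = ln (E * (2 * pi)) + T"
  define b0 where "b0 = ln D + S"
  define g0 where "g0 = real \<alpha> * R"
  \<comment> \<open>The term (n/2) ln n in the exponent beats b0 n whatever the sign and size of the
    constants.\<close>
  have "\<forall>\<^sub>F n in sequentially. exp (a0 + b0 * real n - (real n / 2 - g0) * ln (real n)) \<le> 1 / sqrt (real n)"
    by real_asymp
  thus ?thesis using eventually_gt_at_top[of 0]
  proof eventually_elim
    case (elim n)
    show ?case
    proof (intro allI impI)
      fix k \<omega>0 \<omega> assume k: "k < K" and w: "norm (\<omega>0::complex) \<le> R" "norm (\<omega>::complex) \<le> R"
      have "norm (na n k \<omega>0 \<omega>) = norm (2 * pi * a n k \<omega>0 \<omega>) / norm (scale n \<omega>)" unfolding na_def norm_divide ..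
      also have "\<dots> \<le> (E * D ^ n * (2 * pi)) / exp (- S * real n + (real n / 2 - real \<alpha> * R) * ln (real n) - T)"
        using E D by (intro frac_le bnd k w ST elim) auto
      also have "E * D ^ n * (2 * pi) = exp (ln (E * (2 * pi)) + real n * ln D)"
        using E D by (simp add: exp_add exp_of_nat_mult)
      also have "exp (ln (E * (2 * pi)) + real n * ln D) / exp (- S * real n + (real n / 2 - real \<alpha> * R) * ln (real n) - T)
         = exp (a0 + b0 * real n - (real n / 2 - g0) * ln (real n))"
        unfolding exp_diff[symmetric] a0_def b0_def g0_def by (rule arg_cong[of _ _ exp]) (simp add: algebra_simps)
      also note elim(1)
      finally show "norm (na n k \<omega>0 \<omega>) \<le> 1 / sqrt (real n)" .
    qed
  qed
qed

text \<open>Errors O(1/n) exp (- c X^2) over the window add up to O(n^(-1/2)), again by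
  \<open>near_gaussian_sum\<close>, applied to the majorant. Indices outside the window are either
  large and exponentially small, or fewer than \<open>K\<close> and covered by
  \<open>small_terms\<close>.\<close>

lemma sum_asymp:
  assumes R: "R \<ge> 0"
  shows "\<exists>C. \<forall>\<^sub>F n in sequentially. \<forall>\<omega>0 \<omega>. norm \<omega>0 \<le> R \<longrightarrow> norm \<omega> \<le> R \<longrightarrow>
    norm ((\<Sum>k\<le>n. na n k \<omega>0 \<omega>) - rGamma (1 + \<omega>) ^ \<alpha> * of_real (exp \<kappa> * sqrt (pi / \<mu>) * (peak / (real \<alpha> * lam0)))) \<le> C / sqrt (real n)"
proof -
  obtain C c and K :: nat where C: "C \<ge> 1" and c: "c > 0" and K: "K > 0" and B: "\<And>n k \<omega>0 \<omega>. n > 0 \<Longrightarrow> k \<ge> K \<Longrightarrow> norm \<omega>0 \<le> R \<Longrightarrow> norm \<omega> \<le> R \<Longrightarrow>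
     norm (rGamma (1 + \<omega>)) \<le> C \<and>
     (\<bar>real k / k0 n - 1\<bar> \<le> 1/2 \<longrightarrow>
        norm (na n k \<omega>0 \<omega> - rGamma (1 + \<omega>) ^ \<alpha> * of_real (exp \<kappa> * sqrt (pi / \<mu>) / sqrt (real n) * prof (Xv n k))) \<le> C / real n * exp (- c * (Xv n k)\<^sup>2)) \<and>
     (\<bar>real k / k0 n - 1\<bar> \<ge> 1/2 \<longrightarrow> k \<le> n \<longrightarrow> norm (na n k \<omega>0 \<omega>) \<le> C * exp (- real n / 128))"
    using coeff_bounds[OF R] by blast
  have A: "1 + 1 / \<mu> > 0" using mu_pos by (simp add: add_pos_pos)
  obtain C1 where C1: "C1 \<ge> 0" and P: "\<forall>\<^sub>F n in sequentially. \<bar>(\<Sum>k\<in>near n. prof (Xv n k)) / sqrt (real n) - peak / (real \<alpha> * lam0)\<bar> \<le> C1 / sqrt (real n)"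
    using near_gaussian_sum[OF A, of "c2 - c1 - \<beta> / \<mu>" "- \<beta>\<^sup>2 / (4 * \<mu>)"] unfolding prof_def[symmetric] peak_def[symmetric] by blast
  define J where "J = sqrt (pi / c) * exp (0\<^sup>2 / (4 * c) + 0) / (real \<alpha> * lam0)"
  obtain C2 where C2: "C2 \<ge> 0" and Q: "\<forall>\<^sub>F n in sequentially. \<bar>(\<Sum>k\<in>near n. exp (- c * (Xv n k)\<^sup>2 + 0 * Xv n k + 0)) / sqrt (real n) - J\<bar> \<le> C2 / sqrt (real n)"
    using near_gaussian_sum[OF c, of 0 0] unfolding J_def by blast
  define M where "M = exp \<kappa> * sqrt (pi / \<mu>)"
  have M: "M \<ge> 0" using mu_pos by (simp add: M_def)
  define g where "g = real \<alpha> * lam0"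
  define kK where "kK = real K"
  have "\<forall>\<^sub>F n in sequentially. (real n + 1) * (C * exp (- real n / 128)) \<le> 1 / sqrt (real n)" by real_asymp
  moreover have "\<forall>\<^sub>F n in sequentially. 4 * g * kK \<le> real n" by real_asymp
  ultimately have "\<forall>\<^sub>F n in sequentially. \<forall>\<omega>0 \<omega>. norm \<omega>0 \<le> R \<longrightarrow> norm \<omega> \<le> R \<longrightarrow>
    norm ((\<Sum>k\<le>n. na n k \<omega>0 \<omega>) - rGamma (1 + \<omega>) ^ \<alpha> * of_real (M * (peak / g))) \<le> (C * (J + C2) + C ^ \<alpha> * (M * C1) + 1 + kK) / sqrt (real n)"
    using P Q small_terms[OF R, of K] eventually_gt_at_top[of 0]
  proof eventually_elim
    case (elim n)
    note far = elim(1) and large = elim(2) and P = elim(3) and Q = elim(4) and sm = elim(5) and n = elim(6)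
    define N where "N = sqrt (real n)"
    have N: "N \<ge> 1" "N\<^sup>2 = real n" using n by (auto simp: N_def)
    have gp: "g > 0" using alpha_pos lam0_pos by (simp add: g_def)
    have fin: "finite (near n)" using near_subset[OF n] finite_subset by blast
    have nearK: "k \<ge> K" if "k \<in> near n" for k
    proof -
      have "k0 n / 2 \<le> real k" using that near_iff[OF n] by blast
      moreover have "k0 n / 2 \<ge> real K" using large gp by (simp add: k0_def g_def kK_def field_simps)
      ultimately show ?thesis by linarith
    qed
    show ?case
    proof (intro allI impI)
      fix \<omega>0 \<omega> :: complex assume w: "norm \<omega>0 \<le> R" "norm \<omega> \<le> R"
      define G where "G = rGamma (1 + \<omega>) ^ \<alpha>"
      define f where "f = (\<lambda>k. na n k \<omega>0 \<omega>)"
      define S where "S = (\<Sum>k\<in>near n. prof (Xv n k)) / N"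
      have G: "norm G \<le> C ^ \<alpha>" unfolding G_def norm_power using B[OF n order_refl w] by (intro power_mono) auto
      have d1: "norm (sum f (near n) - G * of_real (M * S)) \<le> C * (J + C2) / N"
      proof -
        have "sum f (near n) - G * of_real (M * S) = (\<Sum>k\<in>near n. f k - G * of_real (M / N * prof (Xv n k)))"
          unfolding sum_subtractf sum_distrib_left[symmetric] of_real_sum[symmetric] by (simp add: S_def)
        also have "norm \<dots> \<le> (\<Sum>k\<in>near n. C / real n * exp (- c * (Xv n k)\<^sup>2 + 0 * Xv n k + 0))"
        proof (rule sum_norm_le)
          fix k assume k: "k \<in> near n"
          hence "\<bar>real k / k0 n - 1\<bar> \<le> 1/2" by (simp add: near_def)
          thus "norm (f k - G * of_real (M / N * prof (Xv n k))) \<le> C / real n * exp (- c * (Xv n k)\<^sup>2 + 0 * Xv n k + 0)"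
            using B[OF n nearK[OF k] w] by (simp add: f_def G_def M_def N_def)
        qed
        also have "\<dots> = C / N * ((\<Sum>k\<in>near n. exp (- c * (Xv n k)\<^sup>2 + 0 * Xv n k + 0)) / N)"
          unfolding sum_distrib_left[symmetric] N(2)[symmetric] by (simp add: power2_eq_square)
        also have "\<dots> \<le> C / N * (J + C2)"
        proof (rule mult_left_mono)
          have "C2 / N \<le> C2" using C2 N by (simp add: divide_le_eq mult_le_cancel_left1)
          thus "(\<Sum>k\<in>near n. exp (- c * (Xv n k)\<^sup>2 + 0 * Xv n k + 0)) / N \<le> J + C2"
            using Q unfolding N_def[symmetric] abs_le_iff by linarith
        qed (use C N in auto)
        finally show ?thesis by simp
      qed
      have d2: "norm (G * of_real (M * S) - G * of_real (M * (peak / g))) \<le> C ^ \<alpha> * (M * C1) / N"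
      proof -
        have "G * of_real (M * S) - G * of_real (M * (peak / g)) = G * of_real (M * (S - peak / g))"
          unfolding right_diff_distrib of_real_diff ..
        also have "norm \<dots> = norm G * (M * \<bar>S - peak / g\<bar>)"
          unfolding norm_mult norm_of_real abs_mult using M by simp
        also have "\<dots> \<le> C ^ \<alpha> * (M * (C1 / N))"
          using P C M G unfolding S_def N_def g_def by (intro mult_mono G mult_left_mono) auto
        finally show ?thesis by simp
      qed
      have d3: "norm (sum f ({..n} - near n)) \<le> (1 + kK) / N"
      proof -
        \<comment> \<open>One bound for both kinds of index outside the window: the second summand
          is present only for k < K.\<close>
        have "norm (sum f ({..n} - near n)) \<le> (\<Sum>k\<in>{..n} - near n. C * exp (- real n / 128) + (if k < K then 1 / N else 0))"
        proof (rule sum_norm_le)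
          fix k assume k: "k \<in> {..n} - near n"
          show "norm (f k) \<le> C * exp (- real n / 128) + (if k < K then 1 / N else 0)"
          proof (cases "k < K")
            case True
            hence "norm (f k) \<le> 1 / N" using sm w unfolding f_def N_def by blast
            moreover have "C * exp (- real n / 128) \<ge> 0" using C by simp
            ultimately show ?thesis using True by simp
          next
            case False
            moreover have "\<bar>real k / k0 n - 1\<bar> \<ge> 1/2" using k unfolding near_def by auto
            ultimately show ?thesis using B[OF n _ w, of k] k unfolding f_def by simp
          qed
        qed
        also have "\<dots> \<le> (\<Sum>k\<le>n. C * exp (- real n / 128)) + (\<Sum>k<K. 1 / N)"
        proof -
          have "(\<Sum>k\<in>{..n} - near n. if k < K then 1 / N else 0) = sum (\<lambda>k. 1 / N) {k \<in> {..n} - near n. k < K}"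
            by (subst sum.inter_filter) auto
          also have "\<dots> \<le> (\<Sum>k<K. 1 / N)" using N by (intro sum_mono2) auto
          finally have "(\<Sum>k\<in>{..n} - near n. if k < K then 1 / N else 0) \<le> (\<Sum>k<K. 1 / N)" .
          moreover have "(\<Sum>k\<in>{..n} - near n. C * exp (- real n / 128)) \<le> (\<Sum>k\<le>n. C * exp (- real n / 128))"
            using C by (intro sum_mono2) auto
          ultimately show ?thesis unfolding sum.distrib by linarith
        qed
        also have "\<dots> = (real n + 1) * (C * exp (- real n / 128)) + kK / N" by (simp add: kK_def add_ac)
        also have "\<dots> \<le> 1 / N + kK / N" using far unfolding N_def by simp
        finally show ?thesis by (simp add: add_divide_distrib)
      qed
      have "(\<Sum>k\<le>n. f k) = sum f ({..n} - near n) + sum f (near n)"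
        by (rule sum.subset_diff[OF near_subset[OF n] finite_atMost])
      hence "(\<Sum>k\<le>n. f k) - G * of_real (M * (peak / g)) = (sum f (near n) - G * of_real (M * S)) + (G * of_real (M * S) - G * of_real (M * (peak / g))) + sum f ({..n} - near n)"
        by simp
      also have "norm \<dots> \<le> C * (J + C2) / N + C ^ \<alpha> * (M * C1) / N + (1 + kK) / N"
        by (intro norm_triangle_le add_mono d1 d2 d3)
      finally show "norm ((\<Sum>k\<le>n. na n k \<omega>0 \<omega>) - rGamma (1 + \<omega>) ^ \<alpha> * of_real (M * (peak / g))) \<le> (C * (J + C2) + C ^ \<alpha> * (M * C1) + 1 + kK) / sqrt (real n)"
        unfolding f_def G_def N_def by (simp add: add_divide_distrib)
    qed
  qed
  thus ?thesis unfolding M_def g_def by blast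
qed

end

section \<open>Identification of the constants\<close>

context saddle
begin

lemma six_powr: "complex_of_real (6 / (real \<alpha> * pi\<^sup>2)) powr \<omega> = exp (- of_real L0 * \<omega>)"
proof -
  have "exp (- L0) = 6 / (real \<alpha> * pi\<^sup>2)" using alpha_pos by (simp add: L0_def exp_minus)
  hence "complex_of_real (6 / (real \<alpha> * pi\<^sup>2)) = exp (of_real (- L0))" by (simp only: exp_of_real)
  thus ?thesis by (simp add: powr_def mult.commute)
qed

text \<open>\<open>scale\<close> is \<open>growth\<close> times the part of the leading constant
  that depends on \<omega> through a nonvanishing factor; 1/\<Gamma> is left out. The square root
  arises as exp ((ln (2 pi) - L0)/2): sqrt (2 pi) from Stirling, the other part from the power 1/2
  of k0.\<close>

lemma scale_eq_growth:
  assumes n: "n > 0" and beta: "\<beta> = beta_const \<alpha> d1 e2 e3"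
  shows "scale n \<omega> = growth \<alpha> d1 e2 e3 \<omega> n * (of_real (sqrt (12 / (real \<alpha> * pi))) * of_real (6 / (real \<alpha> * pi\<^sup>2)) powr \<omega>) ^ \<alpha>"
proof -
  have ap: "real \<alpha> * pi\<^sup>2 / 6 > 0" using alpha_pos by simp
  have r: "rho_const \<alpha> e2 powr (real n / 2) = exp (real n / 2 * (ln e2 - 1 - L0))"
  proof -
    have 1: "rho_const \<alpha> e2 = e2 / exp 1 / (real \<alpha> * pi\<^sup>2 / 6)" by (simp add: rho_const_def mult_ac)
    have "e2 / exp 1 / x > 0" "ln (e2 / exp 1 / x) = ln e2 - 1 - ln x" if "x > 0" for x :: real
      using that e2_pos by (simp_all add: ln_div ln_mult)
    from this[OF ap] have "rho_const \<alpha> e2 > 0" "ln (rho_const \<alpha> e2) = ln e2 - 1 - L0" unfolding 1 L0_def by blast+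
    thus ?thesis by (simp add: powr_def)
  qed
  have p: "(of_nat n :: complex) powr z = exp (z * of_real (ln (real n)))" for z
    using n by (simp add: powr_def Ln_of_nat)
  have s: "sqrt (12 / (real \<alpha> * pi)) = exp ((ln (2 * pi) - L0) / 2)"
  proof -
    have "12 / (real \<alpha> * pi) = 2 * pi / (real \<alpha> * pi\<^sup>2 / 6)" using alpha_pos by (simp add: power2_eq_square)
    hence "12 / (real \<alpha> * pi) = exp (ln (2 * pi) - L0)" using ap by (simp add: exp_diff L0_def)
    also have "\<dots> = exp ((ln (2 * pi) - L0) / 2) ^ 2" by (simp add: exp_double[symmetric])
    finally show ?thesis by simp
  qed
  have "(of_real (sqrt (12 / (real \<alpha> * pi))) * of_real (6 / (real \<alpha> * pi\<^sup>2)) powr \<omega>) ^ \<alpha>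
     = exp (of_nat \<alpha> * (of_real ((ln (2 * pi) - L0) / 2) + - of_real L0 * \<omega>))"
    unfolding s six_powr exp_of_nat_mult exp_add exp_of_real ..
  moreover have "of_nat \<alpha> * (of_real ((ln (2 * pi) - L0) / 2) + - of_real L0 * \<omega>)
     = of_nat \<alpha> * of_real (ln (2 * pi) / 2) - of_nat \<alpha> * (1/2 + \<omega>) * complex_of_real L0"
    by (simp add: algebra_simps diff_divide_distrib)
  ultimately show ?thesis
    unfolding growth_def r p beta[symmetric] scale_def exp_add exp_of_real by simp
qed

text \<open>Uniform over |\<omega>| \<le> R; it converts an error measured by \<open>scale\<close>
  into one measured by \<open>growth\<close>.\<close>

lemma norm_scale_le:
  assumes n: "n > 0" and beta: "\<beta> = beta_const \<alpha> d1 e2 e3" and R: "norm \<omega> \<le> R"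
  shows "norm (scale n \<omega>) \<le> exp (real \<alpha> * (\<bar>ln (12 / (real \<alpha> * pi))\<bar> / 2 + R * \<bar>L0\<bar>)) * norm (growth \<alpha> d1 e2 e3 \<omega> n)"
proof -
  have ap: "real \<alpha> * pi\<^sup>2 / 6 > 0" using alpha_pos by simp
  have p1: "12 / (real \<alpha> * pi) > 0" using alpha_pos by simp
  have s: "sqrt (12 / (real \<alpha> * pi)) = exp (ln (12 / (real \<alpha> * pi)) / 2)"
    unfolding ln_sqrt[OF less_imp_le[OF p1], symmetric] using p1 by simp
  have b: "norm (complex_of_real (6 / (real \<alpha> * pi\<^sup>2)) powr \<omega>) = exp (- L0 * Re \<omega>)"
    unfolding six_powr norm_exp_eq_Re by simp
  have "\<bar>L0 * Re \<omega>\<bar> \<le> R * \<bar>L0\<bar>"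
    unfolding abs_mult mult.commute[of "\<bar>L0\<bar>"] using R abs_Re_le_cmod[of \<omega>] by (intro mult_right_mono) auto
  hence "ln (12 / (real \<alpha> * pi)) / 2 + - L0 * Re \<omega> \<le> \<bar>ln (12 / (real \<alpha> * pi))\<bar> / 2 + R * \<bar>L0\<bar>"
    unfolding abs_le_iff by linarith
  hence "norm (complex_of_real (sqrt (12 / (real \<alpha> * pi))) * of_real (6 / (real \<alpha> * pi\<^sup>2)) powr \<omega>) \<le> exp (\<bar>ln (12 / (real \<alpha> * pi))\<bar> / 2 + R * \<bar>L0\<bar>)"
    unfolding norm_mult b s norm_of_real abs_exp_cancel exp_add[symmetric] exp_le_cancel_iff .
  hence "norm (complex_of_real (sqrt (12 / (real \<alpha> * pi))) * of_real (6 / (real \<alpha> * pi\<^sup>2)) powr \<omega>) ^ \<alpha> \<le> exp (\<bar>ln (12 / (real \<alpha> * pi))\<bar> / 2 + R * \<bar>L0\<bar>) ^ \<alpha>"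
    by (intro power_mono) auto
  thus ?thesis unfolding scale_eq_growth[OF n beta] norm_mult[of "growth _ _ _ _ _ _"] norm_power exp_of_nat_mult
    by (subst mult.commute) (intro mult_right_mono, auto)
qed

end

context saddle_coeff
begin

text \<open>All constants come from \<mu> + 1 = 24 (ln 2)^2 / pi^2. The coefficient 7/8 is 1 - 1/8,
  with 1 from \<kappa> and 1/8 from c1^2/4; the 3/4 is 1/2 from \<kappa> plus 1/4 from c1 c2 / 2;
  the square of ln 2 comes from c2^2/4.\<close>

lemma peak_const:
  assumes q: "q1 = e3 / (2 * e2 * sqrt e2)" "q2 = (e4 / e2 - e2 / 2 - (e3 / e2)\<^sup>2) / (2 * e2)"
    and D: "D1 = d1 / sqrt e2" "D2 = (d2 - d1\<^sup>2 / 2) / e2 - d1 * e3 / (2 * e2\<^sup>2)"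
  shows "exp \<kappa> * sqrt (pi / \<mu>) * (peak / (real \<alpha> * lam0)) / (2 * pi) =
     sqrt 3 / (sqrt 2 * real \<alpha> * pi) * 2 powr (- d1\<^sup>2 / (2 * e2) - 3 * d1 * e3 / (4 * e2\<^sup>2) + d2 / e2)
     * exp (- d1\<^sup>2 / (4 * real \<alpha> * e2)
          - real \<alpha> * pi\<^sup>2 / 12 * (7 * e3\<^sup>2 / (8 * e2 ^ 3) - e4 / e2\<^sup>2 + 1/2)
          + 3 * d1\<^sup>2 / (2 * e2 * real \<alpha> * pi\<^sup>2) * (ln 2)\<^sup>2)"
proof -
  note mp = mu_pos
  define A where "A = real \<alpha>"
  define l2 where "l2 = ln (2::real)"
  define s where "s = sqrt e2"
  have A: "A > 0" using alpha_pos by (simp add: A_def)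
  have l2: "l2 > 0" by (simp add: l2_def)
  have s: "s > 0" "e2 = s\<^sup>2" using e2_pos by (auto simp: s_def)
  have lam0: "lam0 = pi\<^sup>2 / (12 * l2)" by (simp add: lam0_def l2_def)
  have mu1: "\<mu> + 1 = 24 * l2\<^sup>2 / pi\<^sup>2" unfolding \<mu>_def lam0 by (simp add: l2_def power2_eq_square)
  have e: "(c2 - c1 - \<beta> / \<mu>)\<^sup>2 / (4 * (1 + 1 / \<mu>)) + (- \<beta>\<^sup>2 / (4 * \<mu>)) = (c2 - c1)\<^sup>2 / 4 - c2\<^sup>2 / (\<mu> + 1)"
  proof -
    \<comment> \<open>The quadratic form maximised over X, with \<beta> = c1 + c2 inserted. In this
      shape \<mu> enters only through \<mu> + 1, for which a closed form is at hand.\<close>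
    have "(x - y - (y + x) / m)\<^sup>2 / (4 * (1 + 1 / m)) + (- (y + x)\<^sup>2 / (4 * m)) = (x - y)\<^sup>2 / 4 - x\<^sup>2 / (m + 1)" if m: "m > 0" for x y m :: real
    proof -
      have "(x - y - (y + x) / m)\<^sup>2 / (4 * (1 + 1 / m)) = (m * (x - y) - (y + x))\<^sup>2 / (4 * m * (m + 1))"
      proof -
        have "x - y - (y + x) / m = (m * (x - y) - (y + x)) / m" "1 + 1 / m = (m + 1) / m" using m by (simp_all add: field_simps)
        thus ?thesis using m by (simp add: power_divide power2_eq_square)
      qed
      also have "\<dots> + (- (y + x)\<^sup>2 / (4 * m)) = ((m * (x - y) - (y + x))\<^sup>2 - (y + x)\<^sup>2 * (m + 1)) / (4 * m * (m + 1))"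
        using m by (simp add: diff_divide_distrib)
      also have "\<dots> = (m * ((x - y)\<^sup>2 * (m + 1) - 4 * x\<^sup>2)) / (m * (4 * (m + 1)))"
        by (rule arg_cong2[of _ _ _ _ "(/)"]) (simp_all add: algebra_simps power2_eq_square)
      also have "\<dots> = ((x - y)\<^sup>2 * (m + 1) - 4 * x\<^sup>2) / (4 * (m + 1))" using m by simp
      also have "\<dots> = (x - y)\<^sup>2 / 4 - x\<^sup>2 / (m + 1)"
      proof -
        have f: "(p * u - 4 * v) / (4 * u) = p / 4 - v / u" if "u > 0" for p u v :: real
          using that by (simp add: diff_divide_distrib)
        show ?thesis by (rule f) (use m in simp)
      qed
      finally show ?thesis .
    qed
    from this[OF mp, of c2 c1] show ?thesis unfolding \<beta>_def .
  qed
  \<comment> \<open>Both Gaussian widths together: the angular one and that of the index multiply to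
    pi / sqrt (\<mu> + 1).\<close>
  have sq: "sqrt (pi / \<mu>) * sqrt (pi / (1 + 1 / \<mu>)) = pi\<^sup>2 / (2 * sqrt 6 * l2)"
  proof -
    have "sqrt (pi / \<mu>) * sqrt (pi / (1 + 1 / \<mu>)) = sqrt (pi / \<mu> * (pi / (1 + 1 / \<mu>)))" by (rule real_sqrt_mult[symmetric])
    also have "pi / \<mu> * (pi / (1 + 1 / \<mu>)) = pi\<^sup>2 / (\<mu> + 1)" using mp by (simp add: field_simps power2_eq_square)
    also have "\<dots> = (pi\<^sup>2 / (2 * sqrt 6 * l2))\<^sup>2" unfolding mu1 using l2 by (simp add: power_divide power_mult_distrib power2_eq_square)
    finally show ?thesis using l2 by simp
  qed
  have c1: "c1\<^sup>2 = e3\<^sup>2 * pi\<^sup>2 * A / (24 * e2 ^ 3)"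
  proof -
    have "c1\<^sup>2 = (e3 / (2 * s\<^sup>2 * s))\<^sup>2 * (pi\<^sup>2 * (sqrt (A / 6))\<^sup>2)"
      unfolding c1_def unfolding q s_def[symmetric] A_def[symmetric] unfolding s(2) by (simp only: power_mult_distrib)
    also have "(sqrt (A / 6))\<^sup>2 = A / 6" using A by simp
    finally show ?thesis unfolding s(2) using s(1) by (simp add: power2_eq_square power3_eq_cube)
  qed
  have c2: "c2\<^sup>2 = 6 * d1\<^sup>2 * l2\<^sup>2 / (e2 * A * pi\<^sup>2)"
  proof -
    have "c2\<^sup>2 = (d1 / s)\<^sup>2 * (l2\<^sup>2 * (sqrt (6 / A))\<^sup>2 / pi\<^sup>2)"
      unfolding c2_def unfolding D s_def[symmetric] A_def[symmetric] l2_def[symmetric] by (simp only: power_mult_distrib power_divide)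
    also have "(sqrt (6 / A))\<^sup>2 = 6 / A" using A by simp
    finally show ?thesis unfolding s(2) using s(1) A by (simp add: power_divide mult_ac)
  qed
  have c12: "c1 * c2 = e3 * d1 * l2 / (2 * e2\<^sup>2)"
  proof -
    have "sqrt (A / 6) * sqrt (6 / A) = 1" using A by (simp add: real_sqrt_mult[symmetric])
    moreover have "c1 * c2 = e3 / (2 * s\<^sup>2 * s) * (d1 / s) * l2 * (sqrt (A / 6) * sqrt (6 / A))"
      unfolding c1_def c2_def unfolding q D s_def[symmetric] A_def[symmetric] l2_def[symmetric] unfolding s(2) using s(1) by (simp add: mult_ac)
    ultimately show ?thesis unfolding s(2) by (simp add: power2_eq_square)
  qed
  have c2m: "c2\<^sup>2 / (\<mu> + 1) = d1\<^sup>2 / (4 * A * e2)" unfolding c2 mu1 using l2 A e2_pos by (simp add: field_simps)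
  have kap: "\<kappa> = A * pi\<^sup>2 / 12 * (e4 / e2\<^sup>2 - 1 / 2 - e3\<^sup>2 / e2 ^ 3) + (d2 / e2 - d1\<^sup>2 / (2 * e2) - d1 * e3 / (2 * e2\<^sup>2)) * l2"
  proof -
    have q2': "q2 = (e4 / e2\<^sup>2 - 1 / 2 - e3\<^sup>2 / e2 ^ 3) / 2" unfolding q using e2_pos
      by (simp add: diff_divide_distrib power2_eq_square power3_eq_cube)
    have D2': "D2 = d2 / e2 - d1\<^sup>2 / (2 * e2) - d1 * e3 / (2 * e2\<^sup>2)" unfolding D by (simp add: diff_divide_distrib)
    have "\<kappa> = (2 * A * lam0 * l2) * q2 + D2 * l2" unfolding \<kappa>_def A_def l2_def by (simp add: algebra_simps)
    also have "2 * A * lam0 * l2 = A * pi\<^sup>2 / 6" unfolding lam0 using l2 by simp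
    finally show ?thesis unfolding q2' D2' by simp
  qed
  have ex: "\<kappa> + ((c2 - c1)\<^sup>2 / 4 - c2\<^sup>2 / (\<mu> + 1)) = (- d1\<^sup>2 / (2 * e2) - 3 * d1 * e3 / (4 * e2\<^sup>2) + d2 / e2) * l2
     + (- d1\<^sup>2 / (4 * A * e2) - A * pi\<^sup>2 / 12 * (7 * e3\<^sup>2 / (8 * e2 ^ 3) - e4 / e2\<^sup>2 + 1/2) + 3 * d1\<^sup>2 / (2 * e2 * A * pi\<^sup>2) * l2\<^sup>2)"
  proof -
    have "(c2 - c1)\<^sup>2 / 4 = c2\<^sup>2 / 4 + c1\<^sup>2 / 4 - c1 * c2 / 2" by (simp add: power2_eq_square field_simps)
    hence i: "\<kappa> + ((c2 - c1)\<^sup>2 / 4 - c2\<^sup>2 / (\<mu> + 1)) = \<kappa> + c2\<^sup>2 / 4 + c1\<^sup>2 / 4 - c1 * c2 / 2 - d1\<^sup>2 / (4 * A * e2)" unfolding c2m by simp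
    \<comment> \<open>Fractions are made atoms so that the comparison of coefficients becomes linear
      in them.\<close>
    define x1 where "x1 = e4 / e2\<^sup>2"
    define x2 where "x2 = e3\<^sup>2 / e2 ^ 3"
    define x3 where "x3 = d1 * e3 / e2\<^sup>2"
    define x4 where "x4 = d1\<^sup>2 / e2"
    define x5 where "x5 = d1\<^sup>2 / (4 * A * e2)"
    define x6 where "x6 = d1\<^sup>2 / (e2 * A * pi\<^sup>2)"
    define x7 where "x7 = d2 / e2"
    have "\<kappa> = A * pi\<^sup>2 / 12 * (x1 - 1/2 - x2) + (x7 - x4 / 2 - x3 / 2) * l2" unfolding kap x1_def x2_def x3_def x4_def x7_def by simp
    moreover have "c2\<^sup>2 = 6 * x6 * l2\<^sup>2" unfolding c2 x6_def by simp
    moreover have "c1\<^sup>2 = x2 * pi\<^sup>2 * A / 24" unfolding c1 x2_def by simp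
    moreover have "c1 * c2 = x3 * l2 / 2" unfolding c12 x3_def by (simp add: mult_ac)
    ultimately have "\<kappa> + c2\<^sup>2 / 4 + c1\<^sup>2 / 4 - c1 * c2 / 2 - d1\<^sup>2 / (4 * A * e2) =
       A * pi\<^sup>2 / 12 * (x1 - 1/2 - x2) + (x7 - x4 / 2 - x3 / 2) * l2 + 6 * x6 * l2\<^sup>2 / 4 + x2 * pi\<^sup>2 * A / 24 / 4 - x3 * l2 / 2 / 2 - x5" unfolding x5_def by simp
    also have "\<dots> = (- (x4 / 2) - 3 / 4 * x3 + x7) * l2 + (- x5 - A * pi\<^sup>2 / 12 * (7 / 8 * x2 - x1 + 1/2) + 3 / 2 * x6 * l2\<^sup>2)"
      by (simp add: field_simps)
    finally have t: "\<kappa> + c2\<^sup>2 / 4 + c1\<^sup>2 / 4 - c1 * c2 / 2 - d1\<^sup>2 / (4 * A * e2) = \<dots>" .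
    have r: "- d1\<^sup>2 / (2 * e2) = - (x4 / 2)" "3 * d1 * e3 / (4 * e2\<^sup>2) = 3 / 4 * x3" "d2 / e2 = x7" "- d1\<^sup>2 / (4 * A * e2) = - x5"
      "7 * e3\<^sup>2 / (8 * e2 ^ 3) = 7 / 8 * x2" "e4 / e2\<^sup>2 = x1" "3 * d1\<^sup>2 / (2 * e2 * A * pi\<^sup>2) = 3 / 2 * x6"
      unfolding x1_def x2_def x3_def x4_def x5_def x6_def x7_def by simp_all
    show ?thesis unfolding i r by (rule t)
  qed
  have "exp \<kappa> * sqrt (pi / \<mu>) * (peak / (real \<alpha> * lam0)) / (2 * pi) =
     (sqrt (pi / \<mu>) * sqrt (pi / (1 + 1 / \<mu>))) / (A * lam0) / (2 * pi) * (exp \<kappa> * exp ((c2 - c1)\<^sup>2 / 4 - c2\<^sup>2 / (\<mu> + 1)))"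
    unfolding peak_def e A_def by simp
  also have "(sqrt (pi / \<mu>) * sqrt (pi / (1 + 1 / \<mu>))) / (A * lam0) / (2 * pi) = sqrt 3 / (sqrt 2 * A * pi)"
  proof -
    have "pi\<^sup>2 / (2 * sqrt 6 * l2) / (A * lam0) / (2 * pi) = 3 / (sqrt 6 * A * pi)"
      unfolding lam0 using l2 A by (simp add: field_simps)
    also have "\<dots> = sqrt 3 / (sqrt 2 * A * pi)"
    proof -
      have "sqrt 6 = sqrt 2 * sqrt (3::real)" by (simp add: real_sqrt_mult[symmetric])
      moreover have "sqrt 3 * sqrt 3 = (3::real)" by simp
      ultimately show ?thesis using A by (simp add: field_simps)
    qed
    finally show ?thesis unfolding sq .
  qed
  also have "exp \<kappa> * exp ((c2 - c1)\<^sup>2 / 4 - c2\<^sup>2 / (\<mu> + 1)) = 2 powr (- d1\<^sup>2 / (2 * e2) - 3 * d1 * e3 / (4 * e2\<^sup>2) + d2 / e2)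
     * exp (- d1\<^sup>2 / (4 * A * e2) - A * pi\<^sup>2 / 12 * (7 * e3\<^sup>2 / (8 * e2 ^ 3) - e4 / e2\<^sup>2 + 1/2) + 3 * d1\<^sup>2 / (2 * e2 * A * pi\<^sup>2) * l2\<^sup>2)"
  proof -
    have p: "(2::real) powr x = exp (x * l2)" for x by (simp add: powr_def l2_def)
    show ?thesis unfolding exp_add[symmetric] ex p ..
  qed
  finally show ?thesis unfolding A_def l2_def by (simp only: mult.assoc)
qed

end

text \<open>The sign hypothesis of the theorem is \<beta> > 0 multiplied by the positive number 2
  sqrt 6 sqrt \<alpha> e2^(3/2) pi. The second part identifies \<open>beta_const\<close> with
  \<open>c1 + c2\<close> of the saddle point analysis.\<close>

lemma beta_const_pos:
  assumes "\<alpha> > 0" "e2 > 0" "real \<alpha> * e3 * pi\<^sup>2 + 12 * d1 * e2 * ln 2 > 0"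
  shows "beta_const \<alpha> d1 e2 e3 > 0"
    and "e3 / (2 * e2 * sqrt e2) * (pi * sqrt (real \<alpha> / 6)) + d1 / sqrt e2 * (ln 2 * sqrt (6 / real \<alpha>) / pi) = beta_const \<alpha> d1 e2 e3"
proof -
  have p: "e2 powr (3/2) = e2 * sqrt e2"
  proof -
    have "e2 powr (3/2) = e2 powr (1 + 1/2)" by simp
    also have "\<dots> = e2 * sqrt e2" using assms by (simp only: powr_add powr_half_sqrt) simp
    finally show ?thesis .
  qed
  define a where "a = sqrt (real \<alpha>)"
  define t where "t = sqrt e2"
  define s where "s = sqrt (6::real)"
  have a: "a > 0" "real \<alpha> = a\<^sup>2" and t: "t > 0" "e2 = t\<^sup>2" and s: "s > 0" "s * s = 6"
    using assms by (auto simp: a_def t_def s_def)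
  have b: "beta_const \<alpha> d1 e2 e3 = s * d1 * ln 2 / (t * a * pi) + a * e3 * pi / (2 * s * (e2 * t))"
    unfolding beta_const_def p real_sqrt_mult a_def t_def s_def ..
  have "(s * d1 * ln 2 / (t * a * pi) + a * e3 * pi / (2 * s * (e2 * t))) * (2 * s * a * e2 * t * pi) = (s * s) * 2 * d1 * e2 * ln 2 + a\<^sup>2 * e3 * pi\<^sup>2"
    using a(1) t(1) s(1) assms(2) by (simp add: field_simps power2_eq_square)
  also have "\<dots> = real \<alpha> * e3 * pi\<^sup>2 + 12 * d1 * e2 * ln 2" unfolding s(2) a(2) by simp
  finally have "(s * d1 * ln 2 / (t * a * pi) + a * e3 * pi / (2 * s * (e2 * t))) * (2 * s * a * e2 * t * pi) > 0" using assms(3) by simp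
  thus "beta_const \<alpha> d1 e2 e3 > 0" unfolding b using a(1) t(1) s(1) assms(2)
    by (rule_tac zero_less_mult_pos2[of _ "2 * s * a * e2 * t * pi"]) auto
  show "e3 / (2 * e2 * sqrt e2) * (pi * sqrt (real \<alpha> / 6)) + d1 / sqrt e2 * (ln 2 * sqrt (6 / real \<alpha>) / pi) = beta_const \<alpha> d1 e2 e3"
    unfolding b real_sqrt_divide a_def[symmetric] t_def[symmetric] s_def[symmetric] by (simp add: mult_ac)
qed

section \<open>From absolute to relative error\<close>

text \<open>On the compact set of \<omega> in the disc at distance at least \<delta> from every
  negative integer the constant is continuous and nowhere 0, as 1/\<Gamma>(1 + \<omega>) vanishes
  only at negative integers. The minimum is therefore positive.\<close>

lemma lead_const_lower:
  assumes "\<alpha> > 0" "\<delta> > 0"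
  shows "\<exists>c>0. \<forall>\<omega>. norm \<omega> \<le> R \<longrightarrow> (\<forall>m\<ge>1. \<delta> \<le> norm (\<omega> + of_nat m)) \<longrightarrow> c \<le> norm (lead_const \<alpha> d1 d2 e2 e3 e4 \<omega>)"
proof -
  define S where "S = cball (0::complex) R \<inter> (\<Inter>m\<in>{1::nat..}. {\<omega>. \<delta> \<le> norm (\<omega> + of_nat m)})"
  define f where "f = (\<lambda>\<omega>. norm (lead_const \<alpha> d1 d2 e2 e3 e4 \<omega>))"
  have "compact S" unfolding S_def
    by (intro compact_Int_closed compact_cball closed_INT ballI closed_Collect_le continuous_intros)
  moreover have cont: "continuous_on S f"
  proof -
    have "complex_of_real (6 / (real \<alpha> * pi\<^sup>2)) \<noteq> 0" using assms by simp
    hence e: "complex_of_real (6 / (real \<alpha> * pi\<^sup>2)) powr \<omega> = exp (\<omega> * Ln (of_real (6 / (real \<alpha> * pi\<^sup>2))))" for \<omega>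
      by (simp only: powr_def if_False)
    have rg: "continuous_on S (\<lambda>\<omega>. rGamma (1 + \<omega>))"
      by (rule continuous_on_compose2[OF continuous_on_rGamma, of _ "\<lambda>\<omega>. 1 + \<omega>"]) (auto intro!: continuous_intros)
    have "continuous_on S (\<lambda>\<omega>. norm (k1 * (rGamma (1 + \<omega>) * k2 * exp (\<omega> * k3)) ^ \<alpha> * k4 * k5))" for k1 k2 k3 k4 k5 :: complex
      by (intro continuous_intros rg)
    thus ?thesis unfolding f_def lead_const_def e .
  qed
  moreover have pos: "f \<omega> > 0" if "\<omega> \<in> S" for \<omega>
  proof -
    have "1 + \<omega> \<notin> \<int>\<^sub>\<le>\<^sub>0"
    proof
      assume "1 + \<omega> \<in> \<int>\<^sub>\<le>\<^sub>0"
      then obtain j :: nat where "1 + \<omega> = - of_nat j" by (elim nonpos_Ints_cases')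
      hence "1 + \<omega> + of_nat j = 0" by simp
      hence "\<omega> + of_nat (Suc j) = 0" by (simp add: add_ac)
      moreover have "\<delta> \<le> norm (\<omega> + of_nat (Suc j))" using INT_D[OF IntD2[OF that[unfolded S_def]], of "Suc j"] by simp
      ultimately show False using assms by simp
    qed
    hence 1: "rGamma (1 + \<omega>) \<noteq> 0" using rGamma_eq_zero_iff[of "1 + \<omega>"] by blast
    have 2: "complex_of_real (sqrt 3 / (sqrt 2 * real \<alpha> * pi)) \<noteq> 0" "complex_of_real (sqrt (12 / (real \<alpha> * pi))) \<noteq> 0"
      "complex_of_real (6 / (real \<alpha> * pi\<^sup>2)) powr \<omega> \<noteq> 0" using assms by (simp_all add: powr_def)
    have 3: "complex_of_real (2 powr x) \<noteq> 0" "complex_of_real (exp x) \<noteq> 0" for x by simp_all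
    show ?thesis unfolding f_def lead_const_def zero_less_norm_iff by (intro no_zero_divisors power_not_zero 1 2 3)
  qed
  ultimately have "\<exists>c>0. \<forall>\<omega>\<in>S. c \<le> f \<omega>"
  proof (cases "S = {}")
    case False
    then obtain w where "w \<in> S" "\<forall>\<omega>\<in>S. f w \<le> f \<omega>" using continuous_attains_inf[OF \<open>compact S\<close> False cont] by blast
    thus ?thesis using pos by blast
  qed (auto intro: exI[of _ 1])
  then obtain c where c: "c > 0" "\<And>\<omega>. \<omega> \<in> S \<Longrightarrow> c \<le> f \<omega>" by blast
  show ?thesis
  proof (rule exI[of _ c], intro conjI allI impI c(1))
    fix \<omega> :: complex assume "norm \<omega> \<le> R" "\<forall>m\<ge>1. \<delta> \<le> norm (\<omega> + of_nat m)"
    hence "\<omega> \<in> S" by (auto simp: S_def)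
    thus "c \<le> norm (lead_const \<alpha> d1 d2 e2 e3 e4 \<omega>)" using c(2) unfolding f_def by blast
  qed
qed

lemma growth_nonzero: "\<lbrakk>n > 0; \<alpha> > 0; e2 > 0\<rbrakk> \<Longrightarrow> growth \<alpha> d1 e2 e3 \<omega> n \<noteq> 0"
  by (simp add: growth_def rho_const_def)

text \<open>Coefficient and main term share the factor \<sigma> = scale / (2 pi): the former is
  \<sigma> times the normalised sum, the latter \<sigma> times its limit, by
  \<open>peak_const\<close> and \<open>scale_eq_growth\<close>. At a negative integer \<omega> the
  main term is 0 and the estimate is the plain upper bound growth / sqrt n.\<close>

lemma gf_series_asymp:
  fixes \<alpha> :: nat and e d :: "complex fps" and d1 d2 e2 e3 e4 R :: real
  assumes A: "\<alpha> > 0"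
    and e: "fps_conv_radius e > 0" and d: "fps_conv_radius d > 0"
    and ec: "fps_nth e 0 = 1" "fps_nth e 1 = 0" "fps_nth e 2 = of_real e2"
      "fps_nth e 3 = of_real e3" "fps_nth e 4 = of_real e4"
    and dc: "fps_nth d 0 = 1" "fps_nth d 1 = of_real d1" "fps_nth d 2 = of_real d2"
    and e2: "e2 > 0" and pos: "real \<alpha> * e3 * pi\<^sup>2 + 12 * d1 * e2 * ln 2 > 0" and R: "R \<ge> 0"
  shows "\<exists>C. \<forall>\<^sub>F n in sequentially. \<forall>\<omega>0 \<omega>.
        norm \<omega>0 \<le> R \<longrightarrow> norm \<omega> \<le> R \<longrightarrow>
        norm (fps_nth (gf_series \<alpha> d e \<omega>0 \<omega>) n
              - lead_const \<alpha> d1 d2 e2 e3 e4 \<omega> * growth \<alpha> d1 e2 e3 \<omega> n)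
          \<le> C * norm (growth \<alpha> d1 e2 e3 \<omega> n) / sqrt (real n)"
proof -
  obtain q l :: "complex \<Rightarrow> complex" and r B :: real where ql: "r > 0" "B \<ge> 0" and "q holomorphic_on ball 0 r" "l holomorphic_on ball 0 r"
    and approx:     "\<And>w. norm w < r \<Longrightarrow> norm (q w - (of_real (e3 / (2 * e2 * sqrt e2)) * w + of_real ((e4 / e2 - e2 / 2 - (e3 / e2)\<^sup>2) / (2 * e2)) * w\<^sup>2)) \<le> B * norm w ^ 3"
    "\<And>w. norm w < r \<Longrightarrow> norm (l w - (of_real (d1 / sqrt e2) * w + of_real ((d2 - d1\<^sup>2 / 2) / e2 - d1 * e3 / (2 * e2\<^sup>2)) * w\<^sup>2)) \<le> B * norm w ^ 3"
    "\<And>w. norm w < r \<Longrightarrow> norm (w * deriv q w) \<le> B * norm w"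
    and int: "\<And>\<omega>0 \<omega> k n \<rho>. 0 < \<rho> \<Longrightarrow> \<rho> < r \<Longrightarrow>
       ((\<lambda>\<theta>. exp ((of_nat k + \<omega>0) * l (of_real \<rho> * cis \<theta>)) * (\<Prod>j=1..k. (exp ((of_nat j + \<omega>) * (of_real \<rho> * cis \<theta>)\<^sup>2) - 1) ^ \<alpha>)
         * (1 - of_real \<rho> * cis \<theta> * deriv q (of_real \<rho> * cis \<theta>))
         * (exp (q (of_real \<rho> * cis \<theta>)) / (of_real (1 / sqrt e2) * (of_real \<rho> * cis \<theta>))) ^ n)
       has_integral (2 * pi * fps_nth (gf_term \<alpha> d e \<omega>0 \<omega> k) n)) {-(pi/2)..3*pi/2}"
    by (rule gf_term_nth_integral[OF e ec e2 d dc, where ?\<alpha> = \<alpha>]) (rule that, assumption+)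
  define q1 where "q1 = e3 / (2 * e2 * sqrt e2)"
  define q2 where "q2 = (e4 / e2 - e2 / 2 - (e3 / e2)\<^sup>2) / (2 * e2)"
  define D1 where "D1 = d1 / sqrt e2"
  define D2 where "D2 = (d2 - d1\<^sup>2 / 2) / e2 - d1 * e3 / (2 * e2\<^sup>2)"
  \<comment> \<open>The four numbers are the Taylor coefficients of \<open>q\<close> and of ln d in
    the coordinate w; from here on the series enter through them alone.\<close>
  interpret saddle \<alpha> q l e2 r B q1 q2 D1 D2
    by (rule saddle.intro) (fact A e2 ql approx[folded q1_def q2_def D1_def D2_def])+
  have beta: "\<beta> = beta_const \<alpha> d1 e2 e3"
    unfolding \<beta>_def c1_def c2_def unfolding q1_def D1_def by (rule beta_const_pos(2)[OF A e2 pos])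
  define a where "a = (\<lambda>n k \<omega>0 \<omega>. fps_nth (gf_term \<alpha> d e \<omega>0 \<omega> k) n)"
  interpret saddle_coeff \<alpha> q l e2 r B q1 q2 D1 D2 a
  proof (unfold_locales, goal_cases)
    case 1 thus ?case unfolding beta by (rule beta_const_pos(1)[OF A e2 pos])
  next
    case 2 thus ?case unfolding integrand_def a_def by (rule int)
  qed
  define M where "M = exp \<kappa> * sqrt (pi / \<mu>) * (peak / (real \<alpha> * lam0))"
  define W where "W = exp (real \<alpha> * (\<bar>ln (12 / (real \<alpha> * pi))\<bar> / 2 + R * \<bar>L0\<bar>))"
  obtain C where C: "\<forall>\<^sub>F n in sequentially. \<forall>\<omega>0 \<omega>. norm \<omega>0 \<le> R \<longrightarrow> norm \<omega> \<le> R \<longrightarrow>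
    norm ((\<Sum>k\<le>n. na n k \<omega>0 \<omega>) - rGamma (1 + \<omega>) ^ \<alpha> * of_real M) \<le> C / sqrt (real n)"
    using sum_asymp[OF R] unfolding M_def by blast
  have "\<forall>\<^sub>F n in sequentially. \<forall>\<omega>0 \<omega>. norm \<omega>0 \<le> R \<longrightarrow> norm \<omega> \<le> R \<longrightarrow>
      norm (fps_nth (gf_series \<alpha> d e \<omega>0 \<omega>) n - lead_const \<alpha> d1 d2 e2 e3 e4 \<omega> * growth \<alpha> d1 e2 e3 \<omega> n)
        \<le> (W / (2 * pi) * C) * norm (growth \<alpha> d1 e2 e3 \<omega> n) / sqrt (real n)"
    using C eventually_gt_at_top[of 0]
  proof eventually_elim
    case (elim n)
    show ?case
    proof (intro allI impI)
      fix \<omega>0 \<omega> :: complex assume w: "norm \<omega>0 \<le> R" "norm \<omega> \<le> R"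
      define G where "G = growth \<alpha> d1 e2 e3 \<omega> n"
      define H where "H = (complex_of_real (sqrt (12 / (real \<alpha> * pi))) * of_real (6 / (real \<alpha> * pi\<^sup>2)) powr \<omega>) ^ \<alpha>"
      define S where "S = (\<Sum>k\<le>n. na n k \<omega>0 \<omega>)"
      define \<sigma> where "\<sigma> = scale n \<omega> / (2 * pi)"
      have "a n k \<omega>0 \<omega> = \<sigma> * na n k \<omega>0 \<omega>" for k by (simp add: na_def \<sigma>_def)
      hence 1: "fps_nth (gf_series \<alpha> d e \<omega>0 \<omega>) n = \<sigma> * S"
        unfolding gf_series_nth[OF A] S_def sum_distrib_left a_def by simp
      have M: "M / (2 * pi) = sqrt 3 / (sqrt 2 * real \<alpha> * pi) * 2 powr (- d1\<^sup>2 / (2 * e2) - 3 * d1 * e3 / (4 * e2\<^sup>2) + d2 / e2)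
         * exp (- d1\<^sup>2 / (4 * real \<alpha> * e2) - real \<alpha> * pi\<^sup>2 / 12 * (7 * e3\<^sup>2 / (8 * e2 ^ 3) - e4 / e2\<^sup>2 + 1/2)
          + 3 * d1\<^sup>2 / (2 * e2 * real \<alpha> * pi\<^sup>2) * (ln 2)\<^sup>2)"
        unfolding M_def by (rule peak_const[OF q1_def q2_def D1_def D2_def])
      have "lead_const \<alpha> d1 d2 e2 e3 e4 \<omega> = rGamma (1 + \<omega>) ^ \<alpha> * H * of_real (M / (2 * pi))"
        unfolding M lead_const_def H_def of_real_mult[of "_ * _" "exp _"] of_real_mult[of "_ / _" "_ powr _"] power_mult_distrib[of "rGamma _ * _"] power_mult_distrib
        by (simp only: mult_ac)
      moreover have "scale n \<omega> = G * H" unfolding G_def H_def by (rule scale_eq_growth[OF elim(2) beta])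
      ultimately have 2: "lead_const \<alpha> d1 d2 e2 e3 e4 \<omega> * G = \<sigma> * (rGamma (1 + \<omega>) ^ \<alpha> * of_real M)"
        by (simp add: \<sigma>_def)
      have "norm (fps_nth (gf_series \<alpha> d e \<omega>0 \<omega>) n - lead_const \<alpha> d1 d2 e2 e3 e4 \<omega> * G) = norm \<sigma> * norm (S - rGamma (1 + \<omega>) ^ \<alpha> * of_real M)"
        unfolding 1 2 right_diff_distrib[symmetric] norm_mult ..
      also have "\<dots> \<le> (W * norm G / (2 * pi)) * (C / sqrt (real n))"
      proof (rule mult_mono)
        have "norm \<sigma> = norm (scale n \<omega>) / (2 * pi)" unfolding \<sigma>_def by (simp add: norm_divide norm_mult)
        also have "\<dots> \<le> W * norm G / (2 * pi)"
          unfolding W_def G_def by (intro divide_right_mono norm_scale_le elim beta w) auto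
        finally show "norm \<sigma> \<le> W * norm G / (2 * pi)" .
      qed (use elim w in \<open>auto simp: S_def W_def\<close>)
      finally show "norm (fps_nth (gf_series \<alpha> d e \<omega>0 \<omega>) n - lead_const \<alpha> d1 d2 e2 e3 e4 \<omega> * growth \<alpha> d1 e2 e3 \<omega> n)
        \<le> (W / (2 * pi) * C) * norm (growth \<alpha> d1 e2 e3 \<omega> n) / sqrt (real n)"
        unfolding G_def by (simp add: mult_ac)
    qed
  qed
  thus ?thesis by blast
qed

theorem theorem8p1:
  fixes \<alpha> :: nat and e d :: "complex fps" and d1 d2 e2 e3 e4 :: real
  assumes "\<alpha> > 0"
    and "fps_conv_radius e > 0" and "fps_conv_radius d > 0"
    and "fps_nth e 0 = 1" and "fps_nth e 1 = 0" and "fps_nth e 2 = of_real e2"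
    and "fps_nth e 3 = of_real e3" and "fps_nth e 4 = of_real e4"
    and "fps_nth d 0 = 1" and "fps_nth d 1 = of_real d1" and "fps_nth d 2 = of_real d2"
    and "e2 > 0"
    and "real \<alpha> * e3 * pi\<^sup>2 + 12 * d1 * e2 * ln 2 > 0"
  shows
    "(\<forall>R>0. \<forall>\<delta>>0. \<exists>C. \<forall>\<^sub>F n in sequentially. \<forall>\<omega>0 \<omega>.
        norm \<omega>0 \<le> R \<longrightarrow> norm \<omega> \<le> R \<longrightarrow> (\<forall>m\<ge>1. \<delta> \<le> norm (\<omega> + of_nat m)) \<longrightarrow>
        (\<exists>\<epsilon>. norm \<epsilon> \<le> C / sqrt (real n) \<and>
          fps_nth (gf_series \<alpha> d e \<omega>0 \<omega>) n =
            lead_const \<alpha> d1 d2 e2 e3 e4 \<omega> * growth \<alpha> d1 e2 e3 \<omega> n * (1 + \<epsilon>)))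
     \<and> (\<forall>R>0. \<exists>C. \<forall>\<^sub>F n in sequentially. \<forall>\<omega>0 \<omega>.
        norm \<omega>0 \<le> R \<longrightarrow> norm \<omega> \<le> R \<longrightarrow>
        norm (fps_nth (gf_series \<alpha> d e \<omega>0 \<omega>) n
              - lead_const \<alpha> d1 d2 e2 e3 e4 \<omega> * growth \<alpha> d1 e2 e3 \<omega> n)
          \<le> C * norm (growth \<alpha> d1 e2 e3 \<omega> n) / sqrt (real n))"
proof (intro conjI allI impI)
  fix R :: real assume "R > 0"
  thus "\<exists>C. \<forall>\<^sub>F n in sequentially. \<forall>\<omega>0 \<omega>.
        norm \<omega>0 \<le> R \<longrightarrow> norm \<omega> \<le> R \<longrightarrow>
        norm (fps_nth (gf_series \<alpha> d e \<omega>0 \<omega>) n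
              - lead_const \<alpha> d1 d2 e2 e3 e4 \<omega> * growth \<alpha> d1 e2 e3 \<omega> n)
          \<le> C * norm (growth \<alpha> d1 e2 e3 \<omega> n) / sqrt (real n)"
    using gf_series_asymp[OF assms] by simp
next
  fix R \<delta> :: real assume R: "R > 0" and \<delta>: "\<delta> > 0"
  obtain C where C: "\<forall>\<^sub>F n in sequentially. \<forall>\<omega>0 \<omega>.
        norm \<omega>0 \<le> R \<longrightarrow> norm \<omega> \<le> R \<longrightarrow>
        norm (fps_nth (gf_series \<alpha> d e \<omega>0 \<omega>) n
              - lead_const \<alpha> d1 d2 e2 e3 e4 \<omega> * growth \<alpha> d1 e2 e3 \<omega> n)
          \<le> C * norm (growth \<alpha> d1 e2 e3 \<omega> n) / sqrt (real n)"
    using gf_series_asymp[OF assms] R by (meson less_imp_le)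
  \<comment> \<open>Dividing the absolute estimate by the modulus of the main term leaves
    \<open>C\<close> over the modulus of the constant, which is at least \<open>c\<close> on the
    admissible \<omega>.\<close>
  obtain c where c: "c > 0" and lower: "\<And>\<omega>. norm \<omega> \<le> R \<Longrightarrow> (\<forall>m\<ge>1. \<delta> \<le> norm (\<omega> + of_nat m)) \<Longrightarrow> c \<le> norm (lead_const \<alpha> d1 d2 e2 e3 e4 \<omega>)"
    using lead_const_lower[OF assms(1) \<delta>] by blast
  have "\<forall>\<^sub>F n in sequentially. \<forall>\<omega>0 \<omega>.
        norm \<omega>0 \<le> R \<longrightarrow> norm \<omega> \<le> R \<longrightarrow> (\<forall>m\<ge>1. \<delta> \<le> norm (\<omega> + of_nat m)) \<longrightarrow>
        (\<exists>\<epsilon>. norm \<epsilon> \<le> (\<bar>C\<bar> / c) / sqrt (real n) \<and>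
          fps_nth (gf_series \<alpha> d e \<omega>0 \<omega>) n =
            lead_const \<alpha> d1 d2 e2 e3 e4 \<omega> * growth \<alpha> d1 e2 e3 \<omega> n * (1 + \<epsilon>))"
    using C eventually_gt_at_top[of 0]
  proof eventually_elim
    case (elim n)
    show ?case
    proof (intro allI impI)
      fix \<omega>0 \<omega> :: complex
      assume w: "norm \<omega>0 \<le> R" "norm \<omega> \<le> R" "\<forall>m\<ge>1. \<delta> \<le> norm (\<omega> + of_nat m)"
      define L where "L = lead_const \<alpha> d1 d2 e2 e3 e4 \<omega>"
      define G where "G = growth \<alpha> d1 e2 e3 \<omega> n"
      define a where "a = fps_nth (gf_series \<alpha> d e \<omega>0 \<omega>) n"
      have L: "c \<le> norm L" "L \<noteq> 0" using lower[OF w(2,3)] c by (auto simp: L_def)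
      have G: "G \<noteq> 0" using growth_nonzero[OF elim(2) assms(1) assms(12)] by (simp add: G_def)
      have "norm ((a - L * G) / (L * G)) = norm (a - L * G) / (norm L * norm G)" by (simp add: norm_divide norm_mult)
      also have "\<dots> \<le> (C * norm G / sqrt (real n)) / (norm L * norm G)"
        using elim(1) w unfolding a_def L_def G_def by (intro divide_right_mono) auto
      also have "\<dots> = (C / norm L) / sqrt (real n)" using G by simp
      \<comment> \<open>The sign of \<open>C\<close> is unspecified, hence the absolute value when
        its denominator is lowered to \<open>c\<close>.\<close>
      also have "\<dots> \<le> (\<bar>C\<bar> / c) / sqrt (real n)" using L(1) c by (intro divide_right_mono frac_le) auto
      finally have "norm ((a - L * G) / (L * G)) \<le> (\<bar>C\<bar> / c) / sqrt (real n)" .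
      moreover have "a = L * G * (1 + (a - L * G) / (L * G))" using L G by (simp add: field_simps)
      ultimately show "\<exists>\<epsilon>. norm \<epsilon> \<le> (\<bar>C\<bar> / c) / sqrt (real n) \<and>
          fps_nth (gf_series \<alpha> d e \<omega>0 \<omega>) n = lead_const \<alpha> d1 d2 e2 e3 e4 \<omega> * growth \<alpha> d1 e2 e3 \<omega> n * (1 + \<epsilon>)"
        unfolding a_def L_def G_def by blast
    qed
  qed
  thus "\<exists>C. \<forall>\<^sub>F n in sequentially. \<forall>\<omega>0 \<omega>.
        norm \<omega>0 \<le> R \<longrightarrow> norm \<omega> \<le> R \<longrightarrow> (\<forall>m\<ge>1. \<delta> \<le> norm (\<omega> + of_nat m)) \<longrightarrow>
        (\<exists>\<epsilon>. norm \<epsilon> \<le> C / sqrt (real n) \<and>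
          fps_nth (gf_series \<alpha> d e \<omega>0 \<omega>) n =
            lead_const \<alpha> d1 d2 e2 e3 e4 \<omega> * growth \<alpha> d1 e2 e3 \<omega> n * (1 + \<epsilon>))" by blast
qed

end
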